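(* Let $T>0$, $D=\mathbb{R}^d/\mathbb{Z}^d$, and let $P_0$ be a continuous divergence-free vector field on $D$ with zero spatial mean. Then the infimum of $$\frac12\int_{[0,T]\times D}\delta_{ij}M^{ij}$$ over all continuous sub-solutions $(Z,M)$ of the Euler equations with initial condition $P_0$ (as defined in the context) is finite and equal to the optimal value of the relaxed problem $$\mathcal{J}[P_0]=\max_{(E,B)\in\mathcal{EB}}\;\Big(-K[E,B]-\int_{[0,T]\times D}P_0\cdot E\Big)$$ (where, less precisely, $K[E,B]=\frac12\int_{[0,T]\times D}E\cdot(\mathbb{I}_d+2B)^{-1}\cdot E$, and $\mathcal{EB}$ and $K$ are defined in the context), the maximum being attained.
   Context: Summation over repeated lower and upper indices is implied; $\partial^k=\delta^{kj}\partial_j$, $\bigtriangleup=\delta^{ij}\partial_i\partial_j$; $\mathbb{I}_d$ is the $d\times d$ identity matrix; $(-\bigtriangleup)^{-1}$ acts on zero-mean functions (or distributions) on the torus $D$. $P_0$ is regarded as a time-independent field on $[0,T]\times D$. Sub-solutions: a pair $(Z,M)$ of continuous functions on $[0,T]\times D$, valued respectively in $\mathbb{R}^d$ and in the symmetric $d\times d$ matrices, is a continuous sub-solution of the Euler equations with initial condition $P_0$ if $M\ge Z\otimes Z$ pointwise in the sense of symmetric matrices and $$\int_{[0,T]\times D}M^{ij}B_{ij}+(Z^i-P_0^i)E_i=0$$ for all smooth fields $(E,B)$ on $[0,T]\times D$, valued respectively in $\mathbb{R}^d$ and in the symmetric $d\times d$ matrices, such that $$B(T,\cdot)=0,\qquad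 \partial_tB_{ij}=\tfrac12(\partial_jE_i+\partial_iE_j)+\partial_i\partial_j(-\bigtriangleup)^{-1}\partial^kE_k.$$ The class $\mathcal{EB}$: the set of all pairs $(E,B)$ of bounded Borel measures on $[0,T]\times D$, valued respectively in $\mathbb{R}^d$ and in the symmetric $d\times d$ matrices, satisfying the constraint $B(T,\cdot)=0$, $\partial_tB_{ij}=\tfrac12(\partial_jE_i+\partial_iE_j)+\partial_i\partial_j(-\bigtriangleup)^{-1}\partial^kE_k$ in the weak sense: for all smooth functions $\zeta$ on $[0,T]$ vanishing at $t=0$ and all smooth functions $\psi$ on $D$ valued in the symmetric $d\times d$ matrices, $$\int_{[0,T]\times D}\zeta'(t)\psi^{ij}(x)\,dB_{ij}(t,x)-\zeta(t)\left(\partial_j\psi^{kj}+\partial^k(-\bigtriangleup)^{-1}\partial_i\partial_j\psi^{ij}\right)(x)\,dE_k(t,x)=0.$$ The functional $K$: for bounded Borel measures $(E,B)$ on $[0,T]\times D$, valued respectively in $\mathbb{R}^d$ and in the symmetric $d\times d$ matrices (integrals of continuous functions being taken against these measures, and against Lebesgue measure for the $\delta_{ij}M^{ij}$ term), $$K[E,B]=\sup_{M\ge Z\otimes Z}\;\frac12\int_{[0,T]\times D}2E_iZ^i-(\delta_{ij}+2B_{ij})M^{ij}\;\in[0,+\infty],$$ where the supremum is over all pairs $(Z,M)$ of continuous functions on $[0,T]\times D$, valued respectively in $\mathbb{R}^d$ and in the symmetric $d\times d$ matrices, with $M\ge Z\otimes Z$ pointwise in the sense of symmetric matrices. *)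

theory Defs
  imports "HOL-Analysis.Analysis"
begin

text \<open>
  The torus \<open>D\<close>, the quotient of \<open>\<real>\<^sup>d\<close> by the integer lattice, is rendered in the usual way.
  Functions on \<open>D\<close> are functions on \<open>real ^ 'n\<close> that are 1-periodic in every coordinate,
  with \<open>d = CARD('n)\<close>. Borel measures on \<open>D\<close> are Borel measures on the fundamental cell
  \<open>[0,1)\<^sup>d\<close>; the restriction of the quotient map to this cell is a Borel isomorphism onto \<open>D\<close>.
\<close>

definition cell :: "(real ^ 'n) set" where
  "cell = {x. \<forall>i. 0 \<le> x $ i \<and> x $ i < 1}"

definition periodic :: "(real ^ 'n \<Rightarrow> 'a) \<Rightarrow> bool" where
  "periodic f \<longleftrightarrow> (\<forall>x i. f (x + axis i 1) = f x)"

text \<open>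
  \<open>cylinder T\<close> represents \<open>[0,T] \<times> D\<close> as a measurable space. Functions on \<open>[0,T] \<times> D\<close> are
  functions on \<open>real \<times> (real ^ 'n)\<close> of which only the values on \<open>slab T\<close> matter.
\<close>

definition cylinder :: "real \<Rightarrow> (real \<times> (real ^ 'n)) set" where
  "cylinder T = {0..T} \<times> cell"

definition slab :: "real \<Rightarrow> (real \<times> (real ^ 'n)) set" where
  "slab T = {0..T} \<times> UNIV"

definition space_periodic :: "real \<Rightarrow> (real \<times> (real ^ 'n) \<Rightarrow> 'a) \<Rightarrow> bool" where
  "space_periodic T f \<longleftrightarrow> (\<forall>t\<in>{0..T}. periodic (\<lambda>x. f (t, x)))"

text \<open>
  Smoothness on \<open>S\<close>, with derivatives taken within \<open>S\<close>. The definition is used only when \<open>S\<close> is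
  \<open>UNIV\<close>, \<open>{0..T}\<close> or \<open>slab T\<close> with \<open>T > 0\<close>, where derivatives within \<open>S\<close> are unique.
\<close>

fun Ck_on :: "nat \<Rightarrow> 'a::euclidean_space set \<Rightarrow> ('a \<Rightarrow> 'b::real_normed_vector) \<Rightarrow> bool" where
  "Ck_on 0 S f \<longleftrightarrow> continuous_on S f"
| "Ck_on (Suc k) S f \<longleftrightarrow> f differentiable_on S \<and>
     (\<forall>b\<in>Basis. Ck_on k S (\<lambda>x. frechet_derivative f (at x within S) b))"

definition smooth_on :: "'a::euclidean_space set \<Rightarrow> ('a \<Rightarrow> 'b::real_normed_vector) \<Rightarrow> bool" where
  "smooth_on S f \<longleftrightarrow> (\<forall>k. Ck_on k S f)"

definition pd :: "'n \<Rightarrow> (real ^ 'n \<Rightarrow> real) \<Rightarrow> real ^ 'n \<Rightarrow> real" where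
  "pd i f x = frechet_derivative f (at x) (axis i 1)"

definition neg_laplacian :: "(real ^ 'n \<Rightarrow> real) \<Rightarrow> real ^ 'n \<Rightarrow> real" where
  "neg_laplacian f = (\<lambda>x. - (\<Sum>i\<in>UNIV. pd i (pd i f) x))"

definition smooth_zero_mean :: "(real ^ 'n \<Rightarrow> real) set" where
  "smooth_zero_mean = {f. smooth_on UNIV f \<and> periodic f \<and> (LINT x:cell|lborel. f x) = 0}"

text \<open>
  \<open>neg_laplacian\<close> is a bijection of \<open>smooth_zero_mean\<close> onto itself, and this is its inverse.
  Only zero-mean smooth functions occur as arguments in this theory.
\<close>

definition inv_neg_laplacian :: "(real ^ 'n \<Rightarrow> real) \<Rightarrow> real ^ 'n \<Rightarrow> real" where
  "inv_neg_laplacian = inv_into smooth_zero_mean neg_laplacian"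

definition symmetric :: "real ^ 'n ^ 'n \<Rightarrow> bool" where
  "symmetric A \<longleftrightarrow> transpose A = A"

definition mat_le :: "real ^ 'n ^ 'n \<Rightarrow> real ^ 'n ^ 'n \<Rightarrow> bool" where
  "mat_le A B \<longleftrightarrow> (\<forall>v. v \<bullet> (A *v v) \<le> v \<bullet> (B *v v))"

definition tensor :: "real ^ 'n \<Rightarrow> real ^ 'n \<Rightarrow> real ^ 'n ^ 'n" where
  "tensor u v = (\<chi> i j. u $ i * v $ j)"

definition admissible_pairs ::
  "real \<Rightarrow> ((real \<times> (real ^ 'n) \<Rightarrow> real ^ 'n) \<times> (real \<times> (real ^ 'n) \<Rightarrow> real ^ 'n ^ 'n)) set" where
  "admissible_pairs T = {(Z, M).
     continuous_on (slab T) Z \<and> space_periodic T Z \<and>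
     continuous_on (slab T) M \<and> space_periodic T M \<and>
     (\<forall>p\<in>slab T. symmetric (M p) \<and> mat_le (tensor (Z p) (Z p)) (M p))}"

definition test_fields ::
  "real \<Rightarrow> ((real \<times> (real ^ 'n) \<Rightarrow> real ^ 'n) \<times> (real \<times> (real ^ 'n) \<Rightarrow> real ^ 'n ^ 'n)) set" where
  "test_fields T = {(E, B).
     smooth_on (slab T) E \<and> space_periodic T E \<and>
     smooth_on (slab T) B \<and> space_periodic T B \<and>
     (\<forall>p\<in>slab T. symmetric (B p)) \<and>
     (\<forall>x. B (T, x) = 0) \<and>
     (\<forall>t\<in>{0..T}. \<forall>x i j.
        vector_derivative (\<lambda>s. B (s, x) $ i $ j) (at t within {0..T}) =
          1/2 * (pd j (\<lambda>y. E (t, y) $ i) x + pd i (\<lambda>y. E (t, y) $ j) x)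
          + pd i (pd j (inv_neg_laplacian (\<lambda>y. \<Sum>k\<in>UNIV. pd k (\<lambda>z. E (t, z) $ k) y))) x)}"

definition subsolutions ::
  "real \<Rightarrow> (real ^ 'n \<Rightarrow> real ^ 'n) \<Rightarrow>
   ((real \<times> (real ^ 'n) \<Rightarrow> real ^ 'n) \<times> (real \<times> (real ^ 'n) \<Rightarrow> real ^ 'n ^ 'n)) set" where
  "subsolutions T P0 = {(Z, M). (Z, M) \<in> admissible_pairs T \<and>
     (\<forall>(E, B)\<in>test_fields T.
        (LINT p:cylinder T|lborel.
           (\<Sum>i\<in>UNIV. \<Sum>j\<in>UNIV. M p $ i $ j * B p $ i $ j)
           + (\<Sum>i\<in>UNIV. (Z p $ i - P0 (snd p) $ i) * E p $ i)) = 0)}"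

text \<open>
  Bounded signed or vector-valued measures on the measurable space \<open>N\<close>, as countably additive set
  functions; only the values on \<open>sets N\<close> matter.
\<close>

definition vector_measure :: "'a measure \<Rightarrow> ('a set \<Rightarrow> 'b::real_normed_vector) \<Rightarrow> bool" where
  "vector_measure N \<nu> \<longleftrightarrow> \<nu> {} = 0 \<and> bounded (\<nu> ` sets N) \<and>
     (\<forall>A. range A \<subseteq> sets N \<longrightarrow> disjoint_family A \<longrightarrow>
        (\<lambda>n::nat. \<nu> (A n)) sums \<nu> (\<Union>n. A n))"

text \<open>
  The positive part of a real signed measure in its Jordan decomposition. Here \<open>ennreal\<close> sends
  negative values to \<open>0 = ennreal (\<nu> {})\<close>, which does not affect the supremum.
\<close>

definition pos_part :: "'a measure \<Rightarrow> ('a set \<Rightarrow> real) \<Rightarrow> 'a measure" where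
  "pos_part N \<nu> = measure_of (space N) (sets N) (\<lambda>A. SUP C\<in>{C \<in> sets N. C \<subseteq> A}. ennreal (\<nu> C))"

definition signed_integral :: "'a measure \<Rightarrow> ('a set \<Rightarrow> real) \<Rightarrow> ('a \<Rightarrow> real) \<Rightarrow> real" where
  "signed_integral N \<nu> f =
     integral\<^sup>L (pos_part N \<nu>) f - integral\<^sup>L (pos_part N (\<lambda>A. - \<nu> A)) f"

definition cyl_borel :: "real \<Rightarrow> (real \<times> (real ^ 'n)) measure" where
  "cyl_borel T = restrict_space borel (cylinder T)"

abbreviation cyl_integral ::
  "real \<Rightarrow> ((real \<times> (real ^ 'n)) set \<Rightarrow> real) \<Rightarrow> (real \<times> (real ^ 'n) \<Rightarrow> real) \<Rightarrow> real" where
  "cyl_integral T \<equiv> signed_integral (cyl_borel T)"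

definition measure_pairs ::
  "real \<Rightarrow> (((real \<times> (real ^ 'n)) set \<Rightarrow> real ^ 'n) \<times> ((real \<times> (real ^ 'n)) set \<Rightarrow> real ^ 'n ^ 'n)) set"
where
  "measure_pairs T = {(E, B). vector_measure (cyl_borel T) E \<and> vector_measure (cyl_borel T) B \<and>
     (\<forall>A\<in>sets (cyl_borel T). symmetric (B A))}"

definition EB_class ::
  "real \<Rightarrow> (((real \<times> (real ^ 'n)) set \<Rightarrow> real ^ 'n) \<times> ((real \<times> (real ^ 'n)) set \<Rightarrow> real ^ 'n ^ 'n)) set"
where
  "EB_class T = {(E, B). (E, B) \<in> measure_pairs T \<and>
     (\<forall>\<zeta> :: real \<Rightarrow> real. \<forall>\<psi> :: real ^ 'n \<Rightarrow> real ^ 'n ^ 'n.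
        smooth_on {0..T} \<zeta> \<longrightarrow> \<zeta> 0 = 0 \<longrightarrow>
        smooth_on UNIV \<psi> \<longrightarrow> periodic \<psi> \<longrightarrow> (\<forall>x. symmetric (\<psi> x)) \<longrightarrow>
        (\<Sum>i\<in>UNIV. \<Sum>j\<in>UNIV. cyl_integral T (\<lambda>A. B A $ i $ j)
            (\<lambda>(t, x). vector_derivative \<zeta> (at t within {0..T}) * \<psi> x $ i $ j))
        - (\<Sum>k\<in>UNIV. cyl_integral T (\<lambda>A. E A $ k)
            (\<lambda>(t, x). \<zeta> t *
               ((\<Sum>j\<in>UNIV. pd j (\<lambda>y. \<psi> y $ k $ j) x)
                + pd k (inv_neg_laplacian
                    (\<lambda>y. \<Sum>i\<in>UNIV. \<Sum>j\<in>UNIV. pd i (pd j (\<lambda>z. \<psi> z $ i $ j)) y)) x))) = 0)}"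

definition K_functional ::
  "real \<Rightarrow> ((real \<times> (real ^ 'n)) set \<Rightarrow> real ^ 'n) \<Rightarrow> ((real \<times> (real ^ 'n)) set \<Rightarrow> real ^ 'n ^ 'n) \<Rightarrow> ereal"
where
  "K_functional T E B = (SUP (Z, M)\<in>admissible_pairs T. ereal (1/2 *
     (2 * (\<Sum>i\<in>UNIV. cyl_integral T (\<lambda>A. E A $ i) (\<lambda>p. Z p $ i))
      - (LINT p:cylinder T|lborel. trace (M p))
      - 2 * (\<Sum>i\<in>UNIV. \<Sum>j\<in>UNIV. cyl_integral T (\<lambda>A. B A $ i $ j) (\<lambda>p. M p $ i $ j)))))"

definition dual_objective ::
  "real \<Rightarrow> (real ^ 'n \<Rightarrow> real ^ 'n) \<Rightarrow>
   ((real \<times> (real ^ 'n)) set \<Rightarrow> real ^ 'n) \<Rightarrow> ((real \<times> (real ^ 'n)) set \<Rightarrow> real ^ 'n ^ 'n) \<Rightarrow> ereal"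
where
  "dual_objective T P0 E B = - K_functional T E B
     - ereal (\<Sum>i\<in>UNIV. cyl_integral T (\<lambda>A. E A $ i) (\<lambda>(t, x). P0 x $ i))"

definition J_value :: "real \<Rightarrow> (real ^ 'n \<Rightarrow> real ^ 'n) \<Rightarrow> ereal" where
  "J_value T P0 = (SUP (E, B)\<in>EB_class T. dual_objective T P0 E B)"

definition primal_value :: "real \<Rightarrow> (real ^ 'n \<Rightarrow> real ^ 'n) \<Rightarrow> ereal" where
  "primal_value T P0 =
     (INF (Z, M)\<in>subsolutions T P0. ereal (1/2 * (LINT p:cylinder T|lborel. trace (M p))))"

text \<open>A continuous field is divergence-free in the sense of distributions.\<close>

definition weakly_div_free :: "(real ^ 'n \<Rightarrow> real ^ 'n) \<Rightarrow> bool" where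
  "weakly_div_free P \<longleftrightarrow> (\<forall>\<phi> :: real ^ 'n \<Rightarrow> real. smooth_on UNIV \<phi> \<longrightarrow> periodic \<phi> \<longrightarrow>
     (LINT x:cell|lborel. (\<Sum>i\<in>UNIV. P x $ i * pd i \<phi> x)) = 0)"

end

theory Submission
  imports Defs "HOL-Computational_Algebra.Polynomial"
begin

text \<open>
  The infimum over sub-solutions is a linear minimisation over the intersection of the convex set
  \<open>M \<ge> Z \<otimes> Z\<close> of bounded continuous fields with an affine subspace. At \<open>(P0, c I)\<close>, with \<open>c\<close> large,
  the convex set has an interior point, so Hahn-Banach yields a bounded functional that
  vanishes on the directions of the subspace and attains the value of the problem. By Riesz
  representation, minus this functional is a pair of measures \<open>(E, B)\<close>. It satisfies the constraint of \<open>EB_class\<close> because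
  smooth test pairs for that constraint are directions of the subspace, by integration by parts. Test
  fields \<open>B\<close> have zero trace, so \<open>(0, c I)\<close> is also such a direction and does not contribute.

  Conversely, a measure pair in \<open>EB_class\<close> must annihilate all continuous directions \<open>(V, M)\<close>, not only
  the smooth ones. The constraint is diagonal in Fourier space: every Fourier mode of such a
  direction is again one, hence is annihilated after polynomial approximation in time, and the
  Fejer means of \<open>(V, M)\<close> converge to it uniformly.
\<close>

section \<open>Convex duality\<close>

text \<open>The Hahn-Banach step is purely algebraic. Its functional turns out to be bounded
  afterwards, because it is dominated on a whole ball around \<open>(P0, c I)\<close>. For such a
  ball to exist the convex set must be free of periodicity and symmetry; these requirements are
  linear and are moved into the subspace.

  The inverse Laplacian is an \<open>inv_into\<close>. Its values on plane waves follow once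
  \<open>-\<triangle>\<close> is injective on smooth zero-mean functions; general smooth test pairs
  and the zero trace of test matrices also require surjectivity, that is, solving the Poisson
  equation by Fourier series.

  Approximating a continuous direction by smooth ones must respect the constraint. On a single mode
  it says that the amplitude of \<open>V\<close> is a time integral of amplitudes of
  \<open>M\<close>. Hence only the amplitudes of \<open>M\<close> are approximated by polynomials,
  and integration carries the approximation over to \<open>V\<close>.

  Real cosines with a free phase replace complex exponentials; a space derivative shifts the phase
  by \<open>pi / 2\<close>.\<close>

definition sublinear :: "('a::real_vector \<Rightarrow> real) \<Rightarrow> bool" where
  "sublinear q \<longleftrightarrow> (\<forall>x y. q (x + y) \<le> q x + q y) \<and> (\<forall>c>0. \<forall>x. q (c *\<^sub>R x) \<le> c * q x)"

lemma sublinear_add: "sublinear q \<Longrightarrow> q (x + y) \<le> q x + q y"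
  by (simp add: sublinear_def)

text \<open>The inequalities for \<open>c\<close> and for \<open>1 / c\<close> together give
  equality.\<close>

lemma sublinear_scale:
  assumes "sublinear q" "c > 0"
  shows "q (c *\<^sub>R x) = c * q x"
proof (rule antisym)
  show "q (c *\<^sub>R x) \<le> c * q x" using assms by (simp add: sublinear_def)
  have "q ((1/c) *\<^sub>R (c *\<^sub>R x)) \<le> (1/c) * q (c *\<^sub>R x)"
    using assms unfolding sublinear_def by (meson zero_less_divide_1_iff)
  with assms show "c * q x \<le> q (c *\<^sub>R x)" by (simp add: field_simps)
qed

lemma sublinear_zero: "sublinear q \<Longrightarrow> q 0 = 0"
  using sublinear_scale[of q 2 0] by simp

lemma sublinear_minus_le: "sublinear q \<Longrightarrow> - q (- x) \<le> q x"
  using sublinear_add[of q x "- x"] sublinear_zero[of q] by simp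

text \<open>Subadditivity of each functional defined below as an infimum reduces to this: it
  suffices to compare with arbitrary pairs of competitors.\<close>

lemma le_cINF_add:
  fixes f g :: "'a \<Rightarrow> real"
  assumes "\<And>a b. a \<in> C \<Longrightarrow> b \<in> D \<Longrightarrow> K \<le> f a + g b" "C \<noteq> {}" "D \<noteq> {}"
  shows "K \<le> (INF a\<in>C. f a) + (INF b\<in>D. g b)"
proof -
  have "K - g b \<le> (INF a\<in>C. f a)" if "b \<in> D" for b
    using assms that by (intro cINF_greatest) (auto simp: algebra_simps)
  hence "K - (INF a\<in>C. f a) \<le> (INF b\<in>D. g b)"
    using assms by (intro cINF_greatest) (auto simp: algebra_simps)
  thus ?thesis by simp
qed

text \<open>For fixed \<open>y\<close>, the infimum \<open>r x\<close> of
  \<open>q (x + t y) - t q y\<close> over \<open>t \<ge> 0\<close> is again sublinear and below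
  \<open>q\<close>, so minimality gives \<open>r = q\<close>. Comparing at \<open>- y\<close> with
  \<open>t = 1\<close> yields \<open>q (- y) \<le> - q y\<close>, and an odd sublinear functional is
  linear.\<close>

lemma sublinear_minimal_linear:
  assumes q: "sublinear q" and min: "\<And>r. sublinear r \<Longrightarrow> r \<le> q \<Longrightarrow> r = q"
  shows "linear q"
proof -
  have neg: "q (- y) = - q y" for y
  proof -
    define h where "h x t = q (x + t *\<^sub>R y) - t * q y" for x t
    define r where "r x = (INF t\<in>{0..}. h x t)" for x
    have low: "- q (- x) \<le> h x t" if "t \<ge> 0" for x t
    proof -
      have "t * q y = q (t *\<^sub>R y)"
        using that sublinear_scale[OF q] sublinear_zero[OF q] by (cases "t = 0") auto
      also have "\<dots> \<le> q (x + t *\<^sub>R y) + q (- x)"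
        using sublinear_add[OF q, of "x + t *\<^sub>R y" "- x"] by simp
      finally show ?thesis by (simp add: h_def)
    qed
    have bdd: "bdd_below (h x ` {0..})" for x
      using low by (intro bdd_belowI2) auto
    have r_le: "r x \<le> h x t" if "t \<ge> 0" for x t
      unfolding r_def using that bdd by (intro cINF_lower) auto
    have "sublinear r" unfolding sublinear_def
    proof (intro conjI allI impI)
      fix x z
      show "r (x + z) \<le> r x + r z"
        unfolding r_def[of x] r_def[of z]
      proof (rule le_cINF_add)
        fix t s :: real assume "t \<in> {0..}" "s \<in> {0..}"
        hence "r (x + z) \<le> h (x + z) (t + s)" by (intro r_le) auto
        also have "\<dots> \<le> h x t + h z s"
          using sublinear_add[OF q, of "x + t *\<^sub>R y" "z + s *\<^sub>R y"]
          by (simp add: h_def algebra_simps)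
        finally show "r (x + z) \<le> h x t + h z s" .
      qed auto
    next
      fix c :: real and x assume c: "c > 0"
      have "r (c *\<^sub>R x) / c \<le> h x t" if "t \<in> {0..}" for t
      proof -
        have "r (c *\<^sub>R x) \<le> h (c *\<^sub>R x) (c * t)" using that c by (intro r_le) auto
        also have "\<dots> = c * h x t"
          using sublinear_scale[OF q c, of "x + t *\<^sub>R y"] by (simp add: h_def algebra_simps)
        finally show ?thesis using c by (simp add: field_simps)
      qed
      hence "r (c *\<^sub>R x) / c \<le> r x" unfolding r_def[of x] by (intro cINF_greatest) auto
      thus "r (c *\<^sub>R x) \<le> c * r x" using c by (simp add: field_simps)
    qed
    moreover have "r \<le> q" using r_le[of 0] by (auto simp: h_def le_fun_def)
    ultimately have "r = q" by (rule min)
    hence "q (- y) \<le> h (- y) 1" using r_le[of 1] by simp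
    hence "q (- y) \<le> - q y" by (simp add: h_def sublinear_zero[OF q])
    with sublinear_minus_le[OF q, of y] show ?thesis by simp
  qed
  show ?thesis
  proof (rule linearI)
    fix x y
    show "q (x + y) = q x + q y"
      using sublinear_add[OF q, of x y] sublinear_add[OF q, of "- x" "- y"] neg[of x] neg[of y] neg[of "x + y"]
      by simp
    fix c
    show "q (c *\<^sub>R x) = c *\<^sub>R q x"
      using sublinear_scale[OF q, of c x] sublinear_scale[OF q, of "- c" x] neg[of "c *\<^sub>R x"] sublinear_zero[OF q]
      by (cases "c = 0"; cases "c > 0") auto
  qed
qed

text \<open>Hahn-Banach in the form without a subspace: Zorn's lemma gives a minimal sublinear
  functional below \<open>p\<close>, which is linear. Infima along chains are finite because every
  member lies above \<open>- p (- x)\<close>.\<close>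

theorem sublinear_dominates_linear:
  fixes p :: "'a::real_vector \<Rightarrow> real"
  assumes p: "sublinear p"
  obtains f where "linear f" "\<And>x. f x \<le> p x"
proof -
  define A where "A = {q. sublinear q \<and> q \<le> p}"
  \<comment> \<open>The order is reversed, so that the maximal element delivered by Zorn's lemma is
    a minimal functional.\<close>
  define P where "P = (\<lambda>a b :: 'a \<Rightarrow> real. b \<le> a)"
  have "partial_order_on A (relation_of P A)"
    unfolding partial_order_on_def preorder_on_def refl_on_def trans_def antisym_def relation_of_def P_def
    by (auto intro: order_trans)
  moreover have "\<exists>u\<in>A. \<forall>a\<in>C. P a u" if C: "C \<in> Chains (relation_of P A)" for C
  proof (cases "C = {}")
    case True
    thus ?thesis using p by (auto simp: A_def)
  next
    case False
    define u where "u x = (INF q\<in>C. q x)" for x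
    have CA: "q \<in> A" if "q \<in> C" for q using C that by (auto simp: Chains_def relation_of_def)
    have tot: "a \<le> b \<or> b \<le> a" if "a \<in> C" "b \<in> C" for a b
      using C that by (auto simp: Chains_def relation_of_def P_def)
    have low: "- p (- x) \<le> q x" if "q \<in> C" for q x
    proof -
      have "- p (- x) \<le> - q (- x)" using CA[OF that] by (simp add: A_def le_fun_def)
      also have "\<dots> \<le> q x" using CA[OF that] by (intro sublinear_minus_le) (simp add: A_def)
      finally show ?thesis .
    qed
    have u_le: "u x \<le> q x" if "q \<in> C" for q x
      unfolding u_def using that low by (intro cINF_lower bdd_belowI2) auto
    have "sublinear u" unfolding sublinear_def
    proof (intro conjI allI impI)
      fix x y
      show "u (x + y) \<le> u x + u y" unfolding u_def[of x] u_def[of y]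
      proof (rule le_cINF_add)
        fix a b assume ab: "a \<in> C" "b \<in> C"
        \<comment> \<open>In a chain two competitors \<open>a\<close> and \<open>b\<close> can be
          replaced by the smaller one, whose own subadditivity is then available.\<close>
        define q where "q = (if a \<le> b then a else b)"
        have q: "q \<in> C" "q \<le> a" "q \<le> b" using ab tot[OF ab] by (auto simp: q_def)
        have "u (x + y) \<le> q (x + y)" by (rule u_le[OF q(1)])
        also have "\<dots> \<le> q x + q y" using CA[OF q(1)] by (intro sublinear_add) (simp add: A_def)
        also have "\<dots> \<le> a x + b y" using q by (intro add_mono) (auto simp: le_fun_def)
        finally show "u (x + y) \<le> a x + b y" .
      qed (use False in auto)
    next
      fix c :: real and x assume c: "c > 0"
      have "u (c *\<^sub>R x) / c \<le> q x" if "q \<in> C" for q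
        using u_le[OF that, of "c *\<^sub>R x"] sublinear_scale[of q c x] CA[OF that] c
        by (simp add: A_def field_simps)
      hence "u (c *\<^sub>R x) / c \<le> u x" unfolding u_def[of x] using False by (intro cINF_greatest) auto
      thus "u (c *\<^sub>R x) \<le> c * u x" using c by (simp add: field_simps)
    qed
    moreover obtain q where "q \<in> C" using False by auto
    have "u \<le> p" using u_le[OF \<open>q \<in> C\<close>] CA[OF \<open>q \<in> C\<close>] by (auto simp: A_def le_fun_def intro: order_trans)
    ultimately have "u \<in> A" by (simp add: A_def)
    thus ?thesis using u_le by (intro bexI[of _ u]) (auto simp: P_def le_fun_def)
  qed
  ultimately have "\<exists>m\<in>A. \<forall>a\<in>A. P m a \<longrightarrow> a = m" by (rule predicate_Zorn)
  then obtain m where m: "m \<in> A" "\<And>a. a \<in> A \<Longrightarrow> a \<le> m \<Longrightarrow> a = m" by (auto simp: P_def)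
  have "linear m"
    using m by (intro sublinear_minimal_linear) (auto simp: A_def)
  thus ?thesis using m(1) by (intro that[of m]) (auto simp: A_def le_fun_def)
qed

text \<open>A perturbation argument: \<open>p x\<close> is the least slope
  \<open>(\<phi> (u0 + s x + l) - m) / s\<close>, with the directions \<open>l\<close> of
  \<open>L\<close> for free. Convexity of \<open>\<phi>\<close> makes \<open>p\<close> sublinear,
  the bound \<open>m\<close> on the slice \<open>u0 + L\<close> keeps it finite, and a linear
  functional below \<open>p\<close> is the multiplier.\<close>

theorem convex_duality:
  fixes \<phi> :: "'a::real_vector \<Rightarrow> real" and m :: real
  assumes conv: "convex_on A \<phi>" and L: "subspace L" and u0: "u0 \<in> A"
    and internal: "\<And>x. \<exists>s>0. u0 + s *\<^sub>R x \<in> A"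
    and m: "\<And>u. u \<in> A \<Longrightarrow> u - u0 \<in> L \<Longrightarrow> m \<le> \<phi> u"
  obtains f where "linear f" "\<And>l. l \<in> L \<Longrightarrow> f l = 0" "\<And>u. u \<in> A \<Longrightarrow> f (u - u0) \<le> \<phi> u - m"
proof -
  define S where "S x = {(\<phi> (u0 + s *\<^sub>R x + l) - m) / s | s l. s > 0 \<and> l \<in> L \<and> u0 + s *\<^sub>R x + l \<in> A}" for x
  define p where "p x = Inf (S x)" for x
  have comb: "\<exists>c\<in>S (x + y). c \<le> a + b" if aS: "a \<in> S x" and bS: "b \<in> S y" for a b x y
  proof -
    obtain s l where 1: "s > 0" "l \<in> L" "u0 + s *\<^sub>R x + l \<in> A" "a = (\<phi> (u0 + s *\<^sub>R x + l) - m) / s"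
      using aS by (auto simp: S_def)
    obtain t k where 2: "t > 0" "k \<in> L" "u0 + t *\<^sub>R y + k \<in> A" "b = (\<phi> (u0 + t *\<^sub>R y + k) - m) / t"
      using bS by (auto simp: S_def)
    \<comment> \<open>The weights satisfy \<open>\<alpha> s = \<beta> t = r\<close>, so that steps
      of different lengths in the directions \<open>x\<close> and \<open>y\<close> combine into one
      step of length \<open>r\<close> along \<open>x + y\<close>.\<close>
    define \<alpha> \<beta> r n where "\<alpha> = t / (s + t)" and "\<beta> = s / (s + t)" and "r = s * t / (s + t)"
      and "n = \<alpha> *\<^sub>R l + \<beta> *\<^sub>R k"
    have ab: "\<alpha> \<ge> 0" "\<beta> \<ge> 0" "\<alpha> + \<beta> = 1" "\<alpha> * s = r" "\<beta> * t = r" "r > 0" "\<alpha> / r = 1 / s" "\<beta> / r = 1 / t"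
      using 1(1) 2(1) by (auto simp: \<alpha>_def \<beta>_def r_def add_divide_distrib[symmetric] add.commute)
    have nL: "n \<in> L" unfolding n_def using L 1 2 by (intro subspace_add subspace_scale)
    have "u0 + r *\<^sub>R (x + y) + n = (\<alpha> + \<beta>) *\<^sub>R u0 + (\<alpha> * s) *\<^sub>R x + (\<beta> * t) *\<^sub>R y + n"
      by (simp add: ab algebra_simps)
    also have "\<dots> = \<alpha> *\<^sub>R (u0 + s *\<^sub>R x + l) + \<beta> *\<^sub>R (u0 + t *\<^sub>R y + k)"
      by (simp add: n_def algebra_simps)
    finally have eq: "u0 + r *\<^sub>R (x + y) + n = \<alpha> *\<^sub>R (u0 + s *\<^sub>R x + l) + \<beta> *\<^sub>R (u0 + t *\<^sub>R y + k)" .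
    have inA: "u0 + r *\<^sub>R (x + y) + n \<in> A"
      unfolding eq using conv 1 2 ab by (intro convexD) (auto simp: convex_on_def)
    have "\<phi> (u0 + r *\<^sub>R (x + y) + n) \<le> \<alpha> * \<phi> (u0 + s *\<^sub>R x + l) + \<beta> * \<phi> (u0 + t *\<^sub>R y + k)"
      unfolding eq using conv 1 2 ab by (auto simp: convex_on_def)
    also have "\<dots> = \<alpha> * (\<phi> (u0 + s *\<^sub>R x + l) - m) + \<beta> * (\<phi> (u0 + t *\<^sub>R y + k) - m) + (\<alpha> + \<beta>) * m"
      by (simp add: algebra_simps)
    finally have "(\<phi> (u0 + r *\<^sub>R (x + y) + n) - m) / r \<le>
        (\<alpha> * (\<phi> (u0 + s *\<^sub>R x + l) - m) + \<beta> * (\<phi> (u0 + t *\<^sub>R y + k) - m)) / r"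
      using ab by (intro divide_right_mono) auto
    also have "\<dots> = (\<alpha> / r) * (\<phi> (u0 + s *\<^sub>R x + l) - m) + (\<beta> / r) * (\<phi> (u0 + t *\<^sub>R y + k) - m)"
      by (simp add: add_divide_distrib)
    also have "\<dots> = a + b" using 1(4) 2(4) ab by simp
    finally show ?thesis using inA nL ab by (intro bexI[of _ "(\<phi> (u0 + r *\<^sub>R (x + y) + n) - m) / r"]) (auto simp: S_def)
  qed
  have ne: "S x \<noteq> {}" for x
  proof -
    obtain s where "s > 0" "u0 + s *\<^sub>R x \<in> A" using internal by blast
    hence "(\<phi> (u0 + s *\<^sub>R x + 0) - m) / s \<in> S x"
      unfolding S_def using subspace_0[OF L] by (intro CollectI exI[of _ s] exI[of _ 0]) auto
    thus ?thesis by auto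
  qed
  have nonneg: "0 \<le> c" if x: "x \<in> L" and cS: "c \<in> S x" for c x
  proof -
    obtain s l where 1: "s > 0" "l \<in> L" "u0 + s *\<^sub>R x + l \<in> A" "c = (\<phi> (u0 + s *\<^sub>R x + l) - m) / s"
      using cS by (auto simp: S_def)
    have "s *\<^sub>R x + l \<in> L" using x 1 L by (intro subspace_add subspace_scale)
    hence "m \<le> \<phi> (u0 + s *\<^sub>R x + l)" using 1 by (intro m) (auto simp: algebra_simps)
    thus ?thesis using 1 by simp
  qed
  \<comment> \<open>A slope in direction \<open>x\<close> plus a fixed slope \<open>b\<close> in
    direction \<open>- x\<close> dominates a slope in direction 0, which is nonnegative.\<close>
  have bdd: "bdd_below (S x)" for x
  proof -
    obtain b where b: "b \<in> S (- x)" using ne by blast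
    have "- b \<le> a" if "a \<in> S x" for a
      using comb[OF that b] nonneg[OF subspace_0[OF L]] by force
    thus ?thesis by (rule bdd_belowI)
  qed
  have p_le: "p x \<le> c" if "c \<in> S x" for x c
    unfolding p_def using that bdd by (rule cInf_lower)
  have sub: "sublinear p" unfolding sublinear_def
  proof (intro conjI allI impI)
    fix x y
    have "p (x + y) \<le> (INF a\<in>S x. a) + (INF b\<in>S y. b)"
    proof (rule le_cINF_add)
      fix a b assume "a \<in> S x" "b \<in> S y"
      from comb[OF this] obtain c where "c \<in> S (x + y)" "c \<le> a + b" by blast
      thus "p (x + y) \<le> a + b" using p_le[of c "x + y"] by simp
    qed (use ne in auto)
    thus "p (x + y) \<le> p x + p y" by (simp add: p_def)
  next
    fix c :: real and x assume c: "c > 0"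
    have "p (c *\<^sub>R x) / c \<le> a" if aS: "a \<in> S x" for a
    proof -
      obtain s l where 1: "s > 0" "l \<in> L" "u0 + s *\<^sub>R x + l \<in> A" "a = (\<phi> (u0 + s *\<^sub>R x + l) - m) / s"
        using aS by (auto simp: S_def)
      have "(\<phi> (u0 + (s / c) *\<^sub>R (c *\<^sub>R x) + l) - m) / (s / c) \<in> S (c *\<^sub>R x)"
        unfolding S_def using 1 c by (intro CollectI exI[of _ "s / c"] exI[of _ l]) auto
      moreover have "(\<phi> (u0 + (s / c) *\<^sub>R (c *\<^sub>R x) + l) - m) / (s / c) = c * a" using 1 c by simp
      ultimately have "c * a \<in> S (c *\<^sub>R x)" by simp
      from p_le[OF this] show ?thesis using c by (simp add: field_simps)
    qed
    hence "p (c *\<^sub>R x) / c \<le> p x" unfolding p_def[of x] using ne by (intro cInf_greatest)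
    thus "p (c *\<^sub>R x) \<le> c * p x" using c by (simp add: field_simps)
  qed
  then obtain f where f: "linear f" "\<And>x. f x \<le> p x" by (rule sublinear_dominates_linear) auto
  have le0: "f l \<le> 0" if l: "l \<in> L" for l
  proof -
    \<comment> \<open>Moving by \<open>s l\<close> and back by \<open>- s l\<close> inside
      \<open>L\<close> returns to \<open>u0\<close>, so the slope is
      \<open>(\<phi> u0 - m) / s\<close> with \<open>s\<close> as large as desired.\<close>
    have *: "f l \<le> (\<phi> u0 - m) / s" if "s > 0" for s
    proof -
      have "- (s *\<^sub>R l) \<in> L" using l L by (simp add: subspace_neg subspace_scale)
      hence "(\<phi> (u0 + s *\<^sub>R l + - (s *\<^sub>R l)) - m) / s \<in> S l"
        unfolding S_def using that u0 by (intro CollectI exI[of _ s] exI[of _ "- (s *\<^sub>R l)"]) auto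
      from order_trans[OF f(2) p_le[OF this]] show ?thesis by simp
    qed
    show ?thesis
    proof (rule ccontr)
      assume "\<not> ?thesis"
      hence pos: "f l > 0" by simp
      have "\<phi> u0 - m \<ge> 0" using m[OF u0] subspace_0[OF L] by simp
      \<comment> \<open>With this \<open>s\<close> the bound is strictly smaller than
        \<open>f l\<close>; the \<open>+ 1\<close> keeps \<open>s\<close> positive when
        \<open>\<phi> u0 = m\<close>.\<close>
      hence "f l \<le> (\<phi> u0 - m) / ((\<phi> u0 - m + 1) / f l)" using pos by (intro *) auto
      hence "f l \<le> f l * ((\<phi> u0 - m) / (\<phi> u0 - m + 1))" by (simp add: field_simps)
      moreover have "(\<phi> u0 - m) / (\<phi> u0 - m + 1) < 1" using \<open>\<phi> u0 - m \<ge> 0\<close> by simp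
      ultimately show False using pos by (metis mult_less_cancel_left2 not_less)
    qed
  qed
  show ?thesis
  proof (rule that[OF f(1)])
    fix l assume "l \<in> L"
    thus "f l = 0" using le0[of l] le0[of "- l"] subspace_neg[OF L] linear_neg[OF f(1)] by force
  next
    fix u assume u: "u \<in> A"
    have "(\<phi> (u0 + 1 *\<^sub>R (u - u0) + 0) - m) / 1 \<in> S (u - u0)"
      unfolding S_def using u subspace_0[OF L] by (intro CollectI exI[of _ 1] exI[of _ 0]) auto
    from order_trans[OF f(2) p_le[OF this]] show "f (u - u0) \<le> \<phi> u - m" by simp
  qed
qed

section \<open>Riesz representation on function lattices\<close>

text \<open>Modelled on continuous periodic functions on \<open>cylinder T\<close>, a half-open set
  that is not compact. Compactness is therefore replaced by its consequence \<open>dini\<close>, and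
  only values on \<open>\<Omega>\<close> count.\<close>

locale function_lattice =
  fixes \<Omega> :: "'a set" and F :: "('a \<Rightarrow> real) set"
  assumes const: "\<And>c. (\<lambda>_. c) \<in> F"
    and add: "\<And>f g. f \<in> F \<Longrightarrow> g \<in> F \<Longrightarrow> (\<lambda>x. f x + g x) \<in> F"
    and mult: "\<And>f g. f \<in> F \<Longrightarrow> g \<in> F \<Longrightarrow> (\<lambda>x. f x * g x) \<in> F"
    and max: "\<And>f g. f \<in> F \<Longrightarrow> g \<in> F \<Longrightarrow> (\<lambda>x. max (f x) (g x)) \<in> F"
    and bounded: "\<And>f. f \<in> F \<Longrightarrow> \<exists>C. \<forall>x\<in>\<Omega>. \<bar>f x\<bar> \<le> C"
    and dini: "\<And>f g. (\<And>n. f n \<in> F) \<Longrightarrow> g \<in> F \<Longrightarrow> (\<And>n x. x \<in> \<Omega> \<Longrightarrow> 0 \<le> f n x) \<Longrightarrow>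
      (\<And>x. x \<in> \<Omega> \<Longrightarrow> \<exists>n. g x < (\<Sum>i<n. f i x)) \<Longrightarrow> \<exists>n. \<forall>x\<in>\<Omega>. g x \<le> (\<Sum>i<n::nat. f i x)"
begin

lemma scale: "f \<in> F \<Longrightarrow> (\<lambda>x. c * f x) \<in> F"
  using mult[OF const[of c]] .

lemma diff: "f \<in> F \<Longrightarrow> g \<in> F \<Longrightarrow> (\<lambda>x. f x - g x) \<in> F"
  using add[of f "\<lambda>x. -1 * g x"] scale[of g "-1"] by simp

lemma min: 
  assumes "f \<in> F" "g \<in> F" shows "(\<lambda>x. min (f x) (g x)) \<in> F"
proof -
  have "(\<lambda>x. min (f x) (g x)) = (\<lambda>x. f x + g x - max (f x) (g x))" by (auto simp: fun_eq_iff)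
  thus ?thesis using assms add diff max by simp
qed

lemma sum: "(\<And>i. i < n \<Longrightarrow> f i \<in> F) \<Longrightarrow> (\<lambda>x. \<Sum>i<n. f i x) \<in> F" for n :: nat
  by (induction n) (auto intro: const add)

definition Fp :: "('a \<Rightarrow> real) set" where
  "Fp = {f \<in> F. \<forall>x\<in>\<Omega>. 0 \<le> f x}"

end

text \<open>The functional is prescribed on nonnegative functions only, since the positive part of a
  bounded functional is defined there by a supremum. \<open>L_cong\<close> is separate because
  members of \<open>F\<close> may differ off \<open>\<Omega>\<close>.\<close>

locale positive_functional = function_lattice +
  fixes \<Lambda> :: "('a \<Rightarrow> real) \<Rightarrow> real"
  assumes L_add: "\<And>f g. f \<in> Fp \<Longrightarrow> g \<in> Fp \<Longrightarrow> \<Lambda> (\<lambda>x. f x + g x) = \<Lambda> f + \<Lambda> g"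
    and L_scale: "\<And>f c. f \<in> Fp \<Longrightarrow> c \<ge> 0 \<Longrightarrow> \<Lambda> (\<lambda>x. c * f x) = c * \<Lambda> f"
    and L_nonneg: "\<And>f. f \<in> Fp \<Longrightarrow> 0 \<le> \<Lambda> f"
    and L_cong: "\<And>f g. f \<in> Fp \<Longrightarrow> g \<in> Fp \<Longrightarrow> (\<And>x. x \<in> \<Omega> \<Longrightarrow> f x = g x) \<Longrightarrow> \<Lambda> f = \<Lambda> g"
begin

lemma Fp_const: "c \<ge> 0 \<Longrightarrow> (\<lambda>_. c) \<in> Fp" by (simp add: Fp_def const)

lemma Fp_mult: "f \<in> Fp \<Longrightarrow> g \<in> Fp \<Longrightarrow> (\<lambda>x. f x * g x) \<in> Fp" by (simp add: Fp_def mult)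

lemma L_mono:
  assumes "f \<in> Fp" "g \<in> Fp" "\<And>x. x \<in> \<Omega> \<Longrightarrow> f x \<le> g x"
  shows "\<Lambda> f \<le> \<Lambda> g"
proof -
  have d: "(\<lambda>x. g x - f x) \<in> Fp" using assms by (simp add: Fp_def diff)
  have "\<Lambda> g = \<Lambda> (\<lambda>x. f x + (g x - f x))" by simp
  also have "\<dots> = \<Lambda> f + \<Lambda> (\<lambda>x. g x - f x)" by (rule L_add[OF assms(1) d])
  finally show ?thesis using L_nonneg[OF d] by simp
qed

lemma L_zero: "\<Lambda> (\<lambda>_. 0) = 0"
  using L_scale[OF Fp_const[of 0], of 0] by simp

lemma L_sum: "(\<And>i. i < n \<Longrightarrow> f i \<in> Fp) \<Longrightarrow> \<Lambda> (\<lambda>x. \<Sum>i<n. f i x) = (\<Sum>i<n. \<Lambda> (f i))" for n :: nat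
proof (induction n)
  case (Suc n)
  have "(\<lambda>x. \<Sum>i<n. f i x) \<in> Fp" using Suc.prems by (auto simp: Fp_def intro!: sum sum_nonneg)
  thus ?case using Suc by (simp add: L_add)
qed (simp add: L_zero)

text \<open>Daniell's way to an outer measure: sets are covered by countable series of nonnegative
  functions instead of open sets, so no topology on \<open>\<Omega>\<close> enters. The series is
  taken in \<open>ennreal\<close> since it may diverge.\<close>

definition covers :: "'a set \<Rightarrow> (nat \<Rightarrow> 'a \<Rightarrow> real) set" where
  "covers A = {f. (\<forall>n. f n \<in> Fp) \<and> (\<forall>x\<in>A. 1 \<le> (\<Sum>n. ennreal (f n x)))}"

definition outer :: "'a set \<Rightarrow> ennreal" where
  "outer A = (INF f\<in>covers A. \<Sum>n. ennreal (\<Lambda> (f n)))"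

lemma outer_le: "f \<in> covers A \<Longrightarrow> outer A \<le> (\<Sum>n. ennreal (\<Lambda> (f n)))"
  unfolding outer_def by (rule INF_lower)

text \<open>A series of series becomes a single cover by enumerating pairs of indices. Both
  countable subadditivity and the splitting of a cover along a set rest on this.\<close>

lemma outer_le_double:
  assumes f: "\<And>i n. f i n \<in> Fp" and 1: "\<And>x. x \<in> A \<Longrightarrow> 1 \<le> (\<Sum>i. \<Sum>n. ennreal (f i n x))"
  shows "outer A \<le> (\<Sum>i. \<Sum>n. ennreal (\<Lambda> (f i n)))"
proof -
  define g where "g k = (case prod_decode k of (i, n) \<Rightarrow> f i n)" for k
  have eq: "(\<Sum>k. ennreal (h (g k))) = (\<Sum>i. \<Sum>n. ennreal (h (f i n)))" for h :: "('a \<Rightarrow> real) \<Rightarrow> real"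
  proof -
    have "(\<Sum>k. (\<lambda>(i, n). ennreal (h (f i n))) (prod_decode k)) = (\<Sum>i. \<Sum>n. ennreal (h (f i n)))"
      by (rule suminf_ennreal_2dimen) simp
    thus ?thesis by (simp add: g_def case_prod_beta)
  qed
  have "g \<in> covers A" using f 1 eq[of "\<lambda>f. f _"] by (auto simp: covers_def g_def split: prod.split)
  from outer_le[OF this] show ?thesis using eq[of \<Lambda>] by simp
qed

lemma outer_measure_space_outer: "outer_measure_space (Pow \<Omega>) outer"
  unfolding outer_measure_space_def
proof (intro conjI)
  have "(\<lambda>_ _. 0) \<in> covers {}" by (simp add: covers_def Fp_const)
  from outer_le[OF this] show "positive (Pow \<Omega>) outer" by (simp add: positive_def L_zero)
  show "increasing (Pow \<Omega>) outer"
    unfolding increasing_def outer_def covers_def by (auto intro!: INF_superset_mono)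
  show "countably_subadditive (Pow \<Omega>) outer" unfolding countably_subadditive_def
  proof (intro allI impI)
    fix A :: "nat \<Rightarrow> 'a set"
    show "outer (\<Union>i. A i) \<le> (\<Sum>i. outer (A i))"
    proof (rule ennreal_le_epsilon)
      fix e :: real assume e: "e > 0" and fin: "(\<Sum>i. outer (A i)) < top"
      have "\<exists>f\<in>covers (A i). (\<Sum>n. ennreal (\<Lambda> (f n))) < outer (A i) + ennreal (e * (1/2) ^ Suc i)" for i
      proof -
        have "outer (A i) < top"
          using sum_le_suminf[of "\<lambda>i. outer (A i)" "{i}"] by (intro le_less_trans[OF _ fin]) auto
        hence "outer (A i) < outer (A i) + ennreal (e * (1/2) ^ Suc i)"
          using e by (auto simp: ennreal_add_left_cancel_less less_top)
        thus ?thesis unfolding outer_def[of "A i"] INF_less_iff .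
      qed
      then obtain f where f: "\<And>i. f i \<in> covers (A i)"
        "\<And>i. (\<Sum>n. ennreal (\<Lambda> (f i n))) < outer (A i) + ennreal (e * (1/2) ^ Suc i)" by metis
      have "outer (\<Union>i. A i) \<le> (\<Sum>i. \<Sum>n. ennreal (\<Lambda> (f i n)))"
      proof (rule outer_le_double)
        show "f i n \<in> Fp" for i n using f by (auto simp: covers_def)
        fix x assume "x \<in> (\<Union>i. A i)"
        then obtain i where "x \<in> A i" by auto
        hence "1 \<le> (\<Sum>n. ennreal (f i n x))" using f by (auto simp: covers_def)
        also have "\<dots> \<le> (\<Sum>i. \<Sum>n. ennreal (f i n x))"
          using sum_le_suminf[of "\<lambda>i. \<Sum>n. ennreal (f i n x)" "{i}"] by simp
        finally show "1 \<le> (\<Sum>i. \<Sum>n. ennreal (f i n x))" .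
      qed
      also have "\<dots> \<le> (\<Sum>i. outer (A i) + ennreal (e * (1/2) ^ Suc i))"
        using f by (intro suminf_le) (auto intro: less_imp_le)
      also have "\<dots> = (\<Sum>i. outer (A i)) + (\<Sum>i. ennreal (e * (1/2) ^ Suc i))"
        by (subst suminf_add[symmetric]) auto
      also have "(\<Sum>i. ennreal (e * (1/2) ^ Suc i)) = ennreal (e * 1)"
        using e by (intro suminf_ennreal_eq sums_mult power_half_series) auto
      finally show "outer (\<Union>i. A i) \<le> (\<Sum>i. outer (A i)) + ennreal e" by simp
    qed
  qed
qed

text \<open>The functions \<open>u k\<close> increase to the indicator of \<open>U\<close>. A cover
  \<open>f\<close> of \<open>X\<close> splits into \<open>f n * u k\<close> and
  \<open>f n * (1 - u k)\<close>: the former exhaust \<open>f n\<close> on \<open>U\<close> as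
  \<open>k\<close> grows, the latter equal \<open>f n\<close> off \<open>U\<close>, and their costs
  add up to that of \<open>f\<close>. Shifting \<open>h\<close> by constants then makes every member
  of \<open>F\<close> measurable.\<close>

lemma positive_set_in_lambda_system:
  assumes h: "h \<in> F"
  shows "{x\<in>\<Omega>. 0 < h x} \<in> lambda_system \<Omega> (Pow \<Omega>) outer"
proof -
  define U where "U = {x\<in>\<Omega>. 0 < h x}"
  define u where "u k x = min 1 (real k * max 0 (h x))" for k x
  have uF: "u k \<in> F" for k unfolding u_def by (intro min const scale max h)
  have u01: "0 \<le> u k x" "u k x \<le> 1" for k x by (auto simp: u_def)
  have uFp: "u k \<in> Fp" for k using uF u01 by (simp add: Fp_def)
  have u_out: "u k x = 0" if "x \<in> \<Omega>" "x \<notin> U" for k x using that by (auto simp: u_def U_def)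
  have u_mono: "u k x \<le> u l x" if "k \<le> l" for k l x
    using that unfolding u_def by (intro min.mono mult_right_mono) auto
  have "outer (U \<inter> X) + outer ((\<Omega> - U) \<inter> X) = outer X" if X: "X \<subseteq> \<Omega>" for X
  proof (rule antisym)
    show "outer (U \<inter> X) + outer ((\<Omega> - U) \<inter> X) \<le> outer X" unfolding outer_def[of X]
    proof (rule INF_greatest)
      fix f assume "f \<in> covers X"
      hence f: "\<And>n. f n \<in> Fp" "\<And>x. x \<in> X \<Longrightarrow> 1 \<le> (\<Sum>n. ennreal (f n x))" by (auto simp: covers_def)
      define a where "a k n = \<Lambda> (\<lambda>x. f n x * u k x)" for k n
      have fu: "(\<lambda>x. f n x * u k x) \<in> Fp" for n k by (intro Fp_mult f(1) uFp)
      have fd: "(\<lambda>x. f n x * (u l x - u k x)) \<in> Fp" if "k \<le> l" for n k l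
        using f(1)[of n] u_mono[OF that] uF by (intro Fp_mult) (auto simp: Fp_def diff)
      have f1: "(\<lambda>x. f n x * (1 - u k x)) \<in> Fp" for n k
        using f(1)[of n] uF u01 by (intro Fp_mult) (auto simp: Fp_def diff const)
      have ad: "\<Lambda> (\<lambda>x. f n x * (u (Suc k) x - u k x)) = a (Suc k) n - a k n" for k n
        using L_add[OF fu[of n k] fd[of k "Suc k" n]] by (simp add: a_def algebra_simps)
      have a0: "a 0 n = 0" for n by (simp add: a_def u_def L_zero)
      have ann: "0 \<le> a k n" for k n unfolding a_def by (rule L_nonneg[OF fu])
      have ainc: "a k n \<le> a (Suc k) n" for k n using L_nonneg[OF fd[of k "Suc k" n]] ad by simp
      \<comment> \<open>On \<open>U\<close> the function \<open>f n\<close> is the telescoping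
        series of \<open>f n * (u (Suc k) - u k)\<close>, starting from \<open>u 0 = 0\<close>. This
        packs the limit of the covers \<open>f n * u K\<close> into one countable cover.\<close>
      have "outer (U \<inter> X) \<le> (\<Sum>n. \<Sum>k. ennreal (\<Lambda> (\<lambda>x. f n x * (u (Suc k) x - u k x))))"
      proof (rule outer_le_double)
        show "(\<lambda>x. f n x * (u (Suc k) x - u k x)) \<in> Fp" for n k by (rule fd) simp
        fix x assume x: "x \<in> U \<inter> X"
        have "(\<lambda>k. u k x) \<longlonglongrightarrow> 1"
        proof (rule tendsto_eventually)
          obtain N :: nat where "1 / h x \<le> real N" using real_arch_simple by blast
          hence "u k x = 1" if "k \<ge> N" for k
          proof -
            have "1 / h x \<le> real k" using \<open>1 / h x \<le> real N\<close> that by (simp add: order_trans)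
            hence "1 \<le> real k * h x" using x by (simp add: U_def field_simps)
            thus ?thesis using x by (simp add: u_def U_def max_def)
          qed
          thus "\<forall>\<^sub>F k in sequentially. u k x = 1" by (auto simp: eventually_sequentially)
        qed
        hence "(\<lambda>k. u (Suc k) x - u k x) sums (1 - u 0 x)" by (rule telescope_sums)
        hence "(\<lambda>k. f n x * (u (Suc k) x - u k x)) sums f n x" for n
          using sums_mult[of "\<lambda>k. u (Suc k) x - u k x" 1 "f n x"] by (simp add: u_def)
        moreover have "0 \<le> f n x * (u (Suc k) x - u k x)" for n k
          using fd[of k "Suc k" n] x X by (auto simp: Fp_def)
        ultimately have "(\<Sum>k. ennreal (f n x * (u (Suc k) x - u k x))) = ennreal (f n x)" for n
          by (rule suminf_ennreal_eq[rotated])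
        thus "1 \<le> (\<Sum>n. \<Sum>k. ennreal (f n x * (u (Suc k) x - u k x)))" using f(2) x by simp
      qed
      also have "\<dots> = (\<Sum>n. SUP K. ennreal (a K n))"
      proof (rule suminf_cong)
        fix n
        have "(\<Sum>k<K. ennreal (a (Suc k) n - a k n)) = ennreal (a K n)" for K
          using ainc sum_lessThan_telescope[of "\<lambda>k. a k n" K] by (subst sum_ennreal) (auto simp: a0)
        thus "(\<Sum>k. ennreal (\<Lambda> (\<lambda>x. f n x * (u (Suc k) x - u k x)))) = (SUP K. ennreal (a K n))"
          unfolding ad by (subst suminf_eq_SUP) simp
      qed
      also have "\<dots> = (SUP K. \<Sum>n. ennreal (a K n))"
        using ainc by (intro ennreal_suminf_SUP_eq) (auto intro!: incseq_SucI ennreal_leI)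
      finally have "outer (U \<inter> X) + outer ((\<Omega> - U) \<inter> X) \<le>
          (SUP K. \<Sum>n. ennreal (a K n)) + outer ((\<Omega> - U) \<inter> X)" by (rule add_right_mono)
      also have "\<dots> = (SUP K. (\<Sum>n. ennreal (a K n)) + outer ((\<Omega> - U) \<inter> X))"
        by (rule ennreal_SUP_add_left[symmetric]) simp
      also have "\<dots> \<le> (\<Sum>n. ennreal (\<Lambda> (f n)))"
      proof (rule SUP_least)
        fix K
        have "(\<lambda>n x. f n x * (1 - u K x)) \<in> covers ((\<Omega> - U) \<inter> X)"
          unfolding covers_def using f1 f(2) u_out by auto
        from outer_le[OF this]
        have "(\<Sum>n. ennreal (a K n)) + outer ((\<Omega> - U) \<inter> X) \<le>
            (\<Sum>n. ennreal (a K n)) + (\<Sum>n. ennreal (\<Lambda> (\<lambda>x. f n x * (1 - u K x))))"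
          by (rule add_left_mono)
        also have "\<dots> = (\<Sum>n. ennreal (a K n) + ennreal (\<Lambda> (\<lambda>x. f n x * (1 - u K x))))"
          by (rule suminf_add) auto
        also have "\<dots> = (\<Sum>n. ennreal (\<Lambda> (f n)))"
        proof (rule suminf_cong)
          fix n
          have "\<Lambda> (f n) = a K n + \<Lambda> (\<lambda>x. f n x * (1 - u K x))"
            using L_add[OF fu[of n K] f1[of n K]] by (simp add: a_def algebra_simps)
          thus "ennreal (a K n) + ennreal (\<Lambda> (\<lambda>x. f n x * (1 - u K x))) = ennreal (\<Lambda> (f n))"
            using ann L_nonneg[OF f1] by (simp add: ennreal_plus)
        qed
        finally show "(\<Sum>n. ennreal (a K n)) + outer ((\<Omega> - U) \<inter> X) \<le> (\<Sum>n. ennreal (\<Lambda> (f n)))" .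
      qed
      finally show "outer (U \<inter> X) + outer ((\<Omega> - U) \<inter> X) \<le> (\<Sum>n. ennreal (\<Lambda> (f n)))" .
    qed
  next
    interpret algebra \<Omega> "Pow \<Omega>" by (rule algebra_Pow)
    have "subadditive (Pow \<Omega>) outer"
      using outer_measure_space_outer by (intro countably_subadditive_subadditive) (auto simp: outer_measure_space_def)
    from subadditiveD[OF this, of "U \<inter> X" "(\<Omega> - U) \<inter> X"] X
    have "outer ((U \<inter> X) \<union> (\<Omega> - U) \<inter> X) \<le> outer (U \<inter> X) + outer ((\<Omega> - U) \<inter> X)"
      by (auto simp: U_def)
    moreover have "(U \<inter> X) \<union> (\<Omega> - U) \<inter> X = X" using X by auto
    ultimately show "outer X \<le> outer (U \<inter> X) + outer ((\<Omega> - U) \<inter> X)" by simp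
  qed
  thus ?thesis unfolding lambda_system_def U_def[symmetric] by (auto simp: U_def)
qed

lemma outer_le_functional:
  assumes "f \<in> Fp" "\<And>x. x \<in> A \<Longrightarrow> 1 \<le> f x"
  shows "outer A \<le> ennreal (\<Lambda> f)"
proof -
  define g where "g n = (if n = (0::nat) then f else (\<lambda>_. 0))" for n
  have eq: "(\<Sum>n. ennreal (h (g n))) = ennreal (h f)" if "h (\<lambda>_. 0) = 0" for h :: "('a \<Rightarrow> real) \<Rightarrow> real"
    using suminf_finite[of "{0}" "\<lambda>n. ennreal (h (g n))"] that by (simp add: g_def)
  have "g \<in> covers A"
    unfolding covers_def using assms eq[of "\<lambda>f. f _"] by (auto simp: g_def Fp_const)
  from outer_le[OF this] show ?thesis using eq[of \<Lambda>, OF L_zero] by simp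
qed

text \<open>A countable cover beats \<open>g\<close> only pointwise; \<open>dini\<close> lets
  finitely many terms beat \<open>g - e\<close> uniformly, and then additivity and monotonicity of
  \<open>\<Lambda>\<close> apply. Subtracting \<open>e\<close> provides the strict inequality in the
  hypothesis of \<open>dini\<close>.\<close>

lemma functional_le_outer:
  assumes g: "g \<in> Fp" "\<And>x. x \<in> A \<Longrightarrow> g x \<le> 1" "\<And>x. x \<in> \<Omega> - A \<Longrightarrow> g x \<le> 0" and A: "A \<subseteq> \<Omega>"
  shows "ennreal (\<Lambda> g) \<le> outer A"
  unfolding outer_def
proof (rule INF_greatest)
  fix f assume "f \<in> covers A"
  hence f: "\<And>n. f n \<in> Fp" "\<And>x. x \<in> A \<Longrightarrow> 1 \<le> (\<Sum>n. ennreal (f n x))" by (auto simp: covers_def)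
  show "ennreal (\<Lambda> g) \<le> (\<Sum>n. ennreal (\<Lambda> (f n)))"
  proof (rule ennreal_le_epsilon)
    fix e' :: real assume e': "e' > 0"
    define L1 where "L1 = \<Lambda> (\<lambda>_. 1)"
    have L1: "L1 \<ge> 0" unfolding L1_def by (intro L_nonneg Fp_const) simp
    \<comment> \<open>Chosen so that the constant function \<open>e\<close> costs at most
      \<open>e'\<close>; the \<open>+ 1\<close> covers \<open>L1 = 0\<close>.\<close>
    define e where "e = e' / (L1 + 1)"
    have e: "e > 0" using e' L1 by (simp add: e_def)
    have "\<exists>n. \<forall>x\<in>\<Omega>. g x - e \<le> (\<Sum>i<n. f i x)"
    proof (rule dini)
      show "f n \<in> F" for n using f by (simp add: Fp_def)
      show "(\<lambda>x. g x - e) \<in> F" using g by (simp add: Fp_def diff const)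
      show "0 \<le> f n x" if "x \<in> \<Omega>" for n x using f that by (simp add: Fp_def)
      fix x assume x: "x \<in> \<Omega>"
      show "\<exists>n. g x - e < (\<Sum>i<n. f i x)"
      proof (cases "x \<in> A")
        case False
        thus ?thesis using g(3)[of x] x e by (intro exI[of _ 0]) auto
      next
        case True
        show ?thesis
        proof (rule ccontr)
          assume "\<not> ?thesis"
          hence *: "(\<Sum>i<n. f i x) \<le> 1 - e" for n using g(2)[OF True] by (meson diff_right_mono not_less order_trans)
          have "(\<Sum>n. ennreal (f n x)) \<le> ennreal (1 - e)"
            unfolding suminf_eq_SUP using f(1) x *
            by (intro SUP_least) (subst sum_ennreal, auto simp: Fp_def intro!: ennreal_leI)
          also have "\<dots> < 1" using e by (simp add: ennreal_less_one_iff)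
          finally show False using f(2)[OF True] by simp
        qed
      qed
    qed
    then obtain n where n: "\<And>x. x \<in> \<Omega> \<Longrightarrow> g x - e \<le> (\<Sum>i<n. f i x)" by blast
    have s: "(\<lambda>x. \<Sum>i<n. f i x) \<in> Fp" using f by (auto simp: Fp_def intro!: sum sum_nonneg)
    have "\<Lambda> g \<le> \<Lambda> (\<lambda>x. (\<Sum>i<n. f i x) + e)"
      using n g(1) s e by (intro L_mono) (auto simp: Fp_def algebra_simps intro!: add const)
    also have "\<dots> = (\<Sum>i<n. \<Lambda> (f i)) + e * L1"
      using L_add[OF s Fp_const[of e]] L_sum[of n f] f L_scale[OF Fp_const[of 1], of e] e by (simp add: L1_def)
    finally have "ennreal (\<Lambda> g) \<le> ennreal ((\<Sum>i<n. \<Lambda> (f i)) + e')"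
    proof -
      assume *: "\<Lambda> g \<le> (\<Sum>i<n. \<Lambda> (f i)) + e * L1"
      have "e * L1 \<le> e'" using e' L1 by (simp add: e_def field_simps)
      with * show ?thesis by (intro ennreal_leI) simp
    qed
    also have "\<dots> = (\<Sum>i<n. ennreal (\<Lambda> (f i))) + ennreal e'"
      using L_nonneg[OF f(1)] e' by (subst sum_ennreal) (auto simp: sum_nonneg)
    also have "\<dots> \<le> (\<Sum>n. ennreal (\<Lambda> (f n))) + ennreal e'"
      by (intro add_right_mono sum_le_suminf) auto
    finally show "ennreal (\<Lambda> g) \<le> (\<Sum>n. ennreal (\<Lambda> (f n))) + ennreal e'" .
  qed
qed

text \<open>Caratheodory's construction gives the measure. For the integral formula with
  \<open>0 \<le> f \<le> 1\<close> it suffices to bound \<open>\<Lambda> f\<close> by the integral: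
  applied to \<open>1 - f\<close> this gives the converse, as both sides agree on the constant
  1.\<close>

theorem riesz_representation:
  obtains \<mu> where "space \<mu> = \<Omega>" "finite_measure \<mu>" "\<And>f. f \<in> F \<Longrightarrow> f \<in> borel_measurable \<mu>"
    "\<And>f. f \<in> Fp \<Longrightarrow> \<Lambda> f = integral\<^sup>L \<mu> f"
proof -
  define M where "M = lambda_system \<Omega> (Pow \<Omega>) outer"
  interpret P: sigma_algebra \<Omega> "Pow \<Omega>" by (rule sigma_algebra_Pow)
  have ms: "measure_space \<Omega> M outer"
    unfolding M_def by (rule P.caratheodory_lemma[OF outer_measure_space_outer])
  define \<mu> where "\<mu> = measure_of \<Omega> M outer"
  have sub: "M \<subseteq> Pow \<Omega>" by (auto simp: M_def lambda_system_def)
  have space: "space \<mu> = \<Omega>" by (simp add: \<mu>_def space_measure_of_conv)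
  have sets: "sets \<mu> = M"
    using ms sub sigma_algebra.sigma_sets_eq[of \<Omega> M] unfolding \<mu>_def measure_space_def by simp
  have em: "emeasure \<mu> A = outer A" if "A \<in> M" for A
    using ms that unfolding \<mu>_def measure_space_def by (intro emeasure_measure_of_sigma) auto
  have \<Omega>M: "\<Omega> \<in> M" using sets.top[of \<mu>] by (simp add: space sets)
  have "outer \<Omega> \<le> ennreal (\<Lambda> (\<lambda>_. 1))" by (intro outer_le_functional Fp_const) auto
  hence fin: "finite_measure \<mu>"
    using em[OF \<Omega>M] by (intro finite_measureI) (auto simp: space top_unique)
  interpret finite_measure \<mu> by fact
  have pos: "{x\<in>\<Omega>. a < f x} \<in> M" if "f \<in> F" for f a
    using positive_set_in_lambda_system[OF diff[OF that const[of a]]] by (simp add: M_def)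
  have meas: "f \<in> borel_measurable \<mu>" if "f \<in> F" for f
    unfolding borel_measurable_iff_greater space sets using pos[OF that] by simp
  have integrable: "integrable \<mu> f" if f: "f \<in> F" for f
  proof -
    obtain C where C: "\<forall>x\<in>\<Omega>. \<bar>f x\<bar> \<le> C" using bounded[OF f] by blast
    thus ?thesis using meas[OF f] by (intro integrable_const_bound[of f C]) (auto simp: space)
  qed
  have L1: "\<Lambda> (\<lambda>_. 1) = measure \<mu> \<Omega>"
  proof -
    have "ennreal (\<Lambda> (\<lambda>_. 1)) = outer \<Omega>"
      by (intro antisym functional_le_outer outer_le_functional Fp_const) auto
    thus ?thesis using em[OF \<Omega>M] L_nonneg[OF Fp_const[of 1]] by (metis measure_def enn2real_ennreal zero_le_one)
  qed
  have le: "\<Lambda> f \<le> integral\<^sup>L \<mu> f" if f: "f \<in> Fp" and f1: "\<And>x. x \<in> \<Omega> \<Longrightarrow> f x \<le> 1" for f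
  proof -
    have fF: "f \<in> F" and f0: "\<And>x. x \<in> \<Omega> \<Longrightarrow> 0 \<le> f x" using f by (auto simp: Fp_def)
    have *: "\<Lambda> f - integral\<^sup>L \<mu> f \<le> measure \<mu> \<Omega> / n" if n: "n > 0" for n :: nat
    proof -
      \<comment> \<open>Horizontal slices of \<open>f\<close> of height \<open>1 / n\<close>. The
        rescaled slice \<open>n * g j\<close> is at most 1 and vanishes off
        \<open>{f > j / n}\<close>, so the measure of that set bounds its functional.\<close>
      define g where "g j x = min (f x) (real (Suc j) / n) - min (f x) (real j / n)" for j x
      have gF: "g j \<in> F" for j unfolding g_def by (intro diff min fF const)
      have g0: "0 \<le> g j x" for j x using n unfolding g_def by (auto simp: min_def field_simps)
      have g1: "n * g j x \<le> 1" for j x using n unfolding g_def by (auto simp: min_def field_simps)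
      have gFp: "g j \<in> Fp" for j using gF g0 by (simp add: Fp_def)
      have gj: "\<Lambda> (g j) \<le> measure \<mu> {x\<in>\<Omega>. real j / n < f x} / n" for j
      proof -
        have "ennreal (\<Lambda> (\<lambda>x. real n * g j x)) \<le> outer {x\<in>\<Omega>. real j / n < f x}"
        proof (rule functional_le_outer)
          show "(\<lambda>x. real n * g j x) \<in> Fp" using gFp[of j] by (simp add: Fp_def scale)
          show "real n * g j x \<le> 0" if "x \<in> \<Omega> - {x \<in> \<Omega>. real j / n < f x}" for x
          proof -
            have "f x \<le> real j / n" using that by auto
            moreover have "real j / n \<le> real (Suc j) / n" using n by (simp add: divide_right_mono)
            ultimately show ?thesis by (simp add: g_def min_def)
          qed
        qed (use g1 in auto)
        also have "\<dots> = ennreal (measure \<mu> {x\<in>\<Omega>. real j / n < f x})"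
          using em[OF pos[OF fF]] by (simp add: emeasure_eq_measure)
        finally have "\<Lambda> (\<lambda>x. real n * g j x) \<le> measure \<mu> {x\<in>\<Omega>. real j / n < f x}" by (simp add: ennreal_le_iff)
        thus ?thesis using L_scale[OF gFp[of j], of "real n"] n by (simp add: field_simps)
      qed
      have "\<Lambda> f = \<Lambda> (\<lambda>x. \<Sum>j<n. g j x)"
      proof (rule L_cong[OF f])
        show "(\<lambda>x. \<Sum>j<n. g j x) \<in> Fp" using gF g0 by (auto simp: Fp_def intro!: sum sum_nonneg)
        fix x assume "x \<in> \<Omega>"
        thus "f x = (\<Sum>j<n. g j x)"
          unfolding g_def using f0 f1 n sum_lessThan_telescope[of "\<lambda>j. min (f x) (real j / n)" n] by simp
      qed
      also have "\<dots> \<le> (\<Sum>j<n. measure \<mu> {x\<in>\<Omega>. real j / n < f x} / n)"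
        using L_sum[of n g] gFp gj by (simp add: sum_mono)
      also have "\<dots> = (\<Sum>j<n. integral\<^sup>L \<mu> (\<lambda>x. indicator {x\<in>\<Omega>. real j / n < f x} x / n))"
        using pos[OF fF] sets sets.sets_into_space[of _ \<mu>] by (intro sum.cong refl) (auto simp: Int_absorb1)
      also have "\<dots> = integral\<^sup>L \<mu> (\<lambda>x. \<Sum>j<n. indicator {x\<in>\<Omega>. real j / n < f x} x / n)"
        using pos[OF fF] by (intro Bochner_Integration.integral_sum[symmetric]) (auto simp: sets emeasure_eq_measure)
      also have "\<dots> \<le> integral\<^sup>L \<mu> (\<lambda>x. f x + 1 / n)"
      proof (rule integral_mono)
        show "integrable \<mu> (\<lambda>x. \<Sum>j<n. indicator {x\<in>\<Omega>. real j / n < f x} x / n)"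
          using pos[OF fF] by (intro Bochner_Integration.integrable_sum) (auto simp: sets emeasure_eq_measure)
        show "integrable \<mu> (\<lambda>x. f x + 1 / n)" by (intro integrable add fF const)
        fix x assume "x \<in> space \<mu>"
        hence x: "x \<in> \<Omega>" by (simp add: space)
        \<comment> \<open>Truncating \<open>f + 1 / n\<close> instead of \<open>f\<close> makes each
          increment at least \<open>1 / n\<close> times the indicator of \<open>{f > j / n}\<close>;
          the shift costs the error term \<open>measure \<mu> \<Omega> / n\<close>.\<close>
        define m where "m j = min (f x + 1 / n) (real j / n)" for j
        have "(\<Sum>j<n. indicator {x\<in>\<Omega>. real j / n < f x} x / n) \<le> (\<Sum>j<n. m (Suc j) - m j)"
          using n x unfolding m_def by (intro sum_mono) (auto simp: min_def indicator_def field_simps)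
        also have "\<dots> = m n - m 0" by (rule sum_lessThan_telescope)
        also have "\<dots> \<le> f x + 1 / n" using f0[OF x] by (simp add: m_def)
        finally show "(\<Sum>j<n. indicator {x\<in>\<Omega>. real j / n < f x} x / n) \<le> f x + 1 / n" .
      qed
      also have "\<dots> = integral\<^sup>L \<mu> f + measure \<mu> \<Omega> / n"
        using integrable[OF fF] by (simp add: space)
      finally show ?thesis by simp
    qed
    show ?thesis
    proof (rule ccontr)
      assume "\<not> ?thesis"
      hence d: "\<Lambda> f - integral\<^sup>L \<mu> f > 0" by simp
      obtain n :: nat where n: "real n > measure \<mu> \<Omega> / (\<Lambda> f - integral\<^sup>L \<mu> f)" using reals_Archimedean2 by blast
      have "0 \<le> measure \<mu> \<Omega> / (\<Lambda> f - integral\<^sup>L \<mu> f)" using d by simp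
      hence "n > 0" using n by linarith
      thus False using *[of n] n d by (simp add: field_simps)
    qed
  qed
  have eq1: "\<Lambda> f = integral\<^sup>L \<mu> f" if f: "f \<in> Fp" and f1: "\<And>x. x \<in> \<Omega> \<Longrightarrow> f x \<le> 1" for f
  proof (rule antisym[OF le[OF that]])
    have f': "(\<lambda>x. 1 - f x) \<in> Fp" using that by (auto simp: Fp_def diff const)
    have "\<Lambda> (\<lambda>_. 1) = \<Lambda> (\<lambda>x. f x + (1 - f x))" by simp
    also have "\<dots> = \<Lambda> f + \<Lambda> (\<lambda>x. 1 - f x)" by (rule L_add[OF f f'])
    also have "\<Lambda> (\<lambda>x. 1 - f x) \<le> integral\<^sup>L \<mu> (\<lambda>x. 1 - f x)" using f by (intro le f') (auto simp: Fp_def)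
    also have "\<dots> = measure \<mu> \<Omega> - integral\<^sup>L \<mu> f"
      using integrable f by (simp add: Fp_def space)
    finally show "integral\<^sup>L \<mu> f \<le> \<Lambda> f" using L1 by simp
  qed
  have eq: "\<Lambda> f = integral\<^sup>L \<mu> f" if f: "f \<in> Fp" for f
  proof -
    obtain C where C: "\<forall>x\<in>\<Omega>. \<bar>f x\<bar> \<le> C" using bounded[of f] f unfolding Fp_def by blast
    define D where "D = max C 1"
    have D: "D > 0" "\<And>x. x \<in> \<Omega> \<Longrightarrow> f x \<le> D" using C by (force simp: D_def)+
    have f': "(\<lambda>x. (1 / D) * f x) \<in> Fp" using f D unfolding Fp_def by (auto intro: scale simp del: times_divide_eq_left)
    have "(1 / D) * \<Lambda> f = \<Lambda> (\<lambda>x. (1 / D) * f x)" using D by (intro L_scale[OF f, symmetric]) simp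
    also have "\<dots> = integral\<^sup>L \<mu> (\<lambda>x. (1 / D) * f x)" using D by (intro eq1 f') auto
    finally show ?thesis using D by simp
  qed
  show ?thesis by (rule that[OF space fin meas eq])
qed

end

text \<open>Jordan decomposition of a bounded functional: the positive part of \<open>l\<close> at
  \<open>f\<close> is the supremum of \<open>l g\<close> over \<open>0 \<le> g \<le> f\<close>, and
  the negative part is what exceeds \<open>l\<close>. Each is a positive functional with its own
  measure.\<close>

theorem (in function_lattice) bounded_functional_representation:
  assumes add': "\<And>f g. f \<in> F \<Longrightarrow> g \<in> F \<Longrightarrow> l (\<lambda>x. f x + g x) = l f + l g"
    and scale': "\<And>f c. f \<in> F \<Longrightarrow> l (\<lambda>x. c * f x) = c * l f"
    and bd: "\<And>f c. f \<in> F \<Longrightarrow> (\<And>x. x \<in> \<Omega> \<Longrightarrow> \<bar>f x\<bar> \<le> c) \<Longrightarrow> \<bar>l f\<bar> \<le> B * c"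
  obtains \<mu> \<nu> where "space \<mu> = \<Omega>" "finite_measure \<mu>" "\<And>f. f \<in> F \<Longrightarrow> f \<in> borel_measurable \<mu>"
    "space \<nu> = \<Omega>" "finite_measure \<nu>" "\<And>f. f \<in> F \<Longrightarrow> f \<in> borel_measurable \<nu>"
    "\<And>f. f \<in> F \<Longrightarrow> l f = integral\<^sup>L \<mu> f - integral\<^sup>L \<nu> f"
proof -
  \<comment> \<open>The bound with \<open>c = 0\<close> shows that \<open>l\<close> only sees the
    values on \<open>\<Omega>\<close>.\<close>
  have cong: "l f = l g" if "f \<in> F" "g \<in> F" "\<And>x. x \<in> \<Omega> \<Longrightarrow> f x = g x" for f g
  proof -
    have "\<bar>l (\<lambda>x. f x + -1 * g x)\<bar> \<le> B * 0" using that by (intro bd add scale) auto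
    moreover have "l (\<lambda>x. f x + -1 * g x) = l f + -1 * l g"
      using that add'[OF that(1) scale[of g "-1"]] scale'[of g "-1"] by simp
    ultimately show ?thesis by simp
  qed
  define S where "S f = l ` {g \<in> F. \<forall>x\<in>\<Omega>. 0 \<le> g x \<and> g x \<le> f x}" for f
  define P where "P f = Sup (S f)" for f
  have bdd: "bdd_above (S f)" if f: "f \<in> Fp" for f
  proof -
    obtain C where C: "\<forall>x\<in>\<Omega>. \<bar>f x\<bar> \<le> C" using bounded[of f] f unfolding Fp_def by blast
    have "l g \<le> B * C" if "g \<in> F" "\<forall>x\<in>\<Omega>. 0 \<le> g x \<and> g x \<le> f x" for g
      using bd[of g C] that C by fastforce
    thus ?thesis by (intro bdd_aboveI[of _ "B * C"]) (auto simp: S_def)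
  qed
  have P_ge: "l g \<le> P f" if "f \<in> Fp" "g \<in> F" "\<And>x. x \<in> \<Omega> \<Longrightarrow> 0 \<le> g x \<and> g x \<le> f x" for f g
    unfolding P_def using that bdd by (intro cSup_upper) (auto simp: S_def)
  have l0: "l (\<lambda>_. 0) = 0" using scale'[OF const[of 0], of 0] by simp
  have S_ne: "S f \<noteq> {}" if "f \<in> Fp" for f
    using that const[of 0] by (auto simp: S_def Fp_def intro!: exI[of _ "\<lambda>_. 0"])
  have P_le: "P f \<le> c" if "f \<in> Fp" "\<And>g. g \<in> F \<Longrightarrow> (\<And>x. x \<in> \<Omega> \<Longrightarrow> 0 \<le> g x \<and> g x \<le> f x) \<Longrightarrow> l g \<le> c" for f c
    unfolding P_def using S_ne[OF that(1)] that(2) by (intro cSup_least) (auto simp: S_def)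
  have P_add: "P (\<lambda>x. f x + g x) = P f + P g" if f: "f \<in> Fp" and g: "g \<in> Fp" for f g
  proof (rule antisym)
    have fg: "(\<lambda>x. f x + g x) \<in> Fp" using f g by (auto simp: Fp_def add)
    show "P (\<lambda>x. f x + g x) \<le> P f + P g"
    proof (rule P_le[OF fg])
      fix h assume h: "h \<in> F" "\<And>x. x \<in> \<Omega> \<Longrightarrow> 0 \<le> h x \<and> h x \<le> f x + g x"
      \<comment> \<open>Riesz decomposition: a function below \<open>f + g\<close> is the sum of
        \<open>min h f\<close>, which is below \<open>f\<close>, and a remainder below
        \<open>g\<close>.\<close>
      define k where "k x = min (h x) (f x)" for x
      have k: "k \<in> F" unfolding k_def using h f by (intro min) (auto simp: Fp_def)
      have "l h = l (\<lambda>x. k x + (h x - k x))" by simp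
      also have "\<dots> = l k + l (\<lambda>x. h x - k x)" by (rule add'[OF k diff[OF h(1) k]])
      also have "\<dots> \<le> P f + P g"
        using h f g k diff[OF h(1) k] by (intro add_mono P_ge) (auto simp: k_def Fp_def min_def algebra_simps)
      finally show "l h \<le> P f + P g" .
    qed
    have "P f \<le> P (\<lambda>x. f x + g x) - l k" if k: "k \<in> F" "\<And>x. x \<in> \<Omega> \<Longrightarrow> 0 \<le> k x \<and> k x \<le> g x" for k
    proof (rule P_le[OF f])
      fix h assume h: "h \<in> F" "\<And>x. x \<in> \<Omega> \<Longrightarrow> 0 \<le> h x \<and> h x \<le> f x"
      have "l (\<lambda>x. h x + k x) \<le> P (\<lambda>x. f x + g x)"
        using h k fg by (intro P_ge add) (auto intro: add_mono)
      thus "l h \<le> P (\<lambda>x. f x + g x) - l k" using add'[OF h(1) k(1)] by simp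
    qed
    hence "l k \<le> P (\<lambda>x. f x + g x) - P f" if k: "k \<in> F" "\<And>x. x \<in> \<Omega> \<Longrightarrow> 0 \<le> k x \<and> k x \<le> g x" for k
      using that by (simp add: algebra_simps)
    with P_le[OF g] have "P g \<le> P (\<lambda>x. f x + g x) - P f" by blast
    thus "P f + P g \<le> P (\<lambda>x. f x + g x)" by simp
  qed
  have P_scale1: "P (\<lambda>x. c * f x) \<le> c * P f" if f: "f \<in> Fp" and c: "c > 0" for f c
  proof (rule P_le)
    show "(\<lambda>x. c * f x) \<in> Fp" using f c by (auto simp: Fp_def scale)
    fix h assume h: "h \<in> F" "\<And>x. x \<in> \<Omega> \<Longrightarrow> 0 \<le> h x \<and> h x \<le> c * f x"
    have "l (\<lambda>x. (1 / c) * h x) \<le> P f"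
      using h c by (intro P_ge f scale) (auto simp: field_simps)
    hence "(1 / c) * l h \<le> P f" unfolding scale'[OF h(1)] .
    thus "l h \<le> c * P f" using c by (simp add: field_simps)
  qed
  have P0: "P (\<lambda>_. 0) = 0"
  proof (rule antisym)
    have z: "(\<lambda>_. 0) \<in> Fp" by (simp add: Fp_def const)
    show "P (\<lambda>_. 0) \<le> 0"
    proof (rule P_le[OF z])
      fix g assume "g \<in> F" "\<And>x. x \<in> \<Omega> \<Longrightarrow> 0 \<le> g x \<and> g x \<le> 0"
      thus "l g \<le> 0" using cong[of g "\<lambda>_. 0"] const[of 0] l0 by (metis antisym order_refl)
    qed
    show "0 \<le> P (\<lambda>_. 0)" using P_ge[OF z const[of 0]] l0 by simp
  qed
  have P_scale: "P (\<lambda>x. c * f x) = c * P f" if f: "f \<in> Fp" and c: "c \<ge> 0" for f c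
  proof (cases "c = 0")
    case True
    thus ?thesis using P0 by simp
  next
    case False
    hence c': "c > 0" using c by simp
    have cf: "(\<lambda>x. c * f x) \<in> Fp" using f c by (auto simp: Fp_def scale)
    have "P (\<lambda>x. (1 / c) * (c * f x)) \<le> (1 / c) * P (\<lambda>x. c * f x)"
      using c' by (intro P_scale1 cf) simp
    hence "c * P f \<le> P (\<lambda>x. c * f x)" using c' by (simp add: field_simps)
    with P_scale1[OF f c'] show ?thesis by simp
  qed
  have P_cong: "P f = P g" if "f \<in> Fp" "g \<in> Fp" "\<And>x. x \<in> \<Omega> \<Longrightarrow> f x = g x" for f g
  proof -
    have "S f = S g" using that(3) unfolding S_def by (intro arg_cong[of _ _ "image l"]) auto
    thus ?thesis by (simp add: P_def)
  qed
  have P_nonneg: "0 \<le> P f" if "f \<in> Fp" for f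
    using P_ge[OF that const[of 0]] l0 that by (simp add: Fp_def)
  have P_pos: "positive_functional \<Omega> F P"
    by unfold_locales (fact P_add P_scale P_nonneg P_cong)+
  define N where "N f = P f - l f" for f
  have N_pos: "positive_functional \<Omega> F N"
  proof unfold_locales
    fix f assume f: "f \<in> Fp"
    show "0 \<le> N f" using P_ge[OF f, of f] f by (simp add: N_def Fp_def)
    show "N (\<lambda>x. c * f x) = c * N f" if "c \<ge> 0" for c
      using P_scale[OF f that] scale'[of f c] f by (simp add: N_def Fp_def algebra_simps)
    fix g assume g: "g \<in> Fp"
    show "N (\<lambda>x. f x + g x) = N f + N g"
      using P_add[OF f g] add'[of f g] f g by (simp add: N_def Fp_def)
    assume eq: "\<And>x. x \<in> \<Omega> \<Longrightarrow> f x = g x"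
    show "N f = N g"
      using P_cong[OF f g eq] cong[OF _ _ eq] f g by (simp add: N_def Fp_def)
  qed
  obtain \<mu> where \<mu>: "space \<mu> = \<Omega>" "finite_measure \<mu>" "\<And>f. f \<in> F \<Longrightarrow> f \<in> borel_measurable \<mu>"
    "\<And>f. f \<in> Fp \<Longrightarrow> P f = integral\<^sup>L \<mu> f"
    using positive_functional.riesz_representation[OF P_pos] by blast
  obtain \<nu> where \<nu>: "space \<nu> = \<Omega>" "finite_measure \<nu>" "\<And>f. f \<in> F \<Longrightarrow> f \<in> borel_measurable \<nu>"
    "\<And>f. f \<in> Fp \<Longrightarrow> N f = integral\<^sup>L \<nu> f"
    using positive_functional.riesz_representation[OF N_pos] by blast
  show ?thesis
  proof (rule that[OF \<mu>(1-3) \<nu>(1-3)])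
    fix f assume f: "f \<in> F"
    obtain C where C: "\<forall>x\<in>\<Omega>. \<bar>f x\<bar> \<le> C" using bounded[OF f] by blast
    \<comment> \<open>Adding the constant \<open>D\<close> moves \<open>f\<close> into
      \<open>Fp\<close>, where both representations hold.\<close>
    define D where "D = \<bar>C\<bar>"
    have D: "(\<lambda>x. f x + D) \<in> Fp" "(\<lambda>_. D) \<in> Fp"
      using C f by (force simp: Fp_def D_def intro!: add const)+
    have int: "integrable m g" if "finite_measure m" "space m = \<Omega>" "g \<in> borel_measurable m" "g \<in> F" for m g
      using bounded[OF that(4)] that finite_measure.integrable_const_bound[OF that(1), of g] by auto
    have l_Fp: "l g = integral\<^sup>L \<mu> g - integral\<^sup>L \<nu> g" if "g \<in> Fp" for g
      using \<mu>(4)[OF that] \<nu>(4)[OF that] by (simp add: N_def)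
    have "l f = l (\<lambda>x. f x + D) - l (\<lambda>_. D)" using add'[OF f const[of D]] by simp
    also have "\<dots> = (integral\<^sup>L \<mu> (\<lambda>x. f x + D) - integral\<^sup>L \<mu> (\<lambda>_. D)) -
        (integral\<^sup>L \<nu> (\<lambda>x. f x + D) - integral\<^sup>L \<nu> (\<lambda>_. D))"
      using l_Fp D by simp
    also have "\<dots> = integral\<^sup>L \<mu> f - integral\<^sup>L \<nu> f"
      using int[OF \<mu>(2,1) \<mu>(3)[OF f] f] int[OF \<nu>(2,1) \<nu>(3)[OF f] f]
        int[OF \<mu>(2,1) \<mu>(3) const[of D]] int[OF \<nu>(2,1) \<nu>(3) const[of D]] const[of D]
      by (subst (1 2) Bochner_Integration.integral_add) auto
    finally show "l f = integral\<^sup>L \<mu> f - integral\<^sup>L \<nu> f" .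
  qed
qed

section \<open>Signed integrals\<close>

text \<open>Two decompositions \<open>M - P = Q - N\<close> of one signed measure are compared in
  additive form, which has a meaning in \<open>ennreal\<close>.\<close>

lemma nn_integral_add_measures:
  assumes sets: "sets N = sets M" "sets P = sets M" "sets Q = sets M"
    and eq: "\<And>A. A \<in> sets M \<Longrightarrow> emeasure M A + emeasure N A = emeasure P A + emeasure Q A"
    and f: "f \<in> borel_measurable M"
  shows "integral\<^sup>N M f + integral\<^sup>N N f = integral\<^sup>N P f + integral\<^sup>N Q f"
proof -
  have meas: "g \<in> borel_measurable N" "g \<in> borel_measurable P" "g \<in> borel_measurable Q"
    if "g \<in> borel_measurable M" for g :: "'a \<Rightarrow> ennreal"
    using that sets[THEN measurable_cong_sets, OF refl, of borel] by blast+
  have space: "space N = space M" "space P = space M" "space Q = space M"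
    using sets by (auto dest: sets_eq_imp_space_eq)
  show ?thesis
    using f
  proof (induction rule: borel_measurable_induct)
    case (cong f g)
    hence "integral\<^sup>N M f = integral\<^sup>N M g" "integral\<^sup>N N f = integral\<^sup>N N g"
      "integral\<^sup>N P f = integral\<^sup>N P g" "integral\<^sup>N Q f = integral\<^sup>N Q g"
      using space by (auto intro!: nn_integral_cong)
    thus ?case using cong.IH by simp
  next
    case (set A)
    thus ?case using eq[of A] sets by simp
  next
    case (mult u c)
    hence "c * integral\<^sup>N M u + c * integral\<^sup>N N u = c * integral\<^sup>N P u + c * integral\<^sup>N Q u"
      by (simp only: distrib_left[symmetric] mult.IH)
    thus ?case
      unfolding nn_integral_cmult[OF mult(2)] nn_integral_cmult[OF meas(1)[OF mult(2)]]
        nn_integral_cmult[OF meas(2)[OF mult(2)]] nn_integral_cmult[OF meas(3)[OF mult(2)]] .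
  next
    case (add u v)
    have eqs: "integral\<^sup>N K (\<lambda>x. v x + u x) = integral\<^sup>N K v + integral\<^sup>N K u"
      if "v \<in> borel_measurable K" "u \<in> borel_measurable K" for K
      using that by (rule nn_integral_add)
    have *: "integral\<^sup>N K (\<lambda>x. v x + u x) + integral\<^sup>N K' (\<lambda>x. v x + u x) =
        (integral\<^sup>N K v + integral\<^sup>N K' v) + (integral\<^sup>N K u + integral\<^sup>N K' u)"
      if "v \<in> borel_measurable K" "u \<in> borel_measurable K" "v \<in> borel_measurable K'" "u \<in> borel_measurable K'" for K K'
      unfolding eqs[OF that(1,2)] eqs[OF that(3,4)] by (simp only: ac_simps)
    have u: "u \<in> borel_measurable M" and v: "v \<in> borel_measurable M" by fact+
    show ?case
      unfolding *[OF v u meas(1)[OF v] meas(1)[OF u]] *[OF meas(2)[OF v] meas(2)[OF u] meas(3)[OF v] meas(3)[OF u]]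
        add.IH by (rule refl)
  next
    case (seq U)
    have Sup_eq: "Sup (range U) = (\<lambda>x. SUP i. U i x)" by (rule ext) (rule SUP_apply)
    have sup: "integral\<^sup>N K (Sup (range U)) = (SUP i. integral\<^sup>N K (U i))"
      if "\<And>i. U i \<in> borel_measurable K" for K
      using nn_integral_monotone_convergence_SUP[OF \<open>incseq U\<close> that] by (simp only: Sup_eq)
    have inc: "incseq (\<lambda>i. integral\<^sup>N K (U i))" for K
      using \<open>incseq U\<close> by (auto simp: incseq_def le_fun_def intro!: nn_integral_mono)
    have "integral\<^sup>N M (Sup (range U)) + integral\<^sup>N N (Sup (range U)) =
        (SUP i. integral\<^sup>N M (U i) + integral\<^sup>N N (U i))"
      using seq(1) by (simp only: sup meas ennreal_SUP_add[OF inc inc])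
    also have "\<dots> = (SUP i. integral\<^sup>N P (U i) + integral\<^sup>N Q (U i))" by (simp only: seq.IH)
    also have "\<dots> = integral\<^sup>N P (Sup (range U)) + integral\<^sup>N Q (Sup (range U))"
      using seq(1) by (simp only: sup meas ennreal_SUP_add[OF inc inc])
    finally show ?case .
  qed
qed

lemma integral_add_measures:
  fixes f :: "'a \<Rightarrow> real"
  assumes sets: "sets N = sets M" "sets P = sets M" "sets Q = sets M"
    and eq: "\<And>A. A \<in> sets M \<Longrightarrow> emeasure M A + emeasure N A = emeasure P A + emeasure Q A"
    and int: "integrable M f" "integrable N f" "integrable P f" "integrable Q f"
  shows "integral\<^sup>L M f + integral\<^sup>L N f = integral\<^sup>L P f + integral\<^sup>L Q f"
proof -
  have *: "enn2real (integral\<^sup>N M g) + enn2real (integral\<^sup>N N g) = enn2real (integral\<^sup>N P g) + enn2real (integral\<^sup>N Q g)"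
    if "integrable M h" "integrable N h" "integrable P h" "integrable Q h" and g: "g = (\<lambda>x. ennreal (h x))" for g h
  proof -
    have fin: "integral\<^sup>N K g < top" if "integrable K h" for K
      using that unfolding g real_integrable_def by (simp add: top.not_eq_extremum)
    have "integral\<^sup>N M g + integral\<^sup>N N g = integral\<^sup>N P g + integral\<^sup>N Q g"
      using that(1) unfolding g by (intro nn_integral_add_measures sets eq) auto
    from arg_cong[OF this, of enn2real] show ?thesis
      using fin[OF that(1)] fin[OF that(2)] fin[OF that(3)] fin[OF that(4)] by (simp add: enn2real_plus)
  qed
  have neg: "integrable M (\<lambda>x. - f x)" "integrable N (\<lambda>x. - f x)" "integrable P (\<lambda>x. - f x)" "integrable Q (\<lambda>x. - f x)"
    using int by auto
  show ?thesis
    using *[OF int refl] *[OF neg refl] by (simp add: real_lebesgue_integral_def[OF int(1)]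
        real_lebesgue_integral_def[OF int(2)] real_lebesgue_integral_def[OF int(3)] real_lebesgue_integral_def[OF int(4)])
qed

lemma space_pos_part[simp]: "space (pos_part N \<nu>) = space N"
  and sets_pos_part[simp]: "sets (pos_part N \<nu>) = sets N"
  by (simp_all add: pos_part_def sets.space_closed space_measure_of sets.sets_measure_of_eq)

text \<open>By the Hahn decomposition with positive set \<open>Y\<close>, the supremum over subsets
  of \<open>A\<close> is attained at \<open>A \<inter> Y\<close>. This makes the set function in
  \<open>pos_part\<close> countably additive, so that \<open>measure_of\<close> does not discard
  it.\<close>

lemma pos_part_difference:
  assumes fin: "finite_measure \<mu>1" "finite_measure \<mu>2" and sets: "sets \<mu>1 = sets N" "sets \<mu>2 = sets N"
    and Y: "Y \<in> sets N" "\<And>X. X \<in> sets N \<Longrightarrow> X \<subseteq> Y \<Longrightarrow> measure \<mu>2 X \<le> measure \<mu>1 X"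
      "\<And>X. X \<in> sets N \<Longrightarrow> X \<inter> Y = {} \<Longrightarrow> measure \<mu>1 X \<le> measure \<mu>2 X"
    and A: "A \<in> sets N" and \<nu>: "\<And>A. A \<in> sets N \<Longrightarrow> \<nu> A = measure \<mu>1 A - measure \<mu>2 A"
  shows "emeasure (pos_part N \<nu>) A = ennreal (\<nu> (A \<inter> Y))"
proof -
  interpret m1: finite_measure \<mu>1 by fact
  interpret m2: finite_measure \<mu>2 by fact
  have pos: "0 \<le> \<nu> (A \<inter> Y)" if "A \<in> sets N" for A
    using Y(2)[of "A \<inter> Y"] \<nu>[of "A \<inter> Y"] that Y(1) by auto
  have add: "\<nu> (B \<union> C) = \<nu> B + \<nu> C" if "B \<in> sets N" "C \<in> sets N" "B \<inter> C = {}" for B C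
    using that \<nu> sets m1.finite_measure_Union[of B C] m2.finite_measure_Union[of B C] by simp
  have le: "\<nu> C \<le> \<nu> (A \<inter> Y)" if C: "C \<in> sets N" "C \<subseteq> A" and A: "A \<in> sets N" for A C
  proof -
    have "\<nu> C = \<nu> ((C \<inter> Y) \<union> (C - Y))" by (simp add: Int_Diff_Un)
    also have "\<dots> = \<nu> (C \<inter> Y) + \<nu> (C - Y)" using C Y(1) by (intro add) auto
    also have "\<nu> (C - Y) \<le> 0" using Y(3)[of "C - Y"] \<nu>[of "C - Y"] C Y(1) by auto
    also have "\<nu> (C \<inter> Y) + 0 \<le> \<nu> (C \<inter> Y) + \<nu> ((A - C) \<inter> Y)" using pos[of "A - C"] A C by auto
    also have "\<dots> = \<nu> ((C \<inter> Y) \<union> ((A - C) \<inter> Y))" using C A Y(1) by (intro add[symmetric]) auto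
    also have "(C \<inter> Y) \<union> ((A - C) \<inter> Y) = A \<inter> Y" using C by auto
    finally show ?thesis by simp
  qed
  have sup: "(SUP C\<in>{C \<in> sets N. C \<subseteq> A}. ennreal (\<nu> C)) = ennreal (\<nu> (A \<inter> Y))" if "A \<in> sets N" for A
    using that le Y(1) by (intro antisym SUP_least SUP_upper) (auto intro!: ennreal_leI)
  define P where "P = (\<lambda>A. ennreal (\<nu> (A \<inter> Y)))"
  have "countably_additive (sets N) P"
    unfolding countably_additive_def
  proof (intro allI impI)
    fix B :: "nat \<Rightarrow> 'a set" assume B: "range B \<subseteq> sets N" "disjoint_family B" "(\<Union>i. B i) \<in> sets N"
    have d: "disjoint_family (\<lambda>i. B i \<inter> Y)" using B(2) by (auto simp: disjoint_family_on_def)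
    have s: "range (\<lambda>i. B i \<inter> Y) \<subseteq> sets N" using B(1) Y(1) by auto
    have "(\<lambda>i. measure \<mu>1 (B i \<inter> Y)) sums measure \<mu>1 (\<Union>i. B i \<inter> Y)"
      "(\<lambda>i. measure \<mu>2 (B i \<inter> Y)) sums measure \<mu>2 (\<Union>i. B i \<inter> Y)"
      by (rule m1.finite_measure_UNION m2.finite_measure_UNION; use s d sets in simp)+
    hence "(\<lambda>i. \<nu> (B i \<inter> Y)) sums \<nu> (\<Union>i. B i \<inter> Y)"
      using s \<nu>[of "\<Union>i. B i \<inter> Y"] sums_diff[of _ "measure \<mu>1 (\<Union>i. B i \<inter> Y)" _ "measure \<mu>2 (\<Union>i. B i \<inter> Y)"]
      by (subst \<nu>, blast, subst \<nu>, blast, blast)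
    hence "(\<Sum>i. P (B i)) = ennreal (\<nu> (\<Union>i. B i \<inter> Y))"
      unfolding P_def using pos B(1) by (intro suminf_ennreal_eq) auto
    thus "(\<Sum>i. P (B i)) = P (\<Union>i. B i)" by (simp add: P_def)
  qed
  moreover have "positive (sets N) P" using \<nu>[of "{}"] by (simp add: positive_def P_def)
  ultimately have "emeasure (measure_of (space N) (sets N) P) A = P A"
    using A sets.sigma_algebra_axioms by (intro emeasure_measure_of_sigma)
  moreover have "pos_part N \<nu> = measure_of (space N) (sets N) P"
    unfolding pos_part_def using sup sets.sigma_sets_eq[of N] by (intro measure_of_eq) (auto simp: P_def sets.space_closed)
  ultimately show ?thesis by (simp add: P_def)
qed

text \<open>Every representation as a difference of finite measures computes the integral, because
  \<open>p + \<mu>2 = n + \<mu>1\<close> for the Jordan parts \<open>p\<close> and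
  \<open>n\<close>.\<close>

theorem signed_integral_difference:
  fixes f :: "'a \<Rightarrow> real"
  assumes fin: "finite_measure \<mu>1" "finite_measure \<mu>2" and sets: "sets \<mu>1 = sets N" "sets \<mu>2 = sets N"
    and \<nu>: "\<And>A. A \<in> sets N \<Longrightarrow> \<nu> A = measure \<mu>1 A - measure \<mu>2 A"
    and f: "f \<in> borel_measurable N" "\<And>x. x \<in> space N \<Longrightarrow> \<bar>f x\<bar> \<le> C"
  shows "signed_integral N \<nu> f = integral\<^sup>L \<mu>1 f - integral\<^sup>L \<mu>2 f"
proof -
  interpret m1: finite_measure \<mu>1 by fact
  interpret m2: finite_measure \<mu>2 by fact
  obtain Y where Y: "Y \<in> sets N" "\<And>X. X \<in> sets N \<Longrightarrow> X \<subseteq> Y \<Longrightarrow> measure \<mu>2 X \<le> measure \<mu>1 X"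
      "\<And>X. X \<in> sets N \<Longrightarrow> X \<inter> Y = {} \<Longrightarrow> measure \<mu>1 X \<le> measure \<mu>2 X"
    using finite_unsigned_Hahn_decomposition[OF fin] sets
    by (auto simp: m1.emeasure_eq_measure m2.emeasure_eq_measure)
  define p n where "p = pos_part N \<nu>" and "n = pos_part N (\<lambda>A. - \<nu> A)"
  have sp: "space N - Y \<in> sets N" using Y(1) by auto
  have p: "emeasure p A = ennreal (\<nu> (A \<inter> Y))" if "A \<in> sets N" for A
    unfolding p_def by (rule pos_part_difference[OF fin sets Y that \<nu>])
  have n: "emeasure n A = ennreal (- \<nu> (A \<inter> (space N - Y)))" if A: "A \<in> sets N" for A
    unfolding n_def
  proof (rule pos_part_difference[OF fin(2,1) sets(2,1) sp])
    fix X assume X: "X \<in> sets N" "X \<inter> (space N - Y) = {}"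
    hence "X \<subseteq> Y" using sets.sets_into_space by blast
    thus "measure \<mu>2 X \<le> measure \<mu>1 X" using X Y by blast
  next
    fix X assume X: "X \<in> sets N" "X \<subseteq> space N - Y"
    hence "X \<inter> Y = {}" by blast
    thus "measure \<mu>1 X \<le> measure \<mu>2 X" using X Y by blast
  qed (use A Y \<nu> in auto)
  have eq: "emeasure p A + emeasure \<mu>2 A = emeasure n A + emeasure \<mu>1 A" if A: "A \<in> sets N" for A
  proof -
    have 1: "A = (A \<inter> Y) \<union> (A \<inter> (space N - Y))" using A sets.sets_into_space by blast
    have "measure \<mu>1 A = measure \<mu>1 (A \<inter> Y) + measure \<mu>1 (A \<inter> (space N - Y))"
      by (subst 1, rule m1.finite_measure_Union) (use A Y sets in auto)
    moreover have "measure \<mu>2 A = measure \<mu>2 (A \<inter> Y) + measure \<mu>2 (A \<inter> (space N - Y))"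
      by (subst 1, rule m2.finite_measure_Union) (use A Y sets in auto)
    moreover have "0 \<le> \<nu> (A \<inter> Y)" using Y(2)[of "A \<inter> Y"] \<nu>[of "A \<inter> Y"] A Y(1) by auto
    moreover have "0 \<le> - \<nu> (A \<inter> (space N - Y))"
      using Y(3)[of "A \<inter> (space N - Y)"] \<nu>[of "A \<inter> (space N - Y)"] A Y(1) by auto
    ultimately show ?thesis
      using p[OF A] n[OF A] \<nu>[of "A \<inter> Y"] \<nu>[of "A \<inter> (space N - Y)"] A Y(1)
      by (simp add: m1.emeasure_eq_measure m2.emeasure_eq_measure ennreal_plus[symmetric] del: ennreal_plus)
  qed
  have space: "space \<mu>1 = space N" "space \<mu>2 = space N" using sets by (auto dest: sets_eq_imp_space_eq)
  have int: "integrable m f" if "emeasure m (space N) < top" "sets m = sets N" for m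
  proof -
    have "space m = space N" using that(2) by (rule sets_eq_imp_space_eq)
    then interpret finite_measure m using that(1) by (intro finite_measureI) auto
    have "f \<in> borel_measurable m" using f(1) measurable_cong_sets[OF that(2) refl, of borel] by blast
    thus ?thesis using f(2) \<open>space m = space N\<close>
      by (intro integrable_const_bound[of f C]) auto
  qed
  have "integral\<^sup>L p f + integral\<^sup>L \<mu>2 f = integral\<^sup>L n f + integral\<^sup>L \<mu>1 f"
  proof (rule integral_add_measures)
    show "integrable p f" using p[of "space N"] by (intro int) (auto simp: p_def)
    show "integrable n f" using n[of "space N"] by (intro int) (auto simp: n_def)
    show "integrable \<mu>1 f" "integrable \<mu>2 f"
      using sets by (auto intro!: int simp: m1.emeasure_eq_measure m2.emeasure_eq_measure)
  qed (use sets eq in \<open>auto simp: p_def n_def\<close>)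
  thus ?thesis by (simp add: signed_integral_def p_def n_def)
qed

lemma finite_measure_pos_part:
  assumes "\<And>A. A \<in> sets N \<Longrightarrow> \<nu> A \<le> C"
  shows "finite_measure (pos_part N \<nu>)"
proof (rule finite_measureI)
  let ?f = "\<lambda>A. SUP C\<in>{C \<in> sets N. C \<subseteq> A}. ennreal (\<nu> C)"
  \<comment> \<open>\<open>measure_of\<close> yields the zero measure unless the set function is a
    measure, so the inequality holds in either case.\<close>
  have "emeasure (pos_part N \<nu>) (space N) \<le> ?f (space N)"
    unfolding pos_part_def by (subst emeasure_measure_of_conv) (auto simp: sets.sigma_sets_eq)
  also have "\<dots> \<le> ennreal C" using assms by (intro SUP_least ennreal_leI) auto
  finally show "emeasure (pos_part N \<nu>) (space (pos_part N \<nu>)) \<noteq> \<infinity>" by (auto simp: top_unique)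
qed

lemma vector_measure_component_bounded:
  fixes \<nu> :: "'a set \<Rightarrow> 'b::euclidean_space"
  assumes "vector_measure N \<nu>"
  obtains C where "\<And>A. A \<in> sets N \<Longrightarrow> norm (\<nu> A) \<le> C"
  using assms by (auto simp: vector_measure_def bounded_iff)

section \<open>Functionals on periodic fields\<close>

lemma periodic_axis_int:
  assumes "periodic f" shows "f (x + axis i (of_int k)) = f x"
proof (induction k rule: int_induct[where k = 0])
  case base
  thus ?case by (simp add: axis_eq_0_iff[THEN iffD2])
next
  case (step1 k)
  have "x + axis i (of_int (k + 1)) = (x + axis i (of_int k)) + axis i 1"
    by (simp add: vec_eq_iff axis_def)
  thus ?case using step1 assms by (metis periodic_def)
next
  case (step2 k)
  have "(x + axis i (of_int (k - 1))) + axis i 1 = x + axis i (of_int k)"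
    by (simp add: vec_eq_iff axis_def)
  thus ?case using step2 assms by (metis periodic_def)
qed

lemma periodic_int_shift:
  assumes "periodic f" shows "f (x + (\<chi> i. of_int (k i))) = f x"
proof -
  have "f (x + (\<Sum>i\<in>S. axis i (of_int (k i)))) = f x" if "finite S" for S
    using that
  proof (induction S)
    case (insert i S)
    thus ?case using periodic_axis_int[OF assms, of "x + (\<Sum>i\<in>S. axis i (of_int (k i)))" i "k i"]
      by (simp add: ac_simps)
  qed simp
  moreover have "(\<Sum>i\<in>UNIV. axis i (of_int (k i))) = (\<chi> i. real_of_int (k i))"
    by (simp add: vec_eq_iff axis_def if_distrib[of "\<lambda>f. f _"] sum.delta' cong: if_cong)
  ultimately show ?thesis by (metis finite)
qed

definition frac_vec :: "real ^ 'n \<Rightarrow> real ^ 'n" where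
  "frac_vec x = (\<chi> i. frac (x $ i))"

lemma frac_vec_in_cell: "frac_vec x \<in> cell"
  by (auto simp: frac_vec_def cell_def frac_lt_1)

lemma periodic_frac_vec:
  assumes "periodic f" shows "f (frac_vec x) = f x"
proof -
  have "frac_vec x = x + (\<chi> i. of_int (- \<lfloor>x $ i\<rfloor>))" by (simp add: frac_vec_def frac_def vec_eq_iff)
  thus ?thesis using periodic_int_shift[OF assms, of x "\<lambda>i. - \<lfloor>x $ i\<rfloor>"] by simp
qed

text \<open>Compact, unlike \<open>cell\<close>: compactness arguments and the integrability of
  continuous functions are carried out here and transferred to \<open>cell\<close>.\<close>

definition closed_cell :: "(real ^ 'n) set" where
  "closed_cell = cbox 0 (\<chi> i. 1)"

lemma cell_subset: "cell \<subseteq> closed_cell"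
  by (auto simp: cell_def closed_cell_def mem_box_cart less_imp_le)

lemma compact_closed_cell: "compact closed_cell"
  by (simp add: closed_cell_def)

definition cyl_fun :: "real \<Rightarrow> (real \<times> (real ^ 'n) \<Rightarrow> real) set" where
  "cyl_fun T = {f. continuous_on (slab T) f \<and> space_periodic T f}"

lemma cylinder_subset: "cylinder T \<subseteq> {0..T} \<times> closed_cell" "{0..T} \<times> closed_cell \<subseteq> slab T" "cylinder T \<subseteq> slab T"
  using cell_subset by (auto simp: cylinder_def slab_def)

text \<open>Reducing the space coordinates modulo 1 does not change periodic functions, so bounds on
  \<open>cylinder T\<close> extend to the slab and to the closed cell.\<close>

lemma space_periodic_representative:
  assumes "p \<in> slab T"
  obtains q where "q \<in> cylinder T" "\<And>f. space_periodic T f \<Longrightarrow> f q = f p"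
proof -
  obtain t x where p: "p = (t, x)" "t \<in> {0..T}" using assms by (auto simp: slab_def)
  show ?thesis
  proof (rule that[of "(t, frac_vec x)"])
    show "(t, frac_vec x) \<in> cylinder T" using p frac_vec_in_cell by (auto simp: cylinder_def)
    fix f :: "real \<times> (real ^ 'a) \<Rightarrow> 'b" assume "space_periodic T f"
    thus "f (t, frac_vec x) = f p"
      using p periodic_frac_vec[of "\<lambda>x. f (t, x)" x] by (simp add: space_periodic_def)
  qed
qed

lemma cyl_fun_bounded:
  assumes "continuous_on (slab T) f" "space_periodic T f"
  obtains C where "C \<ge> 0" "\<And>p. p \<in> slab T \<Longrightarrow> norm (f p) \<le> C"
proof -
  have "compact (f ` ({0..T} \<times> closed_cell))"
    using assms(1) cylinder_subset(2) compact_closed_cell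
    by (intro compact_continuous_image compact_Times) (auto intro: continuous_on_subset)
  then obtain C where C: "\<And>p. p \<in> {0..T} \<times> closed_cell \<Longrightarrow> norm (f p) \<le> C"
    by (meson bounded_iff compact_imp_bounded imageI)
  have "norm (f p) \<le> \<bar>C\<bar>" if p: "p \<in> slab T" for p
  proof -
    obtain q where q: "q \<in> cylinder T" "f q = f p"
      using space_periodic_representative[OF p] assms(2) by metis
    have "norm (f q) \<le> C" using q(1) cylinder_subset(1)[of T] by (intro C) blast
    thus ?thesis using q by simp
  qed
  thus ?thesis using that[of "\<bar>C\<bar>"] by simp
qed

text \<open>Only boundedness and \<open>dini\<close> need an argument, by compactness of the closed
  cell. For \<open>dini\<close>, the sets where a partial sum exceeds \<open>g\<close> form an open
  cover, and nonnegativity of the terms lets the largest index of a finite subcover serve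
  everywhere.\<close>

lemma cylinder_function_lattice: "function_lattice (cylinder T) (cyl_fun T :: (real \<times> (real ^ 'n) \<Rightarrow> real) set)"
proof
  let ?F = "cyl_fun T :: (real \<times> (real ^ 'n) \<Rightarrow> real) set"
  fix f assume "f \<in> ?F"
  then obtain C where "\<And>p. p \<in> slab T \<Longrightarrow> norm (f p) \<le> C"
    using cyl_fun_bounded[of T f] unfolding cyl_fun_def by blast
  thus "\<exists>C. \<forall>x\<in>cylinder T. \<bar>f x\<bar> \<le> C" using cylinder_subset(3)[of T] by (intro exI[of _ C]) auto
next
  let ?F = "cyl_fun T :: (real \<times> (real ^ 'n) \<Rightarrow> real) set"
  let ?K = "{0..T} \<times> closed_cell :: (real \<times> (real ^ 'n)) set"
  fix f :: "nat \<Rightarrow> real \<times> (real ^ 'n) \<Rightarrow> real" and g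
  assume f: "\<And>n. f n \<in> ?F" and g: "g \<in> ?F"
    and f0: "\<And>n x. x \<in> cylinder T \<Longrightarrow> 0 \<le> f n x"
    and ex: "\<And>x. x \<in> cylinder T \<Longrightarrow> \<exists>n. g x < (\<Sum>i<n. f i x)"
  define h where "h n p = (\<Sum>i<n. f i p) - g p" for n p
  have cont: "continuous_on ?K (h n)" for n
    unfolding h_def using f g cylinder_subset(2)[of T]
    by (intro continuous_on_diff continuous_on_sum) (auto simp: cyl_fun_def intro: continuous_on_subset)
  have per: "space_periodic T (f n)" "space_periodic T g" for n using f g by (auto simp: cyl_fun_def)
  have f0': "0 \<le> f n p" and ex': "\<exists>n. 0 < h n p" if p: "p \<in> ?K" for n p
  proof -
    have "p \<in> slab T" using p cylinder_subset(2) by blast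
    then obtain q where q: "q \<in> cylinder T"
      "\<And>f :: real \<times> (real ^ 'n) \<Rightarrow> real. space_periodic T f \<Longrightarrow> f q = f p"
      by (rule space_periodic_representative) auto
    show "0 \<le> f n p" using f0[OF q(1), of n] q(2)[OF per(1)] by simp
    obtain n where "g q < (\<Sum>i<n. f i q)" using ex[OF q(1)] by blast
    thus "\<exists>n. 0 < h n p" using q(2)[OF per(1)] q(2)[OF per(2)] by (auto simp: h_def)
  qed
  define U where "U n = ?K \<inter> h n -` {0<..}" for n
  have "openin (top_of_set ?K) (U n)" for n
    unfolding U_def by (intro continuous_openin_preimage_gen cont) auto
  moreover have "?K \<subseteq> \<Union>(range U)" using ex' by (auto simp: U_def)
  moreover have "compact ?K" by (intro compact_Times compact_closed_cell) auto
  ultimately obtain D where D: "D \<subseteq> range U" "finite D" "?K \<subseteq> \<Union>D"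
    unfolding compact_eq_openin_cover by (metis (mono_tags, lifting) rangeE)
  then obtain I where I: "finite I" "D = U ` I" by (meson finite_subset_image)
  have "\<forall>p\<in>cylinder T. g p \<le> (\<Sum>i<Max (insert 0 I). f i p)"
  proof
    fix p :: "real \<times> (real ^ 'n)" assume "p \<in> cylinder T"
    hence p: "p \<in> ?K" using cylinder_subset(1)[of T] by blast
    then obtain n where n: "n \<in> I" "p \<in> U n" using D I by blast
    have "g p \<le> (\<Sum>i<n. f i p)" using n by (simp add: U_def h_def)
    also have "\<dots> \<le> (\<Sum>i<Max (insert 0 I). f i p)"
      using I n f0'[OF p] by (intro sum_mono2) (auto intro: less_le_trans)
    finally show "g p \<le> (\<Sum>i<Max (insert 0 I). f i p)" .
  qed
  thus "\<exists>n. \<forall>x\<in>cylinder T. g x \<le> (\<Sum>i<n. f i x)" by blast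
qed (auto simp: cyl_fun_def space_periodic_def periodic_def intro!: continuous_intros)

lemma cyl_fun_measurable:
  assumes "f \<in> cyl_fun T" shows "f \<in> borel_measurable (cyl_borel T)"
  unfolding cyl_borel_def
  using assms cylinder_subset(3)[of T]
  by (intro borel_measurable_continuous_on_restrict) (auto simp: cyl_fun_def intro: continuous_on_subset)

lemma space_cyl_borel[simp]: "space (cyl_borel T) = cylinder T"
  by (simp add: cyl_borel_def space_restrict_space)

text \<open>The measures from the abstract representation live on an unspecified sigma-algebra that
  is only known to make continuous periodic functions measurable. It contains the Borel sets of the
  cylinder because the coordinates are Borel functions of periodic ones.\<close>

lemma cyl_fun_generates:
  fixes \<mu> :: "(real \<times> (real ^ 'n)) measure"
  assumes space: "space \<mu> = cylinder T" and meas: "\<And>f. f \<in> cyl_fun T \<Longrightarrow> f \<in> borel_measurable \<mu>"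
  shows "(\<lambda>x. x) \<in> \<mu> \<rightarrow>\<^sub>M cyl_borel T"
  unfolding cyl_borel_def
proof (rule measurable_restrict_space2)
  have time: "(\<lambda>p. fst p) \<in> borel_measurable \<mu>"
    by (rule meas) (auto simp: cyl_fun_def space_periodic_def periodic_def intro!: continuous_intros)
  have coord: "(\<lambda>p. snd p $ i) \<in> borel_measurable \<mu>" for i
  proof -
    \<comment> \<open>On \<open>[0,1)\<close> a coordinate is recovered from its angle: the cosine
      determines it up to the reflection at 1/2, and the sign of the sine selects the half.\<close>
    let ?a = "\<lambda>p :: real \<times> (real ^ 'n). arccos (cos (2 * pi * snd p $ i))"
    let ?s = "\<lambda>p :: real \<times> (real ^ 'n). sin (2 * pi * snd p $ i)"
    have m: "?a \<in> borel_measurable \<mu>" "?s \<in> borel_measurable \<mu>"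
      by (auto simp: cyl_fun_def space_periodic_def periodic_def axis_def distrib_left sin_add cos_add
          intro!: meas continuous_intros)
    have "snd p $ i = (if 0 \<le> ?s p then ?a p / (2 * pi) else 1 - ?a p / (2 * pi))" if "p \<in> space \<mu>" for p
    proof -
      define s where "s = snd p $ i"
      have s: "0 \<le> s" "s < 1" using that by (auto simp: space s_def cylinder_def cell_def)
      show ?thesis
      proof (cases "s \<le> 1/2")
        case True
        hence "0 \<le> sin (2 * pi * s)" using s by (intro sin_ge_zero) auto
        thus ?thesis using True s arccos_cos[of "2 * pi * s"] by (simp add: s_def[symmetric])
      next
        case False
        have "sin (2 * pi * s) = - sin (2 * pi - 2 * pi * s)" "cos (2 * pi * s) = cos (2 * pi - 2 * pi * s)"
          by (simp_all add: sin_diff cos_diff)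
        moreover have "0 < sin (2 * pi - 2 * pi * s)"
          using False s by (intro sin_gt_zero) (auto simp: algebra_simps)
        moreover have "arccos (cos (2 * pi - 2 * pi * s)) = 2 * pi - 2 * pi * s"
          using False s by (intro arccos_cos) auto
        ultimately show ?thesis by (simp add: s_def[symmetric] field_simps)
      qed
    qed
    moreover have "(\<lambda>p. if 0 \<le> ?s p then ?a p / (2 * pi) else 1 - ?a p / (2 * pi)) \<in> borel_measurable \<mu>"
      using m by measurable
    ultimately show ?thesis by (subst measurable_cong) auto
  qed
  have "(\<lambda>p. p \<bullet> b) \<in> borel_measurable \<mu>" if b: "b \<in> Basis" for b
  proof (cases "\<exists>i. b = (0, axis i 1)")
    case True
    then obtain i where "b = (0, axis i 1)" by blast
    hence "(\<lambda>p. p \<bullet> b) = (\<lambda>p. snd p $ i)" by (auto simp: inner_prod_def inner_axis)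
    thus ?thesis using coord by simp
  next
    case False
    hence "b = (1, 0)" using b by (auto simp: Basis_prod_def Basis_vec_def)
    hence "(\<lambda>p. p \<bullet> b) = (\<lambda>p. fst p)" by (auto simp: inner_prod_def)
    thus ?thesis using time by simp
  qed
  thus "(\<lambda>x. x) \<in> borel_measurable \<mu>" by (subst borel_measurable_euclidean_space) blast
qed (simp add: space)

text \<open>The two representing measures are pushed forward by the identity onto the Borel sets of
  the cylinder, where their difference is the required set function.\<close>

theorem cyl_functional_representation:
  fixes l :: "(real \<times> (real ^ 'n) \<Rightarrow> real) \<Rightarrow> real"
  assumes l_add: "\<And>f g. f \<in> cyl_fun T \<Longrightarrow> g \<in> cyl_fun T \<Longrightarrow> l (\<lambda>x. f x + g x) = l f + l g"
    and l_scale: "\<And>f c. f \<in> cyl_fun T \<Longrightarrow> l (\<lambda>x. c * f x) = c * l f"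
    and l_bd: "\<And>f c. f \<in> cyl_fun T \<Longrightarrow> (\<And>x. x \<in> cylinder T \<Longrightarrow> \<bar>f x\<bar> \<le> c) \<Longrightarrow> \<bar>l f\<bar> \<le> B * c"
  obtains \<nu> where "vector_measure (cyl_borel T) \<nu>" "\<And>f. f \<in> cyl_fun T \<Longrightarrow> cyl_integral T \<nu> f = l f"
proof -
  interpret function_lattice "cylinder T" "cyl_fun T :: (real \<times> (real ^ 'n) \<Rightarrow> real) set"
    by (rule cylinder_function_lattice)
  obtain \<mu> \<mu>' :: "(real \<times> (real ^ 'n)) measure" where
    \<mu>: "space \<mu> = cylinder T" "finite_measure \<mu>" "\<And>f. f \<in> cyl_fun T \<Longrightarrow> f \<in> borel_measurable \<mu>" and
    \<mu>': "space \<mu>' = cylinder T" "finite_measure \<mu>'" "\<And>f. f \<in> cyl_fun T \<Longrightarrow> f \<in> borel_measurable \<mu>'" and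
    l: "\<And>f. f \<in> cyl_fun T \<Longrightarrow> l f = integral\<^sup>L \<mu> f - integral\<^sup>L \<mu>' f"
    by (rule bounded_functional_representation[OF l_add l_scale l_bd]) auto
  define m m' where "m = distr \<mu> (cyl_borel T) (\<lambda>x. x)" and "m' = distr \<mu>' (cyl_borel T) (\<lambda>x. x)"
  note meas = cyl_fun_generates[OF \<mu>(1,3)] cyl_fun_generates[OF \<mu>'(1,3)]
  interpret m: finite_measure m unfolding m_def by (rule finite_measure.finite_measure_distr[OF \<mu>(2) meas(1)])
  interpret m': finite_measure m' unfolding m'_def by (rule finite_measure.finite_measure_distr[OF \<mu>'(2) meas(2)])
  have sets: "sets m = sets (cyl_borel T)" "sets m' = sets (cyl_borel T)" by (simp_all add: m_def m'_def)
  define \<nu> where "\<nu> A = measure m A - measure m' A" for A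
  show ?thesis
  proof (rule that)
    have "norm (\<nu> A) \<le> measure m (space m) + measure m' (space m')" for A
      using m.bounded_measure[of A] m'.bounded_measure[of A] measure_nonneg[of m A] measure_nonneg[of m' A]
      unfolding \<nu>_def real_norm_def by linarith
    moreover have "(\<lambda>n. \<nu> (A n)) sums \<nu> (\<Union>n. A n)"
      if "range A \<subseteq> sets (cyl_borel T)" "disjoint_family A" for A :: "nat \<Rightarrow> (real \<times> (real ^ 'n)) set"
      unfolding \<nu>_def using that sets by (intro sums_diff m.finite_measure_UNION m'.finite_measure_UNION) auto
    ultimately show "vector_measure (cyl_borel T) \<nu>"
      unfolding vector_measure_def bounded_iff by (auto simp: \<nu>_def)
    fix f :: "real \<times> (real ^ 'n) \<Rightarrow> real" assume f: "f \<in> cyl_fun T"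
    obtain C where C: "\<forall>x\<in>cylinder T. \<bar>f x\<bar> \<le> C" using bounded[OF f] by blast
    have "cyl_integral T \<nu> f = integral\<^sup>L m f - integral\<^sup>L m' f"
      using C cyl_fun_measurable[OF f]
      by (intro signed_integral_difference[where C = C] m.finite_measure_axioms m'.finite_measure_axioms sets) (auto simp: \<nu>_def)
    also have "\<dots> = l f"
      unfolding l[OF f] m_def m'_def using cyl_fun_measurable[OF f] meas by (subst (1 2) integral_distr) auto
    finally show "cyl_integral T \<nu> f = l f" .
  qed
qed

lemma signed_integral_linear:
  fixes \<nu> :: "'a set \<Rightarrow> real"
  assumes \<nu>: "\<And>A. A \<in> sets N \<Longrightarrow> \<bar>\<nu> A\<bar> \<le> C"
  shows signed_integral_add: "\<And>f g a b. f \<in> borel_measurable N \<Longrightarrow> (\<And>x. x \<in> space N \<Longrightarrow> \<bar>f x\<bar> \<le> a) \<Longrightarrow>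
      g \<in> borel_measurable N \<Longrightarrow> (\<And>x. x \<in> space N \<Longrightarrow> \<bar>g x\<bar> \<le> b) \<Longrightarrow>
      signed_integral N \<nu> (\<lambda>x. f x + g x) = signed_integral N \<nu> f + signed_integral N \<nu> g"
    and signed_integral_scale: "\<And>f c. signed_integral N \<nu> (\<lambda>x. c * f x) = c * signed_integral N \<nu> f"
    and signed_integral_bound: "\<And>f c. f \<in> borel_measurable N \<Longrightarrow> (\<And>x. x \<in> space N \<Longrightarrow> \<bar>f x\<bar> \<le> c) \<Longrightarrow> c \<ge> 0 \<Longrightarrow>
      \<bar>signed_integral N \<nu> f\<bar> \<le>
        (measure (pos_part N \<nu>) (space N) + measure (pos_part N (\<lambda>A. - \<nu> A)) (space N)) * c"
proof -
  interpret p: finite_measure "pos_part N \<nu>" using \<nu> by (intro finite_measure_pos_part[of _ _ C]) (simp add: abs_le_iff)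
  interpret n: finite_measure "pos_part N (\<lambda>A. - \<nu> A)" using \<nu> by (intro finite_measure_pos_part[of _ _ C]) (simp add: abs_le_iff)
  have m: "f \<in> borel_measurable (pos_part N \<nu>)" "f \<in> borel_measurable (pos_part N (\<lambda>A. - \<nu> A))"
    if "f \<in> borel_measurable N" for f :: "'a \<Rightarrow> real"
    using that measurable_cong_sets[OF sets_pos_part refl, of _ _ borel] by blast+
  have i: "integrable (pos_part N \<nu>) f" "integrable (pos_part N (\<lambda>A. - \<nu> A)) f"
    if "f \<in> borel_measurable N" "\<And>x. x \<in> space N \<Longrightarrow> \<bar>f x\<bar> \<le> a" for f :: "'a \<Rightarrow> real" and a
    using that m[OF that(1)] by (auto intro!: p.integrable_const_bound[of _ a] n.integrable_const_bound[of _ a])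
  show "signed_integral N \<nu> (\<lambda>x. f x + g x) = signed_integral N \<nu> f + signed_integral N \<nu> g"
    if "f \<in> borel_measurable N" "\<And>x. x \<in> space N \<Longrightarrow> \<bar>f x\<bar> \<le> a"
      "g \<in> borel_measurable N" "\<And>x. x \<in> space N \<Longrightarrow> \<bar>g x\<bar> \<le> b" for f g a b
    using i[OF that(1,2)] i[OF that(3,4)] by (simp add: signed_integral_def)
  show "signed_integral N \<nu> (\<lambda>x. c * f x) = c * signed_integral N \<nu> f" for f c
    by (simp add: signed_integral_def algebra_simps)
  show "\<bar>signed_integral N \<nu> f\<bar> \<le>
        (measure (pos_part N \<nu>) (space N) + measure (pos_part N (\<lambda>A. - \<nu> A)) (space N)) * c"
    if f: "f \<in> borel_measurable N" "\<And>x. x \<in> space N \<Longrightarrow> \<bar>f x\<bar> \<le> c" and c: "c \<ge> 0" for f c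
  proof -
    have "\<bar>integral\<^sup>L K f\<bar> \<le> measure K (space N) * c"
      if "finite_measure K" "integrable K f" "space K = space N" for K
    proof -
      interpret finite_measure K by fact
      have "\<bar>integral\<^sup>L K f\<bar> \<le> integral\<^sup>L K (\<lambda>x. \<bar>f x\<bar>)" by (rule integral_abs_bound)
      also have "\<dots> \<le> integral\<^sup>L K (\<lambda>_. c)" using that f by (intro integral_mono) auto
      finally show ?thesis using that by simp
    qed
    from this[OF p.finite_measure_axioms i(1)[OF f]] this[OF n.finite_measure_axioms i(2)[OF f]]
    show ?thesis unfolding signed_integral_def by (simp add: algebra_simps abs_le_iff)
  qed
qed

section \<open>Smooth functions within a slab\<close>

text \<open>The hypothesis of \<open>frechet_derivative_unique_within\<close>, isolated so that it
  is checked once for each domain. It identifies any exhibited derivative within \<open>S\<close>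
  with the chosen \<open>frechet_derivative\<close>.\<close>

definition derivative_unique_on :: "'a::euclidean_space set \<Rightarrow> bool" where
  "derivative_unique_on S \<longleftrightarrow>
     (\<forall>x\<in>S. \<forall>b\<in>Basis. \<forall>e>0. \<exists>d. 0 < \<bar>d\<bar> \<and> \<bar>d\<bar> < e \<and> x + d *\<^sub>R b \<in> S)"

lemma frechet_derivative_within_eq:
  assumes "derivative_unique_on S" "x \<in> S" "(f has_derivative f') (at x within S)"
  shows "frechet_derivative f (at x within S) = f'"
proof (rule frechet_derivative_unique_within[OF _ assms(3)])
  show "(f has_derivative frechet_derivative f (at x within S)) (at x within S)"
    using assms(3) by (meson differentiableI frechet_derivative_works)
qed (use assms(1,2) in \<open>auto simp: derivative_unique_on_def\<close>)

lemma derivative_unique_on_UNIV: "derivative_unique_on UNIV"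
  unfolding derivative_unique_on_def
proof (intro ballI allI impI)
  fix e :: real assume "e > 0"
  thus "\<exists>d. 0 < \<bar>d\<bar> \<and> \<bar>d\<bar> < e \<and> x + d *\<^sub>R b \<in> UNIV" for x b :: 'a by (intro exI[of _ "e / 2"]) auto
qed

lemma small_step_in_Icc:
  assumes "T > 0" "t \<in> {0..T}" "e > 0"
  obtains d where "0 < \<bar>d\<bar>" "\<bar>d\<bar> < e" "t + d \<in> {0..T::real}"
proof (cases "t < T")
  case True
  thus ?thesis using assms by (intro that[of "min (e / 2) (T - t)"]) auto
next
  case False
  thus ?thesis using assms by (intro that[of "- min (e / 2) T"]) auto
qed

lemma derivative_unique_on_Icc: "T > 0 \<Longrightarrow> derivative_unique_on {0..T::real}"
  unfolding derivative_unique_on_def using small_step_in_Icc by (metis Basis_real_def scaleR_one real_scaleR_def mult.right_neutral singletonD)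

lemma derivative_unique_on_slab:
  assumes "T > 0" shows "derivative_unique_on (slab T)"
  unfolding derivative_unique_on_def
proof (intro ballI allI impI)
  fix p :: "real \<times> (real ^ 'n)" and b :: "real \<times> (real ^ 'n)" and e :: real
  assume p: "p \<in> slab T" and b: "b \<in> Basis" and e: "e > 0"
  show "\<exists>d. 0 < \<bar>d\<bar> \<and> \<bar>d\<bar> < e \<and> p + d *\<^sub>R b \<in> slab T"
  proof (cases "fst b = 0")
    case True
    thus ?thesis using p e by (intro exI[of _ "e / 2"]; cases p; cases b) (auto simp: slab_def)
  next
    case False
    hence "b = (1, 0)" using b by (auto simp: Basis_prod_def)
    moreover obtain d where "0 < \<bar>d\<bar>" "\<bar>d\<bar> < e" "fst p + d \<in> {0..T}"
      using p e assms by (auto simp: slab_def intro: small_step_in_Icc)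
    ultimately show ?thesis using p by (intro exI[of _ d]; cases p) (auto simp: slab_def)
  qed
qed

lemma Ck_on_cong: "(\<And>x. x \<in> S \<Longrightarrow> f x = g x) \<Longrightarrow> Ck_on k S f \<longleftrightarrow> Ck_on k S g"
proof (induction k arbitrary: f g)
  case 0
  thus ?case by (simp cong: continuous_on_cong)
next
  case (Suc k)
  have eq: "(f has_derivative f') (at x within S) \<longleftrightarrow> (g has_derivative f') (at x within S)" if "x \<in> S" for f' x
  proof
    assume "(f has_derivative f') (at x within S)"
    thus "(g has_derivative f') (at x within S)"
      by (rule has_derivative_transform[OF that, rotated]) (rule Suc.prems[symmetric])
  next
    assume "(g has_derivative f') (at x within S)"
    thus "(f has_derivative f') (at x within S)"
      by (rule has_derivative_transform[OF that, rotated]) (rule Suc.prems)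
  qed
  have "f differentiable_on S \<longleftrightarrow> g differentiable_on S"
    unfolding differentiable_on_def differentiable_def using eq by simp
  moreover have fd: "frechet_derivative f (at x within S) = frechet_derivative g (at x within S)" if "x \<in> S" for x
    unfolding frechet_derivative_def using eq[OF that] by simp
  have "Ck_on k S (\<lambda>x. frechet_derivative f (at x within S) b) \<longleftrightarrow>
      Ck_on k S (\<lambda>x. frechet_derivative g (at x within S) b)" for b
    by (rule Suc.IH) (simp add: fd)
  ultimately show ?case by simp
qed

text \<open>A class of differentiable functions closed under partial derivatives allows one
  induction on the order of differentiation. Closure is required only up to equality on
  \<open>S\<close>, since derivatives within \<open>S\<close> are known only there.\<close>

lemma smooth_on_coinduct:
  assumes f: "f \<in> C"
    and diff: "\<And>g. g \<in> C \<Longrightarrow> g differentiable_on S"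
    and deriv: "\<And>g b. g \<in> C \<Longrightarrow> b \<in> Basis \<Longrightarrow> \<exists>h\<in>C. \<forall>x\<in>S. frechet_derivative g (at x within S) b = h x"
  shows "smooth_on S f"
proof -
  have "Ck_on k S g" if "g \<in> C" for k g
    using that
  proof (induction k arbitrary: g)
    case 0
    thus ?case using diff differentiable_imp_continuous_on by auto
  next
    case (Suc k)
    have "Ck_on k S (\<lambda>x. frechet_derivative g (at x within S) b)" if b: "b \<in> Basis" for b
    proof -
      obtain h where "h \<in> C" "\<forall>x\<in>S. frechet_derivative g (at x within S) b = h x"
        using deriv[OF Suc.prems b] by blast
      thus ?thesis using Suc.IH[of h] Ck_on_cong[of S "\<lambda>x. frechet_derivative g (at x within S) b" h k] by simp
    qed
    thus ?case using diff[OF Suc.prems] by simp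
  qed
  thus ?thesis using f by (simp add: smooth_on_def)
qed

lemma smooth_on_differentiable: "smooth_on S f \<Longrightarrow> f differentiable_on S"
  unfolding smooth_on_def by (metis Ck_on.simps(2))

lemma smooth_on_continuous: "smooth_on S f \<Longrightarrow> continuous_on S f"
  unfolding smooth_on_def by (metis Ck_on.simps(1))

lemma smooth_on_derivative: "smooth_on S f \<Longrightarrow> b \<in> Basis \<Longrightarrow> smooth_on S (\<lambda>x. frechet_derivative f (at x within S) b)"
  unfolding smooth_on_def by (metis Ck_on.simps(2))

lemma smooth_on_has_derivative:
  "smooth_on S f \<Longrightarrow> x \<in> S \<Longrightarrow> (f has_derivative frechet_derivative f (at x within S)) (at x within S)"
  using smooth_on_differentiable frechet_derivative_works unfolding differentiable_on_def by blast

section \<open>Closure properties and examples of smooth functions\<close>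

lemma smooth_on_bounded_linear:
  assumes S: "derivative_unique_on S" and L: "bounded_linear L" and f: "smooth_on S f"
  shows "smooth_on S (\<lambda>x. L (f x))"
proof (rule smooth_on_coinduct[where C = "{\<lambda>x. L (f x) | f. smooth_on S f}"])
  have D: "((\<lambda>x. L (f x)) has_derivative (\<lambda>h. L (frechet_derivative f (at x within S) h))) (at x within S)"
    if "smooth_on S f" "x \<in> S" for f x
    using smooth_on_has_derivative[OF that] by (rule bounded_linear.has_derivative[OF L])
  show "g differentiable_on S" if "g \<in> {\<lambda>x. L (f x) | f. smooth_on S f}" for g
    using that D by (auto simp: differentiable_on_def intro: differentiableI)
  show "\<exists>h\<in>{\<lambda>x. L (f x) | f. smooth_on S f}. \<forall>x\<in>S. frechet_derivative g (at x within S) b = h x"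
    if gC: "g \<in> {\<lambda>x. L (f x) | f. smooth_on S f}" and bB: "b \<in> Basis" for g b
  proof -
    obtain f where f: "g = (\<lambda>x. L (f x))" "smooth_on S f" using gC by blast
    show ?thesis
      using frechet_derivative_within_eq[OF S _ D[OF f(2)]] smooth_on_derivative[OF f(2) bB] f(1)
      by (intro bexI[of _ "\<lambda>x. L (frechet_derivative f (at x within S) b)"]) auto
  qed
qed (use f in blast)

lemma smooth_on_add:
  assumes S: "derivative_unique_on S" and f: "smooth_on S f" and g: "smooth_on S g"
  shows "smooth_on S (\<lambda>x. f x + g x)"
proof (rule smooth_on_coinduct[where C = "{\<lambda>x. f x + g x | f g. smooth_on S f \<and> smooth_on S g}"])
  let ?C = "{\<lambda>x. f x + g x | f g. smooth_on S f \<and> smooth_on S g}"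
  let ?D = "\<lambda>f x. frechet_derivative f (at x within S)"
  have D: "((\<lambda>x. f x + g x) has_derivative (\<lambda>h. ?D f x h + ?D g x h)) (at x within S)"
    if "smooth_on S f" "smooth_on S g" "x \<in> S" for f g x
    using smooth_on_has_derivative[OF that(1,3)] smooth_on_has_derivative[OF that(2,3)] by (rule has_derivative_add)
  show "h differentiable_on S" if "h \<in> ?C" for h
    using that D by (auto simp: differentiable_on_def intro: differentiableI)
  show "\<exists>h'\<in>?C. \<forall>x\<in>S. frechet_derivative h (at x within S) b = h' x"
    if gC: "h \<in> ?C" and bB: "b \<in> Basis" for h b
  proof -
    obtain f g where f: "h = (\<lambda>x. f x + g x)" "smooth_on S f" "smooth_on S g" using gC by blast
    show ?thesis
      using frechet_derivative_within_eq[OF S _ D[OF f(2,3)]] smooth_on_derivative[OF f(2) bB]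
        smooth_on_derivative[OF f(3) bB] f(1)
      by (intro bexI[of _ "\<lambda>x. ?D f x b + ?D g x b"]) auto
  qed
qed (use f g in blast)

lemma smooth_on_poly:
  fixes p :: "real poly"
  assumes "T > 0" shows "smooth_on {0..T} (poly p)"
proof (rule smooth_on_coinduct[where C = "range poly"])
  have D: "(poly p has_derivative (\<lambda>h. poly (pderiv p) x * h)) (at x within {0..T})" for p :: "real poly" and x
    using poly_DERIV[of p x] by (auto simp: has_field_derivative_def intro: has_derivative_at_withinI)
  show "g differentiable_on {0..T}" if "g \<in> range poly" for g
    using that D by (auto simp: differentiable_on_def intro: differentiableI)
  show "\<exists>h\<in>range poly. \<forall>x\<in>{0..T}. frechet_derivative g (at x within {0..T}) b = h x"
    if gC: "g \<in> range poly" and bB: "b \<in> Basis" for g b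
    using that frechet_derivative_within_eq[OF derivative_unique_on_Icc[OF assms] _ D] by auto
qed auto

text \<open>With a free phase these fields form a class closed under differentiation: a space
  derivative shifts the phase by \<open>pi / 2\<close>, a time derivative acts on the
  polynomial.\<close>

definition wave_field :: "real poly \<Rightarrow> real ^ 'n \<Rightarrow> real \<Rightarrow> 'b::real_normed_vector \<Rightarrow> real \<times> (real ^ 'n) \<Rightarrow> 'b" where
  "wave_field p w \<theta> v = (\<lambda>(t, x). (poly p t * cos (w \<bullet> x + \<theta>)) *\<^sub>R v)"

lemma wave_field_has_derivative:
  "(wave_field p w \<theta> v has_derivative
     (\<lambda>h. (fst h * poly (pderiv p) (fst q) * cos (w \<bullet> snd q + \<theta>) -
        poly p (fst q) * (w \<bullet> snd h) * sin (w \<bullet> snd q + \<theta>)) *\<^sub>R v)) (at q within S)"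
proof -
  have p: "((\<lambda>q. poly p (fst q)) has_derivative (\<lambda>h. poly (pderiv p) (fst q) * fst h)) (at q within S)"
    using DERIV_compose_FDERIV[OF poly_DERIV has_derivative_fst[OF has_derivative_ident], of p q S]
    by (simp add: mult.commute)
  have c: "((\<lambda>q. cos (w \<bullet> snd q + \<theta>)) has_derivative (\<lambda>h. - sin (w \<bullet> snd q + \<theta>) * (w \<bullet> snd h))) (at q within S)"
    by (auto intro!: derivative_eq_intros)
  have "((\<lambda>q. (poly p (fst q) * cos (w \<bullet> snd q + \<theta>)) *\<^sub>R v) has_derivative
     (\<lambda>h. (poly p (fst q) * (- sin (w \<bullet> snd q + \<theta>) * (w \<bullet> snd h)) +
        poly (pderiv p) (fst q) * fst h * cos (w \<bullet> snd q + \<theta>)) *\<^sub>R v)) (at q within S)"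
    by (intro has_derivative_scaleR_left has_derivative_mult p c)
  thus ?thesis by (simp add: wave_field_def case_prod_beta' algebra_simps)
qed

lemma smooth_on_wave_field:
  assumes "T > 0" shows "smooth_on (slab T) (wave_field p w \<theta> v)"
proof (rule smooth_on_coinduct[where C = "{wave_field p w \<theta> v | p \<theta>. True}"])
  let ?C = "{wave_field p w \<theta> v | p \<theta>. True}"
  show "g differentiable_on slab T" if "g \<in> ?C" for g
    using that by (auto simp: differentiable_on_def intro: differentiableI[OF wave_field_has_derivative])
  show "\<exists>h\<in>?C. \<forall>x\<in>slab T. frechet_derivative g (at x within slab T) b = h x"
    if gC: "g \<in> ?C" and bB: "b \<in> Basis" for g b
  proof -
    obtain p \<theta> where g: "g = wave_field p w \<theta> v" using gC by blast
    note D = frechet_derivative_within_eq[OF derivative_unique_on_slab[OF assms] _ wave_field_has_derivative, of _ p w \<theta> v]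
    show ?thesis
    proof (cases "fst b = 0")
      case True
      have "cos (x + (\<theta> + pi / 2)) = - sin (x + \<theta>)" for x
        using cos_add[of "x + \<theta>" "pi / 2"] by (simp add: add.assoc)
      hence "\<forall>x\<in>slab T. frechet_derivative g (at x within slab T) b =
          wave_field (smult (w \<bullet> snd b) p) w (\<theta> + pi / 2) v x"
        using True by (auto simp: g D) (simp add: wave_field_def mult_ac)
      thus ?thesis by blast
    next
      case False
      hence "b = (1, 0)" using bB by (auto simp: Basis_prod_def)
      thus ?thesis using D
        by (intro bexI[of _ "wave_field (pderiv p) w \<theta> v"]) (auto simp: g wave_field_def case_prod_beta')
    qed
  qed
qed blast

section \<open>Slices of smooth fields in space and in time\<close>

lemma slice_has_derivative:
  assumes "(f has_derivative D) (at (t, x) within slab T)" "t \<in> {0..T}"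
  shows "((\<lambda>y. f (t, y)) has_derivative (\<lambda>h. D (0, h))) (at x)"
proof -
  have "((\<lambda>y. (t, y)) has_derivative (\<lambda>h. (0, h))) (at x)"
    by (auto intro!: derivative_eq_intros)
  moreover have "(\<lambda>y. (t, y)) ` UNIV \<subseteq> slab T" using assms(2) by (auto simp: slab_def)
  ultimately have "(f \<circ> (\<lambda>y. (t, y)) has_derivative D \<circ> (\<lambda>h. (0, h))) (at x)"
    using assms(1) by (intro diff_chain_within) (auto intro: has_derivative_subset)
  thus ?thesis by (simp add: comp_def)
qed

lemma smooth_on_slice:
  assumes f: "smooth_on (slab T) f" and t: "t \<in> {0..T}"
  shows "smooth_on UNIV (\<lambda>x. f (t, x))"
proof (rule smooth_on_coinduct[where C = "{\<lambda>x. f (t, x) | f. smooth_on (slab T) f}"])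
  let ?C = "{\<lambda>x. f (t, x) | f. smooth_on (slab T) f}"
  have p: "(t, x) \<in> slab T" for x using t by (auto simp: slab_def)
  note D = slice_has_derivative[OF smooth_on_has_derivative[OF _ p] t]
  show "g differentiable_on UNIV" if "g \<in> ?C" for g
    using that D by (auto simp: differentiable_on_def intro: differentiableI)
  show "\<exists>h\<in>?C. \<forall>x\<in>UNIV. frechet_derivative g (at x within UNIV) b = h x"
    if gC: "g \<in> ?C" and bB: "b \<in> Basis" for g b
  proof -
    obtain f where f: "g = (\<lambda>x. f (t, x))" "smooth_on (slab T) f" using gC by blast
    have "(0, b) \<in> Basis" using bB by (simp add: Basis_prod_def)
    note smooth = smooth_on_derivative[OF f(2) this]
    show ?thesis unfolding f(1)
    proof (rule bexI)
      show "\<forall>x\<in>UNIV. frechet_derivative (\<lambda>x. f (t, x)) (at x) b =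
          frechet_derivative f (at (t, x) within slab T) (0, b)"
        by (simp add: frechet_derivative_at[OF D[OF f(2)], symmetric])
      show "(\<lambda>x. frechet_derivative f (at (t, x) within slab T) (0, b)) \<in> ?C"
        by (rule CollectI, rule exI[of _ "\<lambda>p. frechet_derivative f (at p within slab T) (0, b)"]) (simp add: smooth)
    qed
  qed
qed (use f in blast)

lemma slab_time_derivative:
  assumes "smooth_on (slab T) f" "t \<in> {0..T}"
  shows "((\<lambda>s. f (s, x)) has_vector_derivative frechet_derivative f (at (t, x) within slab T) (1, 0)) (at t within {0..T})"
proof -
  let ?D = "frechet_derivative f (at (t, x) within slab T)"
  have p: "(t, x) \<in> slab T" using assms(2) by (simp add: slab_def)
  note D = smooth_on_has_derivative[OF assms(1) p]
  have 1: "((\<lambda>s. (s, x)) has_derivative (\<lambda>h. (h, 0))) (at t within {0..T})"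
    by (auto intro!: derivative_eq_intros)
  have sub: "(\<lambda>s. (s, x)) ` {0..T} \<subseteq> slab T" by (auto simp: slab_def)
  have "(f \<circ> (\<lambda>s. (s, x)) has_derivative ?D \<circ> (\<lambda>h. (h, 0))) (at t within {0..T})"
    using 1 D sub by (intro diff_chain_within) (auto intro: has_derivative_subset)
  moreover have "?D \<circ> (\<lambda>h. (h, 0)) = (\<lambda>h. h *\<^sub>R ?D (1, 0))"
  proof
    fix h
    interpret linear ?D using D by (rule has_derivative_linear)
    show "(?D \<circ> (\<lambda>h. (h, 0))) h = h *\<^sub>R ?D (1, 0)" using scale[of h "(1, 0)"] by simp
  qed
  ultimately show ?thesis by (simp add: has_vector_derivative_def comp_def)
qed

section \<open>Partial derivatives in space\<close>

lemma pd_eq: "(f has_derivative D) (at x) \<Longrightarrow> pd i f x = D (axis i 1)"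
  unfolding pd_def by (simp add: frechet_derivative_at[symmetric])

lemma smooth_pd: "smooth_on UNIV f \<Longrightarrow> smooth_on UNIV (pd i f)"
  using smooth_on_derivative[of UNIV f "axis i 1"] unfolding pd_def[abs_def] by simp

lemma smooth_has_derivative: "smooth_on UNIV f \<Longrightarrow> (f has_derivative frechet_derivative f (at x)) (at x)"
  using smooth_on_has_derivative[of UNIV f x] by simp

lemma periodic_pd:
  assumes "periodic f" shows "periodic (pd i f)"
proof -
  have "frechet_derivative f (at (x + axis j 1)) = frechet_derivative f (at x)" for x j
  proof -
    \<comment> \<open>Translation identifies the sets of derivatives at the two points, so the
      values chosen by \<open>frechet_derivative\<close> agree even where no derivative
      exists.\<close>
    have eq: "(f has_derivative D) (at (x + axis j 1)) \<longleftrightarrow> (f has_derivative D) (at x)" for D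
    proof -
      have "f (x + axis j 1 + h) = f (x + h)" for h
        using assms unfolding periodic_def by (metis add.assoc add.commute)
      thus ?thesis using assms by (simp add: has_derivative_at periodic_def)
    qed
    show ?thesis unfolding frechet_derivative_def eq ..
  qed
  thus ?thesis by (simp add: periodic_def pd_def)
qed

section \<open>Integration over the cell\<close>

lemma cell_borel[measurable]: "(cell :: (real ^ 'n) set) \<in> sets borel"
proof -
  have "cell = (\<Inter>i. {x :: real ^ 'n. 0 \<le> x $ i}) \<inter> (\<Inter>i. {x. x $ i < 1})"
    by (auto simp: cell_def)
  moreover have "closed (\<Inter>i. {x :: real ^ 'n. 0 \<le> x $ i})"
    by (intro closed_INT ballI closed_Collect_le continuous_intros)
  moreover have "open (\<Inter>i. {x :: real ^ 'n. x $ i < 1})"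
    by (intro open_INT ballI open_Collect_less continuous_intros) auto
  ultimately show ?thesis by (metis borel_closed borel_open sets.Int)
qed

lemma emeasure_cell: "emeasure lborel (cell :: (real ^ 'n) set) = 1"
proof (rule antisym)
  have b: "(\<chi> i. 1) \<bullet> b = (1::real)" if "b \<in> (Basis :: (real ^ 'n) set)" for b
    using that by (auto simp: Basis_vec_def inner_axis)
  have "emeasure lborel (cell :: (real ^ 'n) set) \<le> emeasure lborel (closed_cell :: (real ^ 'n) set)"
    using cell_subset by (intro emeasure_mono) (auto simp: closed_cell_def)
  also have "\<dots> = 1" unfolding closed_cell_def by (subst emeasure_lborel_cbox) (auto simp: b)
  finally show "emeasure lborel (cell :: (real ^ 'n) set) \<le> 1" .
  have "emeasure lborel (box 0 (\<chi> i. 1) :: (real ^ 'n) set) \<le> emeasure lborel (cell :: (real ^ 'n) set)"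
    by (intro emeasure_mono) (auto simp: cell_def mem_box_cart less_imp_le)
  moreover have "emeasure lborel (box 0 (\<chi> i. 1) :: (real ^ 'n) set) = 1"
    by (subst emeasure_lborel_box) (auto simp: b)
  ultimately show "1 \<le> emeasure lborel (cell :: (real ^ 'n) set)" by simp
qed

abbreviation cell_int :: "(real ^ 'n \<Rightarrow> real) \<Rightarrow> real" where
  "cell_int f \<equiv> (LINT x:cell|lborel. f x)"

lemma cell_integrable:
  fixes f :: "real ^ 'n \<Rightarrow> real"
  assumes "continuous_on closed_cell f" shows "set_integrable lborel cell f"
proof (rule set_integrable_subset)
  show "set_integrable lborel closed_cell f"
    unfolding set_integrable_def by (intro borel_integrable_compact compact_closed_cell assms)
qed (auto simp: cell_subset)

lemma cell_int_const: "cell_int (\<lambda>_. c) = c"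
  by (simp add: set_lebesgue_integral_def emeasure_cell measure_def)

lemma cell_int_add:
  assumes "continuous_on closed_cell f" "continuous_on closed_cell g"
  shows "cell_int (\<lambda>x. f x + g x) = cell_int f + cell_int g"
  using assms by (intro set_integral_add cell_integrable)

lemma cell_int_diff:
  assumes "continuous_on closed_cell f" "continuous_on closed_cell g"
  shows "cell_int (\<lambda>x. f x - g x) = cell_int f - cell_int g"
  using assms by (intro set_integral_diff cell_integrable)

lemma cell_int_sum:
  assumes "finite I" "\<And>i. i \<in> I \<Longrightarrow> continuous_on closed_cell (f i)"
  shows "cell_int (\<lambda>x. \<Sum>i\<in>I. f i x) = (\<Sum>i\<in>I. cell_int (f i))"
  using assms
proof (induction I)
  case empty
  show ?case using cell_int_const[of 0] by simp
next
  case (insert i I)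
  thus ?case by (simp add: cell_int_add continuous_on_sum)
qed

lemma cell_int_mult: "cell_int (\<lambda>x. c * f x) = c * cell_int f"
  by simp

lemma cell_int_mono:
  assumes "continuous_on closed_cell f" "continuous_on closed_cell g" "\<And>x. x \<in> cell \<Longrightarrow> f x \<le> g x"
  shows "cell_int f \<le> cell_int g"
  using assms by (intro set_integral_mono cell_integrable)

lemma cell_int_cong: "(\<And>x. x \<in> cell \<Longrightarrow> f x = g x) \<Longrightarrow> cell_int f = cell_int g"
  by (intro set_lebesgue_integral_cong) auto

lemma cell_int_abs_le:
  fixes f :: "real ^ 'n \<Rightarrow> real"
  assumes "continuous_on closed_cell f" "\<And>x. x \<in> cell \<Longrightarrow> \<bar>f x\<bar> \<le> c"
  shows "\<bar>cell_int f\<bar> \<le> c"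
proof -
  have "cell_int f \<le> cell_int (\<lambda>_ :: real ^ 'n. c)" using assms by (intro cell_int_mono[of f "\<lambda>_. c"]) (auto simp: abs_le_iff)
  moreover have "cell_int (\<lambda>_ :: real ^ 'n. - c) \<le> cell_int f" using assms
    by (intro cell_int_mono[of "\<lambda>_. - c" f]) (auto simp: abs_le_iff minus_le_iff)
  ultimately show ?thesis unfolding cell_int_const by simp
qed

section \<open>Integrals over the cylinder\<close>

lemma cylinder_borel[measurable]: "(cylinder T :: (real \<times> (real ^ 'n)) set) \<in> sets borel"
  unfolding cylinder_def by (subst borel_prod[symmetric]) (rule pair_measureI; simp)

lemma cyl_integrable:
  fixes f :: "real \<times> (real ^ 'n) \<Rightarrow> real"
  assumes "continuous_on (slab T) f" shows "set_integrable lborel (cylinder T) f"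
proof (rule set_integrable_subset)
  show "set_integrable lborel ({0..T} \<times> closed_cell) f"
    unfolding set_integrable_def using assms cylinder_subset(2)
    by (intro borel_integrable_compact compact_Times compact_closed_cell) (auto intro: continuous_on_subset)
qed (auto simp: cylinder_subset)

lemma cyl_int_Fubini:
  fixes f :: "real \<times> (real ^ 'n) \<Rightarrow> real"
  assumes "continuous_on (slab T) f"
  shows "(LINT p:cylinder T|lborel. f p) = (LINT t:{0..T}|lborel. cell_int (\<lambda>x. f (t, x)))"
    and "(LINT p:cylinder T|lborel. f p) = cell_int (\<lambda>x. LINT t:{0..T}|lborel. f (t, x))"
proof -
  define g where "g = (\<lambda>t x. indicator (cylinder T) (t, x) *\<^sub>R f (t, x))"
  have g: "g t x = indicator {0..T} t *\<^sub>R (indicator cell x *\<^sub>R f (t, x))" for t x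
    by (simp add: g_def cylinder_def indicator_times)
  have int: "integrable (lborel \<Otimes>\<^sub>M lborel) (case_prod g)"
    using cyl_integrable[OF assms] by (simp add: set_integrable_def g_def lborel_prod case_prod_beta')
  have eq: "(LINT p:cylinder T|lborel. f p) = integral\<^sup>L (lborel \<Otimes>\<^sub>M lborel) (case_prod g)"
    by (simp add: set_lebesgue_integral_def g_def lborel_prod case_prod_beta')
  show "(LINT p:cylinder T|lborel. f p) = (LINT t:{0..T}|lborel. cell_int (\<lambda>x. f (t, x)))"
    using lborel_pair.integral_fst'[OF int] unfolding eq by (simp add: set_lebesgue_integral_def g)
  show "(LINT p:cylinder T|lborel. f p) = cell_int (\<lambda>x. LINT t:{0..T}|lborel. f (t, x))"
    unfolding eq lborel_pair.integral_snd[OF int, symmetric]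
    by (simp add: set_lebesgue_integral_def g mult.left_commute)
qed

text \<open>The translated cell consists of the part \<open>A\<close> of \<open>cell\<close> and the
  strip \<open>B\<close> moved one period along axis \<open>i\<close>.\<close>

lemma cell_int_translate:
  fixes g :: "real ^ 'n \<Rightarrow> real"
  assumes g: "continuous_on UNIV g" "periodic g" and s: "0 \<le> s" "s \<le> 1"
  shows "cell_int (\<lambda>x. g (x + axis i s)) = cell_int g"
proof -
  define A where "A = {x \<in> (cell :: (real ^ 'n) set). s \<le> x $ i}"
  define B where "B = {x \<in> (cell :: (real ^ 'n) set). x $ i < s}"
  have "A = cell \<inter> {x. s \<le> x $ i}" "B = cell \<inter> {x. x $ i < s}" by (auto simp: A_def B_def)
  moreover have "{x :: real ^ 'n. s \<le> x $ i} \<in> sets borel"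
    by (intro borel_closed closed_Collect_le continuous_intros)
  moreover have "{x :: real ^ 'n. x $ i < s} \<in> sets borel"
    by (intro borel_open open_Collect_less continuous_intros)
  ultimately have AB: "A \<in> sets borel" "B \<in> sets borel" by auto
  have sub: "A \<subseteq> cell" "B \<subseteq> cell" by (auto simp: A_def B_def)
  have int: "integrable lborel (\<lambda>x. indicator A x * g x)" "integrable lborel (\<lambda>x. indicator B x * g x)"
    using set_integrable_subset[OF cell_integrable[of g], of A] set_integrable_subset[OF cell_integrable[of g], of B]
      g(1) AB sub by (auto simp: set_integrable_def intro: continuous_on_subset)
  have ind: "indicator cell (y + axis i (- s)) = (indicator A y + indicator B (y + axis i (-1)) :: real)" for y
  proof -
    have c: "y + axis i r \<in> cell \<longleftrightarrow> (\<forall>j. j \<noteq> i \<longrightarrow> 0 \<le> y $ j \<and> y $ j < 1) \<and> 0 \<le> y $ i + r \<and> y $ i + r < 1" for r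
      unfolding cell_def by (auto simp: axis_def)
    have c0: "y \<in> cell \<longleftrightarrow> (\<forall>j. j \<noteq> i \<longrightarrow> 0 \<le> y $ j \<and> y $ j < 1) \<and> 0 \<le> y $ i \<and> y $ i < 1"
      unfolding cell_def by auto
    have "y + axis i (- s) \<in> cell \<longleftrightarrow> (y \<in> A \<or> y + axis i (-1) \<in> B)" "\<not> (y \<in> A \<and> y + axis i (-1) \<in> B)"
      unfolding A_def B_def mem_Collect_eq c c0 using s by auto
    thus ?thesis by (auto simp: indicator_def)
  qed
  have shift: "integral\<^sup>L lborel (\<lambda>x. h (x + c)) = integral\<^sup>L lborel h" if "h \<in> borel_measurable borel"
    for h :: "real ^ 'n \<Rightarrow> real" and c
  proof -
    have "integral\<^sup>L lborel h = integral\<^sup>L (distr lborel borel ((+) c)) h" by (simp add: lborel_distr_plus)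
    also have "\<dots> = integral\<^sup>L lborel (\<lambda>x. h (c + x))" using that by (intro integral_distr) auto
    finally show ?thesis by (simp add: add.commute)
  qed
  have gm[measurable]: "g \<in> borel_measurable borel" using g(1) by (rule borel_measurable_continuous_onI)
  note AB[measurable]
  have ax: "axis i (- s) + axis i s = (0 :: real ^ 'n)" "axis i (- 1) + axis i 1 = (0 :: real ^ 'n)"
    by (simp_all add: axis_def vec_eq_iff)
  have "cell_int (\<lambda>x. g (x + axis i s)) = integral\<^sup>L lborel (\<lambda>x. indicator cell x * g (x + axis i s))"
    by (simp add: set_lebesgue_integral_def)
  also have "\<dots> = integral\<^sup>L lborel (\<lambda>y. indicator cell (y + axis i (- s)) * g (y + axis i (- s) + axis i s))"
    by (rule shift[symmetric]) measurable
  also have "\<dots> = integral\<^sup>L lborel (\<lambda>y. indicator A y * g y + indicator B (y + axis i (-1)) * g (y + axis i (-1)))"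
  proof (intro Bochner_Integration.integral_cong refl)
    fix y
    have "g (y + axis i (-1)) = g y" using g(2) ax(2) unfolding periodic_def by (metis add.assoc add.right_neutral)
    thus "indicator cell (y + axis i (- s)) * g (y + axis i (- s) + axis i s) =
        indicator A y * g y + indicator B (y + axis i (-1)) * g (y + axis i (-1))"
      by (simp add: ind ax(1) add.assoc distrib_right)
  qed
  also have "\<dots> = integral\<^sup>L lborel (\<lambda>y. indicator A y * g y) +
      integral\<^sup>L lborel (\<lambda>y. indicator B (y + axis i (-1)) * g (y + axis i (-1)))"
  proof (rule Bochner_Integration.integral_add)
    have "integrable (distr lborel borel ((+) (axis i (-1)))) (\<lambda>x. indicator B x * g x)"
      using int(2) by (simp add: lborel_distr_plus)
    hence "integrable lborel (\<lambda>x. indicator B (axis i (-1) + x) * g (axis i (-1) + x))"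
      by (subst (asm) integrable_distr_eq) auto
    thus "integrable lborel (\<lambda>y. indicator B (y + axis i (-1)) * g (y + axis i (-1)))" by (simp add: add.commute)
  qed (rule int)
  also have "integral\<^sup>L lborel (\<lambda>y. indicator B (y + axis i (-1)) * g (y + axis i (-1))) =
      integral\<^sup>L lborel (\<lambda>y. indicator B y * g y)"
    by (rule shift) measurable
  also have "integral\<^sup>L lborel (\<lambda>y. indicator A y * g y) + \<dots> =
      integral\<^sup>L lborel (\<lambda>y. indicator A y * g y + indicator B y * g y)"
    by (rule Bochner_Integration.integral_add[symmetric, OF int])
  also have "\<dots> = cell_int g"
    unfolding set_lebesgue_integral_def
    by (intro Bochner_Integration.integral_cong refl) (auto simp: A_def B_def indicator_def)
  finally show ?thesis .
qed

text \<open>The derivative is averaged over the translates \<open>x + s e_i\<close>,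
  \<open>0 \<le> s \<le> 1\<close>. For fixed \<open>x\<close> the integral in \<open>s\<close> is
  \<open>h (x + e_i) - h x = 0\<close>; for fixed \<open>s\<close> the integral over the cell does
  not depend on \<open>s\<close>. Exchanging the two integrals avoids splitting the cell into
  coordinates.\<close>

lemma cell_int_pd_zero:
  fixes h :: "real ^ 'n \<Rightarrow> real"
  assumes h: "smooth_on UNIV h" "periodic h"
  shows "cell_int (pd i h) = 0"
proof -
  define f where "f = (\<lambda>(s, x). pd i h (x + s *\<^sub>R axis i 1))"
  have cont: "continuous_on UNIV (pd i h)" by (intro smooth_on_continuous smooth_pd h)
  have ax: "axis i s = s *\<^sub>R axis i (1::real)" for s :: real by (simp add: axis_def vec_eq_iff)
  have cf: "continuous_on UNIV f"
    unfolding f_def case_prod_beta'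
    by (rule continuous_on_compose2[OF cont]) (auto intro!: continuous_intros)
  have deriv: "((\<lambda>s. h (x + s *\<^sub>R axis i 1)) has_vector_derivative pd i h (x + s *\<^sub>R axis i 1)) (at s within S)" for x s S
  proof -
    have "((\<lambda>s. x + s *\<^sub>R axis i 1) has_derivative (\<lambda>r. r *\<^sub>R axis i 1)) (at s within S)"
      by (auto intro!: derivative_eq_intros)
    hence "(h \<circ> (\<lambda>s. x + s *\<^sub>R axis i 1) has_derivative
        frechet_derivative h (at (x + s *\<^sub>R axis i 1)) \<circ> (\<lambda>r. r *\<^sub>R axis i 1)) (at s within S)"
      by (rule diff_chain_within[OF _ has_derivative_at_withinI[OF smooth_has_derivative[OF h(1)]]])
    moreover have "linear (frechet_derivative h (at (x + s *\<^sub>R axis i 1)))"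
      using smooth_has_derivative[OF h(1)] by (rule has_derivative_linear)
    ultimately show ?thesis
      unfolding has_vector_derivative_def pd_def by (simp add: comp_def linear_scale)
  qed
  have inner: "(LINT s:{0..1}|lborel. f (s, x)) = 0" for x
  proof -
    have "(LINT s:{0..1}|lborel. f (s, x)) = h (x + 1 *\<^sub>R axis i 1) - h (x + 0 *\<^sub>R axis i 1)"
      unfolding set_lebesgue_integral_def f_def case_prod_conv
    proof (rule integral_FTC_Icc)
      show "continuous_on {0..1} (\<lambda>s. pd i h (x + s *\<^sub>R axis i 1))"
        by (rule continuous_on_compose2[OF cont]) (auto intro!: continuous_intros)
    qed (auto intro: deriv)
    thus ?thesis using h(2) by (simp add: periodic_def)
  qed
  have "(LINT s:{0..1}|lborel. cell_int (\<lambda>x. f (s, x))) = cell_int (\<lambda>x. LINT s:{0..1}|lborel. f (s, x))"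
    using cyl_int_Fubini[of 1 f] continuous_on_subset[OF cf, of "slab 1"] by simp
  also have "\<dots> = 0" unfolding inner cell_int_const ..
  finally have 0: "(LINT s:{0..1}|lborel. cell_int (\<lambda>x. f (s, x))) = 0" .
  have "cell_int (\<lambda>x. f (s, x)) = cell_int (pd i h)" if "s \<in> {0..1}" for s
    using cell_int_translate[OF cont periodic_pd[OF h(2)], of s i] that by (simp add: f_def ax[of s])
  hence "(LINT s:{0..1}|lborel. cell_int (\<lambda>x. f (s, x))) = (LINT s:{0..1::real}|lborel. cell_int (pd i h))"
    unfolding set_lebesgue_integral_def[of lborel "{0..1::real}"]
    by (intro Bochner_Integration.integral_cong refl) (auto simp: indicator_def)
  also have "\<dots> = cell_int (pd i h)" by (simp add: set_lebesgue_integral_def measure_def)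
  finally show ?thesis using 0 by simp
qed

lemma continuous_on_smooth: "smooth_on UNIV f \<Longrightarrow> continuous_on S f"
  using smooth_on_continuous continuous_on_subset by blast

text \<open>The derivative of a product is a sum of two products, so products are not a class for
  \<open>smooth_on_coinduct\<close>. The induction runs over the order directly, with closure of
  \<open>Ck_on k\<close> under addition shown along the way.\<close>

lemma smooth_mult:
  fixes f g :: "'a::euclidean_space \<Rightarrow> real"
  assumes "smooth_on UNIV f" "smooth_on UNIV g"
  shows "smooth_on UNIV (\<lambda>x. f x * g x)"
proof -
  have "Ck_on k UNIV (\<lambda>x. f x * g x)" if "smooth_on UNIV f" "smooth_on UNIV g" for k and f g :: "'a \<Rightarrow> real"
    using that
  proof (induction k arbitrary: f g)
    case 0
    thus ?case by (simp add: continuous_on_mult smooth_on_continuous)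
  next
    case (Suc k)
    have D: "((\<lambda>x. f x * g x) has_derivative
        (\<lambda>h. f x * frechet_derivative g (at x) h + frechet_derivative f (at x) h * g x)) (at x)" for x
      using has_derivative_mult[OF smooth_on_has_derivative[OF Suc.prems(1)] smooth_on_has_derivative[OF Suc.prems(2)], of x]
      by simp
    have add: "Ck_on k UNIV (\<lambda>x. u x + v x)" if "Ck_on k UNIV u" "Ck_on k UNIV v" for u v :: "'a \<Rightarrow> real"
      using that
    proof (induction k arbitrary: u v)
      case (Suc k)
      have E: "((\<lambda>x. u x + v x) has_derivative
          (\<lambda>h. frechet_derivative u (at x) h + frechet_derivative v (at x) h)) (at x)" for x
        using Suc.prems by (intro has_derivative_add) (auto simp: frechet_derivative_works[symmetric] differentiable_on_def)
      show ?case using Suc E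
        by (auto simp: differentiable_on_def frechet_derivative_at[OF E, symmetric] intro: differentiableI)
    qed (auto intro: continuous_on_add)
    have "Ck_on k UNIV (\<lambda>x. f x * frechet_derivative g (at x) b + frechet_derivative f (at x) b * g x)"
      if "b \<in> Basis" for b
      using Suc.prems smooth_on_derivative[OF Suc.prems(1) that] smooth_on_derivative[OF Suc.prems(2) that]
      by (intro add Suc.IH) auto
    thus ?case using D by (auto simp: differentiable_on_def frechet_derivative_at[OF D, symmetric] intro: differentiableI)
  qed
  thus ?thesis using assms unfolding smooth_on_def[of UNIV "\<lambda>x. f x * g x"] by blast
qed

lemma pd_mult:
  assumes "smooth_on UNIV f" "smooth_on UNIV g"
  shows "pd i (\<lambda>x. f x * g x) x = f x * pd i g x + pd i f x * g x"
  by (subst pd_eq[OF has_derivative_mult[OF smooth_has_derivative[OF assms(1)] smooth_has_derivative[OF assms(2)]]])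
     (simp add: pd_def)

lemma cell_int_by_parts:
  fixes f g :: "real ^ 'n \<Rightarrow> real"
  assumes f: "smooth_on UNIV f" "periodic f" and g: "smooth_on UNIV g" "periodic g"
  shows "cell_int (\<lambda>x. f x * pd i g x) = - cell_int (\<lambda>x. pd i f x * g x)"
proof -
  have "periodic (\<lambda>x. f x * g x)" using f g by (simp add: periodic_def)
  from cell_int_pd_zero[OF smooth_mult[OF f(1) g(1)] this, of i]
  have "0 = cell_int (\<lambda>x. f x * pd i g x + pd i f x * g x)"
    unfolding pd_mult[OF f(1) g(1), abs_def] by simp
  also have "\<dots> = cell_int (\<lambda>x. f x * pd i g x) + cell_int (\<lambda>x. pd i f x * g x)"
    by (intro cell_int_add continuous_on_mult continuous_on_smooth smooth_pd f g)
  finally show ?thesis by simp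
qed

section \<open>Fourier modes and Fejer means\<close>

definition freq :: "('n \<Rightarrow> int) \<Rightarrow> real ^ 'n" where
  "freq m = (\<chi> i. 2 * pi * of_int (m i))"

lemma freq_nth: "freq m $ i = 2 * pi * of_int (m i)" by (simp add: freq_def)

lemma freq_add: "freq (\<lambda>i. m i + n i) = freq m + freq n"
  and freq_diff: "freq (\<lambda>i. m i - n i) = freq m - freq n"
  and freq_uminus: "freq (\<lambda>i. - m i) = - freq m"
  by (simp_all add: freq_def vec_eq_iff algebra_simps)

lemma freq_eq_0_iff: "freq m = 0 \<longleftrightarrow> m = (\<lambda>_. 0)"
  by (auto simp: freq_def vec_eq_iff)

definition wave :: "('n \<Rightarrow> int) \<Rightarrow> real \<Rightarrow> real ^ 'n \<Rightarrow> real" where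
  "wave m \<theta> x = cos (freq m \<bullet> x + \<theta>)"

lemma smooth_wave: "smooth_on UNIV (wave m \<theta>)"
proof -
  have "smooth_on UNIV (\<lambda>x. wave_field 1 (freq m) \<theta> (1::real) (0, x))"
    by (intro smooth_on_slice[of 1] smooth_on_wave_field) auto
  moreover have "(\<lambda>x. wave_field 1 (freq m) \<theta> (1::real) (0, x)) = wave m \<theta>"
    by (simp add: wave_field_def wave_def fun_eq_iff)
  ultimately show ?thesis by simp
qed

lemma continuous_on_wave: "continuous_on S (wave m \<theta>)"
  by (rule continuous_on_smooth[OF smooth_wave])

lemma periodic_wave: "periodic (wave m \<theta>)"
proof -
  have "cos (freq m \<bullet> (x + axis i 1) + \<theta>) = cos (freq m \<bullet> x + \<theta>)" for x i
  proof -
    have "freq m \<bullet> (x + axis i 1) + \<theta> = (freq m \<bullet> x + \<theta>) + 2 * pi * of_int (m i)"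
      by (simp add: inner_add_right inner_axis freq_nth)
    also have "cos \<dots> = cos (freq m \<bullet> x + \<theta>)"
      by (simp add: cos_add cos_int_2pin sin_int_2pin)
    finally show ?thesis .
  qed
  thus ?thesis by (simp add: periodic_def wave_def)
qed

lemma wave_shift: "wave m (\<theta> + pi / 2) x = - sin (freq m \<bullet> x + \<theta>)"
  using cos_add[of "freq m \<bullet> x + \<theta>" "pi / 2"] by (simp add: wave_def add.assoc)

lemma wave_shift_neg: "wave m (\<theta> - pi / 2) x = sin (freq m \<bullet> x + \<theta>)"
  using cos_diff[of "freq m \<bullet> x + \<theta>" "pi / 2"] by (simp add: wave_def add_diff_eq)

lemma abs_wave_le: "\<bar>wave m \<theta> x\<bar> \<le> 1" by (simp add: wave_def)

lemma wave_has_derivative: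
  "(wave m \<theta> has_derivative (\<lambda>h. - sin (freq m \<bullet> x + \<theta>) * (freq m \<bullet> h))) (at x)"
  unfolding wave_def[abs_def] by (auto intro!: derivative_eq_intros)

lemma pd_wave: "pd i (wave m \<theta>) = (\<lambda>x. freq m $ i * wave m (\<theta> + pi / 2) x)"
  by (simp add: fun_eq_iff pd_eq[OF wave_has_derivative] inner_axis wave_shift)

lemma pd_cmult:
  assumes "smooth_on UNIV f" shows "pd i (\<lambda>x. c * f x) = (\<lambda>x. c * pd i f x)"
  by (rule ext, subst pd_eq[OF has_derivative_mult_right[OF smooth_has_derivative[OF assms]]]) (simp add: pd_def)

lemma pd_add:
  assumes "smooth_on UNIV f" "smooth_on UNIV g" shows "pd i (\<lambda>x. f x + g x) = (\<lambda>x. pd i f x + pd i g x)"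
  by (rule ext, subst pd_eq[OF has_derivative_add[OF smooth_has_derivative[OF assms(1)] smooth_has_derivative[OF assms(2)]]])
     (simp add: pd_def)

lemma smooth_cmult: "smooth_on UNIV f \<Longrightarrow> smooth_on UNIV (\<lambda>x. c * f x)" for f :: "'a::euclidean_space \<Rightarrow> real"
  by (rule smooth_on_bounded_linear[OF derivative_unique_on_UNIV bounded_linear_mult_right])

lemma smooth_uminus: "smooth_on UNIV f \<Longrightarrow> smooth_on UNIV (\<lambda>x. - f x)" for f :: "'a::euclidean_space \<Rightarrow> real"
  using smooth_cmult[of f "-1"] by simp

lemma smooth_add: "smooth_on UNIV f \<Longrightarrow> smooth_on UNIV g \<Longrightarrow> smooth_on UNIV (\<lambda>x. f x + g x)"
  by (rule smooth_on_add[OF derivative_unique_on_UNIV])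

lemma smooth_const: "smooth_on UNIV (\<lambda>x :: real ^ 'n. c)" for c :: real
proof -
  have "(\<lambda>x :: real ^ 'n. c) = (\<lambda>x. c * wave (\<lambda>_. 0) 0 x)" by (simp add: wave_def freq_eq_0_iff[THEN iffD2])
  thus ?thesis using smooth_cmult[OF smooth_wave] by simp
qed

lemma smooth_sum:
  fixes f :: "'i \<Rightarrow> real ^ 'n \<Rightarrow> real"
  assumes "finite I" "\<And>i. i \<in> I \<Longrightarrow> smooth_on UNIV (f i)"
  shows "smooth_on UNIV (\<lambda>x. \<Sum>i\<in>I. f i x)"
  using assms by (induction I) (auto intro: smooth_const smooth_add)

lemma periodic_cmult: "periodic f \<Longrightarrow> periodic (\<lambda>x. c * f x)"
  and periodic_add: "periodic f \<Longrightarrow> periodic g \<Longrightarrow> periodic (\<lambda>x. f x + g x)"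
  and periodic_sum: "(\<And>i. i \<in> I \<Longrightarrow> periodic (F i)) \<Longrightarrow> periodic (\<lambda>x. \<Sum>i\<in>I. F i x)"
  by (auto simp: periodic_def)

text \<open>For nonzero frequency the wave is a nonzero multiple of a partial derivative of the wave
  with phase \<open>\<theta> - pi / 2\<close>.\<close>

lemma cell_int_wave: "cell_int (wave m \<theta>) = (if m = (\<lambda>_. 0) then cos \<theta> else 0)"
proof (cases "m = (\<lambda>_. 0)")
  case True
  hence "wave m \<theta> = (\<lambda>_. cos \<theta>)" by (simp add: wave_def freq_eq_0_iff[THEN iffD2] fun_eq_iff)
  thus ?thesis using True by (simp add: cell_int_const)
next
  case False
  then obtain i where "m i \<noteq> 0" by auto
  hence i: "freq m $ i \<noteq> 0" by (simp add: freq_nth)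
  have "0 = cell_int (pd i (wave m (\<theta> - pi / 2)))"
    by (intro cell_int_pd_zero[symmetric] smooth_wave periodic_wave)
  also have "\<dots> = freq m $ i * cell_int (wave m \<theta>)" unfolding pd_wave by simp
  finally show ?thesis using i False by simp
qed

text \<open>The real part of the Fourier term with frequency \<open>m\<close>. Fourier sums of a
  real function over both signs of \<open>m\<close> are sums of modes.\<close>

definition mode :: "('n \<Rightarrow> int) \<Rightarrow> (real ^ 'n \<Rightarrow> real) \<Rightarrow> real ^ 'n \<Rightarrow> real" where
  "mode m f z = cell_int (\<lambda>y. f y * cos (freq m \<bullet> (y - z)))"

definition coef :: "('n \<Rightarrow> int) \<Rightarrow> real \<Rightarrow> (real ^ 'n \<Rightarrow> real) \<Rightarrow> real" where
  "coef m \<theta> f = cell_int (\<lambda>y. f y * wave m \<theta> y)"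

lemma mode_eq_coef: "mode m f z = coef m (- (freq m \<bullet> z)) f"
  by (simp add: mode_def coef_def wave_def inner_diff_right)

text \<open>The phase enters only through \<open>cos \<theta>\<close> and
  \<open>sin \<theta>\<close>, so the phases 0 and \<open>pi / 2\<close> carry all information about
  frequency \<open>m\<close>.\<close>

lemma coef_expand:
  assumes "continuous_on closed_cell f"
  shows "coef m \<theta> f = coef m 0 f * cos \<theta> + coef m (pi / 2) f * sin \<theta>"
proof -
  have "coef m \<theta> f = cell_int (\<lambda>y. cos \<theta> * (f y * wave m 0 y) + sin \<theta> * (f y * wave m (pi / 2) y))"
    unfolding coef_def using wave_shift[of m 0] by (simp add: wave_def cos_add algebra_simps)
  also have "\<dots> = cell_int (\<lambda>y. cos \<theta> * (f y * wave m 0 y)) + cell_int (\<lambda>y. sin \<theta> * (f y * wave m (pi / 2) y))"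
    using assms by (intro cell_int_add continuous_on_mult continuous_on_const continuous_on_wave)
  finally show ?thesis by (simp add: coef_def mult.commute)
qed

lemma mode_expand:
  assumes "continuous_on closed_cell f"
  shows "mode m f z = coef m 0 f * wave m 0 z + coef m (pi / 2) f * wave m (pi / 2) z"
  using coef_expand[OF assms, of m "- (freq m \<bullet> z)"] wave_shift[of m 0 z]
  by (simp add: mode_eq_coef wave_def)

text \<open>The exponents of the exponential sum whose squared modulus is the Fejer kernel;
  differences of box points are the frequencies in the mean.\<close>

definition box_set :: "nat \<Rightarrow> ('n::finite \<Rightarrow> int) set" where
  "box_set N = (UNIV \<rightarrow>\<^sub>E {0..<int N})"

lemma finite_box_set: "finite (box_set N :: ('n::finite \<Rightarrow> int) set)"
  and card_box_set: "card (box_set N :: ('n::finite \<Rightarrow> int) set) = N ^ CARD('n)"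
  by (simp_all add: box_set_def finite_PiE card_PiE)

text \<open>Counts the pairs of box points that differ by the unit vector \<open>e_i\<close>, hence
  the weight of that frequency in the Fejer kernel.\<close>

lemma card_box_set_shift:
  "card {k \<in> (box_set N :: ('n::finite \<Rightarrow> int) set). (\<lambda>j. k j + (if j = i then 1 else 0)) \<in> box_set N} =
     (N - 1) * N ^ (CARD('n) - 1)"
proof -
  have "{k \<in> (box_set N :: ('n \<Rightarrow> int) set). (\<lambda>j. k j + (if j = i then 1 else 0)) \<in> box_set N} =
      (\<Pi>\<^sub>E j\<in>UNIV. {0..<int (if j = i then N - 1 else N)})"
    (is "?L = ?R")
  proof (intro set_eqI iffI)
    fix k assume k: "k \<in> ?L"
    show "k \<in> ?R"
    proof
      fix j
      have "k j \<in> {0..<int N}" "k j + (if j = i then 1 else 0) \<in> {0..<int N}"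
        using k by (auto simp: box_set_def PiE_iff)
      thus "k j \<in> {0..<int (if j = i then N - 1 else N)}" by (cases N) auto
    qed simp
  next
    fix k assume k: "k \<in> ?R"
    have "k j \<in> {0..<int (if j = i then N - 1 else N)}" for j using k by (auto simp: PiE_iff)
    hence "k j \<in> {0..<int N} \<and> k j + (if j = i then 1 else 0) \<in> {0..<int N}" for j
      by (cases N) (force split: if_splits)+
    thus "k \<in> ?L" by (simp add: box_set_def PiE_iff)
  qed
  hence "card ?L = (\<Prod>j\<in>(UNIV :: 'n set). if j = i then N - 1 else N)"
    by (simp add: card_PiE)
  also have "\<dots> = (N - 1) * (\<Prod>j\<in>(UNIV :: 'n set) - {i}. N)"
    by (subst prod.remove[of _ i]) (auto intro!: prod.cong)
  finally show ?thesis by simp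
qed

text \<open>The squared modulus of the exponential sum over the box, divided by the number of box
  points: a product of one-dimensional Fejer kernels. The double sum makes convolution with it a sum
  of modes.\<close>

definition fejer_kernel :: "nat \<Rightarrow> real ^ 'n \<Rightarrow> real" where
  "fejer_kernel N z = (\<Sum>k\<in>box_set N. \<Sum>l\<in>box_set N. cos (freq (\<lambda>i. k i - l i) \<bullet> z)) / N ^ CARD('n)"

definition fejer :: "nat \<Rightarrow> (real ^ 'n \<Rightarrow> real) \<Rightarrow> real ^ 'n \<Rightarrow> real" where
  "fejer N f z = (\<Sum>k\<in>box_set N. \<Sum>l\<in>box_set N. mode (\<lambda>i. k i - l i) f z) / N ^ CARD('n)"

lemma fejer_kernel_nonneg: "0 \<le> fejer_kernel N z"
proof -
  have "(\<Sum>k\<in>box_set N. \<Sum>l\<in>box_set N. cos (freq (\<lambda>i. k i - l i) \<bullet> z)) =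
      (\<Sum>k\<in>box_set N. cos (freq k \<bullet> z)) * (\<Sum>l\<in>box_set N. cos (freq l \<bullet> z)) +
      (\<Sum>k\<in>box_set N. sin (freq k \<bullet> z)) * (\<Sum>l\<in>box_set N. sin (freq l \<bullet> z))"
    by (simp add: freq_diff inner_diff_left cos_diff sum_product sum.distrib)
  thus ?thesis unfolding fejer_kernel_def by (intro divide_nonneg_nonneg) auto
qed

lemma continuous_on_fejer_kernel:
  fixes g :: "'b::topological_space \<Rightarrow> real ^ 'n"
  shows "continuous_on S g \<Longrightarrow> continuous_on S (\<lambda>y. fejer_kernel N (g y))"
proof -
  have "continuous_on UNIV (fejer_kernel N :: real ^ 'n \<Rightarrow> real)"
    unfolding fejer_kernel_def[abs_def] divide_inverse by (intro continuous_intros)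
  thus "continuous_on S g \<Longrightarrow> continuous_on S (\<lambda>y. fejer_kernel N (g y))"
    by (rule continuous_on_compose2) auto
qed

lemma fejer_eq:
  assumes "continuous_on closed_cell f"
  shows "fejer N f z = cell_int (\<lambda>y. f y * fejer_kernel N (y - z))"
proof -
  have c: "continuous_on closed_cell (\<lambda>y. f y * cos (freq m \<bullet> (y - z)))" for m
    using assms by (intro continuous_intros)
  have "cell_int (\<lambda>y. f y * fejer_kernel N (y - z)) =
      cell_int (\<lambda>y. inverse (real (N ^ CARD('a))) * (\<Sum>k\<in>box_set N. \<Sum>l\<in>box_set N. f y * cos (freq (\<lambda>i. k i - l i) \<bullet> (y - z))))"
    by (simp add: fejer_kernel_def sum_distrib_left sum_divide_distrib divide_simps mult_ac)
  also have "\<dots> = inverse (real (N ^ CARD('a))) *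
      (\<Sum>k\<in>box_set N. \<Sum>l\<in>box_set N. cell_int (\<lambda>y. f y * cos (freq (\<lambda>i. k i - l i) \<bullet> (y - z))))"
    unfolding cell_int_mult using c
    by (simp add: cell_int_sum finite_box_set continuous_on_sum)
  finally show ?thesis by (simp add: fejer_def mode_def divide_inverse mult.commute)
qed

lemma cell_int_shifted_cos: "cell_int (\<lambda>y. cos (freq m \<bullet> (y - z))) = (if m = (\<lambda>_. 0) then 1 else 0)"
proof -
  have "(\<lambda>y. cos (freq m \<bullet> (y - z))) = wave m (- (freq m \<bullet> z))"
    by (simp add: fun_eq_iff wave_def inner_diff_right)
  thus ?thesis using cell_int_wave[of m "- (freq m \<bullet> z)"] by (simp add: freq_eq_0_iff[THEN iffD2])
qed

lemma cell_int_fejer_kernel: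
  assumes "N > 0" shows "cell_int (\<lambda>y :: real ^ 'n. fejer_kernel N (y - z)) = 1"
proof -
  have "fejer N (\<lambda>_ :: real ^ 'n. 1) z = (\<Sum>k\<in>(box_set N :: ('n \<Rightarrow> int) set). \<Sum>l\<in>box_set N. if k = l then 1 else 0) / N ^ CARD('n)"
    unfolding fejer_def mode_def mult_1 cell_int_shifted_cos
    by (intro arg_cong2[where f = "(/)"] sum.cong refl) (auto simp: fun_eq_iff)
  also have "\<dots> = 1" using assms by (simp add: sum.delta' finite_box_set card_box_set)
  finally show ?thesis using fejer_eq[of "\<lambda>_. 1" N z] by simp
qed

text \<open>Among the frequencies \<open>k - l\<close> of the kernel only \<open>e_i\<close> and
  \<open>- e_i\<close> see the cosine. With \<open>d\<close> the dimension, each occurs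
  \<open>(N - 1) * N ^ (d - 1)\<close> times with weight 1/2, against the normalisation
  \<open>N ^ d\<close>.\<close>

lemma cell_int_fejer_kernel_cos:
  assumes "N > 0"
  shows "cell_int (\<lambda>y :: real ^ 'n. cos (2 * pi * (y $ i - z $ i)) * fejer_kernel N (y - z)) = 1 - 1 / N"
proof -
  let ?B = "box_set N :: ('n \<Rightarrow> int) set"
  define e where "e = (\<lambda>j. if j = i then 1 else 0 :: int)"
  have fe: "freq e \<bullet> x = 2 * pi * x $ i" for x
    by (simp add: freq_def e_def inner_vec_def if_distrib[of of_int] if_distrib[of "\<lambda>a. _ * a"] if_distrib[of "\<lambda>a. a * _"] cong: if_cong)
  have m: "mode m (\<lambda>y. cos (2 * pi * (y $ i - z $ i))) z =
      ((if (\<lambda>j. m j + e j) = (\<lambda>_. 0) then 1 else 0) + (if (\<lambda>j. m j - e j) = (\<lambda>_. 0) then 1 else 0)) / 2" for m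
  proof -
    have "mode m (\<lambda>y. cos (2 * pi * (y $ i - z $ i))) z =
        cell_int (\<lambda>y. (1/2) * (cos (freq (\<lambda>j. m j + e j) \<bullet> (y - z)) + cos (freq (\<lambda>j. m j - e j) \<bullet> (y - z))))"
      unfolding mode_def freq_add freq_diff inner_add_left inner_diff_left fe
      by (intro arg_cong[where f = cell_int] ext) (simp add: cos_times_cos algebra_simps)
    also have "\<dots> = (1/2) * (cell_int (\<lambda>y. cos (freq (\<lambda>j. m j + e j) \<bullet> (y - z))) + cell_int (\<lambda>y. cos (freq (\<lambda>j. m j - e j) \<bullet> (y - z))))"
      unfolding cell_int_mult by (subst cell_int_add) (auto intro!: continuous_intros)
    finally show ?thesis unfolding cell_int_shifted_cos by simp
  qed
  have c: "card {k \<in> ?B. (\<lambda>j. k j + e j) \<in> ?B} = (N - 1) * N ^ (CARD('n) - 1)"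
    unfolding e_def by (rule card_box_set_shift)
  have 1: "(\<Sum>k\<in>?B. \<Sum>l\<in>?B. if (\<lambda>j. k j - l j + e j) = (\<lambda>_. 0) then 1 else 0) = real ((N - 1) * N ^ (CARD('n) - 1))"
  proof -
    have "(\<Sum>k\<in>?B. \<Sum>l\<in>?B. if (\<lambda>j. k j - l j + e j) = (\<lambda>_. 0) then 1 else 0) =
        (\<Sum>k\<in>?B. \<Sum>l\<in>?B. if l = (\<lambda>j. k j + e j) then 1 else (0::real))"
      by (intro sum.cong refl if_cong) (auto simp: fun_eq_iff algebra_simps)
    also have "\<dots> = (\<Sum>k\<in>?B. if (\<lambda>j. k j + e j) \<in> ?B then 1 else 0)"
      by (simp add: sum.delta finite_box_set)
    also have "\<dots> = real (card {k \<in> ?B. (\<lambda>j. k j + e j) \<in> ?B})"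
      by (simp add: sum.If_cases finite_box_set Int_def)
    finally show ?thesis unfolding c .
  qed
  have 2: "(\<Sum>k\<in>?B. \<Sum>l\<in>?B. if (\<lambda>j. k j - l j - e j) = (\<lambda>_. 0) then 1 else 0) = real ((N - 1) * N ^ (CARD('n) - 1))"
  proof -
    have "(\<Sum>k\<in>?B. \<Sum>l\<in>?B. if (\<lambda>j. k j - l j - e j) = (\<lambda>_. 0) then 1 else (0::real)) =
        (\<Sum>l\<in>?B. \<Sum>k\<in>?B. if (\<lambda>j. k j - l j - e j) = (\<lambda>_. 0) then 1 else 0)" by (rule sum.swap)
    also have "\<dots> = (\<Sum>l\<in>?B. \<Sum>k\<in>?B. if (\<lambda>j. l j - k j + e j) = (\<lambda>_. 0) then 1 else 0)"
      by (intro sum.cong refl if_cong) (auto simp: fun_eq_iff algebra_simps)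
    finally show ?thesis unfolding 1 .
  qed
  have "cell_int (\<lambda>y :: real ^ 'n. cos (2 * pi * (y $ i - z $ i)) * fejer_kernel N (y - z)) =
      fejer N (\<lambda>y. cos (2 * pi * (y $ i - z $ i))) z"
    by (rule fejer_eq[symmetric]) (intro continuous_intros)
  also have "\<dots> = real ((N - 1) * N ^ (CARD('n) - 1)) / N ^ CARD('n)"
    unfolding fejer_def m sum_divide_distrib[symmetric] sum.distrib 1 2 by simp
  also have "\<dots> = 1 - 1 / N"
  proof -
    have "real N ^ CARD('n) = N * real N ^ (CARD('n) - 1)"
      by (metis One_nat_def Suc_pred power_Suc zero_less_card_finite)
    thus ?thesis using assms by (simp add: of_nat_diff field_simps)
  qed
  finally show ?thesis .
qed

text \<open>On the compact set where \<open>h \<ge> e\<close> the penalty has a positive minimum;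
  \<open>C\<close> is the maximum of \<open>h\<close> there divided by that minimum. This replaces
  the usual splitting of a convolution into a small neighbourhood and its complement.\<close>

lemma dominated_by_penalty:
  fixes h s :: "'a::metric_space \<Rightarrow> real"
  assumes K: "compact K" and h: "continuous_on K h" and s: "continuous_on K s"
    and s0: "\<And>p. p \<in> K \<Longrightarrow> 0 \<le> s p" and z: "\<And>p. p \<in> K \<Longrightarrow> s p = 0 \<Longrightarrow> h p \<le> 0" and e: "e > 0"
  obtains C where "C \<ge> 0" "\<And>p. p \<in> K \<Longrightarrow> h p \<le> e + C * s p"
proof -
  define L where "L = {p \<in> K. e \<le> h p}"
  have "L = K \<inter> h -` {e..}" by (auto simp: L_def)
  hence L: "compact L"
    using K h by (metis closed_atLeast compact_Int_closed compact_imp_closed continuous_closed_preimage inf.idem inf_left_idem)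
  show ?thesis
  proof (cases "L = {}")
    case True
    thus ?thesis using s0 by (intro that[of 0]) (auto simp: L_def not_le less_imp_le)
  next
    case False
    have LK: "L \<subseteq> K" by (auto simp: L_def)
    obtain p where p: "p \<in> L" "\<And>q. q \<in> L \<Longrightarrow> s p \<le> s q"
      using continuous_attains_inf[OF L False continuous_on_subset[OF s LK]] by blast
    obtain q where q: "q \<in> L" "\<And>r. r \<in> L \<Longrightarrow> h r \<le> h q"
      using continuous_attains_sup[OF L False continuous_on_subset[OF h LK]] by blast
    have sp: "s p > 0" using p(1) s0[of p] z[of p] e by (force simp: L_def)
    have hq: "h q > 0" using q(1) e by (auto simp: L_def)
    show ?thesis
    proof (rule that[of "h q / s p"])
      show "0 \<le> h q / s p" using sp hq by simp
      fix r assume r: "r \<in> K"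
      show "h r \<le> e + h q / s p * s r"
      proof (cases "r \<in> L")
        case True
        have "h r \<le> h q" by (rule q(2)[OF True])
        also have "\<dots> \<le> h q / s p * s r" using p(2)[OF True] sp hq by (simp add: field_simps)
        finally show ?thesis using e by simp
      next
        case False
        have "0 \<le> h q / s p * s r" using sp hq s0[OF r] by simp
        thus ?thesis using False r by (simp add: L_def)
      qed
    qed
  qed
qed

text \<open>
  The kernel is concentrated on the zero set of the penalty
  \<open>\<Sum>i. 1 - cos (2 * pi * (y $ i - x $ i))\<close>, because its integral against the penalty is at most
  \<open>d / N\<close>; on that zero set \<open>y\<close> and \<open>x\<close> represent the same point of the torus.
\<close>

theorem fejer_uniform_limit:
  fixes f :: "real \<times> (real ^ 'n) \<Rightarrow> real"
  assumes f: "continuous_on (slab T) f" "space_periodic T f" and e: "e > 0"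
  shows "\<forall>\<^sub>F N in sequentially. \<forall>t\<in>{0..T}. \<forall>x\<in>cell. \<bar>fejer N (\<lambda>x. f (t, x)) x - f (t, x)\<bar> \<le> e"
proof -
  let ?K = "{0..T} \<times> closed_cell \<times> (closed_cell :: (real ^ 'n) set)"
  define h where "h = (\<lambda>(t, x, y). \<bar>f (t, y) - f (t, x)\<bar>)"
  define s where "s = (\<lambda>(t :: real, x, y :: real ^ 'n). \<Sum>i\<in>UNIV. 1 - cos (2 * pi * (y $ i - x $ i)))"
  have cK: "compact ?K" by (intro compact_Times compact_closed_cell) auto
  have ch: "continuous_on ?K h"
    unfolding h_def case_prod_beta'
    by (intro continuous_on_rabs continuous_on_diff continuous_on_compose2[OF f(1)]) (auto simp: slab_def intro!: continuous_intros)
  have cs: "continuous_on ?K s" unfolding s_def case_prod_beta' by (intro continuous_intros)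
  have s0: "0 \<le> s p" for p by (auto simp: s_def intro!: sum_nonneg split: prod.split)
  have hz: "h p \<le> 0" if p: "p \<in> ?K" "s p = 0" for p
  proof -
    obtain t x y where pe: "p = (t, x, y)" by (cases p) auto
    have "cos (2 * pi * (y $ i - x $ i)) = 1" for i
    proof -
      have "(\<Sum>i\<in>UNIV. 1 - cos (2 * pi * (y $ i - x $ i))) = 0" using p(2) by (simp add: s_def pe)
      hence "1 - cos (2 * pi * (y $ i - x $ i)) = 0" by (subst (asm) sum_nonneg_eq_0_iff) auto
      thus ?thesis by simp
    qed
    note c1 = this
    have "\<exists>n::int. y $ i - x $ i = n" for i
    proof -
      from c1[of i] obtain n :: int where "2 * pi * (y $ i - x $ i) = of_int n * 2 * pi"
        unfolding cos_one_2pi_int by auto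
      hence "y $ i - x $ i = n" by simp
      thus ?thesis by blast
    qed
    then obtain n :: "'n \<Rightarrow> int" where "\<And>i. y $ i - x $ i = n i" by metis
    hence "y = x + (\<chi> i. of_int (n i))" by (simp add: vec_eq_iff algebra_simps)
    moreover have "periodic (\<lambda>x. f (t, x))" using f(2) p(1) by (auto simp: space_periodic_def pe)
    ultimately have "f (t, y) = f (t, x)" using periodic_int_shift by metis
    thus ?thesis by (simp add: h_def pe)
  qed
  have "e / 2 > 0" using e by simp
  from dominated_by_penalty[OF cK ch cs s0 hz this]
  obtain C where C: "C \<ge> 0" "\<And>p. p \<in> ?K \<Longrightarrow> h p \<le> e / 2 + C * s p" by blast
  have est: "\<bar>fejer N (\<lambda>x. f (t, x)) x - f (t, x)\<bar> \<le> e / 2 + C * CARD('n) / N"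
    if N: "N > 0" and t: "t \<in> {0..T}" and x: "x \<in> cell" for N t x
  proof -
    let ?k = "\<lambda>y. fejer_kernel N (y - x)"
    have cf: "continuous_on closed_cell (\<lambda>y. f (t, y))"
      by (rule continuous_on_compose2[OF f(1)]) (use t in \<open>auto simp: slab_def intro!: continuous_intros\<close>)
    have ck: "continuous_on closed_cell ?k" by (intro continuous_on_fejer_kernel continuous_intros)
    have "fejer N (\<lambda>x. f (t, x)) x - f (t, x) = cell_int (\<lambda>y. f (t, y) * ?k y) - f (t, x) * cell_int ?k"
      using fejer_eq[OF cf, of N x] cell_int_fejer_kernel[OF N, of x] by simp
    also have "\<dots> = cell_int (\<lambda>y. f (t, y) * ?k y - f (t, x) * ?k y)"
      unfolding cell_int_mult[symmetric] by (intro cell_int_diff[symmetric] continuous_on_mult cf ck continuous_on_const)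
    finally have eq: "fejer N (\<lambda>x. f (t, x)) x - f (t, x) = cell_int (\<lambda>y. (f (t, y) - f (t, x)) * ?k y)"
      by (simp add: left_diff_distrib)
    \<comment> \<open>The bound by the penalty, multiplied by the kernel and arranged so that each
      term of the sum integrates to \<open>C / N\<close>.\<close>
    let ?p = "\<lambda>y. e / 2 * ?k y + (\<Sum>i\<in>UNIV. C * (?k y - cos (2 * pi * (y $ i - x $ i)) * ?k y))"
    have alg: "(e / 2 + C * (\<Sum>i\<in>UNIV. 1 - c i)) * K = e / 2 * K + (\<Sum>i\<in>UNIV. C * (K - c i * K))"
      for c :: "'n \<Rightarrow> real" and K
      by (simp add: sum_distrib_left sum_distrib_right sum_subtractf algebra_simps)
    have pt: "\<bar>(f (t, y) - f (t, x)) * ?k y\<bar> \<le> ?p y" if "y \<in> cell" for y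
    proof -
      have "(t, x, y) \<in> ?K" using t x that cell_subset by auto
      from C(2)[OF this] have "\<bar>f (t, y) - f (t, x)\<bar> \<le> e / 2 + C * (\<Sum>i\<in>UNIV. 1 - cos (2 * pi * (y $ i - x $ i)))"
        by (simp add: h_def s_def)
      hence "\<bar>f (t, y) - f (t, x)\<bar> * ?k y \<le> (e / 2 + C * (\<Sum>i\<in>UNIV. 1 - cos (2 * pi * (y $ i - x $ i)))) * ?k y"
        using fejer_kernel_nonneg by (rule mult_right_mono)
      also have "\<dots> = ?p y" by (rule alg)
      finally show ?thesis using fejer_kernel_nonneg[of N "y - x"] by (simp add: abs_mult)
    qed
    have cp: "continuous_on closed_cell (\<lambda>y. C * (?k y - cos (2 * pi * (y $ i - x $ i)) * ?k y))" for i
      by (intro continuous_on_mult continuous_on_diff ck continuous_intros)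
    have c1: "continuous_on closed_cell (\<lambda>y. e / 2 * ?k y)" by (intro continuous_on_mult continuous_on_const ck)
    have c2: "continuous_on closed_cell (\<lambda>y. \<Sum>i\<in>UNIV. C * (?k y - cos (2 * pi * (y $ i - x $ i)) * ?k y))"
      by (intro continuous_on_sum cp)
    have cp': "continuous_on closed_cell ?p" by (intro continuous_on_add continuous_on_mult continuous_on_const ck continuous_on_sum cp)
    have cd: "continuous_on closed_cell (\<lambda>y. (f (t, y) - f (t, x)) * ?k y)"
      by (intro continuous_on_mult continuous_on_diff cf ck continuous_on_const)
    have "cell_int (\<lambda>y. (f (t, y) - f (t, x)) * ?k y) \<le> cell_int ?p"
      using pt by (intro cell_int_mono cd cp') (auto simp: abs_le_iff)
    moreover have "cell_int (\<lambda>y. - ((f (t, y) - f (t, x)) * ?k y)) \<le> cell_int ?p"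
      using pt by (intro cell_int_mono continuous_on_minus cd cp') (auto simp: abs_le_iff)
    ultimately have "\<bar>cell_int (\<lambda>y. (f (t, y) - f (t, x)) * ?k y)\<bar> \<le> cell_int ?p"
      using cell_int_mult[of "-1" "\<lambda>y. (f (t, y) - f (t, x)) * ?k y"] by simp
    also have "cell_int ?p = cell_int (\<lambda>y. e / 2 * ?k y) + (\<Sum>i\<in>UNIV. cell_int (\<lambda>y. C * (?k y - cos (2 * pi * (y $ i - x $ i)) * ?k y)))"
      unfolding cell_int_add[OF c1 c2] by (simp only: cell_int_sum[OF finite cp])
    also have "\<dots> = e / 2 + (\<Sum>i\<in>(UNIV :: 'n set). C * (1 / N))"
    proof -
      have "cell_int (\<lambda>y. ?k y - cos (2 * pi * (y $ i - x $ i)) * ?k y) = 1 / N" for i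
        by (subst cell_int_diff)
           (auto intro!: continuous_on_mult ck continuous_intros simp: cell_int_fejer_kernel[OF N] cell_int_fejer_kernel_cos[OF N])
      thus ?thesis unfolding cell_int_mult by (simp add: cell_int_fejer_kernel[OF N])
    qed
    finally show ?thesis unfolding eq by (simp add: mult.commute[of C])
  qed
  have "\<forall>\<^sub>F N in sequentially. e / 2 + C * CARD('n) / real N < e"
  proof (rule order_tendstoD(2))
    show "(\<lambda>N. e / 2 + C * CARD('n) / real N) \<longlonglongrightarrow> e / 2 + 0"
      by (intro tendsto_intros lim_const_over_n)
  qed (use e in simp)
  thus ?thesis
    using eventually_gt_at_top[of "0::nat"]
  proof eventually_elim
    case (elim N)
    show ?case
    proof (intro ballI)
      fix t x assume "t \<in> {0..T}" "x \<in> (cell :: (real ^ 'n) set)"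
      from est[OF elim(2) this] elim(1)
      show "\<bar>fejer N (\<lambda>x. f (t, x)) x - f (t, x)\<bar> \<le> e" by linarith
    qed
  qed
qed

text \<open>The Fejer means vanish, yet they converge uniformly to \<open>f\<close>. For the
  convergence theorem \<open>f\<close> is regarded as constant in time on
  \<open>slab 1\<close>.\<close>

theorem modes_determine:
  fixes f :: "real ^ 'n \<Rightarrow> real"
  assumes f: "continuous_on UNIV f" "periodic f" and 0: "\<And>m z. mode m f z = 0"
  shows "f x = 0"
proof -
  let ?g = "\<lambda>p :: real \<times> (real ^ 'n). f (snd p)"
  have "continuous_on (slab 1) ?g"
    by (rule continuous_on_compose2[OF f(1)]) (auto intro!: continuous_intros)
  moreover have "space_periodic 1 ?g" using f(2) by (simp add: space_periodic_def periodic_def)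
  ultimately have *: "\<forall>\<^sub>F N in sequentially. \<forall>t\<in>{0..1::real}. \<forall>x\<in>cell. \<bar>fejer N f x - f x\<bar> \<le> e" if "e > 0" for e
    using fejer_uniform_limit[of 1 ?g e] that by simp
  have "\<bar>f (frac_vec x)\<bar> \<le> e" if e: "e > 0" for e
  proof -
    obtain N where "\<forall>t\<in>{0..1::real}. \<forall>x\<in>cell. \<bar>fejer N f x - f x\<bar> \<le> e"
      using eventually_happens'[OF sequentially_bot *[OF e]] by blast
    hence "\<forall>x\<in>cell. \<bar>fejer N f x - f x\<bar> \<le> e" by force
    hence "\<bar>fejer N f (frac_vec x) - f (frac_vec x)\<bar> \<le> e" using frac_vec_in_cell by blast
    thus ?thesis by (simp add: fejer_def 0)
  qed
  hence "f (frac_vec x) = 0" by (metis abs_ge_zero abs_le_zero_iff dense_ge order_antisym)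
  thus ?thesis using periodic_frac_vec[OF f(2)] by simp
qed

section \<open>The Poisson equation\<close>

lemma neg_laplacian_eq: "neg_laplacian f = (\<lambda>x. \<Sum>i\<in>UNIV. -1 * pd i (pd i f) x)"
  by (simp add: neg_laplacian_def sum_negf)

lemma smooth_neg_laplacian: "smooth_on UNIV f \<Longrightarrow> smooth_on UNIV (neg_laplacian f)"
  unfolding neg_laplacian_def by (intro smooth_uminus smooth_sum smooth_pd) auto

lemma periodic_neg_laplacian: "periodic f \<Longrightarrow> periodic (neg_laplacian f)"
  unfolding neg_laplacian_eq by (intro periodic_sum periodic_cmult periodic_pd)

lemma coef_add:
  assumes "continuous_on closed_cell f" "continuous_on closed_cell g"
  shows "coef m \<theta> (\<lambda>x. f x + g x) = coef m \<theta> f + coef m \<theta> g"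
proof -
  have "coef m \<theta> (\<lambda>x. f x + g x) = cell_int (\<lambda>x. f x * wave m \<theta> x + g x * wave m \<theta> x)"
    by (simp add: coef_def distrib_right)
  also have "\<dots> = coef m \<theta> f + coef m \<theta> g"
    unfolding coef_def by (intro cell_int_add continuous_on_mult continuous_on_wave assms)
  finally show ?thesis .
qed

lemma coef_cmult: "coef m \<theta> (\<lambda>x. c * f x) = c * coef m \<theta> f"
  by (simp add: coef_def mult.assoc)

lemma coef_sum:
  assumes "finite I" "\<And>i. i \<in> I \<Longrightarrow> continuous_on closed_cell (f i)"
  shows "coef m \<theta> (\<lambda>x. \<Sum>i\<in>I. f i x) = (\<Sum>i\<in>I. coef m \<theta> (f i))"
  unfolding coef_def sum_distrib_right
  by (intro cell_int_sum assms continuous_on_mult continuous_on_wave)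

lemma coef_pd:
  fixes f :: "real ^ 'n \<Rightarrow> real"
  assumes "smooth_on UNIV f" "periodic f"
  shows "coef m \<theta> (pd i f) = - freq m $ i * coef m (\<theta> + pi / 2) f"
proof -
  have "coef m \<theta> (pd i f) = cell_int (\<lambda>x. wave m \<theta> x * pd i f x)" by (simp add: coef_def mult.commute)
  also have "\<dots> = - cell_int (\<lambda>x. pd i (wave m \<theta>) x * f x)"
    by (intro cell_int_by_parts smooth_wave periodic_wave assms)
  also have "cell_int (\<lambda>x. pd i (wave m \<theta>) x * f x) = cell_int (\<lambda>x. freq m $ i * (f x * wave m (\<theta> + pi / 2) x))"
    by (simp add: pd_wave mult_ac)
  finally show ?thesis by (simp add: coef_def)
qed

lemma wave_pi: "wave m (\<theta> + pi / 2 + pi / 2) x = - wave m \<theta> x"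
  using sin_add[of "freq m \<bullet> x + \<theta>" "pi / 2"] by (simp only: wave_shift) (simp add: wave_def add.assoc)

lemma coef_pd_pd:
  fixes f :: "real ^ 'n \<Rightarrow> real"
  assumes "smooth_on UNIV f" "periodic f"
  shows "coef m \<theta> (pd i (pd i f)) = - (freq m $ i)\<^sup>2 * coef m \<theta> f"
proof -
  have "coef m (\<theta> + pi / 2 + pi / 2) f = - coef m \<theta> f"
    unfolding coef_def wave_pi using cell_int_mult[of "-1" "\<lambda>x. f x * wave m \<theta> x"] by simp
  thus ?thesis
    unfolding coef_pd[OF smooth_pd[OF assms(1)] periodic_pd[OF assms(2)]] coef_pd[OF assms]
    by (simp only: power2_eq_square) simp
qed

lemma coef_neg_laplacian:
  fixes f :: "real ^ 'n \<Rightarrow> real"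
  assumes "smooth_on UNIV f" "periodic f"
  shows "coef m \<theta> (neg_laplacian f) = (freq m \<bullet> freq m) * coef m \<theta> f"
proof -
  have "coef m \<theta> (neg_laplacian f) = (\<Sum>i\<in>UNIV. coef m \<theta> (\<lambda>x. -1 * pd i (pd i f) x))"
    unfolding neg_laplacian_eq
    by (intro coef_sum continuous_on_mult continuous_on_const continuous_on_smooth smooth_pd assms) auto
  also have "\<dots> = (\<Sum>i\<in>UNIV. (freq m $ i)\<^sup>2 * coef m \<theta> f)"
    unfolding coef_cmult coef_pd_pd[OF assms] by simp
  finally show ?thesis by (simp add: inner_vec_def sum_distrib_right power2_eq_square)
qed

lemma coef_zero_freq: "coef (\<lambda>_. 0) \<theta> f = cos \<theta> * cell_int f"
proof -
  have "(\<lambda>y. f y * wave (\<lambda>_. 0) \<theta> y) = (\<lambda>y. cos \<theta> * f y)" by (simp add: wave_def freq_eq_0_iff[THEN iffD2] fun_eq_iff)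
  thus ?thesis by (simp add: coef_def)
qed

text \<open>\<open>-\<triangle>\<close> multiplies coefficients by \<open>|freq m|^2\<close>, which
  is nonzero except at \<open>m = 0\<close>, where both functions have coefficient zero by their
  zero mean. Equal coefficients then force equality.\<close>

lemma inj_on_neg_laplacian: "inj_on neg_laplacian (smooth_zero_mean :: (real ^ 'n \<Rightarrow> real) set)"
proof
  fix u v :: "real ^ 'n \<Rightarrow> real"
  assume u: "u \<in> smooth_zero_mean" and v: "v \<in> smooth_zero_mean" and eq: "neg_laplacian u = neg_laplacian v"
  have u': "smooth_on UNIV u" "periodic u" "cell_int u = 0" and v': "smooth_on UNIV v" "periodic v" "cell_int v = 0"
    using u v by (auto simp: smooth_zero_mean_def)
  have c: "coef m \<theta> u = coef m \<theta> v" for m \<theta>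
  proof (cases "m = (\<lambda>_. 0)")
    case True
    thus ?thesis using u' v' by (simp add: coef_zero_freq)
  next
    case False
    hence "freq m \<bullet> freq m \<noteq> 0" by (simp add: freq_eq_0_iff)
    thus ?thesis using coef_neg_laplacian[OF u'(1,2), of m \<theta>] coef_neg_laplacian[OF v'(1,2), of m \<theta>] eq by simp
  qed
  have cu: "continuous_on S u" "continuous_on S v" for S using u' v' continuous_on_smooth by auto
  have "u x + -1 * v x = 0" for x
  proof (rule modes_determine[of "\<lambda>x. u x + -1 * v x"])
    show "continuous_on UNIV (\<lambda>x. u x + -1 * v x)" by (intro continuous_on_add continuous_on_mult continuous_on_const cu)
    show "periodic (\<lambda>x. u x + -1 * v x)" using u' v' by (simp add: periodic_def)
    show "mode m (\<lambda>x. u x + -1 * v x) z = 0" for m z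
    proof -
      have "coef m \<theta> (\<lambda>x. u x + -1 * v x) = coef m \<theta> u + coef m \<theta> (\<lambda>x. -1 * v x)" for \<theta>
        by (intro coef_add cu continuous_on_mult continuous_on_const)
      thus ?thesis unfolding mode_eq_coef coef_cmult c by simp
    qed
  qed
  thus "u = v" by (simp add: fun_eq_iff)
qed

lemma inv_neg_laplacian_eq: "u \<in> smooth_zero_mean \<Longrightarrow> inv_neg_laplacian (neg_laplacian u) = u"
  unfolding inv_neg_laplacian_def by (rule inv_into_f_f[OF inj_on_neg_laplacian])

section \<open>Summation over all frequencies\<close>

definition enum :: "nat \<Rightarrow> ('n::finite \<Rightarrow> int)" where
  "enum = from_nat_into UNIV"

lemma bij_enum: "bij (enum :: nat \<Rightarrow> ('n::finite \<Rightarrow> int))"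
proof -
  have "inj (\<lambda>k. (\<lambda>_. k) :: 'n \<Rightarrow> int)" by (auto simp: inj_def fun_eq_iff)
  hence "infinite (UNIV :: ('n \<Rightarrow> int) set)" using infinite_UNIV_int finite_imageD infinite_iff_countable_subset by (metis finite_subset subset_UNIV)
  thus ?thesis unfolding enum_def by (intro bij_betw_from_nat_into) auto
qed

text \<open>The symbol of \<open>1 - \<triangle> / (4 pi^2)\<close>; its powers measure the decay of
  Fourier coefficients.\<close>

definition weight :: "('n::finite \<Rightarrow> int) \<Rightarrow> real" where
  "weight m = 1 + (\<Sum>i\<in>UNIV. (of_int (m i))\<^sup>2)"

lemma weight_ge_1: "1 \<le> weight m"
  unfolding weight_def by (simp add: sum_nonneg)

lemma weight_component: "1 + (of_int (m i))\<^sup>2 \<le> weight m"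
  unfolding weight_def using member_le_sum[of i UNIV "\<lambda>i. (real_of_int (m i))\<^sup>2"] by simp

lemma freq_inner_freq: "freq m \<bullet> freq m = 4 * pi\<^sup>2 * (weight m - 1)"
  by (simp add: inner_vec_def freq_def weight_def sum_distrib_left power2_eq_square mult_ac)

lemma sum_int_inverse_square_bounded:
  obtains c where "\<And>N. (\<Sum>k\<in>{- int N..int N}. 1 / (1 + (of_int k)\<^sup>2)) \<le> (c::real)"
proof -
  define g where "g k = 1 / (1 + (real k)\<^sup>2)" for k :: nat
  have "summable (\<lambda>n. inverse (real n ^ 2))" by (rule inverse_power_summable) simp
  hence s: "summable g"
  proof (rule summable_comparison_test'[where N = 1])
    fix n :: nat assume "n \<ge> 1"
    thus "norm (g n) \<le> inverse (real n ^ 2)" by (simp add: g_def field_simps add_pos_nonneg)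
  qed
  have "(\<Sum>k\<in>{- int N..int N}. 1 / (1 + (of_int k)\<^sup>2)) \<le> 2 * suminf g" for N
  proof -
    have "{- int N..int N} \<subseteq> int ` {..N} \<union> (\<lambda>k. - int k) ` {..N}"
    proof
      fix k assume "k \<in> {- int N..int N}"
      thus "k \<in> int ` {..N} \<union> (\<lambda>k. - int k) ` {..N}"
        by (cases "k \<ge> 0") (auto intro!: image_eqI[of _ _ "nat \<bar>k\<bar>"])
    qed
    hence "(\<Sum>k\<in>{- int N..int N}. 1 / (1 + (of_int k)\<^sup>2)) \<le>
        (\<Sum>k\<in>int ` {..N} \<union> (\<lambda>k. - int k) ` {..N}. 1 / (1 + (real_of_int k)\<^sup>2))"
      by (intro sum_mono2) auto
    also have "\<dots> \<le> (\<Sum>k\<in>int ` {..N}. 1 / (1 + (real_of_int k)\<^sup>2)) + (\<Sum>k\<in>(\<lambda>k. - int k) ` {..N}. 1 / (1 + (real_of_int k)\<^sup>2))"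
      using sum.union_inter[of "int ` {..N}" "(\<lambda>k. - int k) ` {..N}" "\<lambda>k. 1 / (1 + (real_of_int k)\<^sup>2)"]
        sum_nonneg[of "int ` {..N} \<inter> (\<lambda>k. - int k) ` {..N}" "\<lambda>k. 1 / (1 + (real_of_int k)\<^sup>2)"]
      by auto
    also have "\<dots> = (\<Sum>k\<le>N. g k) + (\<Sum>k\<le>N. g k)"
      by (subst (1 2) sum.reindex) (auto simp: inj_on_def g_def comp_def)
    also have "\<dots> \<le> 2 * suminf g"
      using sum_le_suminf[OF s, of "{..N}"] by (simp add: g_def)
    finally show ?thesis .
  qed
  thus ?thesis by (rule that)
qed

text \<open>Each factor \<open>1 + (m i)^2\<close> is at most \<open>weight m\<close>, so the power
  with the dimension as exponent bounds their product, and the sum over a box factors into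
  one-dimensional sums.\<close>

lemma summable_inverse_weight: "summable (\<lambda>n. 1 / weight (enum n :: 'n::finite \<Rightarrow> int) ^ CARD('n))"
proof -
  obtain c :: real where c: "\<And>N. (\<Sum>k\<in>{- int N..int N}. 1 / (1 + (of_int k)\<^sup>2)) \<le> c"
    using sum_int_inverse_square_bounded by blast
  have le: "1 / weight m ^ CARD('n) \<le> (\<Prod>i\<in>UNIV. 1 / (1 + (of_int (m i))\<^sup>2))" for m :: "'n \<Rightarrow> int"
  proof -
    have "(\<Prod>i\<in>UNIV. 1 + (real_of_int (m i))\<^sup>2) \<le> (\<Prod>i\<in>(UNIV :: 'n set). weight m)"
      by (intro prod_mono) (auto intro: weight_component)
    moreover have "0 < (\<Prod>i\<in>(UNIV :: 'n set). 1 + (real_of_int (m i))\<^sup>2)"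
      by (intro prod_pos) (auto intro: add_pos_nonneg)
    ultimately show ?thesis by (simp add: prod_dividef frac_le)
  qed
  show ?thesis
  proof (rule summableI_nonneg_bounded)
    show "0 \<le> 1 / weight (enum n :: 'n \<Rightarrow> int) ^ CARD('n)" for n
      using weight_ge_1[of "enum n :: 'n \<Rightarrow> int"] by simp
    fix K
    let ?S = "enum ` {..<K} :: ('n \<Rightarrow> int) set"
    \<comment> \<open>A box containing the first \<open>K\<close> frequencies; the final bound does
      not depend on its size.\<close>
    define N where "N = nat (Max (insert 0 ((\<lambda>(m, i). \<bar>m i\<bar>) ` (?S \<times> UNIV))))"
    have N: "m \<in> UNIV \<rightarrow>\<^sub>E {- int N..int N}" if "m \<in> ?S" for m
    proof
      fix i
      have "\<bar>m i\<bar> \<le> Max (insert 0 ((\<lambda>(m, i). \<bar>m i\<bar>) ` (?S \<times> UNIV)))"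
        using that by (intro Max_ge) auto
      moreover have "B \<le> int (nat B)" for B by simp
      ultimately have "\<bar>m i\<bar> \<le> int N" unfolding N_def by (rule order_trans)
      thus "m i \<in> {- int N..int N}" by auto
    qed simp
    have "(\<Sum>n<K. 1 / weight (enum n :: 'n \<Rightarrow> int) ^ CARD('n)) = (\<Sum>m\<in>?S. 1 / weight m ^ CARD('n))"
      using bij_enum by (subst sum.reindex) (auto intro: inj_on_subset dest: bij_is_inj)
    also have "\<dots> \<le> (\<Sum>m\<in>?S. \<Prod>i\<in>(UNIV :: 'n set). 1 / (1 + (of_int (m i))\<^sup>2))" by (intro sum_mono le)
    also have "\<dots> \<le> (\<Sum>m\<in>UNIV \<rightarrow>\<^sub>E {- int N..int N}. \<Prod>i\<in>(UNIV :: 'n set). 1 / (1 + (of_int (m i))\<^sup>2))"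
      using N by (intro sum_mono2) (auto simp: finite_PiE intro!: prod_nonneg)
    also have "\<dots> = (\<Prod>i\<in>(UNIV :: 'n set). \<Sum>k\<in>{- int N..int N}. 1 / (1 + (of_int k)\<^sup>2))"
      by (rule prod_sum_PiE[symmetric]) auto
    also have "\<dots> \<le> (\<Prod>i\<in>(UNIV :: 'n set). c)"
      using c by (intro prod_mono) (auto intro!: sum_nonneg)
    also have "\<dots> = c ^ CARD('n)" by simp
    finally show "(\<Sum>n<K. 1 / weight (enum n :: 'n \<Rightarrow> int) ^ CARD('n)) \<le> c ^ CARD('n)" .
  qed
qed

section \<open>Rapidly convergent Fourier series\<close>

definition rapid :: "(('n::finite \<Rightarrow> int) \<Rightarrow> real) \<Rightarrow> bool" where
  "rapid a \<longleftrightarrow> (\<forall>K. \<exists>C. \<forall>m. \<bar>a m\<bar> * weight m ^ K \<le> C)"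

lemma rapid_summable:
  fixes a :: "('n::finite \<Rightarrow> int) \<Rightarrow> real"
  assumes "rapid a" shows "summable (\<lambda>n. \<bar>a (enum n :: 'n::finite \<Rightarrow> int)\<bar>)"
proof -
  obtain C where C: "\<And>m. \<bar>a m\<bar> * weight m ^ CARD('n) \<le> C" using assms unfolding rapid_def by blast
  have "summable (\<lambda>n. C * (1 / weight (enum n :: 'n \<Rightarrow> int) ^ CARD('n)))"
    by (intro summable_mult summable_inverse_weight)
  thus ?thesis
  proof (rule summable_comparison_test'[where N = 0])
    fix n
    have "0 < weight (enum n :: 'n \<Rightarrow> int)" using weight_ge_1[of "enum n :: 'n \<Rightarrow> int"] by linarith
    thus "norm \<bar>a (enum n)\<bar> \<le> C * (1 / weight (enum n :: 'n \<Rightarrow> int) ^ CARD('n))"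
      using C[of "enum n"] by (simp add: field_simps)
  qed
qed

text \<open>One power of \<open>weight\<close> covers every multiplier that occurs: the components
  of \<open>freq m\<close>, its norm, and the reciprocal of its square.\<close>

lemma rapid_mult:
  fixes a :: "('n::finite \<Rightarrow> int) \<Rightarrow> real"
  assumes a: "rapid a" and b: "\<And>m. \<bar>b m\<bar> \<le> c * weight m"
  shows "rapid (\<lambda>m. a m * b m)"
  unfolding rapid_def
proof
  fix K
  obtain C where C: "\<And>m. \<bar>a m\<bar> * weight m ^ Suc K \<le> C" using a unfolding rapid_def by blast
  have "0 \<le> c * weight (\<lambda>_ :: 'n. 0)" using b abs_ge_zero order_trans by blast
  hence c0: "c \<ge> 0" by (simp add: weight_def)
  have "\<bar>a m * b m\<bar> * weight m ^ K \<le> c * C" for m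
  proof -
    have w: "weight m > 0" using weight_ge_1[of m] by linarith
    have "\<bar>a m * b m\<bar> * weight m ^ K \<le> \<bar>a m\<bar> * (c * weight m) * weight m ^ K"
      using b[of m] w by (simp add: abs_mult mult_left_mono mult_right_mono)
    also have "\<dots> = c * (\<bar>a m\<bar> * weight m ^ Suc K)" by simp
    also have "\<dots> \<le> c * C" by (rule mult_left_mono[OF C c0])
    finally show ?thesis .
  qed
  thus "\<exists>C. \<forall>m. \<bar>a m * b m\<bar> * weight m ^ K \<le> C" by blast
qed

lemma abs_freq_le: "\<bar>freq m $ i\<bar> \<le> 2 * pi * weight m"
proof -
  have "\<bar>real_of_int (m i)\<bar> \<le> 1 + (real_of_int (m i))\<^sup>2"
  proof -
    have "0 \<le> (\<bar>real_of_int (m i)\<bar> - 1)\<^sup>2" by simp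
    hence "2 * \<bar>real_of_int (m i)\<bar> \<le> 1 + (real_of_int (m i))\<^sup>2" by (simp add: power2_diff)
    thus ?thesis by linarith
  qed
  also have "\<dots> \<le> weight m" by (rule weight_component)
  finally show ?thesis by (simp add: freq_nth abs_mult)
qed

lemma norm_freq_le: "norm (freq m :: real ^ 'n) \<le> CARD('n) * (2 * pi) * weight m"
proof -
  have "norm (freq m :: real ^ 'n) \<le> (\<Sum>i\<in>UNIV. \<bar>freq m $ i\<bar>)" by (rule norm_le_l1_cart)
  also have "\<dots> \<le> (\<Sum>i\<in>(UNIV :: 'n set). 2 * pi * weight m)" by (intro sum_mono abs_freq_le)
  finally show ?thesis by simp
qed

definition ser :: "(('n::finite \<Rightarrow> int) \<Rightarrow> real) \<Rightarrow> real \<Rightarrow> real ^ 'n \<Rightarrow> real" where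
  "ser a \<theta> x = (\<Sum>n. a (enum n) * wave (enum n) \<theta> x)"

lemma ser_summable:
  assumes "rapid a" shows "summable (\<lambda>n. a (enum n) * wave (enum n) \<theta> x)"
proof (rule summable_comparison_test'[OF rapid_summable[OF assms], where N = 0])
  show "norm (a (enum n) * wave (enum n) \<theta> x) \<le> \<bar>a (enum n)\<bar>" for n
    using abs_wave_le[of "enum n" \<theta> x] by (simp add: abs_mult mult_left_le)
qed

text \<open>Termwise differentiation: \<open>|a m| * |freq m|\<close> is a summable majorant of the
  derivatives, uniform in \<open>x\<close>.\<close>

lemma ser_has_derivative:
  fixes a :: "('n::finite \<Rightarrow> int) \<Rightarrow> real"
  assumes a: "rapid a"
  shows "(ser a \<theta> has_derivative
    (\<lambda>h. \<Sum>n. a (enum n) * (- sin (freq (enum n) \<bullet> x + \<theta>) * (freq (enum n) \<bullet> h)))) (at x)"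
proof -
  define f' where "f' n x h = a (enum n) * (- sin (freq (enum n) \<bullet> x + \<theta>) * (freq (enum n) \<bullet> h))" for n and x h :: "real ^ 'n"
  define b where "b m = a m * norm (freq m)" for m
  have "rapid b" unfolding b_def using norm_freq_le by (intro rapid_mult[OF a]) auto
  note b = rapid_summable[OF this]
  have le: "norm (f' n x h) \<le> \<bar>b (enum n)\<bar> * norm h" for n x h
  proof -
    have "norm (f' n x h) = \<bar>a (enum n)\<bar> * (\<bar>sin (freq (enum n) \<bullet> x + \<theta>)\<bar> * \<bar>freq (enum n) \<bullet> h\<bar>)"
      by (simp add: f'_def abs_mult)
    also have "\<dots> \<le> \<bar>a (enum n)\<bar> * (1 * (norm (freq (enum n) :: real ^ 'n) * norm h))"
      by (intro mult_left_mono mult_mono) (auto simp: Cauchy_Schwarz_ineq2)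
    finally show ?thesis by (simp add: b_def abs_mult mult.assoc)
  qed
  have sf: "summable (\<lambda>n. f' n x h)" for x h
    by (rule summable_comparison_test'[OF summable_mult2[OF b], where N = 0]) (rule le)
  have "\<exists>g. \<forall>x\<in>UNIV. (\<lambda>n. a (enum n) * wave (enum n) \<theta> x) sums g x \<and>
      (g has_derivative (\<lambda>h. \<Sum>n. f' n x h)) (at x within UNIV)"
  proof (rule has_derivative_series)
    show "((\<lambda>x. a (enum n) * wave (enum n) \<theta> x) has_derivative f' n x) (at x within UNIV)" for n x
      unfolding f'_def using wave_has_derivative by (intro has_derivative_mult_right) auto
    fix e :: real assume e: "e > 0"
    then obtain N where N: "\<And>n. n \<ge> N \<Longrightarrow> norm (\<Sum>i. \<bar>b (enum (i + n))\<bar>) < e"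
      using suminf_exist_split[OF e b] by blast
    have "norm ((\<Sum>i<n. f' i x h) - (\<Sum>i. f' i x h)) \<le> e * norm h" if "n \<ge> N" for n x h
    proof -
      have "norm ((\<Sum>i<n. f' i x h) - (\<Sum>i. f' i x h)) = norm (\<Sum>i. f' (i + n) x h)"
        using suminf_minus_initial_segment[OF sf[of x h], of n] by (simp add: norm_minus_commute)
      also have "\<dots> \<le> (\<Sum>i. \<bar>b (enum (i + n))\<bar> * norm h)"
        using summable_ignore_initial_segment[OF b, of n] by (intro norm_suminf_le le summable_mult2)
      also have "\<dots> = (\<Sum>i. \<bar>b (enum (i + n))\<bar>) * norm h"
        using summable_ignore_initial_segment[OF b, of n] by (rule suminf_mult2[symmetric])
      also have "\<dots> \<le> e * norm h" using N[OF that] by (intro mult_right_mono) auto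
      finally show ?thesis .
    qed
    thus "\<forall>\<^sub>F n in sequentially. \<forall>x\<in>UNIV. \<forall>h. norm ((\<Sum>i<n. f' i x h) - (\<Sum>i. f' i x h)) \<le> e * norm h"
      by (auto simp: eventually_sequentially)
  next
    show "(\<lambda>n. a (enum n) * wave (enum n) \<theta> (0 :: real ^ 'n)) sums ser a \<theta> 0"
      unfolding ser_def by (rule summable_sums[OF ser_summable[OF a]])
  qed auto
  then obtain g where g: "\<And>x. (\<lambda>n. a (enum n) * wave (enum n) \<theta> x) sums g x"
    "\<And>x. (g has_derivative (\<lambda>h. \<Sum>n. f' n x h)) (at x)" by auto
  have "g = ser a \<theta>" using sums_unique[OF g(1)] by (simp add: ser_def fun_eq_iff)
  thus ?thesis using g(2)[of x] by (simp add: f'_def)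
qed

lemma rapid_freq: "rapid a \<Longrightarrow> rapid (\<lambda>m. a m * freq m $ i)"
  by (rule rapid_mult[OF _ abs_freq_le])

lemma frechet_ser:
  fixes a :: "('n::finite \<Rightarrow> int) \<Rightarrow> real"
  assumes "rapid a"
  shows "frechet_derivative (ser a \<theta>) (at x) (axis i 1) = ser (\<lambda>m. a m * freq m $ i) (\<theta> + pi / 2) x"
  unfolding frechet_derivative_at[OF ser_has_derivative[OF assms], symmetric] ser_def
  by (simp add: inner_axis wave_shift mult_ac)

lemma smooth_ser:
  fixes a :: "('n::finite \<Rightarrow> int) \<Rightarrow> real"
  assumes "rapid a" shows "smooth_on UNIV (ser a \<theta>)"
proof (rule smooth_on_coinduct[where C = "{ser a \<theta> | a \<theta>. rapid a}"])
  show "g differentiable_on UNIV" if "g \<in> {ser a \<theta> | a \<theta>. rapid a}" for g :: "real ^ 'n \<Rightarrow> real"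
    using that ser_has_derivative unfolding differentiable_on_def by (auto intro: differentiableI)
  show "\<exists>h\<in>{ser a \<theta> | a \<theta>. rapid a}. \<forall>x\<in>UNIV. frechet_derivative g (at x within UNIV) b = h x"
    if g: "g \<in> {ser a \<theta> | a \<theta>. rapid a}" and b: "b \<in> Basis" for g and b :: "real ^ 'n"
  proof -
    obtain a \<theta> where a: "g = ser a \<theta>" "rapid a" using g by blast
    obtain i where "b = axis i 1" using b by (auto simp: Basis_vec_def)
    thus ?thesis using frechet_ser[OF a(2)] rapid_freq[OF a(2)] a(1)
      by (intro bexI[of _ "ser (\<lambda>m. a m * freq m $ i) (\<theta> + pi / 2)"]) auto
  qed
qed (use assms in blast)

lemma pd_ser: "rapid a \<Longrightarrow> pd i (ser a \<theta>) = ser (\<lambda>m. a m * freq m $ i) (\<theta> + pi / 2)"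
  by (rule ext) (simp add: pd_def frechet_ser)

lemma periodic_ser: "periodic (ser a \<theta>)"
  by (simp add: periodic_def ser_def periodic_wave[unfolded periodic_def, rule_format])

lemma neg_laplacian_ser:
  fixes a :: "('n::finite \<Rightarrow> int) \<Rightarrow> real"
  assumes a: "rapid a" shows "neg_laplacian (ser a \<theta>) = ser (\<lambda>m. a m * (freq m \<bullet> freq m)) \<theta>"
proof
  fix x
  have r: "rapid (\<lambda>m. a m * freq m $ i * freq m $ i)" for i by (intro rapid_freq a)
  have "neg_laplacian (ser a \<theta>) x = (\<Sum>i\<in>(UNIV :: 'n set). \<Sum>n. a (enum n) * freq (enum n) $ i * freq (enum n) $ i * wave (enum n) \<theta> x)"
  proof -
    have "ser b (\<theta> + pi / 2 + pi / 2) x = - ser b \<theta> x" if "rapid b" for b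
      unfolding ser_def wave_pi using suminf_minus[OF ser_summable[OF that]] by simp
    hence "pd i (pd i (ser a \<theta>)) x = - ser (\<lambda>m. a m * freq m $ i * freq m $ i) \<theta> x" for i
      unfolding pd_ser[OF a] pd_ser[OF rapid_freq[OF a]] using r by blast
    thus ?thesis by (simp add: neg_laplacian_def ser_def sum_negf)
  qed
  also have "\<dots> = (\<Sum>n. \<Sum>i\<in>(UNIV :: 'n set). a (enum n) * freq (enum n) $ i * freq (enum n) $ i * wave (enum n) \<theta> x)"
    using ser_summable[OF r] by (intro suminf_sum[symmetric])
  also have "\<dots> = ser (\<lambda>m. a m * (freq m \<bullet> freq m)) \<theta> x"
    by (simp add: ser_def inner_vec_def sum_distrib_left sum_distrib_right mult.assoc)
  finally show "neg_laplacian (ser a \<theta>) x = ser (\<lambda>m. a m * (freq m \<bullet> freq m)) \<theta> x" .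
qed

text \<open>Termwise integration by absolute summability. With \<open>g\<close> a cosine it computes
  the modes of a series, with \<open>g = 1\<close> its mean.\<close>

lemma cell_int_ser_mult:
  fixes a :: "('n::finite \<Rightarrow> int) \<Rightarrow> real"
  assumes a: "rapid a" and g: "continuous_on UNIV g" "\<And>x. \<bar>g x\<bar> \<le> 1"
  shows "(\<lambda>n. a (enum n) * cell_int (\<lambda>x. wave (enum n) \<theta> x * g x)) sums cell_int (\<lambda>x. ser a \<theta> x * g x)"
proof -
  define f where "f n x = indicator cell x * (a (enum n) * (wave (enum n) \<theta> x * g x))" for n x
  have c: "continuous_on closed_cell (\<lambda>x. a (enum n) * (wave (enum n) \<theta> x * g x))" for n
    using continuous_on_subset[OF g(1)] by (intro continuous_on_mult continuous_on_const continuous_on_wave) auto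
  have int: "integrable lborel (f n)" for n
    using cell_integrable[OF c[of n]] by (simp add: f_def[abs_def] set_integrable_def)
  have le: "norm (f n x) \<le> \<bar>a (enum n)\<bar> * indicator cell x" for n x
  proof -
    have "\<bar>wave (enum n) \<theta> x * g x\<bar> \<le> 1 * 1" unfolding abs_mult using abs_wave_le g(2) by (intro mult_mono) auto
    thus ?thesis by (simp add: f_def abs_mult mult_left_le indicator_def)
  qed
  have eq: "integral\<^sup>L lborel (f n) = a (enum n) * cell_int (\<lambda>x. wave (enum n) \<theta> x * g x)" for n
  proof -
    have "integral\<^sup>L lborel (f n) = (LINT x|lborel. a (enum n) * (indicator cell x *\<^sub>R (wave (enum n) \<theta> x * g x)))"
      by (simp add: f_def[abs_def] mult.left_commute)
    also have "\<dots> = a (enum n) * (LINT x|lborel. indicator cell x *\<^sub>R (wave (enum n) \<theta> x * g x))"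
      by (rule integral_mult_right_zero)
    finally show ?thesis by (simp only: set_lebesgue_integral_def)
  qed
  have sn: "summable (\<lambda>n. norm (f n x))" for x
    by (rule summable_comparison_test'[OF summable_mult2[OF rapid_summable[OF a]], where N = 0]) (use le in simp)
  have si: "summable (\<lambda>n. LINT x|lborel. norm (f n x))"
  proof (rule summable_comparison_test'[OF rapid_summable[OF a], where N = 0])
    fix n
    have "(LINT x|lborel. norm (f n x)) \<le> (LINT x|(lborel :: (real ^ 'n) measure). \<bar>a (enum n)\<bar> * indicator cell x)"
      using int[of n] le by (intro integral_mono) (auto simp: emeasure_cell intro!: integrable_real_indicator)
    also have "\<dots> = \<bar>a (enum n)\<bar>" by (simp add: measure_def emeasure_cell)
    finally show "norm (LINT x|lborel. norm (f n x)) \<le> \<bar>a (enum n)\<bar>" by (simp add: integral_nonneg_AE)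
  qed
  have "(\<lambda>n. integral\<^sup>L lborel (f n)) sums (LINT x|lborel. (\<Sum>n. f n x))"
    using sn si int by (intro sums_integral) auto
  moreover have "(\<Sum>n. f n x) = indicator cell x * (ser a \<theta> x * g x)" for x
  proof -
    have "(\<Sum>n. f n x) = (\<Sum>n. (indicator cell x * g x) * (a (enum n) * wave (enum n) \<theta> x))"
      by (simp add: f_def mult_ac)
    also have "\<dots> = (indicator cell x * g x) * ser a \<theta> x"
      unfolding ser_def by (rule suminf_mult[OF ser_summable[OF a]])
    finally show ?thesis by (simp add: mult_ac)
  qed
  ultimately show ?thesis unfolding eq by (simp add: set_lebesgue_integral_def)
qed

text \<open>The frequencies \<open>k\<close> and \<open>- k\<close> define the same mode, and a wave
  of either frequency gives half. For \<open>m = k = 0\<close> both cases apply and the halves add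
  up.\<close>

lemma mode_wave:
  "mode k (wave m \<theta>) z = ((if m = k then wave m \<theta> z else 0) + (if m = (\<lambda>i. - k i) then wave m \<theta> z else 0)) / 2"
proof -
  have eq: "wave m \<theta> y * cos (freq k \<bullet> (y - z)) =
      (1/2) * wave (\<lambda>i. m i - k i) (\<theta> + freq k \<bullet> z) y + (1/2) * wave (\<lambda>i. m i + k i) (\<theta> - freq k \<bullet> z) y" for y
    by (simp add: wave_def freq_add freq_diff inner_add_left inner_diff_left inner_diff_right cos_times_cos algebra_simps)
  have "mode k (wave m \<theta>) z = (1/2) * cell_int (wave (\<lambda>i. m i - k i) (\<theta> + freq k \<bullet> z)) +
      (1/2) * cell_int (wave (\<lambda>i. m i + k i) (\<theta> - freq k \<bullet> z))"
    unfolding mode_def eq cell_int_mult[symmetric]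
    by (intro cell_int_add continuous_on_mult continuous_on_const continuous_on_wave)
  moreover have "(\<lambda>i. m i - k i) = (\<lambda>_. 0) \<longleftrightarrow> m = k" "(\<lambda>i. m i + k i) = (\<lambda>_. 0) \<longleftrightarrow> m = (\<lambda>i. - k i)"
    by (auto simp: fun_eq_iff eq_neg_iff_add_eq_0)
  ultimately show ?thesis
    unfolding cell_int_wave by (auto simp: wave_def freq_uminus add.commute)
qed

lemma sums_enum_delta: "(\<lambda>n. if enum n = k then F (enum n) else 0) sums (F k :: real)"
proof -
  obtain n0 where n0: "enum n0 = k" using bij_enum by (metis bij_pointE)
  have "enum n = k \<longleftrightarrow> n = n0" for n using n0 bij_enum by (metis bij_pointE)
  thus ?thesis using sums_single[of n0 "\<lambda>n. F (enum n)"] n0 by simp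
qed

lemma mode_uminus: "mode (\<lambda>i. - k i) f = mode k f"
  by (simp add: mode_def freq_uminus fun_eq_iff)

lemma mode_add:
  assumes "continuous_on closed_cell f" "continuous_on closed_cell g"
  shows "mode m (\<lambda>x. f x + g x) z = mode m f z + mode m g z"
  unfolding mode_eq_coef by (rule coef_add[OF assms])

text \<open>Both sides have the same modes: in mode \<open>k\<close> of the series only the indices
  \<open>k\<close> and \<open>- k\<close> survive, each contributing half of
  \<open>mode k f\<close>.\<close>

lemma fourier_inversion:
  fixes f :: "real ^ 'n \<Rightarrow> real"
  assumes f: "smooth_on UNIV f" "periodic f" and r: "\<And>\<theta>. rapid (\<lambda>m. coef m \<theta> f)"
  shows "f x = ser (\<lambda>m. coef m 0 f) 0 x + ser (\<lambda>m. coef m (pi / 2) f) (pi / 2) x"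
proof -
  define s where "s x = ser (\<lambda>m. coef m 0 f) 0 x + ser (\<lambda>m. coef m (pi / 2) f) (pi / 2) x" for x
  have cf: "continuous_on S f" for S using f(1) by (rule continuous_on_smooth)
  have cs: "continuous_on S (ser (\<lambda>m. coef m \<theta> f) \<theta>)" for S \<theta> using smooth_ser[OF r] by (rule continuous_on_smooth)
  have ser_mode: "(\<lambda>n. coef (enum n) \<theta> f * mode k (wave (enum n) \<theta>) z) sums mode k (ser (\<lambda>m. coef m \<theta> f) \<theta>) z" for k z \<theta>
    unfolding mode_def by (rule cell_int_ser_mult[OF r]) (auto intro!: continuous_intros)
  have "mode k s z = mode k f z" for k z
  proof -
    define F where "F m = coef m 0 f * wave m 0 z + coef m (pi / 2) f * wave m (pi / 2) z" for m
    have F: "F m = mode m f z" for m unfolding F_def by (rule mode_expand[symmetric, OF cf])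
    have "(\<lambda>n. coef (enum n) 0 f * mode k (wave (enum n) 0) z + coef (enum n) (pi / 2) f * mode k (wave (enum n) (pi / 2)) z)
        sums (mode k (ser (\<lambda>m. coef m 0 f) 0) z + mode k (ser (\<lambda>m. coef m (pi / 2) f) (pi / 2)) z)"
      by (intro sums_add ser_mode)
    moreover have "mode k s z = mode k (ser (\<lambda>m. coef m 0 f) 0) z + mode k (ser (\<lambda>m. coef m (pi / 2) f) (pi / 2)) z"
      unfolding s_def by (rule mode_add[OF cs cs])
    moreover have "coef (enum n) 0 f * mode k (wave (enum n) 0) z + coef (enum n) (pi / 2) f * mode k (wave (enum n) (pi / 2)) z =
        (1/2) * (if enum n = k then F (enum n) else 0) + (1/2) * (if enum n = (\<lambda>i. - k i) then F (enum n) else 0)" for n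
      unfolding mode_wave F_def by (auto simp: algebra_simps)
    ultimately have "(\<lambda>n. (1/2) * (if enum n = k then F (enum n) else 0) + (1/2) * (if enum n = (\<lambda>i. - k i) then F (enum n) else 0))
        sums mode k s z" by simp
    moreover have "(\<lambda>n. (1/2) * (if enum n = k then F (enum n) else 0) + (1/2) * (if enum n = (\<lambda>i. - k i) then F (enum n) else 0))
        sums ((1/2) * F k + (1/2) * F (\<lambda>i. - k i))"
      by (intro sums_add sums_mult sums_enum_delta)
    ultimately have "mode k s z = (1/2) * F k + (1/2) * F (\<lambda>i. - k i)" by (rule sums_unique2)
    thus ?thesis by (simp add: F mode_uminus)
  qed
  hence "mode k (\<lambda>x. s x + -1 * f x) z = 0" for k z
    using mode_add[of s "\<lambda>x. -1 * f x" k z] cf cs coef_cmult[of k "- (freq k \<bullet> z)" "-1" f]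
    by (simp add: s_def[abs_def] mode_eq_coef continuous_on_add continuous_on_minus)
  moreover have "continuous_on UNIV (\<lambda>x. s x + -1 * f x)"
    unfolding s_def by (intro continuous_on_add continuous_on_mult continuous_on_const cs cf)
  moreover have "periodic (\<lambda>x. s x + -1 * f x)"
    using f(2) periodic_ser[of "\<lambda>m. coef m 0 f" 0] periodic_ser[of "\<lambda>m. coef m (pi / 2) f" "pi / 2"]
    by (simp add: s_def periodic_def)
  ultimately have "s x + -1 * f x = 0" using modes_determine[of "\<lambda>x. s x + -1 * f x" x] by blast
  thus ?thesis by (simp add: s_def)
qed

text \<open>\<open>P\<close> is \<open>1 - \<triangle> / (4 pi^2)\<close>, whose symbol is
  \<open>weight m\<close>. The coefficients of the bounded function \<open>P^K f\<close> are
  bounded, and they are \<open>weight m ^ K\<close> times those of \<open>f\<close>.\<close>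

lemma rapid_coef:
  fixes f :: "real ^ 'n \<Rightarrow> real"
  assumes f: "smooth_on UNIV f" "periodic f" shows "rapid (\<lambda>m. coef m \<theta> f)"
  unfolding rapid_def
proof
  fix K
  define P where "P = (\<lambda>(f :: real ^ 'n \<Rightarrow> real) x. f x + (1 / (4 * pi\<^sup>2)) * neg_laplacian f x)"
  have P_eq: "P g = (\<lambda>x. g x + (1 / (4 * pi\<^sup>2)) * neg_laplacian g x)" for g by (simp add: P_def)
  have P: "smooth_on UNIV ((P ^^ K) f) \<and> periodic ((P ^^ K) f) \<and>
      (\<forall>m. coef m \<theta> ((P ^^ K) f) = weight m ^ K * coef m \<theta> f)"
  proof (induction K)
    case (Suc K)
    let ?g = "(P ^^ K) f"
    have g: "smooth_on UNIV ?g" "periodic ?g" "\<And>m. coef m \<theta> ?g = weight m ^ K * coef m \<theta> f" using Suc by auto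
    have "smooth_on UNIV (P ?g)" unfolding P_eq[of ?g] by (intro smooth_add smooth_cmult smooth_neg_laplacian g)
    moreover have "periodic (P ?g)" unfolding P_eq[of ?g] by (intro periodic_add periodic_cmult periodic_neg_laplacian g)
    moreover have "coef m \<theta> (P ?g) = weight m * coef m \<theta> ?g" for m
    proof -
      have "coef m \<theta> (P ?g) = coef m \<theta> ?g + coef m \<theta> (\<lambda>x. (1 / (4 * pi\<^sup>2)) * neg_laplacian ?g x)"
        unfolding P_eq[of ?g] by (intro coef_add continuous_on_smooth smooth_cmult smooth_neg_laplacian g)
      also have "\<dots> = weight m * coef m \<theta> ?g"
        unfolding coef_cmult coef_neg_laplacian[OF g(1,2)] freq_inner_freq by (simp add: algebra_simps)
      finally show ?thesis .
    qed
    ultimately show ?case using g by simp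
  qed (use f in simp)
  let ?g = "(P ^^ K) f"
  have g: "continuous_on UNIV ?g" "periodic ?g" using P smooth_on_continuous by auto
  \<comment> \<open>\<open>slab 0\<close> is a single time slice; on it
    \<open>cyl_fun_bounded\<close> bounds a periodic function of space.\<close>
  have "continuous_on (slab 0) (\<lambda>p :: real \<times> (real ^ 'n). ?g (snd p))"
    by (rule continuous_on_compose2[OF g(1)]) (auto intro!: continuous_intros)
  moreover have "space_periodic 0 (\<lambda>p :: real \<times> (real ^ 'n). ?g (snd p))"
    using g(2) by (simp add: space_periodic_def periodic_def)
  ultimately obtain C where "\<And>p :: real \<times> (real ^ 'n). p \<in> slab 0 \<Longrightarrow> norm (?g (snd p)) \<le> C" "C \<ge> 0"
    by (rule cyl_fun_bounded) auto
  hence C: "\<bar>?g x\<bar> \<le> C" for x by (force simp: slab_def dest: spec[of _ 0])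
  have "\<bar>coef m \<theta> f\<bar> * weight m ^ K \<le> C" for m
  proof -
    have "\<bar>coef m \<theta> ?g\<bar> \<le> C" unfolding coef_def
    proof (rule cell_int_abs_le)
      show "continuous_on closed_cell (\<lambda>y. ?g y * wave m \<theta> y)"
        using P by (intro continuous_on_mult continuous_on_wave continuous_on_smooth) auto
      fix x
      have "\<bar>?g x * wave m \<theta> x\<bar> \<le> \<bar>?g x\<bar> * 1" unfolding abs_mult using abs_wave_le by (intro mult_left_mono) auto
      thus "\<bar>?g x * wave m \<theta> x\<bar> \<le> C" using C[of x] by simp
    qed
    thus ?thesis using P weight_ge_1[of m] by (simp add: abs_mult mult.commute)
  qed
  thus "\<exists>C. \<forall>m. \<bar>coef m \<theta> f\<bar> * weight m ^ K \<le> C" by blast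
qed

text \<open>The coefficients of \<open>f\<close> are divided by \<open>|freq m|^2\<close>, which is
  at least 1 for \<open>m\<close> nonzero, so rapid decay survives and the series can be
  differentiated termwise.\<close>

theorem neg_laplacian_surj:
  fixes f :: "real ^ 'n \<Rightarrow> real"
  assumes "f \<in> smooth_zero_mean" shows "f \<in> neg_laplacian ` smooth_zero_mean"
proof -
  have f: "smooth_on UNIV f" "periodic f" "cell_int f = 0" using assms by (auto simp: smooth_zero_mean_def)
  \<comment> \<open>At \<open>m = 0\<close> division by zero gives \<open>c m = 0\<close>, which
    selects the solution with zero mean; there the equation holds because \<open>f\<close> has zero
    mean.\<close>
  define c where "c m = 1 / (freq m \<bullet> freq m)" for m :: "'n \<Rightarrow> int"
  define a where "a \<theta> m = coef m \<theta> f * c m" for \<theta> m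
  have c: "\<bar>c m\<bar> \<le> 1 * weight m" for m
  proof (cases "m = (\<lambda>_. 0)")
    case True
    thus ?thesis using weight_ge_1[of m] by (simp add: c_def freq_eq_0_iff[THEN iffD2])
  next
    case False
    then obtain i where "m i \<noteq> 0" by auto
    hence "1 \<le> (m i)\<^sup>2" by (simp add: int_one_le_iff_zero_less)
    hence "1 \<le> (real_of_int (m i))\<^sup>2" by (metis of_int_1_le_iff of_int_power)
    hence "1 \<le> weight m - 1" using weight_component[of m i] by linarith
    moreover have "1 \<le> pi\<^sup>2" using pi_gt3 by (intro one_le_power) linarith
    hence "1 \<le> 4 * pi\<^sup>2" by linarith
    ultimately have "1 * 1 \<le> freq m \<bullet> freq m" unfolding freq_inner_freq by (intro mult_mono) auto
    hence "\<bar>c m\<bar> \<le> 1" by (simp add: c_def divide_le_eq_1)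
    thus ?thesis using weight_ge_1[of m] by simp
  qed
  have ra: "rapid (a \<theta>)" for \<theta> unfolding a_def by (rule rapid_mult[OF rapid_coef[OF f(1,2)] c])
  have ac: "a \<theta> m * (freq m \<bullet> freq m) = coef m \<theta> f" for \<theta> m
    using f(3) by (cases "m = (\<lambda>_. 0)") (auto simp: a_def c_def freq_eq_0_iff coef_zero_freq)
  define u where "u x = ser (a 0) 0 x + ser (a (pi / 2)) (pi / 2) x" for x
  have su: "smooth_on UNIV u" unfolding u_def[abs_def] by (intro smooth_add smooth_ser ra)
  have pu: "periodic u" unfolding u_def[abs_def] by (intro periodic_add periodic_ser)
  have cu: "cell_int (ser (a \<theta>) \<theta>) = 0" for \<theta>
  proof -
    have "(\<lambda>n. a \<theta> (enum n) * cell_int (\<lambda>x :: real ^ 'n. wave (enum n) \<theta> x * 1)) sums cell_int (\<lambda>x. ser (a \<theta>) \<theta> x * 1)"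
      by (rule cell_int_ser_mult[OF ra]) auto
    moreover have "a \<theta> (enum n) * cell_int (\<lambda>x :: real ^ 'n. wave (enum n) \<theta> x * 1) = 0" for n
      using f(3) by (simp add: cell_int_wave a_def coef_zero_freq)
    ultimately have "(\<lambda>n. 0) sums cell_int (\<lambda>x. ser (a \<theta>) \<theta> x * 1)" by (simp only:)
    thus ?thesis using sums_unique2[OF sums_zero] by fastforce
  qed
  have "cell_int u = cell_int (ser (a 0) 0) + cell_int (ser (a (pi / 2)) (pi / 2))"
    unfolding u_def[abs_def] by (intro cell_int_add continuous_on_smooth smooth_ser ra)
  hence "u \<in> smooth_zero_mean" using su pu cu by (simp add: smooth_zero_mean_def)
  moreover have "neg_laplacian u = f"
  proof
    fix x
    have "neg_laplacian u x = neg_laplacian (ser (a 0) 0) x + neg_laplacian (ser (a (pi / 2)) (pi / 2)) x"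
      unfolding neg_laplacian_def u_def[abs_def] using ra
      by (simp add: pd_add smooth_ser smooth_pd sum.distrib)
    also have "\<dots> = f x" unfolding neg_laplacian_ser[OF ra] ac
      by (rule fourier_inversion[symmetric, OF f(1,2) rapid_coef[OF f(1,2)]])
    finally show "neg_laplacian u x = f x" .
  qed
  ultimately show ?thesis by blast
qed

lemma inv_neg_laplacian_solves:
  fixes f :: "real ^ 'n \<Rightarrow> real"
  assumes "f \<in> smooth_zero_mean"
  shows "inv_neg_laplacian f \<in> smooth_zero_mean" "neg_laplacian (inv_neg_laplacian f) = f"
  unfolding inv_neg_laplacian_def
  by (rule inv_into_into[OF neg_laplacian_surj[OF assms]], rule f_inv_into_f[OF neg_laplacian_surj[OF assms]])

section \<open>Functionals on the cylinder\<close>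

lemma time_integrable: "continuous_on {0..T} f \<Longrightarrow> set_integrable lborel {0..T} f" for f :: "real \<Rightarrow> real"
  by (rule borel_integrable_atLeastAtMost')

lemma time_int_FTC:
  fixes F f :: "real \<Rightarrow> real"
  assumes "0 \<le> T" "\<And>t. t \<in> {0..T} \<Longrightarrow> (F has_vector_derivative f t) (at t within {0..T})" "continuous_on {0..T} f"
  shows "(LINT t:{0..T}|lborel. f t) = F T - F 0"
  unfolding set_lebesgue_integral_def using assms by (intro integral_FTC_Icc) auto

lemma time_int_by_parts:
  fixes F G f g :: "real \<Rightarrow> real"
  assumes T: "0 \<le> T" and F: "\<And>t. t \<in> {0..T} \<Longrightarrow> (F has_vector_derivative f t) (at t within {0..T})"
    and G: "\<And>t. t \<in> {0..T} \<Longrightarrow> (G has_vector_derivative g t) (at t within {0..T})"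
    and f: "continuous_on {0..T} f" and g: "continuous_on {0..T} g"
  shows "(LINT t:{0..T}|lborel. f t * G t) = F T * G T - F 0 * G 0 - (LINT t:{0..T}|lborel. F t * g t)"
proof -
  have cF: "continuous_on {0..T} F" "continuous_on {0..T} G"
    unfolding continuous_on_eq_continuous_within
    using has_vector_derivative_continuous[OF F] has_vector_derivative_continuous[OF G] by blast+
  have "(LINT t:{0..T}|lborel. f t * G t) + (LINT t:{0..T}|lborel. F t * g t) =
      (LINT t:{0..T}|lborel. f t * G t + F t * g t)"
    using cF f g by (intro set_integral_add(2)[symmetric] time_integrable continuous_on_mult)
  also have "\<dots> = F T * G T - F 0 * G 0"
  proof (rule time_int_FTC[OF T])
    fix t assume "t \<in> {0..T}"
    from has_vector_derivative_mult[OF F[OF this] G[OF this]]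
    show "((\<lambda>t. F t * G t) has_vector_derivative f t * G t + F t * g t) (at t within {0..T})"
      by (simp add: add.commute)
  qed (intro continuous_on_add continuous_on_mult cF f g)
  finally show ?thesis by simp
qed

text \<open>The zero \<open>c\<close> is prescribed because time factors of test fields must vanish
  at \<open>T\<close>, and those in \<open>EB_class\<close> at 0.\<close>

lemma poly_antiderivative:
  fixes g :: "real poly" and c :: real
  obtains H where "pderiv H = g" "poly H c = 0"
proof -
  define H0 where "H0 = (\<Sum>i\<le>degree g. monom (coeff g i / real (Suc i)) (Suc i))"
  have p: "pderiv H0 = (\<Sum>i\<le>degree g. pderiv (monom (coeff g i / real (Suc i)) (Suc i)))"
  proof -
    have "pderiv (\<Sum>i\<le>n. h i) = (\<Sum>i\<le>n. pderiv (h i))" for n :: nat and h :: "nat \<Rightarrow> real poly"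
      by (induction n) (simp_all add: pderiv_add)
    thus ?thesis unfolding H0_def .
  qed
  also have "\<dots> = (\<Sum>i\<le>degree g. monom (coeff g i) i)"
    by (intro sum.cong refl) (simp add: pderiv_monom)
  also have "\<dots> = g" by (rule poly_as_sum_of_monoms)
  finally have "pderiv (H0 - [:poly H0 c:]) = g" by (simp add: pderiv_diff pderiv_pCons)
  thus ?thesis by (rule that) simp
qed

lemma poly_approximation:
  fixes f :: "real \<Rightarrow> real"
  assumes "continuous_on {0..T} f" "e > 0"
  obtains g where "\<And>t. t \<in> {0..T} \<Longrightarrow> \<bar>f t - poly g t\<bar> < e"
proof -
  obtain g where g: "real_polynomial_function g" "\<And>x. x \<in> {0..T} \<Longrightarrow> \<bar>f x - g x\<bar> < e"
    using Stone_Weierstrass_real_polynomial_function[OF compact_Icc assms] by blast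
  then obtain a n where "g = (\<lambda>x. \<Sum>i\<le>n. a i * x ^ i)" unfolding real_polynomial_function_iff_sum by blast
  hence "g x = poly (\<Sum>i\<le>n. monom (a i) i) x" for x by (simp add: poly_sum poly_monom)
  thus ?thesis using g(2) that by metis
qed

lemma poly_has_vector_derivative: "(poly p has_vector_derivative poly (pderiv p) t) (at t within S)" for p :: "real poly"
  using poly_DERIV has_real_derivative_iff_has_vector_derivative has_field_derivative_at_within by blast

lemma continuous_on_poly': "continuous_on S (poly p)" for p :: "real poly"
  by (intro continuous_intros)

text \<open>By Weierstrass approximation \<open>h\<close> is orthogonal to itself.\<close>

lemma orthogonal_to_polys_zero:
  fixes h :: "real \<Rightarrow> real"
  assumes T: "T > 0" and h: "continuous_on {0..T} h" and 0: "\<And>g. (LINT t:{0..T}|lborel. poly g t * h t) = 0" and t: "t \<in> {0..T}"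
  shows "h t = 0"
proof -
  define N where "N = (LINT t:{0..T}|lborel. \<bar>h t\<bar>)"
  have ch: "continuous_on {0..T} (\<lambda>t. \<bar>h t\<bar>)" "continuous_on {0..T} (\<lambda>t. h t * h t)" using h by (auto intro!: continuous_intros)
  have le: "(LINT t:{0..T}|lborel. h t * h t) \<le> e * N" if e: "e > 0" for e
  proof -
    obtain g where g: "\<And>t. t \<in> {0..T} \<Longrightarrow> \<bar>h t - poly g t\<bar> < e" using poly_approximation[OF h e] by blast
    have cg: "continuous_on {0..T} (\<lambda>t. poly g t * h t)" by (intro continuous_on_mult h continuous_on_poly')
    have "(LINT t:{0..T}|lborel. h t * h t) = (LINT t:{0..T}|lborel. h t * h t) - (LINT t:{0..T}|lborel. poly g t * h t)"
      using 0 by simp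
    also have "\<dots> = (LINT t:{0..T}|lborel. h t * h t - poly g t * h t)"
      by (intro set_integral_diff(2)[symmetric] time_integrable ch cg)
    also have "\<dots> \<le> (LINT t:{0..T}|lborel. e * \<bar>h t\<bar>)"
    proof (rule set_integral_mono)
      fix t assume "t \<in> {0..T}"
      have "h t * h t - poly g t * h t = (h t - poly g t) * h t" by (simp add: algebra_simps)
      also have "\<dots> \<le> \<bar>h t - poly g t\<bar> * \<bar>h t\<bar>" by (metis abs_ge_self abs_mult)
      also have "\<dots> \<le> e * \<bar>h t\<bar>" using g[OF \<open>t \<in> {0..T}\<close>] by (intro mult_right_mono) auto
      finally show "h t * h t - poly g t * h t \<le> e * \<bar>h t\<bar>" .
    qed (intro time_integrable continuous_on_diff continuous_on_mult ch cg continuous_on_const)+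
    finally show ?thesis by (simp add: N_def)
  qed
  have N0: "N \<ge> 0" unfolding N_def set_lebesgue_integral_def by (intro integral_nonneg_AE) auto
  have "(LINT t:{0..T}|lborel. h t * h t) \<le> 0 + e" if "e > 0" for e
  proof -
    have "(LINT t:{0..T}|lborel. h t * h t) \<le> e / (N + 1) * N" using that N0 by (intro le) simp
    also have "\<dots> \<le> e" using that N0 by (simp add: field_simps)
    finally show ?thesis by simp
  qed
  hence "(LINT t:{0..T}|lborel. h t * h t) \<le> 0" by (rule field_le_epsilon)
  moreover have "(LINT t:{0..T}|lborel. h t * h t) \<ge> 0"
    unfolding set_lebesgue_integral_def by (intro integral_nonneg_AE) auto
  moreover have "(LINT t:{0..T}|lborel. h t * h t) = integral {0..T} (\<lambda>t. h t * h t)"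
    by (intro set_borel_integral_eq_integral time_integrable ch)
  ultimately have "integral {0..T} (\<lambda>t. h t * h t) = 0" by simp
  hence "h t * h t = 0" using integral_eq_0_iff[OF ch(2) T] t by simp
  thus ?thesis by simp
qed

text \<open>Uniform continuity on the compact closed cell makes nearby time slices uniformly close,
  and integration against a wave does not increase the distance.\<close>

lemma continuous_on_time_coef:
  fixes f :: "real \<times> (real ^ 'n) \<Rightarrow> real"
  assumes f: "continuous_on (slab T) f"
  shows "continuous_on {0..T} (\<lambda>t. coef m \<theta> (\<lambda>x. f (t, x)))"
proof -
  have uc: "uniformly_continuous_on ({0..T} \<times> closed_cell) f"
    by (intro compact_uniformly_continuous continuous_on_subset[OF f] compact_Times compact_closed_cell cylinder_subset) auto
  have cf: "continuous_on closed_cell (\<lambda>x. f (t, x))" if "t \<in> {0..T}" for t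
    by (rule continuous_on_compose2[OF f]) (use that in \<open>auto simp: slab_def intro!: continuous_intros\<close>)
  show ?thesis unfolding continuous_on_iff
  proof (intro ballI allI impI)
    fix t and e :: real assume t: "t \<in> {0..T}" and e: "e > 0"
    obtain d where d: "d > 0" "\<And>p q. p \<in> {0..T} \<times> closed_cell \<Longrightarrow> q \<in> {0..T} \<times> closed_cell \<Longrightarrow> dist q p < d \<Longrightarrow> dist (f q) (f p) < e / 2"
      using uc e unfolding uniformly_continuous_on_def by (metis half_gt_zero)
    have "dist (coef m \<theta> (\<lambda>x. f (s, x))) (coef m \<theta> (\<lambda>x. f (t, x))) < e" if s: "s \<in> {0..T}" "dist s t < d" for s
    proof -
      have "coef m \<theta> (\<lambda>x. f (s, x)) - coef m \<theta> (\<lambda>x. f (t, x)) =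
          cell_int (\<lambda>x. f (s, x) * wave m \<theta> x - f (t, x) * wave m \<theta> x)"
        unfolding coef_def by (intro cell_int_diff[symmetric] continuous_on_mult continuous_on_wave cf s t)
      also have "\<bar>\<dots>\<bar> \<le> e / 2"
      proof (rule cell_int_abs_le)
        show "continuous_on closed_cell (\<lambda>x. f (s, x) * wave m \<theta> x - f (t, x) * wave m \<theta> x)"
          by (intro continuous_on_diff continuous_on_mult continuous_on_wave cf s t)
        fix x :: "real ^ 'n" assume "x \<in> cell"
        hence x: "x \<in> closed_cell" using cell_subset by blast
        have "dist (s, x) (t, x) < d" using s(2) by (simp add: dist_Pair_Pair)
        hence "dist (f (s, x)) (f (t, x)) < e / 2" using d(2)[of "(t, x)" "(s, x)"] s t x by auto
        hence "\<bar>f (s, x) - f (t, x)\<bar> \<le> e / 2" by (simp add: dist_real_def)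
        hence "\<bar>f (s, x) - f (t, x)\<bar> * \<bar>wave m \<theta> x\<bar> \<le> e / 2 * 1" using abs_wave_le e by (intro mult_mono) auto
        thus "\<bar>f (s, x) * wave m \<theta> x - f (t, x) * wave m \<theta> x\<bar> \<le> e / 2"
          by (simp add: left_diff_distrib[symmetric] abs_mult)
      qed
      finally show ?thesis using e by (simp add: dist_real_def)
    qed
    thus "\<exists>d>0. \<forall>s\<in>{0..T}. dist s t < d \<longrightarrow> dist (coef m \<theta> (\<lambda>x. f (s, x))) (coef m \<theta> (\<lambda>x. f (t, x))) < e"
      using d(1) by blast
  qed
qed

text \<open>The properties of a signed integral on which the Fourier argument relies; the bound is
  by the supremum over \<open>cylinder T\<close>, so values elsewhere do not count.\<close>

definition cyl_functional :: "real \<Rightarrow> ((real \<times> (real ^ 'n) \<Rightarrow> real) \<Rightarrow> real) \<Rightarrow> bool" where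
  "cyl_functional T l \<longleftrightarrow>
     (\<forall>f\<in>cyl_fun T. \<forall>g\<in>cyl_fun T. l (\<lambda>x. f x + g x) = l f + l g) \<and>
     (\<forall>f\<in>cyl_fun T. \<forall>c. l (\<lambda>x. c * f x) = c * l f) \<and>
     (\<exists>B\<ge>0. \<forall>f\<in>cyl_fun T. \<forall>c\<ge>0. (\<forall>x\<in>cylinder T. \<bar>f x\<bar> \<le> c) \<longrightarrow> \<bar>l f\<bar> \<le> B * c)"

lemma cyl_fun_cmult: "f \<in> cyl_fun T \<Longrightarrow> (\<lambda>x. c * f x) \<in> cyl_fun T"
  by (rule function_lattice.scale[OF cylinder_function_lattice])

lemma cyl_fun_wave:
  assumes "continuous_on {0..T} a"
  shows "(\<lambda>(t, x). a t * wave m \<theta> x) \<in> cyl_fun T"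
proof -
  have "continuous_on (slab T) (\<lambda>p :: real \<times> (real ^ 'a). a (fst p) * wave m \<theta> (snd p))"
    by (intro continuous_on_mult continuous_on_compose2[OF assms] continuous_on_compose2[OF continuous_on_wave[of UNIV]])
       (auto simp: slab_def intro!: continuous_intros)
  thus ?thesis
    using periodic_wave[of m \<theta>] by (simp add: cyl_fun_def case_prod_beta' space_periodic_def periodic_def)
qed

lemma cyl_functional_add: "cyl_functional T l \<Longrightarrow> f \<in> cyl_fun T \<Longrightarrow> g \<in> cyl_fun T \<Longrightarrow> l (\<lambda>x. f x + g x) = l f + l g"
  and cyl_functional_cmult: "cyl_functional T l \<Longrightarrow> f \<in> cyl_fun T \<Longrightarrow> l (\<lambda>x. c * f x) = c * l f"
  by (auto simp: cyl_functional_def)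

lemma cyl_functional_diff:
  "cyl_functional T l \<Longrightarrow> f \<in> cyl_fun T \<Longrightarrow> g \<in> cyl_fun T \<Longrightarrow> l (\<lambda>x. f x - g x) = l f - l g"
  using cyl_functional_add[of T l f "\<lambda>x. -1 * g x"] cyl_functional_cmult[of T l g "-1"] cyl_fun_cmult[of g T "-1"] by simp

lemma cyl_functional_cyl_integral:
  assumes "\<And>A. A \<in> sets (cyl_borel T) \<Longrightarrow> \<bar>\<nu> A\<bar> \<le> C"
  shows "cyl_functional T (cyl_integral T \<nu>)"
  unfolding cyl_functional_def
proof (intro conjI ballI allI)
  have bd: "\<exists>C. \<forall>x\<in>space (cyl_borel T). \<bar>f x\<bar> \<le> C" if "f \<in> cyl_fun T" for f :: "real \<times> (real ^ 'a) \<Rightarrow> real"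
    using function_lattice.bounded[OF cylinder_function_lattice that] by simp
  fix f g :: "real \<times> (real ^ 'a) \<Rightarrow> real" and c :: real
  assume f: "f \<in> cyl_fun T"
  show "cyl_integral T \<nu> (\<lambda>x. c * f x) = c * cyl_integral T \<nu> f" by (rule signed_integral_scale[OF assms])
  assume g: "g \<in> cyl_fun T"
  obtain a b where a: "\<And>x. x \<in> space (cyl_borel T) \<Longrightarrow> \<bar>f x\<bar> \<le> a"
    and b: "\<And>x. x \<in> space (cyl_borel T) \<Longrightarrow> \<bar>g x\<bar> \<le> b"
    using bd[OF f] bd[OF g] by blast
  show "cyl_integral T \<nu> (\<lambda>x. f x + g x) = cyl_integral T \<nu> f + cyl_integral T \<nu> g"
    by (rule signed_integral_add[OF assms cyl_fun_measurable[OF f] a cyl_fun_measurable[OF g] b])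
next
  let ?m = "measure (pos_part (cyl_borel T) \<nu>) (space (cyl_borel T)) + measure (pos_part (cyl_borel T) (\<lambda>A. - \<nu> A)) (space (cyl_borel T))"
  show "\<exists>B\<ge>0. \<forall>f\<in>cyl_fun T. \<forall>c\<ge>0. (\<forall>x\<in>cylinder T. \<bar>f x\<bar> \<le> c) \<longrightarrow> \<bar>cyl_integral T \<nu> f\<bar> \<le> B * c"
  proof (intro exI[of _ ?m] conjI ballI allI impI)
    show "0 \<le> ?m" by simp
    fix f :: "real \<times> (real ^ 'a) \<Rightarrow> real" and c :: real
    assume "f \<in> cyl_fun T" "0 \<le> c" "\<forall>x\<in>cylinder T. \<bar>f x\<bar> \<le> c"
    thus "\<bar>cyl_integral T \<nu> f\<bar> \<le> ?m * c"
      by (intro signed_integral_bound[OF assms] cyl_fun_measurable) auto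
  qed
qed

section \<open>The constraint on Fourier modes\<close>

definition cyl_field :: "real \<Rightarrow> (real \<times> (real ^ 'n) \<Rightarrow> 'b::topological_space) \<Rightarrow> bool" where
  "cyl_field T f \<longleftrightarrow> continuous_on (slab T) f \<and> space_periodic T f"

lemma cyl_field_add: "cyl_field T f \<Longrightarrow> cyl_field T g \<Longrightarrow> cyl_field T (\<lambda>p. f p + g p)"
  and cyl_field_diff: "cyl_field T f \<Longrightarrow> cyl_field T g \<Longrightarrow> cyl_field T (\<lambda>p. f p - g p)"
  and cyl_field_scaleR: "cyl_field T f \<Longrightarrow> cyl_field T (\<lambda>p. c *\<^sub>R f p)"
  for f g :: "real \<times> (real ^ 'n) \<Rightarrow> 'b::real_normed_vector"
  by (auto simp: cyl_field_def space_periodic_def periodic_def intro!: continuous_intros)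

lemma cyl_field_sum:
  fixes f :: "'i \<Rightarrow> real \<times> (real ^ 'n) \<Rightarrow> 'b::real_normed_vector"
  shows "(\<And>i. i \<in> I \<Longrightarrow> cyl_field T (f i)) \<Longrightarrow> cyl_field T (\<lambda>p. \<Sum>i\<in>I. f i p)"
  by (auto simp: cyl_field_def space_periodic_def periodic_def intro!: continuous_intros)

lemma cyl_field_component: "cyl_field T V \<Longrightarrow> (\<lambda>p. V p $ k) \<in> cyl_fun T"
  by (auto simp: cyl_field_def cyl_fun_def space_periodic_def periodic_def intro!: continuous_intros)

lemma cyl_field_component2: "cyl_field T M \<Longrightarrow> (\<lambda>p. M p $ i $ j) \<in> cyl_fun T"
  by (auto simp: cyl_field_def cyl_fun_def space_periodic_def periodic_def intro!: continuous_intros)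

lemma cyl_field_vec: "(\<And>k. (\<lambda>p. f k p) \<in> cyl_fun T) \<Longrightarrow> cyl_field T (\<lambda>p. \<chi> k. f k p)"
  by (auto simp: cyl_field_def cyl_fun_def space_periodic_def periodic_def vec_eq_iff
      intro!: continuous_on_vec_lambda)

lemma cyl_field_mat: "(\<And>i j. (\<lambda>p. f i j p) \<in> cyl_fun T) \<Longrightarrow> cyl_field T (\<lambda>p. \<chi> i j. f i j p)"
  by (auto simp: cyl_field_def cyl_fun_def space_periodic_def periodic_def vec_eq_iff
      intro!: continuous_on_vec_lambda)

definition pairing ::
  "real \<Rightarrow> ((real \<times> (real ^ 'n)) set \<Rightarrow> real ^ 'n) \<Rightarrow> ((real \<times> (real ^ 'n)) set \<Rightarrow> real ^ 'n ^ 'n) \<Rightarrow>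
   (real \<times> (real ^ 'n) \<Rightarrow> real ^ 'n) \<Rightarrow> (real \<times> (real ^ 'n) \<Rightarrow> real ^ 'n ^ 'n) \<Rightarrow> real"
where
  "pairing T E B V M = (\<Sum>k\<in>UNIV. cyl_integral T (\<lambda>A. E A $ k) (\<lambda>p. V p $ k)) +
     (\<Sum>i\<in>UNIV. \<Sum>j\<in>UNIV. cyl_integral T (\<lambda>A. B A $ i $ j) (\<lambda>p. M p $ i $ j))"

lemma measure_pairs_functionals:
  assumes "(E, B) \<in> measure_pairs T"
  shows "cyl_functional T (cyl_integral T (\<lambda>A. E A $ k))" "cyl_functional T (cyl_integral T (\<lambda>A. B A $ i $ j))"
proof -
  obtain C where C: "\<And>A. A \<in> sets (cyl_borel T) \<Longrightarrow> norm (E A) \<le> C"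
    using assms vector_measure_component_bounded unfolding measure_pairs_def by blast
  show "cyl_functional T (cyl_integral T (\<lambda>A. E A $ k))"
    by (rule cyl_functional_cyl_integral[of T _ C]) (rule order_trans[OF component_le_norm_cart C])
  obtain D where D: "\<And>A. A \<in> sets (cyl_borel T) \<Longrightarrow> norm (B A) \<le> D"
    using assms vector_measure_component_bounded unfolding measure_pairs_def by blast
  show "cyl_functional T (cyl_integral T (\<lambda>A. B A $ i $ j))"
    by (rule cyl_functional_cyl_integral[of T _ D])
       (rule order_trans[OF component_le_norm_cart order_trans[OF Finite_Cartesian_Product.norm_nth_le D]])
qed

lemma pairing_add:
  assumes m: "(E, B) \<in> measure_pairs T" and f: "cyl_field T V" "cyl_field T W" "cyl_field T M" "cyl_field T N"
  shows "pairing T E B (\<lambda>p. V p + W p) (\<lambda>p. M p + N p) = pairing T E B V M + pairing T E B W N"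
proof -
  note l = measure_pairs_functionals[OF m]
  note eqs = cyl_functional_add[OF l(1) cyl_field_component[OF f(1)] cyl_field_component[OF f(2)]]
    cyl_functional_add[OF l(2) cyl_field_component2[OF f(3)] cyl_field_component2[OF f(4)]]
  show ?thesis by (simp add: pairing_def eqs sum.distrib)
qed

lemma pairing_scaleR:
  assumes m: "(E, B) \<in> measure_pairs T" and f: "cyl_field T V" "cyl_field T M"
  shows "pairing T E B (\<lambda>p. c *\<^sub>R V p) (\<lambda>p. c *\<^sub>R M p) = c * pairing T E B V M"
proof -
  note l = measure_pairs_functionals[OF m]
  note eqs = cyl_functional_cmult[OF l(1) cyl_field_component[OF f(1)]]
    cyl_functional_cmult[OF l(2) cyl_field_component2[OF f(2)]]
  show ?thesis by (simp add: pairing_def eqs sum_distrib_left distrib_left)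
qed

lemma pairing_diff:
  assumes m: "(E, B) \<in> measure_pairs T" and f: "cyl_field T V" "cyl_field T W" "cyl_field T M" "cyl_field T N"
  shows "pairing T E B (\<lambda>p. V p - W p) (\<lambda>p. M p - N p) = pairing T E B V M - pairing T E B W N"
proof -
  note l = measure_pairs_functionals[OF m]
  note eqs = cyl_functional_diff[OF l(1) cyl_field_component[OF f(1)] cyl_field_component[OF f(2)]]
    cyl_functional_diff[OF l(2) cyl_field_component2[OF f(3)] cyl_field_component2[OF f(4)]]
  show ?thesis by (simp add: pairing_def eqs sum_subtractf)
qed

lemma pairing_sum:
  assumes "(E, B) \<in> measure_pairs T" "finite I" "\<And>i. i \<in> I \<Longrightarrow> cyl_field T (V i)" "\<And>i. i \<in> I \<Longrightarrow> cyl_field T (M i)"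
  shows "pairing T E B (\<lambda>p. \<Sum>i\<in>I. V i p) (\<lambda>p. \<Sum>i\<in>I. M i p) = (\<Sum>i\<in>I. pairing T E B (V i) (M i))"
  using assms(2-4)
proof (induction I rule: finite_induct)
  case empty
  have "cyl_field T (\<lambda>p :: real \<times> (real ^ 'n). 0 :: real ^ 'n)" "cyl_field T (\<lambda>p :: real \<times> (real ^ 'n). 0 :: real ^ 'n ^ 'n)"
    by (auto simp: cyl_field_def space_periodic_def periodic_def)
  from pairing_scaleR[OF assms(1) this, of 0] show ?case by simp
next
  case (insert i I)
  thus ?case using pairing_add[OF assms(1), of "V i" "\<lambda>p. \<Sum>i\<in>I. V i p" "M i" "\<lambda>p. \<Sum>i\<in>I. M i p"]
    by (simp add: cyl_field_sum)
qed

text \<open>Continuity in the uniform norm. Both limits, in the polynomial approximation in time and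
  in the Fejer index, rest on it.\<close>

lemma pairing_bound:
  fixes E :: "(real \<times> (real ^ 'n)) set \<Rightarrow> real ^ 'n"
  assumes "(E, B) \<in> measure_pairs T"
  obtains K where "K \<ge> 0" "\<And>V M c. cyl_field T V \<Longrightarrow> cyl_field T M \<Longrightarrow> c \<ge> 0 \<Longrightarrow>
      (\<And>p k. p \<in> cylinder T \<Longrightarrow> \<bar>V p $ k\<bar> \<le> c) \<Longrightarrow> (\<And>p i j. p \<in> cylinder T \<Longrightarrow> \<bar>M p $ i $ j\<bar> \<le> c) \<Longrightarrow>
      \<bar>pairing T E B V M\<bar> \<le> K * c"
proof -
  have "\<exists>K. K \<ge> 0 \<and> (\<forall>f\<in>cyl_fun T. \<forall>c\<ge>0. (\<forall>x\<in>cylinder T. \<bar>f x\<bar> \<le> c) \<longrightarrow> \<bar>cyl_integral T (\<lambda>A. E A $ k) f\<bar> \<le> K * c)" for k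
    using measure_pairs_functionals(1)[OF assms, of k] unfolding cyl_functional_def by blast
  then obtain KE where KE: "\<And>k. KE k \<ge> 0"
    "\<And>k f c. f \<in> cyl_fun T \<Longrightarrow> c \<ge> 0 \<Longrightarrow> (\<forall>x\<in>cylinder T. \<bar>f x\<bar> \<le> c) \<Longrightarrow> \<bar>cyl_integral T (\<lambda>A. E A $ k) f\<bar> \<le> KE k * c"
    by metis
  have "\<exists>K. K \<ge> 0 \<and> (\<forall>f\<in>cyl_fun T. \<forall>c\<ge>0. (\<forall>x\<in>cylinder T. \<bar>f x\<bar> \<le> c) \<longrightarrow> \<bar>cyl_integral T (\<lambda>A. B A $ i $ j) f\<bar> \<le> K * c)" for i j
    using measure_pairs_functionals(2)[OF assms, of i j] unfolding cyl_functional_def by blast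
  then obtain KB where KB: "\<And>i j. KB i j \<ge> 0"
    "\<And>i j f c. f \<in> cyl_fun T \<Longrightarrow> c \<ge> 0 \<Longrightarrow> (\<forall>x\<in>cylinder T. \<bar>f x\<bar> \<le> c) \<Longrightarrow> \<bar>cyl_integral T (\<lambda>A. B A $ i $ j) f\<bar> \<le> KB i j * c"
    by metis
  show ?thesis
  proof (rule that[of "(\<Sum>k\<in>UNIV. KE k) + (\<Sum>i\<in>UNIV. \<Sum>j\<in>UNIV. KB i j)"])
    show "0 \<le> (\<Sum>k\<in>UNIV. KE k) + (\<Sum>i\<in>UNIV. \<Sum>j\<in>UNIV. KB i j)" using KE(1) KB(1) by (intro add_nonneg_nonneg sum_nonneg) auto
    fix V :: "real \<times> (real ^ 'n) \<Rightarrow> real ^ 'n" and M :: "real \<times> (real ^ 'n) \<Rightarrow> real ^ 'n ^ 'n" and c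
    assume V: "cyl_field T V" and M: "cyl_field T M" and c: "(c::real) \<ge> 0"
      and Vc: "\<And>p k. p \<in> cylinder T \<Longrightarrow> \<bar>V p $ k\<bar> \<le> c" and Mc: "\<And>p i j. p \<in> cylinder T \<Longrightarrow> \<bar>M p $ i $ j\<bar> \<le> c"
    have "\<bar>pairing T E B V M\<bar> \<le> (\<Sum>k\<in>UNIV. KE k * c) + (\<Sum>i\<in>UNIV. \<Sum>j\<in>UNIV. KB i j * c)"
      unfolding pairing_def
      using Vc Mc
      by (intro order_trans[OF abs_triangle_ineq] add_mono sum_abs[THEN order_trans] sum_mono KE(2) KB(2)
          cyl_field_component V cyl_field_component2 M c) auto
    thus "\<bar>pairing T E B V M\<bar> \<le> ((\<Sum>k\<in>UNIV. KE k) + (\<Sum>i\<in>UNIV. \<Sum>j\<in>UNIV. KB i j)) * c"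
      by (simp add: sum_distrib_right distrib_right)
  qed
qed

section \<open>The constraint operator on plane waves\<close>

lemma pd_cwave: "pd i (\<lambda>y. c * wave m \<theta> y) = (\<lambda>y. (c * freq m $ i) * wave m (\<theta> + pi / 2) y)"
  unfolding pd_cmult[OF smooth_wave] pd_wave by (simp add: mult.assoc)

lemma wave_minus_half_pi: "wave m (\<theta> + pi / 2) x = - wave m (\<theta> - pi / 2) x"
  by (simp only: wave_shift wave_shift_neg)

lemma pd_pd_cwave: "pd i (pd j (\<lambda>y. c * wave m \<theta> y)) = (\<lambda>y. - (c * freq m $ i * freq m $ j) * wave m \<theta> y)"
  unfolding pd_cwave wave_pi by (simp add: mult_ac)

lemma neg_laplacian_cwave: "neg_laplacian (\<lambda>y. c * wave m \<theta> y) = (\<lambda>y. (c * (freq m \<bullet> freq m)) * wave m \<theta> y)"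
  unfolding neg_laplacian_def pd_pd_cwave
  by (simp add: inner_vec_def sum_negf sum_distrib_left sum_distrib_right mult_ac)

text \<open>At \<open>m = 0\<close> the wave is constant and the assumption gives
  \<open>c = 0\<close>; division by zero then yields the correct value 0.\<close>

lemma inv_neg_laplacian_cwave:
  fixes m :: "'n::finite \<Rightarrow> int"
  assumes "m = (\<lambda>_. 0) \<Longrightarrow> c = 0"
  shows "inv_neg_laplacian (\<lambda>y. c * wave m \<theta> y) = (\<lambda>y. (c / (freq m \<bullet> freq m)) * wave m \<theta> y)"
proof -
  let ?u = "\<lambda>y :: real ^ 'n. (c / (freq m \<bullet> freq m)) * wave m \<theta> y"
  have "cell_int ?u = (c / (freq m \<bullet> freq m)) * cell_int (wave m \<theta>)" by (rule cell_int_mult)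
  also have "\<dots> = 0" using assms by (simp add: cell_int_wave)
  finally have "?u \<in> smooth_zero_mean"
    using smooth_cmult[OF smooth_wave] periodic_cmult[OF periodic_wave] by (simp only: smooth_zero_mean_def) blast
  from inv_neg_laplacian_eq[OF this] show ?thesis
    unfolding neg_laplacian_cwave using assms by (cases "m = (\<lambda>_. 0)") (auto simp: freq_eq_0_iff)
qed

text \<open>
  The Fourier symbol of \<open>E \<mapsto> (\<partial>\<^sub>jE\<^sub>i + \<partial>\<^sub>iE\<^sub>j)/2 + \<partial>\<^sub>i\<partial>\<^sub>j(-\<triangle>)\<^sup>-\<^sup>1\<partial>\<^sup>kE\<^sub>k\<close> on \<open>E = e\<^sub>k\<close>, up to a factor \<open>\<i>\<close>;
  division by zero makes it vanish at \<open>m = 0\<close>.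
\<close>

definition symb :: "('n::finite \<Rightarrow> int) \<Rightarrow> 'n \<Rightarrow> 'n \<Rightarrow> 'n \<Rightarrow> real" where
  "symb m k i j = ((if i = k then freq m $ j else 0) + (if j = k then freq m $ i else 0)) / 2
     - freq m $ k * freq m $ i * freq m $ j / (freq m \<bullet> freq m)"

lemma wave_field_nth:
  "wave_field p (freq m) \<theta> v (t, x) $ i = (poly p t * v $ i) * wave m \<theta> x"
  "wave_field p (freq m) \<theta> S (t, x) $ i $ j = (poly p t * S $ i $ j) * wave m \<theta> x"
  by (simp_all add: wave_field_def wave_def)

lemma periodic_wave_field: "space_periodic T (wave_field p (freq m) \<theta> v)"
  using periodic_wave[of m \<theta>] by (simp add: space_periodic_def periodic_def wave_field_def wave_def)

text \<open>On a wave the constraint is solved explicitly: the velocity amplitude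
  \<open>- H'\<close> integrates in time to the matrix amplitude \<open>H\<close>, and the space
  derivative shifts the phase. Shifting by \<open>- pi / 2\<close> instead of \<open>pi / 2\<close>
  absorbs the minus sign, and \<open>H T = 0\<close> is the final condition.\<close>

lemma wave_test_field:
  fixes m :: "'n::finite \<Rightarrow> int"
  assumes T: "T > 0" and H: "poly H T = 0"
  shows "(wave_field (- pderiv H) (freq m) \<theta> (axis k 1),
      wave_field H (freq m) (\<theta> - pi / 2) (\<chi> i j. symb m k i j)) \<in> test_fields T"
proof -
  let ?E = "wave_field (- pderiv H) (freq m) \<theta> (axis k (1::real)) :: real \<times> (real ^ 'n) \<Rightarrow> real ^ 'n"
  let ?B = "wave_field H (freq m) (\<theta> - pi / 2) (\<chi> i j. symb m k i j) :: real \<times> (real ^ 'n) \<Rightarrow> real ^ 'n ^ 'n"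
  have eq: "vector_derivative (\<lambda>s. ?B (s, x) $ i $ j) (at t within {0..T}) =
      1/2 * (pd j (\<lambda>y. ?E (t, y) $ i) x + pd i (\<lambda>y. ?E (t, y) $ j) x)
      + pd i (pd j (inv_neg_laplacian (\<lambda>y. \<Sum>l\<in>UNIV. pd l (\<lambda>z. ?E (t, z) $ l) y))) x"
    if t: "t \<in> {0..T}" for t x i j
  proof -
    define g where "g = poly (pderiv H) t"
    have "((\<lambda>s. poly H s * (symb m k i j * wave m (\<theta> - pi / 2) x)) has_vector_derivative
        g * (symb m k i j * wave m (\<theta> - pi / 2) x)) (at t within {0..T})"
      unfolding g_def using has_vector_derivative_mult_left[OF poly_has_vector_derivative] by blast
    hence "vector_derivative (\<lambda>s. poly H s * (symb m k i j * wave m (\<theta> - pi / 2) x)) (at t within {0..T}) =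
        g * (symb m k i j * wave m (\<theta> - pi / 2) x)"
      by (rule vector_derivative_within_closed_interval[OF T t])
    hence 1: "vector_derivative (\<lambda>s. ?B (s, x) $ i $ j) (at t within {0..T}) = g * symb m k i j * wave m (\<theta> - pi / 2) x"
      unfolding wave_field_nth by (simp add: mult.assoc)
    have E: "(\<lambda>y. ?E (t, y) $ l) = (\<lambda>y. (if l = k then - g else 0) * wave m \<theta> y)" for l
      unfolding wave_field_nth by (auto simp: g_def axis_def)
    have pdE: "pd j (\<lambda>y. ?E (t, y) $ l) x = (if l = k then g else 0) * freq m $ j * wave m (\<theta> - pi / 2) x" for l j x
      unfolding E pd_cwave wave_minus_half_pi by simp
    have div: "(\<lambda>y. \<Sum>l\<in>UNIV. pd l (\<lambda>z. ?E (t, z) $ l) y) = (\<lambda>y. (g * freq m $ k) * wave m (\<theta> - pi / 2) y)"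
      unfolding pdE by (simp add: if_distrib[of "\<lambda>a. a * _"] sum.delta cong: if_cong)
    have inv: "inv_neg_laplacian (\<lambda>y. \<Sum>l\<in>UNIV. pd l (\<lambda>z. ?E (t, z) $ l) y) =
        (\<lambda>y. (g * freq m $ k / (freq m \<bullet> freq m)) * wave m (\<theta> - pi / 2) y)"
      unfolding div by (rule inv_neg_laplacian_cwave) (simp add: freq_nth)
    show ?thesis unfolding 1 inv unfolding pd_pd_cwave pdE by (auto simp: symb_def algebra_simps)
  qed
  have sym: "symmetric (?B p)" for p
    by (auto simp: symmetric_def transpose_def vec_eq_iff wave_field_def symb_def split: prod.split)
  have zero: "?B (T, x) = 0" for x using H by (simp add: wave_field_def)
  show ?thesis
    unfolding test_fields_def mem_Collect_eq prod.case
    by (intro conjI ballI allI smooth_on_wave_field T periodic_wave_field sym zero eq)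
qed

lemma cyl_field_slice:
  assumes "cyl_field T f" "t \<in> {0..T}"
  shows "continuous_on S (\<lambda>x. f (t, x))" "periodic (\<lambda>x. f (t, x))"
proof -
  show "continuous_on S (\<lambda>x. f (t, x))"
    by (rule continuous_on_compose2[of "slab T" f]) (use assms in \<open>auto simp: cyl_field_def slab_def intro!: continuous_intros\<close>)
  show "periodic (\<lambda>x. f (t, x))" using assms by (simp add: cyl_field_def space_periodic_def)
qed

text \<open>
  What a sub-solution says about a single Fourier mode: testing with \<open>E = - H'(t) cos(\<omega>\<bullet>x + \<theta>) e\<^sub>k\<close>
  for all polynomials \<open>H\<close> vanishing at \<open>T\<close>.
\<close>

lemma mode_identity:
  fixes V :: "real \<times> (real ^ 'n) \<Rightarrow> real ^ 'n" and M :: "real \<times> (real ^ 'n) \<Rightarrow> real ^ 'n ^ 'n"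
  assumes T: "T > 0" and V: "cyl_field T V" and M: "cyl_field T M"
    and test: "\<And>E B. (E, B) \<in> test_fields T \<Longrightarrow>
      (LINT p:cylinder T|lborel. (\<Sum>i\<in>UNIV. \<Sum>j\<in>UNIV. M p $ i $ j * B p $ i $ j) + (\<Sum>i\<in>UNIV. V p $ i * E p $ i)) = 0"
    and t: "t \<in> {0..T}"
  shows "coef m \<theta> (\<lambda>x. V (t, x) $ k) =
    - (\<Sum>i\<in>UNIV. \<Sum>j\<in>UNIV. symb m k i j * integral {0..t} (\<lambda>s. coef m (\<theta> - pi / 2) (\<lambda>x. M (s, x) $ i $ j)))"
proof -
  define a where "a i j s = coef m (\<theta> - pi / 2) (\<lambda>x. M (s, x) $ i $ j)" for i j s
  define b where "b s = coef m \<theta> (\<lambda>x. V (s, x) $ k)" for s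
  define A where "A s = (\<Sum>i\<in>UNIV. \<Sum>j\<in>UNIV. symb m k i j * a i j s)" for s
  define q where "q t = integral {0..t} A" for t
  have ca: "continuous_on {0..T} (a i j)" for i j
    unfolding a_def using cyl_field_component2[OF M] by (intro continuous_on_time_coef) (simp add: cyl_fun_def)
  have cb: "continuous_on {0..T} b"
    unfolding b_def using cyl_field_component[OF V] by (intro continuous_on_time_coef) (simp add: cyl_fun_def)
  have cA: "continuous_on {0..T} A"
    unfolding A_def by (intro continuous_on_sum continuous_on_mult continuous_on_const ca)
  have dq: "(q has_vector_derivative A t) (at t within {0..T})" if "t \<in> {0..T}" for t
    unfolding q_def by (rule integral_has_vector_derivative[OF cA that])
  have cq: "continuous_on {0..T} q"
    unfolding continuous_on_eq_continuous_within using has_vector_derivative_continuous[OF dq] by blast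
  have "b t + q t = 0"
  proof (rule orthogonal_to_polys_zero[OF T _ _ t, of "\<lambda>t. b t + q t"])
    show "continuous_on {0..T} (\<lambda>t. b t + q t)" by (intro continuous_on_add cb cq)
    fix g :: "real poly"
    \<comment> \<open>Every polynomial \<open>g\<close> is the derivative of an admissible time
      factor, so the test identities give all moments of \<open>b + q\<close>.\<close>
    obtain H where H: "pderiv H = g" "poly H T = 0" by (rule poly_antiderivative)
    define E where "E = wave_field (- pderiv H) (freq m) \<theta> (axis k (1::real) :: real ^ 'n)"
    define B where "B = wave_field H (freq m) (\<theta> - pi / 2) (\<chi> i j. symb m k i j)"
    define f where "f p = (\<Sum>i\<in>UNIV. \<Sum>j\<in>UNIV. M p $ i $ j * B p $ i $ j) + (\<Sum>i\<in>UNIV. V p $ i * E p $ i)" for p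
    have cEB: "continuous_on (slab T) E" "continuous_on (slab T) B"
      unfolding E_def B_def by (intro smooth_on_continuous smooth_on_wave_field T)+
    have "continuous_on (slab T) f"
      unfolding f_def using V M cEB unfolding cyl_field_def by (intro continuous_intros) auto
    from cyl_int_Fubini(1)[OF this]
    have "0 = (LINT t:{0..T}|lborel. cell_int (\<lambda>x. f (t, x)))"
      using test[OF wave_test_field[OF T H(2), of m \<theta> k]] unfolding f_def E_def B_def by simp
    also have "\<dots> = (LINT t:{0..T}|lborel. A t * poly H t - poly g t * b t)"
    proof (rule set_lebesgue_integral_cong)
      show "\<forall>t. t \<in> {0..T} \<longrightarrow> cell_int (\<lambda>x. f (t, x)) = A t * poly H t - poly g t * b t"
      proof (intro allI impI)
        fix t assume t: "t \<in> {0..T}"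
        have cM: "continuous_on closed_cell (\<lambda>x. M (t, x) $ i $ j * wave m (\<theta> - pi / 2) x)" for i j
          using cyl_field_slice(1)[OF M t] by (intro continuous_intros continuous_on_wave)
        have cV: "continuous_on closed_cell (\<lambda>x. V (t, x) $ k * wave m \<theta> x)"
          using cyl_field_slice(1)[OF V t] by (intro continuous_intros continuous_on_wave)
        have f_eq: "f (t, x) = (\<Sum>i\<in>UNIV. \<Sum>j\<in>UNIV. (poly H t * symb m k i j) * (M (t, x) $ i $ j * wave m (\<theta> - pi / 2) x))
            + (- poly g t) * (V (t, x) $ k * wave m \<theta> x)" for x
        proof -
          have "(\<Sum>i\<in>UNIV. V (t, x) $ i * E (t, x) $ i) =
              (\<Sum>i\<in>UNIV. if i = k then (- poly g t) * (V (t, x) $ i * wave m \<theta> x) else 0)"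
            unfolding E_def wave_field_nth by (intro sum.cong refl) (auto simp: axis_def H)
          thus ?thesis unfolding f_def B_def wave_field_nth by (simp add: sum.delta mult_ac)
        qed
        have "cell_int (\<lambda>x. f (t, x)) =
            cell_int (\<lambda>x. \<Sum>i\<in>UNIV. \<Sum>j\<in>UNIV. (poly H t * symb m k i j) * (M (t, x) $ i $ j * wave m (\<theta> - pi / 2) x))
            + cell_int (\<lambda>x. (- poly g t) * (V (t, x) $ k * wave m \<theta> x))"
          unfolding f_eq by (intro cell_int_add continuous_on_sum continuous_on_mult[OF continuous_on_const] cM cV)
        also have "cell_int (\<lambda>x. \<Sum>i\<in>UNIV. \<Sum>j\<in>UNIV. (poly H t * symb m k i j) * (M (t, x) $ i $ j * wave m (\<theta> - pi / 2) x)) =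
            (\<Sum>i\<in>UNIV. cell_int (\<lambda>x. \<Sum>j\<in>UNIV. (poly H t * symb m k i j) * (M (t, x) $ i $ j * wave m (\<theta> - pi / 2) x)))"
          by (intro cell_int_sum continuous_on_sum continuous_on_mult[OF continuous_on_const] cM) auto
        also have "\<dots> = (\<Sum>i\<in>UNIV. \<Sum>j\<in>UNIV. cell_int (\<lambda>x. (poly H t * symb m k i j) * (M (t, x) $ i $ j * wave m (\<theta> - pi / 2) x)))"
          by (intro sum.cong refl cell_int_sum continuous_on_mult[OF continuous_on_const] cM) auto
        also have "\<dots> = A t * poly H t"
          unfolding cell_int_mult A_def a_def coef_def by (simp add: sum_distrib_left mult_ac)
        also have "cell_int (\<lambda>x. (- poly g t) * (V (t, x) $ k * wave m \<theta> x)) = - poly g t * b t"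
          unfolding cell_int_mult b_def coef_def ..
        finally show "cell_int (\<lambda>x. f (t, x)) = A t * poly H t - poly g t * b t" by simp
      qed
    qed simp
    also have "\<dots> = (LINT t:{0..T}|lborel. A t * poly H t) - (LINT t:{0..T}|lborel. poly g t * b t)"
      by (intro set_integral_diff time_integrable continuous_on_mult cA cb continuous_on_poly')
    \<comment> \<open>Integration by parts moves the time derivative from \<open>q\<close> to
      \<open>H\<close>; the boundary terms vanish since \<open>q 0 = 0\<close> and \<open>H\<close>
      vanishes at \<open>T\<close>.\<close>
    also have "(LINT t:{0..T}|lborel. A t * poly H t) =
        q T * poly H T - q 0 * poly H 0 - (LINT t:{0..T}|lborel. q t * poly g t)"
      using T H by (intro time_int_by_parts dq cA continuous_on_poly') (auto intro: poly_has_vector_derivative)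
    also have "q 0 = 0" by (simp add: q_def)
    finally have "(LINT t:{0..T}|lborel. poly g t * b t) + (LINT t:{0..T}|lborel. poly g t * q t) = 0"
      using H(2) by (simp add: mult.commute)
    moreover have "(LINT t:{0..T}|lborel. poly g t * (b t + q t)) =
        (LINT t:{0..T}|lborel. poly g t * b t) + (LINT t:{0..T}|lborel. poly g t * q t)"
      unfolding distrib_left by (intro set_integral_add time_integrable continuous_on_mult cq cb continuous_on_poly')
    ultimately show "(LINT t:{0..T}|lborel. poly g t * (b t + q t)) = 0" by simp
  qed
  moreover have "q t = (\<Sum>i\<in>UNIV. \<Sum>j\<in>UNIV. symb m k i j * integral {0..t} (a i j))"
  proof -
    have io: "(\<lambda>s. symb m k i j * a i j s) integrable_on {0..t}" for i j
      using t by (intro integrable_continuous_real continuous_on_mult continuous_on_const continuous_on_subset[OF ca]) auto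
    have "q t = (\<Sum>i\<in>UNIV. integral {0..t} (\<lambda>s. \<Sum>j\<in>UNIV. symb m k i j * a i j s))"
      unfolding q_def A_def by (intro integral_sum integrable_sum io) auto
    also have "\<dots> = (\<Sum>i\<in>UNIV. \<Sum>j\<in>UNIV. integral {0..t} (\<lambda>s. symb m k i j * a i j s))"
      by (intro sum.cong refl integral_sum io) auto
    finally show ?thesis by simp
  qed
  ultimately show ?thesis unfolding a_def b_def by linarith
qed

lemma signed_integral_cong:
  "(\<And>x. x \<in> space N \<Longrightarrow> f x = g x) \<Longrightarrow> signed_integral N \<nu> f = signed_integral N \<nu> g"
  unfolding signed_integral_def by (intro arg_cong2[where f = "(-)"] Bochner_Integration.integral_cong) auto

lemma signed_integral_minus: "signed_integral N \<nu> (\<lambda>x. - f x) = - signed_integral N \<nu> f"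
  by (simp add: signed_integral_def)

text \<open>Symmetrised matrix units, since test matrices must be symmetric. The factor 1/2 lets a
  symmetric matrix be expanded over all ordered pairs without counting twice.\<close>

definition sym_unit :: "'n \<Rightarrow> 'n \<Rightarrow> real ^ 'n ^ 'n" where
  "sym_unit p q = (\<chi> i j. ((if i = p \<and> j = q then 1 else 0) + (if i = q \<and> j = p then 1 else 0)) / 2)"

lemma sum_sym_unit: "(\<Sum>i\<in>UNIV. \<Sum>j\<in>UNIV. sym_unit p q $ i $ j * F i j) = (F p q + F q p) / 2"
proof -
  have d: "(\<Sum>i\<in>UNIV. \<Sum>j\<in>UNIV. if i = p \<and> j = q then F i j else 0) = F p q" for p q
  proof -
    have "(\<Sum>i\<in>UNIV. \<Sum>j\<in>UNIV. if i = p \<and> j = q then F i j else 0) = (\<Sum>i\<in>UNIV. if i = p then F i q else 0)"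
    proof (intro sum.cong refl)
      show "(\<Sum>j\<in>UNIV. if i = p \<and> j = q then F i j else 0) = (if i = p then F i q else 0)" for i
        by (cases "i = p") simp_all
    qed
    thus ?thesis by (simp add: sum.delta)
  qed
  have "(\<Sum>i\<in>UNIV. \<Sum>j\<in>UNIV. sym_unit p q $ i $ j * F i j) =
      (\<Sum>i\<in>UNIV. \<Sum>j\<in>UNIV. (if i = p \<and> j = q then F i j else 0) / 2 + (if i = q \<and> j = p then F i j else 0) / 2)"
  proof -
    have "((if P then 1 else 0) + (if Q then 1 else 0)) / 2 * f = (if P then f else 0) / 2 + (if Q then f else 0) / 2"
      for P Q and f :: real by (cases P; cases Q) simp_all
    thus ?thesis unfolding sym_unit_def vec_lambda_beta by (simp only:)
  qed
  also have "\<dots> = (\<Sum>i\<in>UNIV. \<Sum>j\<in>UNIV. if i = p \<and> j = q then F i j else 0) / 2 +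
      (\<Sum>i\<in>UNIV. \<Sum>j\<in>UNIV. if i = q \<and> j = p then F i j else 0) / 2"
    by (simp only: sum.distrib sum_divide_distrib)
  finally show ?thesis unfolding d by (simp only: add_divide_distrib)
qed

lemma sum_UNIV_pairs:
  fixes F :: "'a::finite \<Rightarrow> 'b::finite \<Rightarrow> 'c::comm_monoid_add"
  shows "(\<Sum>pq\<in>UNIV. F (fst pq) (snd pq)) = (\<Sum>p\<in>UNIV. \<Sum>q\<in>UNIV. F p q)"
  unfolding UNIV_Times_UNIV[symmetric] sum.cartesian_product by (simp add: case_prod_beta')

lemma symmetric_expand:
  assumes "symmetric A" shows "A = (\<Sum>pq\<in>UNIV. A $ fst pq $ snd pq *\<^sub>R sym_unit (fst pq) (snd pq))"
proof -
  have "(\<Sum>pq\<in>UNIV. A $ fst pq $ snd pq *\<^sub>R sym_unit (fst pq) (snd pq)) $ i $ j = A $ i $ j" for i j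
  proof -
    have "(\<Sum>pq\<in>UNIV. A $ fst pq $ snd pq *\<^sub>R sym_unit (fst pq) (snd pq)) $ i $ j =
        (\<Sum>p\<in>UNIV. \<Sum>q\<in>UNIV. sym_unit i j $ p $ q * A $ p $ q)"
    proof -
      have "(\<Sum>pq\<in>UNIV. A $ fst pq $ snd pq *\<^sub>R sym_unit (fst pq) (snd pq)) $ i $ j =
          (\<Sum>pq\<in>UNIV. A $ fst pq $ snd pq * sym_unit (fst pq) (snd pq) $ i $ j)" by simp
      also have "\<dots> = (\<Sum>pq\<in>UNIV. sym_unit i j $ fst pq $ snd pq * A $ fst pq $ snd pq)"
      proof (intro sum.cong refl)
        have "sym_unit p q $ i $ j = sym_unit i j $ p $ q" for p q by (simp add: sym_unit_def eq_commute conj_commute)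
        thus "A $ fst pq $ snd pq * sym_unit (fst pq) (snd pq) $ i $ j =
            sym_unit i j $ fst pq $ snd pq * A $ fst pq $ snd pq" for pq by simp
      qed
      also have "\<dots> = (\<Sum>p\<in>UNIV. \<Sum>q\<in>UNIV. sym_unit i j $ p $ q * A $ p $ q)"
        by (rule sum_UNIV_pairs)
      finally show ?thesis .
    qed
    also have "\<dots> = (A $ i $ j + A $ j $ i) / 2" by (rule sum_sym_unit)
    also have "A $ j $ i = A $ i $ j" using assms by (auto simp: symmetric_def transpose_def vec_eq_iff)
    finally show ?thesis by simp
  qed
  thus ?thesis by (simp add: vec_eq_iff)
qed

text \<open>The amplitude is merely continuous in time, as are the Fourier coefficients of
  continuous fields; \<open>wave_field\<close> is the polynomial case.\<close>

definition twave :: "(real \<Rightarrow> real) \<Rightarrow> ('n \<Rightarrow> int) \<Rightarrow> real \<Rightarrow> 'b::real_normed_vector \<Rightarrow> real \<times> (real ^ 'n) \<Rightarrow> 'b" where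
  "twave a m \<theta> v = (\<lambda>(t, x). (a t * wave m \<theta> x) *\<^sub>R v)"

lemma twave_field: assumes "continuous_on {0..T} a" shows "cyl_field T (twave a m \<theta> v)"
  using cyl_fun_wave[OF assms, of m \<theta>] unfolding cyl_field_def cyl_fun_def twave_def case_prod_beta'
  by (auto simp: space_periodic_def periodic_def intro!: continuous_intros)

text \<open>The weak constraint for \<open>\<psi>\<close> a wave times \<open>sym_unit p q\<close>.
  The spatial operator on \<open>\<psi>\<close> is, up to sign, the adjoint of the one on
  \<open>E\<close>, so the same symbol \<open>symb\<close> appears.\<close>

lemma EB_wave_poly:
  fixes E :: "(real \<times> (real ^ 'n)) set \<Rightarrow> real ^ 'n" and B :: "(real \<times> (real ^ 'n)) set \<Rightarrow> real ^ 'n ^ 'n"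
  assumes T: "T > 0" and EB: "(E, B) \<in> EB_class T" and \<zeta>: "poly \<zeta> 0 = 0"
  shows "pairing T E B (twave (poly \<zeta>) m \<theta> (- (\<chi> k. symb m k p q))) (twave (poly (pderiv \<zeta>)) m (\<theta> - pi / 2) (sym_unit p q)) = 0"
proof -
  define \<psi> where "\<psi> x = wave_field 1 (freq m) (\<theta> - pi / 2) (sym_unit p q) (0 :: real, x)" for x
  have \<psi>_nth: "\<psi> x $ i $ j = sym_unit p q $ i $ j * wave m (\<theta> - pi / 2) x" for x i j
    by (simp add: \<psi>_def wave_field_def wave_def)
  have "smooth_on UNIV \<psi>"
    unfolding \<psi>_def[abs_def] using T by (intro smooth_on_slice[OF smooth_on_wave_field[OF T]]) auto
  moreover have "periodic \<psi>" using periodic_wave_field[of T 1 m "\<theta> - pi / 2" "sym_unit p q"] T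
    by (simp add: \<psi>_def[abs_def] space_periodic_def)
  moreover have "symmetric (\<psi> x)" for x
  proof -
    have "\<psi> x $ j $ i = \<psi> x $ i $ j" for i j
      unfolding \<psi>_nth by (simp add: sym_unit_def conj_commute add.commute)
    thus ?thesis by (simp add: symmetric_def transpose_def vec_eq_iff)
  qed
  ultimately have eq: "(\<Sum>i\<in>UNIV. \<Sum>j\<in>UNIV. cyl_integral T (\<lambda>A. B A $ i $ j)
            (\<lambda>(t, x). vector_derivative (poly \<zeta>) (at t within {0..T}) * \<psi> x $ i $ j))
        - (\<Sum>k\<in>UNIV. cyl_integral T (\<lambda>A. E A $ k)
            (\<lambda>(t, x). poly \<zeta> t * ((\<Sum>j\<in>UNIV. pd j (\<lambda>y. \<psi> y $ k $ j) x)
                + pd k (inv_neg_laplacian (\<lambda>y. \<Sum>i\<in>UNIV. \<Sum>j\<in>UNIV. pd i (pd j (\<lambda>z. \<psi> z $ i $ j)) y)) x))) = 0"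
    using EB smooth_on_poly[OF T, of \<zeta>] \<zeta> unfolding EB_class_def by blast
  have div: "(\<Sum>j\<in>UNIV. pd j (\<lambda>y. \<psi> y $ k $ j) x) =
      ((if k = p then freq m $ q else 0) + (if k = q then freq m $ p else 0)) / 2 * wave m \<theta> x" for k x
  proof -
    have "(\<Sum>j\<in>UNIV. pd j (\<lambda>y. \<psi> y $ k $ j) x) = (\<Sum>j\<in>UNIV. sym_unit p q $ k $ j * freq m $ j) * wave m \<theta> x"
      unfolding \<psi>_nth pd_cwave by (simp add: sum_distrib_right)
    also have "(\<Sum>j\<in>UNIV. sym_unit p q $ k $ j * freq m $ j) =
        (\<Sum>j\<in>UNIV. (if j = q then (if k = p then freq m $ j / 2 else 0) else 0) + (if j = p then (if k = q then freq m $ j / 2 else 0) else 0))"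
      by (intro sum.cong refl) (auto simp: sym_unit_def)
    finally show ?thesis by (simp add: sum.distrib sum.delta add_divide_distrib)
  qed
  have "(\<lambda>y. \<Sum>i\<in>UNIV. \<Sum>j\<in>UNIV. pd i (pd j (\<lambda>z. \<psi> z $ i $ j)) y) = (\<lambda>y. (- (freq m $ p * freq m $ q)) * wave m (\<theta> - pi / 2) y)"
  proof
    fix y
    have "(\<Sum>i\<in>UNIV. \<Sum>j\<in>UNIV. pd i (pd j (\<lambda>z. \<psi> z $ i $ j)) y) =
        (\<Sum>i\<in>UNIV. \<Sum>j\<in>UNIV. sym_unit p q $ i $ j * (- (freq m $ i * freq m $ j) * wave m (\<theta> - pi / 2) y))"
      unfolding \<psi>_nth pd_pd_cwave by (simp add: mult_ac)
    also have "\<dots> = (- (freq m $ p * freq m $ q)) * wave m (\<theta> - pi / 2) y" unfolding sum_sym_unit by (simp add: mult_ac)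
    finally show "(\<Sum>i\<in>UNIV. \<Sum>j\<in>UNIV. pd i (pd j (\<lambda>z. \<psi> z $ i $ j)) y) = (- (freq m $ p * freq m $ q)) * wave m (\<theta> - pi / 2) y" .
  qed
  hence inv: "inv_neg_laplacian (\<lambda>y. \<Sum>i\<in>UNIV. \<Sum>j\<in>UNIV. pd i (pd j (\<lambda>z. \<psi> z $ i $ j)) y) =
      (\<lambda>y. (- (freq m $ p * freq m $ q) / (freq m \<bullet> freq m)) * wave m (\<theta> - pi / 2) y)"
    by (simp only:) (rule inv_neg_laplacian_cwave, simp add: freq_nth)
  have op: "(\<Sum>j\<in>UNIV. pd j (\<lambda>y. \<psi> y $ k $ j) x)
                + pd k (inv_neg_laplacian (\<lambda>y. \<Sum>i\<in>UNIV. \<Sum>j\<in>UNIV. pd i (pd j (\<lambda>z. \<psi> z $ i $ j)) y)) x = symb m k p q * wave m \<theta> x" for k x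
    unfolding inv div pd_cwave by (auto simp: symb_def algebra_simps)
  have d: "vector_derivative (poly \<zeta>) (at t within {0..T}) = poly (pderiv \<zeta>) t" if "t \<in> {0..T}" for t
    by (rule vector_derivative_within_closed_interval[OF T that poly_has_vector_derivative])
  have "cyl_integral T (\<lambda>A. B A $ i $ j) (\<lambda>(t, x). vector_derivative (poly \<zeta>) (at t within {0..T}) * \<psi> x $ i $ j) =
      cyl_integral T (\<lambda>A. B A $ i $ j) (\<lambda>p'. twave (poly (pderiv \<zeta>)) m (\<theta> - pi / 2) (sym_unit p q) p' $ i $ j)" for i j
    by (rule signed_integral_cong) (auto simp: cylinder_def d \<psi>_nth twave_def)
  moreover have "cyl_integral T (\<lambda>A. E A $ k) (\<lambda>(t, x). poly \<zeta> t * ((\<Sum>j\<in>UNIV. pd j (\<lambda>y. \<psi> y $ k $ j) x)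
                + pd k (inv_neg_laplacian (\<lambda>y. \<Sum>i\<in>UNIV. \<Sum>j\<in>UNIV. pd i (pd j (\<lambda>z. \<psi> z $ i $ j)) y)) x)) =
      - cyl_integral T (\<lambda>A. E A $ k) (\<lambda>p'. twave (poly \<zeta>) m \<theta> (- (\<chi> k. symb m k p q)) p' $ k)" for k
    unfolding op signed_integral_minus[symmetric]
    by (rule signed_integral_cong) (auto simp: twave_def)
  ultimately show ?thesis using eq unfolding pairing_def by (simp add: sum_negf)
qed

text \<open>The derivative \<open>a\<close> is approximated by a polynomial, which is then
  integrated from 0. The velocity amplitude thereby stays the primitive of the matrix amplitude, and
  both errors are uniform.\<close>

lemma EB_wave:
  fixes E :: "(real \<times> (real ^ 'n)) set \<Rightarrow> real ^ 'n" and B :: "(real \<times> (real ^ 'n)) set \<Rightarrow> real ^ 'n ^ 'n"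
  assumes T: "T > 0" and EB: "(E, B) \<in> EB_class T" and a: "continuous_on {0..T} a"
  shows "pairing T E B (twave (\<lambda>t. integral {0..t} a) m \<theta> (- (\<chi> k. symb m k p q))) (twave a m (\<theta> - pi / 2) (sym_unit p q)) = 0"
    (is "pairing T E B (twave ?q m \<theta> ?v) (twave a m ?\<phi> ?S) = 0")
proof -
  have mp: "(E, B) \<in> measure_pairs T" using EB unfolding EB_class_def by blast
  obtain K where K: "K \<ge> 0" "\<And>V M c. cyl_field T V \<Longrightarrow> cyl_field T M \<Longrightarrow> c \<ge> 0 \<Longrightarrow>
      (\<And>p k. p \<in> cylinder T \<Longrightarrow> \<bar>V p $ k\<bar> \<le> c) \<Longrightarrow> (\<And>p i j. p \<in> cylinder T \<Longrightarrow> \<bar>M p $ i $ j\<bar> \<le> c) \<Longrightarrow>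
      \<bar>pairing T E B V M\<bar> \<le> K * c" using pairing_bound[OF mp] by blast
  define D where "D = norm ?v + norm ?S"
  have D: "\<bar>?v $ k\<bar> \<le> D" "\<bar>?S $ i $ j\<bar> \<le> D" for k i j
    using component_le_norm_cart[of ?v k] order_trans[OF component_le_norm_cart Finite_Cartesian_Product.norm_nth_le, of ?S i j]
      norm_ge_zero[of ?v] norm_ge_zero[of ?S] unfolding D_def by linarith+
  have D0: "D \<ge> 0" by (simp add: D_def)
  have cq: "continuous_on {0..T} ?q"
    unfolding continuous_on_eq_continuous_within using has_vector_derivative_continuous[OF integral_has_vector_derivative[OF a]] by blast
  have est: "\<bar>pairing T E B (twave ?q m \<theta> ?v) (twave a m ?\<phi> ?S)\<bar> \<le> K * (e * (1 + T) * D)" if e: "e > 0" for e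
  proof -
    obtain g where g: "\<And>t. t \<in> {0..T} \<Longrightarrow> \<bar>a t - poly g t\<bar> < e" using poly_approximation[OF a e] by blast
    obtain \<zeta> where \<zeta>: "pderiv \<zeta> = g" "poly \<zeta> 0 = 0" by (rule poly_antiderivative)
    have z: "\<bar>?q t - poly \<zeta> t\<bar> \<le> e * (1 + T)" if t: "t \<in> {0..T}" for t
    proof -
      have at: "continuous_on {0..t} a" using t by (intro continuous_on_subset[OF a]) auto
      have "(poly g has_integral poly \<zeta> t - poly \<zeta> 0) {0..t}"
        using t poly_has_vector_derivative[of \<zeta>] unfolding \<zeta>(1) by (intro fundamental_theorem_of_calculus) auto
      hence "poly \<zeta> t = integral {0..t} (poly g)" using \<zeta>(2) by (simp add: integral_unique)
      hence "?q t - poly \<zeta> t = integral {0..t} (\<lambda>s. a s - poly g s)"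
        by (simp add: integral_diff integrable_continuous_real at continuous_on_poly')
      also have "norm \<dots> \<le> e * (t - 0)"
        using t g by (intro integral_bound continuous_on_diff at continuous_on_poly') (auto intro: less_imp_le)
      also have "\<dots> \<le> e * (1 + T)" using t e by (intro mult_left_mono) auto
      finally show ?thesis by simp
    qed
    have "pairing T E B (twave ?q m \<theta> ?v) (twave a m ?\<phi> ?S) =
        pairing T E B (twave ?q m \<theta> ?v) (twave a m ?\<phi> ?S) - pairing T E B (twave (poly \<zeta>) m \<theta> ?v) (twave (poly g) m ?\<phi> ?S)"
      using EB_wave_poly[OF T EB \<zeta>(2), of m \<theta> p q] unfolding \<zeta>(1) by simp
    also have "\<dots> = pairing T E B (\<lambda>p. twave ?q m \<theta> ?v p - twave (poly \<zeta>) m \<theta> ?v p) (\<lambda>p. twave a m ?\<phi> ?S p - twave (poly g) m ?\<phi> ?S p)"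
      by (intro pairing_diff[symmetric] mp twave_field cq a continuous_on_poly')
    also have "\<bar>\<dots>\<bar> \<le> K * (e * (1 + T) * D)"
    proof (rule K(2))
      show "0 \<le> e * (1 + T) * D" using e T D0 by simp
      fix p' :: "real \<times> (real ^ 'n)" assume "p' \<in> cylinder T"
      then obtain t x where p': "p' = (t, x)" "t \<in> {0..T}" by (auto simp: cylinder_def)
      have b: "\<bar>(c * wave m \<phi> x) * r\<bar> \<le> e * (1 + T) * D" if "\<bar>c\<bar> \<le> e * (1 + T)" "\<bar>r\<bar> \<le> D" for c \<phi> r
      proof -
        have "\<bar>c\<bar> * \<bar>wave m \<phi> x\<bar> \<le> (e * (1 + T)) * 1" using that abs_wave_le e T by (intro mult_mono) auto
        hence "\<bar>c\<bar> * \<bar>wave m \<phi> x\<bar> \<le> e * (1 + T)" by simp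
        hence "(\<bar>c\<bar> * \<bar>wave m \<phi> x\<bar>) * \<bar>r\<bar> \<le> (e * (1 + T)) * D" by (rule mult_mono[OF _ that(2)]) (use e T in auto)
        thus ?thesis by (simp add: abs_mult)
      qed
      show "\<bar>(twave ?q m \<theta> ?v p' - twave (poly \<zeta>) m \<theta> ?v p') $ k\<bar> \<le> e * (1 + T) * D" for k
        using b[OF z[OF p'(2)] D(1), of \<theta> k] by (simp add: twave_def p' algebra_simps)
      have "\<bar>a t - poly g t\<bar> \<le> e * (1 + T)"
        using g[OF p'(2)] T e by (simp add: distrib_left) (smt (verit) mult_pos_pos)
      note bM = b[OF this D(2)]
      show "\<bar>(twave a m ?\<phi> ?S p' - twave (poly g) m ?\<phi> ?S p') $ i $ j\<bar> \<le> e * (1 + T) * D" for i j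
        using bM[of "\<theta> - pi / 2" i j] by (simp add: twave_def p' algebra_simps)
    qed (intro cyl_field_diff twave_field cq a continuous_on_poly')+
    finally show ?thesis .
  qed
  have "\<bar>pairing T E B (twave ?q m \<theta> ?v) (twave a m ?\<phi> ?S)\<bar> \<le> 0 + d" if d: "d > 0" for d
  proof -
    define L where "L = K * ((1 + T) * D)"
    have L: "L \<ge> 0" using K(1) T D0 by (simp add: L_def)
    have "\<bar>pairing T E B (twave ?q m \<theta> ?v) (twave a m ?\<phi> ?S)\<bar> \<le> K * (d / (L + 1) * (1 + T) * D)"
      using d L by (intro est) simp
    also have "\<dots> = d * L / (L + 1)" by (simp add: L_def)
    also have "\<dots> \<le> d" using d L by (simp add: field_simps)
    finally show ?thesis by simp
  qed
  hence "\<bar>pairing T E B (twave ?q m \<theta> ?v) (twave a m ?\<phi> ?S)\<bar> \<le> 0" by (rule field_le_epsilon)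
  thus ?thesis by simp
qed

text \<open>One mode expanded in two ways: phases 0 and \<open>pi / 2\<close> for the velocity, and
  both shifted by \<open>- pi / 2\<close> for the matrix, which is the phase lag between the two in
  the constraint.\<close>

lemma coef_mode_split:
  assumes "continuous_on closed_cell f"
  shows "mode m f z = coef m 0 f * wave m 0 z + coef m (pi / 2) f * wave m (pi / 2) z"
    "mode m f z = coef m (0 - pi / 2) f * wave m (0 - pi / 2) z + coef m (pi / 2 - pi / 2) f * wave m (pi / 2 - pi / 2) z"
proof -
  show 1: "mode m f z = coef m 0 f * wave m 0 z + coef m (pi / 2) f * wave m (pi / 2) z" by (rule mode_expand[OF assms])
  have w: "wave m (0 - pi / 2) x = - wave m (pi / 2) x" for x using wave_minus_half_pi[of m 0 x] by simp
  have "coef m (0 - pi / 2) f = - coef m (pi / 2) f"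
    unfolding coef_def w using cell_int_mult[of "-1" "\<lambda>x. f x * wave m (pi / 2) x"] by simp
  thus "mode m f z = coef m (0 - pi / 2) f * wave m (0 - pi / 2) z + coef m (pi / 2 - pi / 2) f * wave m (pi / 2 - pi / 2) z"
    unfolding 1 w by simp
qed

text \<open>
  The constraint is diagonal in Fourier space, so it passes from smooth test fields to measures mode by
  mode; Fejer sums recover the fields from their modes uniformly.
\<close>

theorem EB_orthogonal:
  fixes E :: "(real \<times> (real ^ 'n)) set \<Rightarrow> real ^ 'n" and B :: "(real \<times> (real ^ 'n)) set \<Rightarrow> real ^ 'n ^ 'n"
    and V :: "real \<times> (real ^ 'n) \<Rightarrow> real ^ 'n" and M :: "real \<times> (real ^ 'n) \<Rightarrow> real ^ 'n ^ 'n"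
  assumes T: "T > 0" and EB: "(E, B) \<in> EB_class T" and V: "cyl_field T V" and M: "cyl_field T M"
    and sym: "\<And>p. p \<in> slab T \<Longrightarrow> symmetric (M p)"
    and test: "\<And>E B. (E, B) \<in> test_fields T \<Longrightarrow>
      (LINT p:cylinder T|lborel. (\<Sum>i\<in>UNIV. \<Sum>j\<in>UNIV. M p $ i $ j * B p $ i $ j) + (\<Sum>i\<in>UNIV. V p $ i * E p $ i)) = 0"
  shows "pairing T E B V M = 0"
proof -
  have mp: "(E, B) \<in> measure_pairs T" using EB unfolding EB_class_def by blast
  define a where "a m \<theta> i j s = coef m (\<theta> - pi / 2) (\<lambda>x. M (s, x) $ i $ j)" for m \<theta> i j s
  have ca: "continuous_on {0..T} (a m \<theta> i j)" for m \<theta> i j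
    unfolding a_def using cyl_field_component2[OF M] by (intro continuous_on_time_coef) (simp add: cyl_fun_def)
  have cq: "continuous_on {0..T} (\<lambda>t. integral {0..t} (a m \<theta> i j))" for m \<theta> i j
    unfolding continuous_on_eq_continuous_within using has_vector_derivative_continuous[OF integral_has_vector_derivative[OF ca]] by blast
  \<comment> \<open>\<open>MM\<close> collects the Fourier amplitudes of \<open>M\<close> for one
    frequency and phase, split into \<open>sym_unit\<close> terms; \<open>VV\<close> is the velocity
    that \<open>EB_wave\<close> attaches to each term.\<close>
  define VV where "VV m \<theta> = (\<lambda>z. \<Sum>pq\<in>UNIV. twave (\<lambda>t. integral {0..t} (a m \<theta> (fst pq) (snd pq))) m \<theta> (- (\<chi> k. symb m k (fst pq) (snd pq))) z)" for m \<theta>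
  define MM where "MM m \<theta> = (\<lambda>z. \<Sum>pq\<in>UNIV. twave (a m \<theta> (fst pq) (snd pq)) m (\<theta> - pi / 2) (sym_unit (fst pq) (snd pq)) z)" for m \<theta>
  have fV: "cyl_field T (VV m \<theta>)" for m \<theta> unfolding VV_def by (intro cyl_field_sum twave_field cq)
  have fM: "cyl_field T (MM m \<theta>)" for m \<theta> unfolding MM_def by (intro cyl_field_sum twave_field ca)
  have zero: "pairing T E B (VV m \<theta>) (MM m \<theta>) = 0" for m \<theta>
    unfolding VV_def MM_def
    by (subst pairing_sum[OF mp]) (auto intro!: twave_field cq ca sum.neutral EB_wave[OF T EB])
  \<comment> \<open>The link to the given field: by \<open>mode_identity\<close> the integrated
    amplitudes of \<open>M\<close> are the Fourier coefficients of \<open>V\<close>.\<close>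
  have VV: "VV m \<theta> (t, x) $ k = coef m \<theta> (\<lambda>x. V (t, x) $ k) * wave m \<theta> x" if t: "t \<in> {0..T}" for m \<theta> t x k
  proof -
    have "VV m \<theta> (t, x) $ k = - (\<Sum>pq\<in>UNIV. symb m k (fst pq) (snd pq) * integral {0..t} (a m \<theta> (fst pq) (snd pq))) * wave m \<theta> x"
      by (simp add: VV_def twave_def sum_distrib_left sum_negf mult_ac)
    also have "(\<Sum>pq\<in>UNIV. symb m k (fst pq) (snd pq) * integral {0..t} (a m \<theta> (fst pq) (snd pq))) =
        (\<Sum>i\<in>UNIV. \<Sum>j\<in>UNIV. symb m k i j * integral {0..t} (a m \<theta> i j))"
      by (rule sum_UNIV_pairs)
    also have "- \<dots> = coef m \<theta> (\<lambda>x. V (t, x) $ k)"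
      unfolding a_def by (rule mode_identity[OF T V M test t, symmetric])
    finally show ?thesis .
  qed
  have MM: "MM m \<theta> (t, x) $ i $ j = coef m (\<theta> - pi / 2) (\<lambda>x. M (t, x) $ i $ j) * wave m (\<theta> - pi / 2) x"
    if t: "t \<in> {0..T}" for m \<theta> t x i j
  proof -
    define A where "A = (\<chi> i j. a m \<theta> i j t)"
    have "M (t, x) $ j $ i = M (t, x) $ i $ j" for x i j
      using sym[of "(t, x)"] t by (auto simp: slab_def symmetric_def transpose_def vec_eq_iff)
    hence "symmetric A" by (simp add: A_def a_def symmetric_def transpose_def vec_eq_iff)
    have "MM m \<theta> (t, x) = wave m (\<theta> - pi / 2) x *\<^sub>R (\<Sum>pq\<in>UNIV. A $ fst pq $ snd pq *\<^sub>R sym_unit (fst pq) (snd pq))"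
      by (simp add: MM_def twave_def A_def scaleR_sum_right mult.commute)
    also have "\<dots> = wave m (\<theta> - pi / 2) x *\<^sub>R A" using symmetric_expand[OF \<open>symmetric A\<close>] by simp
    finally show ?thesis by (simp add: A_def a_def)
  qed
  \<comment> \<open>The Fejer means of all components at once, assembled from pairs that are already
    annihilated.\<close>
  define FV where "FV N = (\<lambda>z. inverse (real (N ^ CARD('n))) *\<^sub>R (\<Sum>k\<in>box_set N. \<Sum>l\<in>box_set N. VV (\<lambda>i. k i - l i) 0 z + VV (\<lambda>i. k i - l i) (pi / 2) z))" for N :: nat
  define FM where "FM N = (\<lambda>z. inverse (real (N ^ CARD('n))) *\<^sub>R (\<Sum>k\<in>box_set N. \<Sum>l\<in>box_set N. MM (\<lambda>i. k i - l i) 0 z + MM (\<lambda>i. k i - l i) (pi / 2) z))" for N :: nat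
  have fF: "cyl_field T (FV N)" "cyl_field T (FM N)" for N
    unfolding FV_def FM_def by (intro cyl_field_scaleR cyl_field_sum cyl_field_add fV fM)+
  have zeroF: "pairing T E B (FV N) (FM N) = 0" for N
  proof -
    have 1: "pairing T E B (\<lambda>z. VV m 0 z + VV m (pi / 2) z) (\<lambda>z. MM m 0 z + MM m (pi / 2) z) = 0" for m
      using pairing_add[OF mp fV fV fM fM, of m 0 m "pi / 2"] zero by simp
    have 2: "pairing T E B (\<lambda>z. \<Sum>l\<in>box_set N. VV (\<lambda>i. k i - l i) 0 z + VV (\<lambda>i. k i - l i) (pi / 2) z)
        (\<lambda>z. \<Sum>l\<in>box_set N. MM (\<lambda>i. k i - l i) 0 z + MM (\<lambda>i. k i - l i) (pi / 2) z) = 0" for k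
      by (subst pairing_sum[OF mp finite_box_set]) (intro cyl_field_add fV fM sum.neutral ballI 1)+
    have 3: "pairing T E B (\<lambda>z. \<Sum>k\<in>box_set N. \<Sum>l\<in>box_set N. VV (\<lambda>i. k i - l i) 0 z + VV (\<lambda>i. k i - l i) (pi / 2) z)
        (\<lambda>z. \<Sum>k\<in>box_set N. \<Sum>l\<in>box_set N. MM (\<lambda>i. k i - l i) 0 z + MM (\<lambda>i. k i - l i) (pi / 2) z) = 0"
      by (subst pairing_sum[OF mp finite_box_set]) (intro cyl_field_sum cyl_field_add fV fM sum.neutral ballI 2)+
    show ?thesis unfolding FV_def FM_def
      by (subst pairing_scaleR[OF mp]) (intro cyl_field_sum cyl_field_add fV fM | simp add: 3)+
  qed
  have FV: "FV N (t, x) $ k = fejer N (\<lambda>x. V (t, x) $ k) x" if t: "t \<in> {0..T}" for N t x k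
  proof -
    have c: "continuous_on closed_cell (\<lambda>x. V (t, x) $ k)" using cyl_field_slice(1)[OF V t] by (intro continuous_intros)
    have "VV m 0 (t, x) $ k + VV m (pi / 2) (t, x) $ k = mode m (\<lambda>x. V (t, x) $ k) x" for m
      unfolding coef_mode_split(1)[OF c] VV[OF t] ..
    thus ?thesis by (simp only: fejer_def FV_def divide_inverse_commute vector_scaleR_component sum_component vector_add_component real_scaleR_def)
  qed
  have FM: "FM N (t, x) $ i $ j = fejer N (\<lambda>x. M (t, x) $ i $ j) x" if t: "t \<in> {0..T}" for N t x i j
  proof -
    have c: "continuous_on closed_cell (\<lambda>x. M (t, x) $ i $ j)" using cyl_field_slice(1)[OF M t] by (intro continuous_intros)
    have "MM m 0 (t, x) $ i $ j + MM m (pi / 2) (t, x) $ i $ j = mode m (\<lambda>x. M (t, x) $ i $ j) x" for m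
      unfolding coef_mode_split(2)[OF c] MM[OF t] ..
    thus ?thesis by (simp only: fejer_def FM_def divide_inverse_commute vector_scaleR_component sum_component vector_add_component real_scaleR_def)
  qed
  obtain K where K: "K \<ge> 0" "\<And>V M c. cyl_field T V \<Longrightarrow> cyl_field T M \<Longrightarrow> c \<ge> 0 \<Longrightarrow>
      (\<And>p k. p \<in> cylinder T \<Longrightarrow> \<bar>V p $ k\<bar> \<le> c) \<Longrightarrow> (\<And>p i j. p \<in> cylinder T \<Longrightarrow> \<bar>M p $ i $ j\<bar> \<le> c) \<Longrightarrow>
      \<bar>pairing T E B V M\<bar> \<le> K * c" using pairing_bound[OF mp] by blast
  have "\<bar>pairing T E B V M\<bar> \<le> 0 + d" if d: "d > 0" for d
  proof -
    define e where "e = d / (K + 1)"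
    have e: "e > 0" using d K(1) by (simp add: e_def)
    have "\<forall>\<^sub>F N in sequentially. \<forall>k. \<forall>t\<in>{0..T}. \<forall>x\<in>cell. \<bar>fejer N (\<lambda>x. V (t, x) $ k) x - V (t, x) $ k\<bar> \<le> e"
      using fejer_uniform_limit[OF _ _ e, of T "\<lambda>p. V p $ _"] cyl_field_component[OF V]
      by (intro eventually_all_finite) (simp add: cyl_fun_def)
    moreover have "\<forall>\<^sub>F N in sequentially. \<forall>i j. \<forall>t\<in>{0..T}. \<forall>x\<in>cell. \<bar>fejer N (\<lambda>x. M (t, x) $ i $ j) x - M (t, x) $ i $ j\<bar> \<le> e"
      using fejer_uniform_limit[OF _ _ e, of T "\<lambda>p. M p $ _ $ _"] cyl_field_component2[OF M]
      by (intro eventually_all_finite) (simp add: cyl_fun_def)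
    ultimately have "\<forall>\<^sub>F N in sequentially. (\<forall>k. \<forall>t\<in>{0..T}. \<forall>x\<in>cell. \<bar>fejer N (\<lambda>x. V (t, x) $ k) x - V (t, x) $ k\<bar> \<le> e) \<and>
       (\<forall>i j. \<forall>t\<in>{0..T}. \<forall>x\<in>cell. \<bar>fejer N (\<lambda>x. M (t, x) $ i $ j) x - M (t, x) $ i $ j\<bar> \<le> e)" by (rule eventually_conj)
    from eventually_happens'[OF sequentially_bot this] obtain N where
      NV: "\<And>k t x. t \<in> {0..T} \<Longrightarrow> x \<in> cell \<Longrightarrow> \<bar>fejer N (\<lambda>x. V (t, x) $ k) x - V (t, x) $ k\<bar> \<le> e" and
      NM: "\<And>i j t x. t \<in> {0..T} \<Longrightarrow> x \<in> cell \<Longrightarrow> \<bar>fejer N (\<lambda>x. M (t, x) $ i $ j) x - M (t, x) $ i $ j\<bar> \<le> e" by blast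
    have "pairing T E B V M = pairing T E B (\<lambda>p. V p - FV N p) (\<lambda>p. M p - FM N p)"
      using pairing_diff[OF mp V fF(1) M fF(2), of N N] zeroF by simp
    also have "\<bar>\<dots>\<bar> \<le> K * e"
    proof (rule K(2)[OF cyl_field_diff[OF V fF(1)] cyl_field_diff[OF M fF(2)]])
      fix p :: "real \<times> (real ^ 'n)" assume "p \<in> cylinder T"
      then obtain t x where p: "p = (t, x)" "t \<in> {0..T}" "x \<in> cell" by (auto simp: cylinder_def)
      show "\<bar>(V p - FV N p) $ k\<bar> \<le> e" for k using NV[OF p(2,3), of k] by (simp add: p FV[OF p(2)] abs_minus_commute)
      show "\<bar>(M p - FM N p) $ i $ j\<bar> \<le> e" for i j using NM[OF p(2,3), of i j] by (simp add: p FM[OF p(2)] abs_minus_commute)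
    qed (use e in simp)
    also have "\<dots> \<le> d" using d K(1) by (simp add: e_def field_simps)
    finally show ?thesis by simp
  qed
  hence "\<bar>pairing T E B V M\<bar> \<le> 0" by (rule field_le_epsilon)
  thus ?thesis by simp
qed

section \<open>Smooth solutions of the constraint\<close>

lemma smooth_component:
  fixes f :: "'a::euclidean_space \<Rightarrow> real ^ 'n"
  assumes "derivative_unique_on S" "smooth_on S f" shows "smooth_on S (\<lambda>x. f x $ i)"
  using smooth_on_bounded_linear[OF assms(1) bounded_linear_vec_nth assms(2)] .

lemma smooth_component2:
  fixes f :: "'a::euclidean_space \<Rightarrow> real ^ 'n ^ 'm"
  assumes "derivative_unique_on S" "smooth_on S f" shows "smooth_on S (\<lambda>x. f x $ i $ j)"
proof -
  have "bounded_linear (\<lambda>A :: real ^ 'n ^ 'm. A $ i $ j)"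
    by (rule bounded_linear_compose[OF bounded_linear_vec_nth bounded_linear_vec_nth])
  from smooth_on_bounded_linear[OF assms(1) this assms(2)] show ?thesis .
qed

lemma cell_int_neg_laplacian_symmetric:
  assumes u: "smooth_on UNIV u" "periodic u" and v: "smooth_on UNIV v" "periodic v"
  shows "cell_int (\<lambda>x. neg_laplacian u x * v x) = cell_int (\<lambda>x. u x * neg_laplacian v x)"
proof -
  have ibp: "cell_int (\<lambda>x. pd i (pd i u) x * v x) = cell_int (\<lambda>x. u x * pd i (pd i v) x)" for i
    using cell_int_by_parts[OF smooth_pd[OF u(1)] periodic_pd[OF u(2)] v, of i i]
      cell_int_by_parts[OF u smooth_pd[OF v(1)] periodic_pd[OF v(2)], of i i] by simp
  have "cell_int (\<lambda>x. neg_laplacian u x * v x) = cell_int (\<lambda>x. \<Sum>i\<in>UNIV. -1 * (pd i (pd i u) x * v x))"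
    by (simp add: neg_laplacian_def sum_distrib_right sum_negf)
  also have "\<dots> = (\<Sum>i\<in>UNIV. cell_int (\<lambda>x. -1 * (pd i (pd i u) x * v x)))"
    by (intro cell_int_sum continuous_on_mult continuous_on_const continuous_on_smooth smooth_pd u v) auto
  also have "\<dots> = (\<Sum>i\<in>UNIV. cell_int (\<lambda>x. -1 * (u x * pd i (pd i v) x)))"
    unfolding cell_int_mult ibp ..
  also have "\<dots> = cell_int (\<lambda>x. \<Sum>i\<in>UNIV. -1 * (u x * pd i (pd i v) x))"
    by (intro cell_int_sum[symmetric] continuous_on_mult continuous_on_const continuous_on_smooth smooth_pd u v) auto
  also have "\<dots> = cell_int (\<lambda>x. u x * neg_laplacian v x)"
    by (simp add: neg_laplacian_def sum_distrib_left sum_negf)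
  finally show ?thesis .
qed

lemma cell_int_sum_pd_zero:
  assumes "finite I" "\<And>i. i \<in> I \<Longrightarrow> smooth_on UNIV (F i)" "\<And>i. i \<in> I \<Longrightarrow> periodic (F i)"
  shows "cell_int (\<lambda>x. \<Sum>i\<in>I. pd (d i) (F i) x) = 0"
  using assms by (subst cell_int_sum) (auto intro!: continuous_on_smooth smooth_pd simp: cell_int_pd_zero)

lemma divergence_zero_mean:
  assumes "\<And>i. smooth_on UNIV (e i)" "\<And>i. periodic (e i)"
  shows "(\<lambda>y :: real ^ 'n. \<Sum>k\<in>UNIV. pd k (e k) y) \<in> smooth_zero_mean"
  unfolding smooth_zero_mean_def mem_Collect_eq
  using assms cell_int_sum_pd_zero[of UNIV e "\<lambda>k. k"]
  by (auto intro!: smooth_sum smooth_pd periodic_sum periodic_pd)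

lemma double_divergence_zero_mean:
  assumes "\<And>i j. smooth_on UNIV (\<psi> i j)" "\<And>i j. periodic (\<psi> i j)"
  shows "(\<lambda>y :: real ^ 'n. \<Sum>i\<in>UNIV. \<Sum>j\<in>UNIV. pd i (pd j (\<psi> i j)) y) \<in> smooth_zero_mean"
  unfolding smooth_zero_mean_def mem_Collect_eq
proof (intro conjI)
  show "smooth_on UNIV (\<lambda>y :: real ^ 'n. \<Sum>i\<in>UNIV. \<Sum>j\<in>UNIV. pd i (pd j (\<psi> i j)) y)"
    by (intro smooth_sum smooth_pd assms) auto
  show "periodic (\<lambda>y :: real ^ 'n. \<Sum>i\<in>UNIV. \<Sum>j\<in>UNIV. pd i (pd j (\<psi> i j)) y)"
    by (intro periodic_sum periodic_pd assms)
  have "cell_int (\<lambda>y :: real ^ 'n. \<Sum>i\<in>UNIV. \<Sum>j\<in>UNIV. pd i (pd j (\<psi> i j)) y) =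
      (\<Sum>i\<in>UNIV. cell_int (\<lambda>y. \<Sum>j\<in>UNIV. pd i (pd j (\<psi> i j)) y))"
    by (intro cell_int_sum continuous_on_sum continuous_on_smooth smooth_pd assms) auto
  also have "\<dots> = 0"
  proof (intro sum.neutral ballI)
    show "cell_int (\<lambda>y. \<Sum>j\<in>UNIV. pd i (pd j (\<psi> i j)) y) = 0" for i
      by (rule cell_int_sum_pd_zero) (auto intro: smooth_pd periodic_pd assms)
  qed
  finally show "cell_int (\<lambda>y :: real ^ 'n. \<Sum>i\<in>UNIV. \<Sum>j\<in>UNIV. pd i (pd j (\<psi> i j)) y) = 0" .
qed

text \<open>The symmetric gradient is integrated by parts, its two halves agreeing by symmetry of
  \<open>\<psi>\<close>. With \<open>U\<close> and \<open>\<Theta>\<close> the potentials of the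
  double divergence of \<open>\<psi>\<close> and of \<open>div e\<close>, the nonlocal term is the
  integral of \<open>(-\<triangle>U) \<Theta>\<close>, hence of
  \<open>U (-\<triangle>\<Theta>) = U div e\<close>.\<close>

lemma constraint_adjoint:
  fixes \<psi> :: "'n::finite \<Rightarrow> 'n \<Rightarrow> real ^ 'n \<Rightarrow> real" and e :: "'n \<Rightarrow> real ^ 'n \<Rightarrow> real"
  assumes \<psi>: "\<And>i j. smooth_on UNIV (\<psi> i j)" "\<And>i j. periodic (\<psi> i j)" and sym: "\<And>i j. \<psi> j i = \<psi> i j"
    and e: "\<And>i. smooth_on UNIV (e i)" "\<And>i. periodic (e i)"
  shows "(\<Sum>i\<in>UNIV. \<Sum>j\<in>UNIV. cell_int (\<lambda>x. \<psi> i j x * (1/2 * (pd j (e i) x + pd i (e j) x)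
        + pd i (pd j (inv_neg_laplacian (\<lambda>y. \<Sum>k\<in>UNIV. pd k (e k) y))) x))) =
    - (\<Sum>k\<in>UNIV. cell_int (\<lambda>x. ((\<Sum>j\<in>UNIV. pd j (\<psi> k j) x)
        + pd k (inv_neg_laplacian (\<lambda>y. \<Sum>i\<in>UNIV. \<Sum>j\<in>UNIV. pd i (pd j (\<psi> i j)) y)) x) * e k x))"
proof -
  define h where "h = (\<lambda>y. \<Sum>k\<in>UNIV. pd k (e k) y)"
  define g where "g = (\<lambda>y. \<Sum>i\<in>UNIV. \<Sum>j\<in>UNIV. pd i (pd j (\<psi> i j)) y)"
  define \<Theta> where "\<Theta> = inv_neg_laplacian h"
  define U where "U = inv_neg_laplacian g"
  have h: "h \<in> smooth_zero_mean" unfolding h_def by (intro divergence_zero_mean e)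
  have g: "g \<in> smooth_zero_mean" unfolding g_def by (intro double_divergence_zero_mean \<psi>)
  have \<Theta>: "smooth_on UNIV \<Theta>" "periodic \<Theta>" "neg_laplacian \<Theta> = h"
    using inv_neg_laplacian_solves[OF h] by (auto simp: \<Theta>_def smooth_zero_mean_def)
  have U: "smooth_on UNIV U" "periodic U" "neg_laplacian U = g"
    using inv_neg_laplacian_solves[OF g] by (auto simp: U_def smooth_zero_mean_def)
  note smooth = \<psi>(1) e(1) \<Theta>(1) U(1)
  note cont = continuous_on_mult continuous_on_const continuous_on_add continuous_on_smooth smooth_pd smooth continuous_on_sum
  define a where "a i j = cell_int (\<lambda>x. \<psi> i j x * pd j (e i) x)" for i j
  have split: "cell_int (\<lambda>x. \<psi> i j x * (1/2 * (pd j (e i) x + pd i (e j) x) + pd i (pd j \<Theta>) x)) =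
      1/2 * a i j + 1/2 * a j i + cell_int (\<lambda>x. \<psi> i j x * pd i (pd j \<Theta>) x)" for i j
  proof -
    have "cell_int (\<lambda>x. \<psi> i j x * (1/2 * (pd j (e i) x + pd i (e j) x) + pd i (pd j \<Theta>) x)) =
        cell_int (\<lambda>x. (1/2 * (\<psi> i j x * pd j (e i) x) + 1/2 * (\<psi> i j x * pd i (e j) x)) + \<psi> i j x * pd i (pd j \<Theta>) x)"
      by (simp add: algebra_simps)
    also have "\<dots> = cell_int (\<lambda>x. 1/2 * (\<psi> i j x * pd j (e i) x) + 1/2 * (\<psi> i j x * pd i (e j) x)) + cell_int (\<lambda>x. \<psi> i j x * pd i (pd j \<Theta>) x)"
      by (intro cell_int_add cont)
    also have "cell_int (\<lambda>x. 1/2 * (\<psi> i j x * pd j (e i) x) + 1/2 * (\<psi> i j x * pd i (e j) x)) =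
        cell_int (\<lambda>x. 1/2 * (\<psi> i j x * pd j (e i) x)) + cell_int (\<lambda>x. 1/2 * (\<psi> i j x * pd i (e j) x))"
      by (intro cell_int_add cont)
    finally show ?thesis unfolding cell_int_mult a_def sym[of i j] .
  qed
  have 1: "a i j = - cell_int (\<lambda>x. pd j (\<psi> i j) x * e i x)" for i j
    unfolding a_def by (intro cell_int_by_parts \<psi> e)
  have 2: "cell_int (\<lambda>x. \<psi> i j x * pd i (pd j \<Theta>) x) = cell_int (\<lambda>x. pd j (pd i (\<psi> i j)) x * \<Theta> x)" for i j
    using cell_int_by_parts[OF \<psi> smooth_pd[OF \<Theta>(1)] periodic_pd[OF \<Theta>(2)], of i j i j]
      cell_int_by_parts[OF smooth_pd[OF \<psi>(1)] periodic_pd[OF \<psi>(2)] \<Theta>(1,2), of i i j j] by simp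
  have "(\<Sum>i\<in>UNIV. \<Sum>j\<in>UNIV. cell_int (\<lambda>x. \<psi> i j x * (1/2 * (pd j (e i) x + pd i (e j) x) + pd i (pd j \<Theta>) x))) =
      1/2 * (\<Sum>i\<in>UNIV. \<Sum>j\<in>UNIV. a i j) + 1/2 * (\<Sum>i\<in>UNIV. \<Sum>j\<in>UNIV. a j i) +
      (\<Sum>i\<in>UNIV. \<Sum>j\<in>UNIV. cell_int (\<lambda>x. pd j (pd i (\<psi> i j)) x * \<Theta> x))"
    unfolding split 2 by (simp add: sum.distrib sum_distrib_left)
  also have "(\<Sum>i\<in>UNIV. \<Sum>j\<in>UNIV. a j i) = (\<Sum>i\<in>UNIV. \<Sum>j\<in>UNIV. a i j)" by (rule sum.swap)
  also have "(\<Sum>i\<in>UNIV. \<Sum>j\<in>UNIV. cell_int (\<lambda>x. pd j (pd i (\<psi> i j)) x * \<Theta> x)) =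
      (\<Sum>i\<in>UNIV. \<Sum>j\<in>UNIV. cell_int (\<lambda>x. pd i (pd j (\<psi> i j)) x * \<Theta> x))"
    by (subst sum.swap) (simp only: sym)
  also have "\<dots> = (\<Sum>i\<in>UNIV. cell_int (\<lambda>x. \<Sum>j\<in>UNIV. pd i (pd j (\<psi> i j)) x * \<Theta> x))"
    by (intro sum.cong refl cell_int_sum[symmetric] cont) auto
  also have "\<dots> = cell_int (\<lambda>x. \<Sum>i\<in>UNIV. \<Sum>j\<in>UNIV. pd i (pd j (\<psi> i j)) x * \<Theta> x)"
    by (intro cell_int_sum[symmetric] cont) auto
  also have "\<dots> = cell_int (\<lambda>x. neg_laplacian U x * \<Theta> x)"
    unfolding U(3) g_def by (simp add: sum_distrib_right)
  also have "\<dots> = cell_int (\<lambda>x. U x * neg_laplacian \<Theta> x)"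
    by (intro cell_int_neg_laplacian_symmetric U \<Theta>)
  also have "\<dots> = cell_int (\<lambda>x. \<Sum>k\<in>UNIV. U x * pd k (e k) x)"
    unfolding \<Theta>(3) h_def by (simp add: sum_distrib_left)
  also have "\<dots> = (\<Sum>k\<in>UNIV. cell_int (\<lambda>x. U x * pd k (e k) x))"
    by (intro cell_int_sum cont) auto
  also have "\<dots> = (\<Sum>k\<in>UNIV. - cell_int (\<lambda>x. pd k U x * e k x))"
    by (intro sum.cong refl cell_int_by_parts U e)
  finally have L: "(\<Sum>i\<in>UNIV. \<Sum>j\<in>UNIV. cell_int (\<lambda>x. \<psi> i j x * (1/2 * (pd j (e i) x + pd i (e j) x) + pd i (pd j \<Theta>) x))) =
      - (\<Sum>k\<in>UNIV. (\<Sum>j\<in>UNIV. cell_int (\<lambda>x. pd j (\<psi> k j) x * e k x)) + cell_int (\<lambda>x. pd k U x * e k x))"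
    unfolding 1 by (simp add: sum.distrib sum_negf)
  have R: "cell_int (\<lambda>x. ((\<Sum>j\<in>UNIV. pd j (\<psi> k j) x) + pd k U x) * e k x) =
      (\<Sum>j\<in>UNIV. cell_int (\<lambda>x. pd j (\<psi> k j) x * e k x)) + cell_int (\<lambda>x. pd k U x * e k x)" for k
  proof -
    have "cell_int (\<lambda>x. ((\<Sum>j\<in>UNIV. pd j (\<psi> k j) x) + pd k U x) * e k x) =
        cell_int (\<lambda>x. (\<Sum>j\<in>UNIV. pd j (\<psi> k j) x * e k x) + pd k U x * e k x)"
      by (simp add: sum_distrib_right distrib_right)
    also have "\<dots> = cell_int (\<lambda>x. \<Sum>j\<in>UNIV. pd j (\<psi> k j) x * e k x) + cell_int (\<lambda>x. pd k U x * e k x)"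
      by (intro cell_int_add cont)
    also have "cell_int (\<lambda>x. \<Sum>j\<in>UNIV. pd j (\<psi> k j) x * e k x) = (\<Sum>j\<in>UNIV. cell_int (\<lambda>x. pd j (\<psi> k j) x * e k x))"
      by (intro cell_int_sum cont) auto
    finally show ?thesis .
  qed
  show ?thesis
    using L unfolding R[symmetric] unfolding \<Theta>_def U_def h_def g_def .
qed

text \<open>Together with \<open>EB_test_matrix\<close>, the direction whose pairing with a measure
  pair is the left-hand side of the constraint in \<open>EB_class\<close>; the minus sign comes from
  there.\<close>

definition EB_test_velocity :: "(real \<Rightarrow> real) \<Rightarrow> (real ^ 'n \<Rightarrow> real ^ 'n ^ 'n) \<Rightarrow> real \<times> (real ^ 'n) \<Rightarrow> real ^ 'n" where
  "EB_test_velocity \<zeta> \<psi> = (\<lambda>(t, x). \<chi> k. - \<zeta> t * ((\<Sum>j\<in>UNIV. pd j (\<lambda>y. \<psi> y $ k $ j) x)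
     + pd k (inv_neg_laplacian (\<lambda>y. \<Sum>i\<in>UNIV. \<Sum>j\<in>UNIV. pd i (pd j (\<lambda>z. \<psi> z $ i $ j)) y)) x))"

definition EB_test_matrix :: "real \<Rightarrow> (real \<Rightarrow> real) \<Rightarrow> (real ^ 'n \<Rightarrow> real ^ 'n ^ 'n) \<Rightarrow> real \<times> (real ^ 'n) \<Rightarrow> real ^ 'n ^ 'n" where
  "EB_test_matrix T \<zeta> \<psi> = (\<lambda>(t, x). vector_derivative \<zeta> (at t within {0..T}) *\<^sub>R \<psi> x)"

lemma smooth_on_Icc_derivative:
  fixes \<zeta> :: "real \<Rightarrow> real"
  assumes T: "T > 0" and \<zeta>: "smooth_on {0..T} \<zeta>"
  shows "t \<in> {0..T} \<Longrightarrow> (\<zeta> has_vector_derivative vector_derivative \<zeta> (at t within {0..T})) (at t within {0..T})"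
    and "continuous_on {0..T} (\<lambda>t. vector_derivative \<zeta> (at t within {0..T}))"
proof -
  define D where "D t = frechet_derivative \<zeta> (at t within {0..T}) 1" for t
  have D: "(\<zeta> has_vector_derivative D t) (at t within {0..T})" if "t \<in> {0..T}" for t
  proof -
    note d = smooth_on_has_derivative[OF \<zeta> that]
    interpret linear "frechet_derivative \<zeta> (at t within {0..T})" using d by (rule has_derivative_linear)
    have "frechet_derivative \<zeta> (at t within {0..T}) h = h *\<^sub>R D t" for h
      using scale[of h 1] by (simp add: D_def)
    hence "frechet_derivative \<zeta> (at t within {0..T}) = (\<lambda>h. h *\<^sub>R D t)" by (rule ext)
    thus ?thesis using d unfolding has_vector_derivative_def by (simp only:)
  qed
  have eq: "vector_derivative \<zeta> (at t within {0..T}) = D t" if "t \<in> {0..T}" for t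
    by (rule vector_derivative_within_closed_interval[OF T that D[OF that]])
  show "t \<in> {0..T} \<Longrightarrow> (\<zeta> has_vector_derivative vector_derivative \<zeta> (at t within {0..T})) (at t within {0..T})"
    using D eq by simp
  have "continuous_on {0..T} D"
    unfolding D_def using smooth_on_continuous[OF smooth_on_derivative[OF \<zeta>, of 1]] by simp
  thus "continuous_on {0..T} (\<lambda>t. vector_derivative \<zeta> (at t within {0..T}))"
    by (rule continuous_on_eq) (rule eq[symmetric])
qed

lemma cyl_fun_product:
  assumes a: "continuous_on {0..T} a" and f: "smooth_on UNIV f" "periodic f"
  shows "(\<lambda>p :: real \<times> (real ^ 'n). a (fst p) * f (snd p)) \<in> cyl_fun T"
proof -
  have "continuous_on (slab T) (\<lambda>p :: real \<times> (real ^ 'n). a (fst p) * f (snd p))"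
    by (intro continuous_on_mult continuous_on_compose2[OF a] continuous_on_compose2[OF smooth_on_continuous[OF f(1)]])
       (auto simp: slab_def intro!: continuous_intros)
  thus ?thesis using f(2) by (simp add: cyl_fun_def space_periodic_def periodic_def)
qed

section \<open>Directions given by smooth test pairs\<close>

context
  fixes T :: real and \<zeta> :: "real \<Rightarrow> real" and \<psi> :: "real ^ 'n \<Rightarrow> real ^ 'n ^ 'n"
  assumes T: "T > 0" and \<zeta>: "smooth_on {0..T} \<zeta>" and \<zeta>0: "\<zeta> 0 = 0"
    and \<psi>: "smooth_on UNIV \<psi>" "periodic \<psi>" "\<And>x. symmetric (\<psi> x)"
begin

lemma EB_test_components: "smooth_on UNIV (\<lambda>x. \<psi> x $ i $ j)" "periodic (\<lambda>x. \<psi> x $ i $ j)" "(\<lambda>x. \<psi> x $ j $ i) = (\<lambda>x. \<psi> x $ i $ j)"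
  using smooth_component2[OF derivative_unique_on_UNIV \<psi>(1)] \<psi>(2,3)
  by (auto simp: periodic_def symmetric_def transpose_def vec_eq_iff)

lemma EB_test_operator:
  "smooth_on UNIV (\<lambda>x. (\<Sum>j\<in>UNIV. pd j (\<lambda>y. \<psi> y $ k $ j) x)
     + pd k (inv_neg_laplacian (\<lambda>y. \<Sum>i\<in>UNIV. \<Sum>j\<in>UNIV. pd i (pd j (\<lambda>z. \<psi> z $ i $ j)) y)) x)"
  "periodic (\<lambda>x. (\<Sum>j\<in>UNIV. pd j (\<lambda>y. \<psi> y $ k $ j) x)
     + pd k (inv_neg_laplacian (\<lambda>y. \<Sum>i\<in>UNIV. \<Sum>j\<in>UNIV. pd i (pd j (\<lambda>z. \<psi> z $ i $ j)) y)) x)"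
proof -
  have "(\<lambda>y. \<Sum>i\<in>UNIV. \<Sum>j\<in>UNIV. pd i (pd j (\<lambda>z. \<psi> z $ i $ j)) y) \<in> smooth_zero_mean"
    by (intro double_divergence_zero_mean EB_test_components)
  from inv_neg_laplacian_solves(1)[OF this]
  have inv: "smooth_on UNIV (inv_neg_laplacian (\<lambda>y. \<Sum>i\<in>UNIV. \<Sum>j\<in>UNIV. pd i (pd j (\<lambda>z. \<psi> z $ i $ j)) y))"
    "periodic (inv_neg_laplacian (\<lambda>y. \<Sum>i\<in>UNIV. \<Sum>j\<in>UNIV. pd i (pd j (\<lambda>z. \<psi> z $ i $ j)) y))"
    by (auto simp: smooth_zero_mean_def)
  show "smooth_on UNIV (\<lambda>x. (\<Sum>j\<in>UNIV. pd j (\<lambda>y. \<psi> y $ k $ j) x)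
     + pd k (inv_neg_laplacian (\<lambda>y. \<Sum>i\<in>UNIV. \<Sum>j\<in>UNIV. pd i (pd j (\<lambda>z. \<psi> z $ i $ j)) y)) x)"
    by (intro smooth_add smooth_sum smooth_pd EB_test_components finite inv)
  show "periodic (\<lambda>x. (\<Sum>j\<in>UNIV. pd j (\<lambda>y. \<psi> y $ k $ j) x)
     + pd k (inv_neg_laplacian (\<lambda>y. \<Sum>i\<in>UNIV. \<Sum>j\<in>UNIV. pd i (pd j (\<lambda>z. \<psi> z $ i $ j)) y)) x)"
    by (intro periodic_add periodic_sum periodic_pd EB_test_components inv)
qed

lemma EB_test_velocity_field: "cyl_field T (EB_test_velocity \<zeta> \<psi>)"
proof -
  have "continuous_on {0..T} (\<lambda>t. - \<zeta> t)" by (intro continuous_on_minus smooth_on_continuous \<zeta>)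
  from cyl_fun_product[OF this EB_test_operator]
  show ?thesis unfolding EB_test_velocity_def case_prod_beta' by (rule cyl_field_vec)
qed

lemma EB_test_matrix_field: "cyl_field T (EB_test_matrix T \<zeta> \<psi>)"
proof -
  have "cyl_field T (\<lambda>p. \<chi> i j. vector_derivative \<zeta> (at (fst p) within {0..T}) * \<psi> (snd p) $ i $ j)"
    by (intro cyl_field_mat cyl_fun_product smooth_on_Icc_derivative T \<zeta> EB_test_components)
  moreover have "EB_test_matrix T \<zeta> \<psi> = (\<lambda>p. \<chi> i j. vector_derivative \<zeta> (at (fst p) within {0..T}) * \<psi> (snd p) $ i $ j)"
    by (auto simp: EB_test_matrix_def vec_eq_iff fun_eq_iff)
  ultimately show ?thesis by simp
qed

text \<open>The time derivative moves from \<open>\<zeta>\<close> to \<open>B\<close>, without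
  boundary terms since \<open>\<zeta> 0 = 0\<close> and \<open>B\<close> vanishes at
  \<open>T\<close>. The equation for the time derivative of \<open>B\<close> and
  \<open>constraint_adjoint\<close> then move the spatial operator from \<open>E\<close> to
  \<open>\<psi>\<close>.\<close>

lemma EB_test_constraint:
  assumes EB: "(E, B) \<in> test_fields T"
  shows "(LINT p:cylinder T|lborel. (\<Sum>i\<in>UNIV. \<Sum>j\<in>UNIV. EB_test_matrix T \<zeta> \<psi> p $ i $ j * B p $ i $ j)
      + (\<Sum>i\<in>UNIV. EB_test_velocity \<zeta> \<psi> p $ i * E p $ i)) = 0"
proof -
  define AA where "AA k x = (\<Sum>j\<in>UNIV. pd j (\<lambda>y. \<psi> y $ k $ j) x)
     + pd k (inv_neg_laplacian (\<lambda>y. \<Sum>i\<in>UNIV. \<Sum>j\<in>UNIV. pd i (pd j (\<lambda>z. \<psi> z $ i $ j)) y)) x" for k x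
  have AA: "smooth_on UNIV (AA k)" for k using EB_test_operator(1)[of k] by (simp add: AA_def[abs_def])
  define z' where "z' t = vector_derivative \<zeta> (at t within {0..T})" for t
  note dz = smooth_on_Icc_derivative[OF T \<zeta>, folded z'_def]
  have cz: "continuous_on {0..T} \<zeta>" by (rule smooth_on_continuous[OF \<zeta>])
  have E: "smooth_on (slab T) E" "space_periodic T E" and B: "smooth_on (slab T) B" and BT: "\<And>x. B (T, x) = 0"
    and dB: "\<And>t x i j. t \<in> {0..T} \<Longrightarrow> vector_derivative (\<lambda>s. B (s, x) $ i $ j) (at t within {0..T}) =
          1/2 * (pd j (\<lambda>y. E (t, y) $ i) x + pd i (\<lambda>y. E (t, y) $ j) x)
          + pd i (pd j (inv_neg_laplacian (\<lambda>y. \<Sum>k\<in>UNIV. pd k (\<lambda>z. E (t, z) $ k) y))) x"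
    using EB unfolding test_fields_def by auto
  note uniq = derivative_unique_on_slab[OF T]
  have Bc: "smooth_on (slab T) (\<lambda>p. B p $ i $ j)" for i j by (rule smooth_component2[OF uniq B])
  \<comment> \<open>The time derivative of \<open>B\<close> taken within the slab; as a partial
    derivative of a smooth field it is continuous up to both end times.\<close>
  define D where "D i j p = frechet_derivative (\<lambda>p. B p $ i $ j) (at p within slab T) (1, 0)" for i j p
  have cD: "continuous_on (slab T) (D i j)" for i j
    unfolding D_def by (intro smooth_on_continuous smooth_on_derivative Bc) (simp add: Basis_prod_def)
  have DB: "((\<lambda>s. B (s, x) $ i $ j) has_vector_derivative D i j (t, x)) (at t within {0..T})" if "t \<in> {0..T}" for t x i j
    unfolding D_def by (rule slab_time_derivative[OF Bc that])
  have D_eq: "D i j (t, x) = 1/2 * (pd j (\<lambda>y. E (t, y) $ i) x + pd i (\<lambda>y. E (t, y) $ j) x)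
          + pd i (pd j (inv_neg_laplacian (\<lambda>y. \<Sum>k\<in>UNIV. pd k (\<lambda>z. E (t, z) $ k) y))) x" if "t \<in> {0..T}" for t x i j
    using dB[OF that] vector_derivative_within_closed_interval[OF T that DB[OF that]] by simp
  have cE: "continuous_on (slab T) E" and cB: "continuous_on (slab T) B" using E B smooth_on_continuous by auto
  have st: "continuous_on (slab T) (\<lambda>p. a (fst p))" if "continuous_on {0..T} a" for a :: "real \<Rightarrow> real"
    by (rule continuous_on_compose2[OF that]) (auto simp: slab_def intro!: continuous_intros)
  have sx: "continuous_on (slab T) (\<lambda>p. f (snd p))" if "smooth_on UNIV f" for f :: "real ^ 'n \<Rightarrow> real"
    by (rule continuous_on_compose2[OF smooth_on_continuous[OF that]]) (auto intro!: continuous_intros)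
  \<comment> \<open>\<open>F1\<close> pairs \<open>\<zeta>' \<psi>\<close> with \<open>B\<close>,
    \<open>F2\<close> pairs \<open>\<zeta>\<close> times the operator on \<open>\<psi>\<close> with
    \<open>E\<close>, and \<open>F3\<close> pairs \<open>\<zeta> \<psi>\<close> with the time
    derivative of \<open>B\<close>. The integrals of \<open>F1\<close> and \<open>F2\<close> agree
    because each is minus that of \<open>F3\<close>.\<close>
  define F1 where "F1 p = z' (fst p) * (\<Sum>i\<in>UNIV. \<Sum>j\<in>UNIV. \<psi> (snd p) $ i $ j * B p $ i $ j)" for p
  define F2 where "F2 p = \<zeta> (fst p) * (\<Sum>k\<in>UNIV. AA k (snd p) * E p $ k)" for p
  define F3 where "F3 p = \<zeta> (fst p) * (\<Sum>i\<in>UNIV. \<Sum>j\<in>UNIV. \<psi> (snd p) $ i $ j * D i j p)" for p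
  have c1: "continuous_on (slab T) F1"
    unfolding F1_def using cB by (intro continuous_on_mult continuous_on_sum st dz sx EB_test_components continuous_on_component)
  have c2: "continuous_on (slab T) F2"
    unfolding F2_def using cE by (intro continuous_on_mult continuous_on_sum st cz sx AA continuous_on_component)
  have c3: "continuous_on (slab T) F3"
    unfolding F3_def by (intro continuous_on_mult continuous_on_sum st cz sx EB_test_components cD)
  have sliceB: "continuous_on {0..T} (\<lambda>t. f (t, x))" if "continuous_on (slab T) f" for f :: "real \<times> (real ^ 'n) \<Rightarrow> real" and x
    by (rule continuous_on_compose2[OF that]) (auto simp: slab_def intro!: continuous_intros)
  have sliceX: "continuous_on closed_cell (\<lambda>x. f (t, x))" if "continuous_on (slab T) f" "t \<in> {0..T}" for f :: "real \<times> (real ^ 'n) \<Rightarrow> real" and t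
    by (rule continuous_on_compose2[OF that(1)]) (use that(2) in \<open>auto simp: slab_def intro!: continuous_intros\<close>)
  have "(LINT p:cylinder T|lborel. F1 p) = cell_int (\<lambda>x. LINT t:{0..T}|lborel. F1 (t, x))"
    by (rule cyl_int_Fubini(2)[OF c1])
  also have "\<dots> = cell_int (\<lambda>x. - (LINT t:{0..T}|lborel. F3 (t, x)))"
  proof (rule cell_int_cong)
    fix x :: "real ^ 'n"
    define G where "G t = (\<Sum>i\<in>UNIV. \<Sum>j\<in>UNIV. \<psi> x $ i $ j * B (t, x) $ i $ j)" for t
    define G' where "G' t = (\<Sum>i\<in>UNIV. \<Sum>j\<in>UNIV. \<psi> x $ i $ j * D i j (t, x))" for t
    have "(LINT t:{0..T}|lborel. z' t * G t) = \<zeta> T * G T - \<zeta> 0 * G 0 - (LINT t:{0..T}|lborel. \<zeta> t * G' t)"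
    proof (rule time_int_by_parts)
      show "(G has_vector_derivative G' t) (at t within {0..T})" if "t \<in> {0..T}" for t
        unfolding G_def G'_def by (intro has_vector_derivative_sum has_vector_derivative_mult_right DB that)
      show "continuous_on {0..T} G'"
        unfolding G'_def by (intro continuous_on_sum continuous_on_mult continuous_on_const sliceB cD)
    qed (use T dz in auto)
    moreover have "G T = 0" by (simp add: G_def BT)
    ultimately show "(LINT t:{0..T}|lborel. F1 (t, x)) = - (LINT t:{0..T}|lborel. F3 (t, x))"
      by (simp add: F1_def F3_def G_def G'_def \<zeta>0)
  qed
  also have "\<dots> = - cell_int (\<lambda>x. LINT t:{0..T}|lborel. F3 (t, x))"
    using cell_int_mult[of "-1" "\<lambda>x. LINT t:{0..T}|lborel. F3 (t, x)"] by simp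
  also have "\<dots> = - (LINT t:{0..T}|lborel. cell_int (\<lambda>x. F3 (t, x)))"
    using cyl_int_Fubini[OF c3] by simp
  also have "(LINT t:{0..T}|lborel. cell_int (\<lambda>x. F3 (t, x))) = (LINT t:{0..T}|lborel. - cell_int (\<lambda>x. F2 (t, x)))"
  proof (rule set_lebesgue_integral_cong)
    show "\<forall>t. t \<in> {0..T} \<longrightarrow> cell_int (\<lambda>x. F3 (t, x)) = - cell_int (\<lambda>x. F2 (t, x))"
    proof (intro allI impI)
      fix t assume t: "t \<in> {0..T}"
      have e: "smooth_on UNIV (\<lambda>y. E (t, y) $ i)" "periodic (\<lambda>y. E (t, y) $ i)" for i
        using smooth_on_slice[OF smooth_component[OF uniq E(1)] t, of i] E(2) t
        by (auto simp: space_periodic_def periodic_def)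
      have "cell_int (\<lambda>x. F3 (t, x)) = \<zeta> t * cell_int (\<lambda>x. \<Sum>i\<in>UNIV. \<Sum>j\<in>UNIV. \<psi> x $ i $ j * D i j (t, x))"
        unfolding F3_def by simp
      also have "cell_int (\<lambda>x. \<Sum>i\<in>UNIV. \<Sum>j\<in>UNIV. \<psi> x $ i $ j * D i j (t, x)) =
          (\<Sum>i\<in>UNIV. cell_int (\<lambda>x. \<Sum>j\<in>UNIV. \<psi> x $ i $ j * D i j (t, x)))"
        by (intro cell_int_sum continuous_on_sum continuous_on_mult sliceX cD t continuous_on_smooth EB_test_components) auto
      also have "\<dots> = (\<Sum>i\<in>UNIV. \<Sum>j\<in>UNIV. cell_int (\<lambda>x. \<psi> x $ i $ j * D i j (t, x)))"
        by (intro sum.cong refl cell_int_sum continuous_on_mult sliceX cD t continuous_on_smooth EB_test_components) auto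
      also have "\<dots> = - (\<Sum>k\<in>UNIV. cell_int (\<lambda>x. AA k x * E (t, x) $ k))"
        unfolding D_eq[OF t] AA_def
        by (rule constraint_adjoint) (rule EB_test_components e)+
      also have "(\<Sum>k\<in>UNIV. cell_int (\<lambda>x. AA k x * E (t, x) $ k)) = cell_int (\<lambda>x. \<Sum>k\<in>UNIV. AA k x * E (t, x) $ k)"
        by (intro cell_int_sum[symmetric] continuous_on_mult continuous_on_smooth AA e) auto
      finally show "cell_int (\<lambda>x. F3 (t, x)) = - cell_int (\<lambda>x. F2 (t, x))" by (simp add: F2_def)
    qed
  qed simp
  also have "- \<dots> = (LINT t:{0..T}|lborel. cell_int (\<lambda>x. F2 (t, x)))" by (simp add: set_lebesgue_integral_def)
  also have "\<dots> = (LINT p:cylinder T|lborel. F2 p)" by (rule cyl_int_Fubini(1)[OF c2, symmetric])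
  finally have "(LINT p:cylinder T|lborel. F1 p) - (LINT p:cylinder T|lborel. F2 p) = 0" by simp
  moreover have "(LINT p:cylinder T|lborel. F1 p) - (LINT p:cylinder T|lborel. F2 p) = (LINT p:cylinder T|lborel. F1 p - F2 p)"
    by (intro set_integral_diff(2)[symmetric] cyl_integrable c1 c2)
  moreover have "F1 p - F2 p = (\<Sum>i\<in>UNIV. \<Sum>j\<in>UNIV. EB_test_matrix T \<zeta> \<psi> p $ i $ j * B p $ i $ j)
      + (\<Sum>i\<in>UNIV. EB_test_velocity \<zeta> \<psi> p $ i * E p $ i)" for p
    by (simp add: F1_def F2_def EB_test_matrix_def EB_test_velocity_def AA_def z'_def case_prod_beta'
        sum_distrib_left sum_negf mult_ac)
  ultimately show ?thesis by simp
qed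

end

section \<open>Representation of functionals on pairs of fields\<close>

lemma vector_measure_vec:
  fixes \<nu> :: "'n::finite \<Rightarrow> 'a set \<Rightarrow> 'b::real_normed_vector"
  assumes "\<And>k. vector_measure N (\<nu> k)"
  shows "vector_measure N (\<lambda>A. \<chi> k. \<nu> k A)"
  unfolding vector_measure_def
proof (intro conjI allI impI)
  show "(\<chi> k. \<nu> k {}) = 0" using assms by (simp add: vector_measure_def vec_eq_iff)
  have "\<exists>C. \<forall>A\<in>sets N. norm (\<nu> k A) \<le> C" for k
    using assms[of k] by (auto simp: vector_measure_def bounded_iff)
  then obtain C where C: "\<And>k A. A \<in> sets N \<Longrightarrow> norm (\<nu> k A) \<le> C k" by metis
  have "norm (\<chi> k. \<nu> k A) \<le> (\<Sum>k\<in>UNIV. C k)" if "A \<in> sets N" for A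
  proof -
    have "norm (\<chi> k. \<nu> k A) \<le> (\<Sum>k\<in>UNIV. norm (\<nu> k A))"
      unfolding norm_vec_def using L2_set_le_sum[of UNIV "\<lambda>k. norm (\<nu> k A)"] by simp
    also have "\<dots> \<le> (\<Sum>k\<in>UNIV. C k)" by (intro sum_mono C that)
    finally show ?thesis .
  qed
  thus "bounded ((\<lambda>A. \<chi> k. \<nu> k A) ` sets N)" by (auto simp: bounded_iff)
  fix A :: "nat \<Rightarrow> 'a set" assume A: "range A \<subseteq> sets N" "disjoint_family A"
  have "(\<lambda>n. \<nu> k (A n)) sums \<nu> k (\<Union>n. A n)" for k using assms[of k] A by (simp add: vector_measure_def)
  thus "(\<lambda>n. \<chi> k. \<nu> k (A n)) sums (\<chi> k. \<nu> k (\<Union>n. A n))"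
    unfolding sums_def by (intro vec_tendstoI) (simp add: sum_component)
qed

text \<open>
  Constant extension in time turns fields on \<open>slab T\<close> into elements of a normed space of bounded
  continuous functions.
\<close>

definition clamp_time :: "real \<Rightarrow> real \<times> 'a \<Rightarrow> real \<times> 'a" where
  "clamp_time T p = (max 0 (min T (fst p)), snd p)"

definition clamped :: "real \<Rightarrow> (real \<times> (real ^ 'n) \<Rightarrow> 'b) \<Rightarrow> (real \<times> (real ^ 'n)) \<Rightarrow>\<^sub>C 'b::real_normed_vector" where
  "clamped T f = Bcontfun (\<lambda>p. f (clamp_time T p))"

lemma clamp_time_slab: "T \<ge> 0 \<Longrightarrow> clamp_time T p \<in> slab T"
  and clamp_time_id: "p \<in> slab T \<Longrightarrow> clamp_time T p = p"
  by (auto simp: clamp_time_def slab_def)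

lemma apply_clamped:
  assumes T: "T \<ge> 0" and f: "cyl_field T f"
  shows "apply_bcontfun (clamped T f) p = f (clamp_time T p)"
proof -
  obtain C where C: "\<And>p. p \<in> slab T \<Longrightarrow> norm (f p) \<le> C"
    using f cyl_fun_bounded unfolding cyl_field_def by blast
  have "continuous_on UNIV (\<lambda>p. f (clamp_time T p))"
    by (rule continuous_on_compose2[of "slab T" f])
       (use f clamp_time_slab[OF T] in \<open>auto simp: cyl_field_def clamp_time_def intro!: continuous_intros\<close>)
  hence "(\<lambda>p. f (clamp_time T p)) \<in> bcontfun"
    by (rule bcontfun_normI) (rule C[OF clamp_time_slab[OF T]])
  thus ?thesis by (simp add: clamped_def Bcontfun_inverse)
qed

lemma clamped_add: "T \<ge> 0 \<Longrightarrow> cyl_field T f \<Longrightarrow> cyl_field T g \<Longrightarrow> clamped T (\<lambda>p. f p + g p) = clamped T f + clamped T g"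
  by (rule bcontfun_eqI) (simp add: apply_clamped cyl_field_add plus_bcontfun.rep_eq)

lemma clamped_scaleR: "T \<ge> 0 \<Longrightarrow> cyl_field T f \<Longrightarrow> clamped T (\<lambda>p. c *\<^sub>R f p) = c *\<^sub>R clamped T f"
  by (rule bcontfun_eqI) (simp add: apply_clamped cyl_field_scaleR)

lemma cyl_field_const: "cyl_field T (\<lambda>p. c)"
  by (simp add: cyl_field_def space_periodic_def periodic_def)

lemma clamped_sum:
  assumes T: "T \<ge> 0" and "finite I" "\<And>i. i \<in> I \<Longrightarrow> cyl_field T (f i)"
  shows "clamped T (\<lambda>p. \<Sum>i\<in>I. f i p) = (\<Sum>i\<in>I. clamped T (f i))"
  using assms(2,3)
proof (induction I rule: finite_induct)
  case empty
  show ?case by (rule bcontfun_eqI) (simp add: apply_clamped[OF T cyl_field_const])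
next
  case (insert i I)
  thus ?case using clamped_add[OF T, of "f i" "\<lambda>p. \<Sum>i\<in>I. f i p"] cyl_field_sum[of I T f] by simp
qed

lemma cyl_field_Pair: "cyl_field T V \<Longrightarrow> cyl_field T M \<Longrightarrow> cyl_field T (\<lambda>p. (V p, M p))"
  by (auto simp: cyl_field_def space_periodic_def periodic_def intro!: continuous_intros)

lemma cyl_field_scaleR_const: "h \<in> cyl_fun T \<Longrightarrow> cyl_field T (\<lambda>p. h p *\<^sub>R w)" for w :: "'b::real_normed_vector"
  by (auto simp: cyl_fun_def cyl_field_def space_periodic_def periodic_def intro!: continuous_intros)

text \<open>On fields with values along one fixed vector \<open>w\<close> the functional depends on
  a scalar function, so the scalar representation applies.\<close>

lemma clamped_functional_measure:
  fixes f :: "(real \<times> (real ^ 'n)) \<Rightarrow>\<^sub>C 'b::real_normed_vector \<Rightarrow> real"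
  assumes T: "T > 0" and f: "linear f" "\<And>u. \<bar>f u\<bar> \<le> K * norm u"
  shows "\<exists>\<nu>. vector_measure (cyl_borel T) \<nu> \<and> (\<forall>h\<in>cyl_fun T. cyl_integral T \<nu> h = f (clamped T (\<lambda>p. h p *\<^sub>R w)))"
proof -
  interpret f: linear f by fact
  have T0: "T \<ge> 0" using T by simp
  \<comment> \<open>Replacing \<open>K\<close> by its positive part makes the bound monotone in the
    norm.\<close>
  have K': "\<bar>f u\<bar> \<le> max K 0 * norm u" for u using f(2)[of u] by (smt (verit) mult_right_mono norm_ge_zero)
  show ?thesis
  proof (rule cyl_functional_representation[of T "\<lambda>h. f (clamped T (\<lambda>p. h p *\<^sub>R w))" "max K 0 * norm w"])
    fix h g :: "real \<times> (real ^ 'n) \<Rightarrow> real" and c :: real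
    assume h: "h \<in> cyl_fun T"
    show "f (clamped T (\<lambda>p. (c * h p) *\<^sub>R w)) = c * f (clamped T (\<lambda>p. h p *\<^sub>R w))"
      using clamped_scaleR[OF T0 cyl_field_scaleR_const[OF h, of w], of c] f.scale by simp
    show "\<bar>f (clamped T (\<lambda>p. h p *\<^sub>R w))\<bar> \<le> max K 0 * norm w * c" if c: "\<And>x. x \<in> cylinder T \<Longrightarrow> \<bar>h x\<bar> \<le> c"
    proof -
      have "norm (clamped T (\<lambda>p. h p *\<^sub>R w)) \<le> c * norm w"
      proof (rule norm_bound)
        fix p
        obtain q where q: "q \<in> cylinder T" "\<And>g :: real \<times> (real ^ 'n) \<Rightarrow> real. space_periodic T g \<Longrightarrow> g q = g (clamp_time T p)"
          using space_periodic_representative[OF clamp_time_slab[OF T0]] by metis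
        have "h (clamp_time T p) = h q" using q(2)[of h] h by (simp add: cyl_fun_def)
        thus "norm (apply_bcontfun (clamped T (\<lambda>p. h p *\<^sub>R w)) p) \<le> c * norm w"
          using c[OF q(1)] by (simp add: apply_clamped[OF T0 cyl_field_scaleR_const[OF h]] mult_right_mono)
      qed
      hence "max K 0 * norm (clamped T (\<lambda>p. h p *\<^sub>R w)) \<le> max K 0 * (c * norm w)" by (intro mult_left_mono) auto
      with K'[of "clamped T (\<lambda>p. h p *\<^sub>R w)"] show ?thesis by (simp add: mult_ac)
    qed
    assume g: "g \<in> cyl_fun T"
    show "f (clamped T (\<lambda>p. (h p + g p) *\<^sub>R w)) = f (clamped T (\<lambda>p. h p *\<^sub>R w)) + f (clamped T (\<lambda>p. g p *\<^sub>R w))"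
      using clamped_add[OF T0 cyl_field_scaleR_const[OF h, of w] cyl_field_scaleR_const[OF g, of w]] f.add
      by (simp add: scaleR_add_left)
  qed blast
qed

text \<open>One scalar measure is taken for each basis vector and each symmetrised matrix unit. The
  units make \<open>B\<close> symmetric, and as they expand symmetric matrices, the formula holds
  for symmetric \<open>M\<close>.\<close>

lemma clamped_functional_representation:
  fixes f :: "(real \<times> (real ^ 'n)) \<Rightarrow>\<^sub>C ((real ^ 'n) \<times> (real ^ 'n ^ 'n)) \<Rightarrow> real"
  assumes T: "T > 0" and f: "linear f" "\<And>u. \<bar>f u\<bar> \<le> K * norm u"
  obtains E B where "(E, B) \<in> measure_pairs T"
    "\<And>V M. cyl_field T V \<Longrightarrow> cyl_field T M \<Longrightarrow> (\<And>p. p \<in> slab T \<Longrightarrow> symmetric (M p)) \<Longrightarrow>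
      pairing T E B V M = f (clamped T (\<lambda>p. (V p, M p)))"
proof -
  interpret f: linear f by fact
  have T0: "T \<ge> 0" using T by simp
  obtain \<nu> where \<nu>: "\<And>w. vector_measure (cyl_borel T) (\<nu> w)"
    "\<And>w h. h \<in> cyl_fun T \<Longrightarrow> cyl_integral T (\<nu> w) h = f (clamped T (\<lambda>p. h p *\<^sub>R w))"
    using clamped_functional_measure[OF T f] by metis
  define E where "E A = (\<chi> k. \<nu> (axis k 1, 0) A)" for A
  define B where "B A = (\<chi> i j. \<nu> (0, sym_unit i j) A)" for A
  have s: "sym_unit i j = sym_unit j i" for i j :: 'n by (simp add: sym_unit_def vec_eq_iff add.commute)
  show ?thesis
  proof
    have "symmetric (B A)" for A by (simp only: B_def symmetric_def transpose_def vec_lambda_beta s)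
    thus "(E, B) \<in> measure_pairs T"
      unfolding measure_pairs_def E_def[abs_def] B_def[abs_def] by (simp add: vector_measure_vec \<nu>)
    fix V :: "real \<times> (real ^ 'n) \<Rightarrow> real ^ 'n" and M :: "real \<times> (real ^ 'n) \<Rightarrow> real ^ 'n ^ 'n"
    assume V: "cyl_field T V" and M: "cyl_field T M" and sym: "\<And>p. p \<in> slab T \<Longrightarrow> symmetric (M p)"
    define a where "a k = (\<lambda>p. V p $ k *\<^sub>R (axis k 1 :: real ^ 'n, 0 :: real ^ 'n ^ 'n))" for k
    define b where "b pq = (\<lambda>p. M p $ fst pq $ snd pq *\<^sub>R (0 :: real ^ 'n, sym_unit (fst pq) (snd pq)))" for pq
    have a: "cyl_field T (a k)" for k unfolding a_def by (rule cyl_field_scaleR_const[OF cyl_field_component[OF V]])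
    have b: "cyl_field T (b pq)" for pq unfolding b_def by (rule cyl_field_scaleR_const[OF cyl_field_component2[OF M]])
    have "clamped T (\<lambda>p. (V p, M p)) = clamped T (\<lambda>p. (\<Sum>k\<in>UNIV. a k p) + (\<Sum>pq\<in>UNIV. b pq p))"
    proof (rule bcontfun_eqI)
      fix p :: "real \<times> (real ^ 'n)"
      let ?q = "clamp_time T p"
      have "M ?q = (\<Sum>pq\<in>UNIV. M ?q $ fst pq $ snd pq *\<^sub>R sym_unit (fst pq) (snd pq))"
        by (intro symmetric_expand sym clamp_time_slab T0)
      moreover have "V ?q = (\<Sum>k\<in>UNIV. V ?q $ k *\<^sub>R axis k 1)"
        using basis_expansion[of "V ?q"] by (simp add: scalar_mult_eq_scaleR)
      ultimately have "(V ?q, M ?q) = (\<Sum>k\<in>UNIV. a k ?q) + (\<Sum>pq\<in>UNIV. b pq ?q)"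
        by (intro prod_eqI) (simp_all add: a_def b_def fst_sum snd_sum)
      thus "apply_bcontfun (clamped T (\<lambda>p. (V p, M p))) p =
          apply_bcontfun (clamped T (\<lambda>p. (\<Sum>k\<in>UNIV. a k p) + (\<Sum>pq\<in>UNIV. b pq p))) p"
        by (simp add: apply_clamped T0 cyl_field_Pair V M cyl_field_add cyl_field_sum a b)
    qed
    also have "\<dots> = (\<Sum>k\<in>UNIV. clamped T (a k)) + (\<Sum>pq\<in>UNIV. clamped T (b pq))"
      using clamped_add[OF T0 cyl_field_sum cyl_field_sum, of UNIV a UNIV b] clamped_sum[OF T0, of UNIV a]
        clamped_sum[OF T0, of UNIV b] a b by simp
    finally have "f (clamped T (\<lambda>p. (V p, M p))) = (\<Sum>k\<in>UNIV. f (clamped T (a k))) + (\<Sum>pq\<in>UNIV. f (clamped T (b pq)))"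
      by (simp only: f.add f.sum)
    also have "(\<Sum>pq\<in>UNIV. f (clamped T (b pq))) =
        (\<Sum>i\<in>UNIV. \<Sum>j\<in>UNIV. f (clamped T (\<lambda>p. M p $ i $ j *\<^sub>R (0, sym_unit i j))))"
      unfolding b_def by (rule sum_UNIV_pairs)
    finally show "pairing T E B V M = f (clamped T (\<lambda>p. (V p, M p)))"
      by (simp add: pairing_def E_def B_def \<nu>(2) cyl_field_component[OF V] cyl_field_component2[OF M] a_def)
  qed
qed

section \<open>Matrix inequalities and the trace of test matrices\<close>

lemma inner_tensor: "v \<bullet> (tensor z z *v v) = (v \<bullet> z)\<^sup>2"
  by (simp add: inner_vec_def tensor_def matrix_vector_mult_def power2_eq_square sum_product sum_distrib_left mult_ac)

lemma mat_le_tensor_iff: "mat_le (tensor z z) M \<longleftrightarrow> (\<forall>v. (v \<bullet> z)\<^sup>2 \<le> v \<bullet> (M *v v))"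
  by (simp add: mat_le_def inner_tensor)

lemma trace_nonneg_of_mat_le:
  assumes "mat_le (tensor z z) M" shows "trace M \<ge> 0"
proof -
  have "M $ i $ i = axis i 1 \<bullet> (M *v axis i 1)" for i
    by (simp add: inner_axis' matrix_vector_mult_basis column_def)
  thus ?thesis
    unfolding trace_def using assms by (intro sum_nonneg) (metis mat_le_tensor_iff order_trans zero_le_power2)
qed

lemma quadratic_form_bound:
  fixes M :: "real ^ 'n ^ 'n"
  shows "\<bar>v \<bullet> (M *v v)\<bar> \<le> (real CARD('n))\<^sup>2 * norm M * (norm v)\<^sup>2"
proof -
  have "v \<bullet> (M *v v) = (\<Sum>i\<in>UNIV. \<Sum>j\<in>UNIV. v $ i * (M $ i $ j * v $ j))"
    by (simp add: inner_vec_def matrix_vector_mult_def sum_distrib_left)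
  also have "\<bar>\<dots>\<bar> \<le> (\<Sum>i\<in>(UNIV :: 'n set). \<Sum>j\<in>(UNIV :: 'n set). norm v * (norm M * norm v))"
  proof (intro order_trans[OF sum_abs] sum_mono)
    fix i j
    have "\<bar>M $ i $ j\<bar> \<le> norm M" by (rule order_trans[OF component_le_norm_cart Finite_Cartesian_Product.norm_nth_le])
    thus "\<bar>v $ i * (M $ i $ j * v $ j)\<bar> \<le> norm v * (norm M * norm v)"
      unfolding abs_mult by (intro mult_mono component_le_norm_cart) auto
  qed
  also have "\<dots> = (real CARD('n))\<^sup>2 * norm M * (norm v)\<^sup>2" by (simp add: power2_eq_square)
  finally show ?thesis .
qed

text \<open>Source of the constants: the perturbed vector has norm at most \<open>C + 1\<close>, so
  \<open>(C + 1)^2\<close> dominates its tensor square. The extra 1 absorbs \<open>s N\<close>,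
  whose quadratic form is at most \<open>|v|^2\<close> by the crude bound with the squared
  dimension.\<close>

lemma mat_le_tensor_perturb:
  fixes z w :: "real ^ 'n" and N :: "real ^ 'n ^ 'n"
  assumes "norm z \<le> C" "norm w \<le> 1" "norm N \<le> 1" and s: "0 \<le> s" "s * (real CARD('n))\<^sup>2 \<le> 1"
  shows "mat_le (tensor (z + s *\<^sub>R w) (z + s *\<^sub>R w)) (mat ((C + 1)\<^sup>2 + 1) + s *\<^sub>R N)"
  unfolding mat_le_tensor_iff
proof
  fix v :: "real ^ 'n"
  have "1 \<le> (real CARD('n))\<^sup>2" by (simp add: Suc_leI)
  hence "s * 1 \<le> s * (real CARD('n))\<^sup>2" using s(1) by (rule mult_left_mono)
  hence s1: "s \<le> 1" using s(2) by simp
  have "norm (z + s *\<^sub>R w) \<le> C + 1"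
  proof -
    have "norm (s *\<^sub>R w) \<le> 1" using mult_mono[OF s1 assms(2)] s(1) by simp
    thus ?thesis using norm_triangle_ineq[of z "s *\<^sub>R w"] assms(1) by linarith
  qed
  hence "\<bar>v \<bullet> (z + s *\<^sub>R w)\<bar> \<le> norm v * (C + 1)"
    by (intro order_trans[OF Cauchy_Schwarz_ineq2] mult_left_mono) auto
  hence "(v \<bullet> (z + s *\<^sub>R w))\<^sup>2 \<le> (norm v * (C + 1))\<^sup>2" by (metis abs_ge_zero power2_abs power_mono)
  also have "\<dots> = (C + 1)\<^sup>2 * (v \<bullet> v)" by (simp add: power_mult_distrib power2_norm_eq_inner mult.commute)
  also have "- (s * (v \<bullet> (N *v v))) \<le> v \<bullet> v"
  proof -
    have "\<bar>v \<bullet> (N *v v)\<bar> \<le> (real CARD('n))\<^sup>2 * 1 * (norm v)\<^sup>2"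
      by (rule order_trans[OF quadratic_form_bound]) (intro mult_right_mono mult_left_mono assms; simp)
    hence "s * \<bar>v \<bullet> (N *v v)\<bar> \<le> s * ((real CARD('n))\<^sup>2 * (norm v)\<^sup>2)" using s(1) by (intro mult_left_mono) auto
    also have "\<dots> \<le> 1 * (norm v)\<^sup>2" unfolding mult.assoc[symmetric] by (rule mult_right_mono[OF s(2)]) simp
    finally have "s * \<bar>v \<bullet> (N *v v)\<bar> \<le> v \<bullet> v" by (simp add: power2_norm_eq_inner)
    thus ?thesis using s(1) by (smt (verit) mult_left_mono mult_minus_right)
  qed
  moreover have "v \<bullet> ((mat ((C + 1)\<^sup>2 + 1) + s *\<^sub>R N) *v v) = ((C + 1)\<^sup>2 + 1) * (v \<bullet> v) + s * (v \<bullet> (N *v v))"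
  proof -
    have "mat c *v v = c *\<^sub>R v" for c :: real
    proof -
      have "(mat c *v v) $ i = c * v $ i" for i
        by (simp add: matrix_vector_mult_def mat_def if_distrib[of "\<lambda>a. a * _"] cong: if_cong)
      thus ?thesis by (simp add: vec_eq_iff)
    qed
    thus ?thesis by (simp add: matrix_vector_mult_add_rdistrib scaleR_matrix_vector_assoc[symmetric] inner_add_right)
  qed
  ultimately show "(v \<bullet> (z + s *\<^sub>R w))\<^sup>2 \<le> v \<bullet> ((mat ((C + 1)\<^sup>2 + 1) + s *\<^sub>R N) *v v)"
    by (simp add: distrib_right)
qed

text \<open>The trace of the right-hand side of the constraint is
  \<open>div E + \<triangle>(-\<triangle>)^(-1) div E = 0\<close>, so the trace of \<open>B\<close>
  is constant in time and vanishes at \<open>T\<close>.\<close>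

lemma test_field_trace_zero:
  fixes E :: "real \<times> (real ^ 'n) \<Rightarrow> real ^ 'n"
  assumes T: "T > 0" and EB: "(E, B) \<in> test_fields T" and p: "p \<in> slab T"
  shows "(\<Sum>i\<in>UNIV. B p $ i $ i) = 0"
proof -
  obtain t x where tx: "p = (t, x)" "t \<in> {0..T}" using p by (auto simp: slab_def)
  have E: "smooth_on (slab T) E" "space_periodic T E" and B: "smooth_on (slab T) B" and BT: "B (T, x) = 0"
    and dB: "\<And>t i j. t \<in> {0..T} \<Longrightarrow> vector_derivative (\<lambda>s. B (s, x) $ i $ j) (at t within {0..T}) =
          1/2 * (pd j (\<lambda>y. E (t, y) $ i) x + pd i (\<lambda>y. E (t, y) $ j) x)
          + pd i (pd j (inv_neg_laplacian (\<lambda>y. \<Sum>k\<in>UNIV. pd k (\<lambda>z. E (t, z) $ k) y))) x"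
    using EB unfolding test_fields_def by auto
  note uniq = derivative_unique_on_slab[OF T]
  have "((\<lambda>s. \<Sum>i\<in>UNIV. B (s, x) $ i $ i) has_vector_derivative 0) (at s within {0..T})" if s: "s \<in> {0..T}" for s
  proof -
    define D where "D i = vector_derivative (\<lambda>s. B (s, x) $ i $ i) (at s within {0..T})" for i
    have D: "((\<lambda>s. B (s, x) $ i $ i) has_vector_derivative D i) (at s within {0..T})" for i
    proof -
      have d: "((\<lambda>s. B (s, x) $ i $ i) has_vector_derivative
          frechet_derivative (\<lambda>p. B p $ i $ i) (at (s, x) within slab T) (1, 0)) (at s within {0..T})"
        by (rule slab_time_derivative[OF smooth_component2[OF uniq B] s])
      show ?thesis using d vector_derivative_within_closed_interval[OF T s d] by (simp add: D_def)
    qed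
    define h where "h = (\<lambda>y. \<Sum>k\<in>UNIV. pd k (\<lambda>z. E (s, z) $ k) y)"
    have e: "smooth_on UNIV (\<lambda>y. E (s, y) $ i)" "periodic (\<lambda>y. E (s, y) $ i)" for i
      using smooth_on_slice[OF smooth_component[OF uniq E(1)] s, of i] E(2) s
      by (auto simp: space_periodic_def periodic_def)
    have "h \<in> smooth_zero_mean" unfolding h_def by (rule divergence_zero_mean[OF e])
    from inv_neg_laplacian_solves(2)[OF this] have "neg_laplacian (inv_neg_laplacian h) x = h x" by simp
    moreover have "D i = pd i (\<lambda>y. E (s, y) $ i) x + pd i (pd i (inv_neg_laplacian h)) x" for i
      unfolding D_def dB[OF s] h_def by simp
    ultimately have "(\<Sum>i\<in>UNIV. D i) = 0"
      by (simp add: sum.distrib neg_laplacian_def h_def)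
    moreover have "((\<lambda>s. \<Sum>i\<in>UNIV. B (s, x) $ i $ i) has_vector_derivative (\<Sum>i\<in>UNIV. D i)) (at s within {0..T})"
      by (intro has_vector_derivative_sum D)
    ultimately show ?thesis by simp
  qed
  then obtain c where c: "\<And>s. s \<in> {0..T} \<Longrightarrow> (\<Sum>i\<in>UNIV. B (s, x) $ i $ i) = c"
    using has_vector_derivative_zero_constant[of "{0..T}" "\<lambda>s. \<Sum>i\<in>UNIV. B (s, x) $ i $ i"] by auto
  have "c = 0" using c[of T] BT T by simp
  thus ?thesis using c tx by simp
qed

section \<open>Duality\<close>

lemma cyl_int_lincomb:
  fixes f g :: "real \<times> (real ^ 'n) \<Rightarrow> real"
  assumes "continuous_on (slab T) f" "continuous_on (slab T) g"
  shows "(LINT p:cylinder T|lborel. a * f p + b * g p) = a * (LINT p:cylinder T|lborel. f p) + b * (LINT p:cylinder T|lborel. g p)"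
  by (subst set_integral_add(2)) (auto intro!: cyl_integrable continuous_intros assms)

lemma cyl_int_abs_le:
  fixes f :: "real \<times> (real ^ 'n) \<Rightarrow> real"
  assumes f: "continuous_on (slab T) f" and c: "\<And>p. p \<in> cylinder T \<Longrightarrow> \<bar>f p\<bar> \<le> c"
  shows "\<bar>LINT p:cylinder T|lborel. f p\<bar> \<le> c * (LINT p:(cylinder T :: (real \<times> (real ^ 'n)) set)|lborel. 1)"
proof -
  have const: "(LINT p:(cylinder T :: (real \<times> (real ^ 'n)) set)|lborel. r) = r * (LINT p:(cylinder T :: (real \<times> (real ^ 'n)) set)|lborel. 1)" for r :: real
    using cyl_int_lincomb[of T "\<lambda>p :: real \<times> (real ^ 'n). 1" "\<lambda>p. 0" r 0] by simp
  have "(LINT p:cylinder T|lborel. f p) \<le> (LINT p:(cylinder T :: (real \<times> (real ^ 'n)) set)|lborel. c)"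
    using c by (intro set_integral_mono cyl_integrable f continuous_on_const) (simp add: abs_le_iff)
  moreover have "(LINT p:(cylinder T :: (real \<times> (real ^ 'n)) set)|lborel. - c) \<le> (LINT p:cylinder T|lborel. f p)"
    using c by (intro set_integral_mono cyl_integrable f continuous_on_const) (force simp: abs_le_iff)
  ultimately show ?thesis using const[of c] const[of "- c"] by (simp add: abs_le_iff)
qed

definition test_pairing where
  "test_pairing T V M E B = (LINT p:cylinder T|lborel.
     (\<Sum>i\<in>UNIV. \<Sum>j\<in>UNIV. (M p :: real ^ 'n ^ 'n) $ i $ j * B p $ i $ j) + (\<Sum>i\<in>UNIV. (V p :: real ^ 'n) $ i * E p $ i))"

lemma test_pairing_lincomb:
  fixes V W E :: "real \<times> (real ^ 'n) \<Rightarrow> real ^ 'n" and M N B :: "real \<times> (real ^ 'n) \<Rightarrow> real ^ 'n ^ 'n"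
  assumes "continuous_on (slab T) V" "continuous_on (slab T) W" "continuous_on (slab T) E"
    "continuous_on (slab T) M" "continuous_on (slab T) N" "continuous_on (slab T) B"
  shows "test_pairing T (\<lambda>p. a *\<^sub>R V p + b *\<^sub>R W p) (\<lambda>p. a *\<^sub>R M p + b *\<^sub>R N p) E B =
    a * test_pairing T V M E B + b * test_pairing T W N E B"
proof -
  have c: "continuous_on (slab T) (\<lambda>p. (\<Sum>i\<in>UNIV. \<Sum>j\<in>UNIV. M p $ i $ j * B p $ i $ j) + (\<Sum>i\<in>UNIV. V p $ i * E p $ i))"
    "continuous_on (slab T) (\<lambda>p. (\<Sum>i\<in>UNIV. \<Sum>j\<in>UNIV. N p $ i $ j * B p $ i $ j) + (\<Sum>i\<in>UNIV. W p $ i * E p $ i))"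
    using assms by (auto intro!: continuous_intros)
  show ?thesis
    unfolding test_pairing_def cyl_int_lincomb[OF c, symmetric]
    by (simp add: distrib_right distrib_left sum.distrib sum_distrib_left ac_simps)
qed

lemma test_pairing_cong:
  assumes "\<And>p. p \<in> cylinder T \<Longrightarrow> V p = V' p" "\<And>p. p \<in> cylinder T \<Longrightarrow> M p = M' p"
  shows "test_pairing T V M E B = test_pairing T V' M' E B"
  unfolding test_pairing_def by (rule set_lebesgue_integral_cong) (auto simp: assms)

lemma test_fields_continuous:
  "(E, B) \<in> test_fields T \<Longrightarrow> continuous_on (slab T) E" "(E, B) \<in> test_fields T \<Longrightarrow> continuous_on (slab T) B"
  unfolding test_fields_def using smooth_on_continuous by auto

lemma subsolutions_iff:
  "(Z, M) \<in> subsolutions T P0 \<longleftrightarrow> (Z, M) \<in> admissible_pairs T \<and>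
    (\<forall>(E, B)\<in>test_fields T. test_pairing T (\<lambda>p. Z p - P0 (snd p)) M E B = 0)"
  by (simp add: subsolutions_def test_pairing_def)

definition dominating_fields :: "((real \<times> (real ^ 'n)) \<Rightarrow>\<^sub>C ((real ^ 'n) \<times> (real ^ 'n ^ 'n))) set" where
  "dominating_fields = {u. \<forall>p. mat_le (tensor (fst (apply_bcontfun u p)) (fst (apply_bcontfun u p))) (snd (apply_bcontfun u p))}"

text \<open>The linear part of the notion of sub-solution with \<open>P0\<close> removed: a
  dominating \<open>u\<close> whose difference from the base point lies here restricts to a
  sub-solution.\<close>

definition homogeneous_fields :: "real \<Rightarrow> ((real \<times> (real ^ 'n)) \<Rightarrow>\<^sub>C ((real ^ 'n) \<times> (real ^ 'n ^ 'n))) set" where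
  "homogeneous_fields T = {u. space_periodic T (apply_bcontfun u) \<and> (\<forall>p\<in>slab T. symmetric (snd (apply_bcontfun u p))) \<and>
     (\<forall>(E, B)\<in>test_fields T. test_pairing T (\<lambda>p. fst (apply_bcontfun u p)) (\<lambda>p. snd (apply_bcontfun u p)) E B = 0)}"

definition half_trace :: "real \<Rightarrow> ((real \<times> (real ^ 'n)) \<Rightarrow>\<^sub>C ((real ^ 'n) \<times> (real ^ 'n ^ 'n))) \<Rightarrow> real" where
  "half_trace T u = 1/2 * (LINT p:cylinder T|lborel. trace (snd (apply_bcontfun u p)))"

lemma continuous_on_trace: "continuous_on S f \<Longrightarrow> continuous_on S (\<lambda>p. trace (f p))" for f :: "_ \<Rightarrow> real ^ 'n ^ 'n"
  unfolding trace_def by (intro continuous_intros)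

lemma half_trace_lincomb: "half_trace T (a *\<^sub>R u + b *\<^sub>R v) = a * half_trace T u + b * half_trace T v"
proof -
  have c: "continuous_on (slab T) (\<lambda>p. trace (snd (apply_bcontfun u p)))" for u :: "(real \<times> (real ^ 'n)) \<Rightarrow>\<^sub>C ((real ^ 'n) \<times> (real ^ 'n ^ 'n))"
    by (intro continuous_on_trace continuous_on_snd continuous_on_apply_bcontfun)
  have "trace (snd (apply_bcontfun (a *\<^sub>R u + b *\<^sub>R v) p)) = a * trace (snd (apply_bcontfun u p)) + b * trace (snd (apply_bcontfun v p))" for p
    by (simp add: plus_bcontfun.rep_eq trace_def sum.distrib sum_distrib_left)
  thus ?thesis by (simp add: half_trace_def cyl_int_lincomb[OF c c] distrib_left)
qed

lemma half_trace_bounded: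
  obtains C where "\<And>u :: (real \<times> (real ^ 'n)) \<Rightarrow>\<^sub>C ((real ^ 'n) \<times> (real ^ 'n ^ 'n)). \<bar>half_trace T u\<bar> \<le> C * norm u"
proof -
  define V where "V = (LINT p:(cylinder T :: (real \<times> (real ^ 'n)) set)|lborel. (1::real))"
  have "\<bar>half_trace T u\<bar> \<le> (real CARD('n) * V / 2) * norm u" for u :: "(real \<times> (real ^ 'n)) \<Rightarrow>\<^sub>C ((real ^ 'n) \<times> (real ^ 'n ^ 'n))"
  proof -
    have "\<bar>LINT p:cylinder T|lborel. trace (snd (apply_bcontfun u p))\<bar> \<le> (real CARD('n) * norm u) * V"
      unfolding V_def
    proof (rule cyl_int_abs_le)
      fix p
      have "\<bar>snd (apply_bcontfun u p) $ i $ i\<bar> \<le> norm u" for i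
        using component_le_norm_cart[of "snd (apply_bcontfun u p) $ i" i]
          Finite_Cartesian_Product.norm_nth_le[of "snd (apply_bcontfun u p)" i]
          norm_snd_le[of "snd (apply_bcontfun u p)" "fst (apply_bcontfun u p)", unfolded prod.collapse] norm_bounded[of u p] by linarith
      hence "(\<Sum>i\<in>UNIV. \<bar>snd (apply_bcontfun u p) $ i $ i\<bar>) \<le> real CARD('n) * norm u" by (rule sum_bounded_above)
      thus "\<bar>trace (snd (apply_bcontfun u p))\<bar> \<le> real CARD('n) * norm u" unfolding trace_def by (rule order_trans[OF sum_abs])
    qed (intro continuous_on_trace continuous_on_snd continuous_on_apply_bcontfun)
    thus ?thesis by (simp add: half_trace_def abs_mult field_simps)
  qed
  thus ?thesis by (rule that)
qed

text \<open>The objective is linear; the content is convexity of the set, which follows pointwise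
  from convexity of the square.\<close>

lemma convex_half_trace: "convex_on dominating_fields (half_trace T)"
  unfolding convex_on_def convex_def
proof (intro conjI ballI allI impI)
  fix u v :: "(real \<times> (real ^ 'n)) \<Rightarrow>\<^sub>C ((real ^ 'n) \<times> (real ^ 'n ^ 'n))" and a b :: real
  assume u: "u \<in> dominating_fields" and v: "v \<in> dominating_fields" and ab: "a \<ge> 0" "b \<ge> 0" "a + b = 1"
  show "half_trace T (a *\<^sub>R u + b *\<^sub>R v) \<le> a * half_trace T u + b * half_trace T v" by (simp add: half_trace_lincomb)
  show "a *\<^sub>R u + b *\<^sub>R v \<in> dominating_fields"
    unfolding dominating_fields_def mat_le_tensor_iff mem_Collect_eq
  proof (intro allI)
    fix p w
    define x y where "x = w \<bullet> fst (apply_bcontfun u p)" and "y = w \<bullet> fst (apply_bcontfun v p)"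
    have "(a * x + b * y)\<^sup>2 \<le> a * x\<^sup>2 + b * y\<^sup>2"
      using convex_power2 ab unfolding convex_on_def by auto
    also have "\<dots> \<le> a * (w \<bullet> (snd (apply_bcontfun u p) *v w)) + b * (w \<bullet> (snd (apply_bcontfun v p) *v w))"
    proof (intro add_mono mult_left_mono ab)
      show "x\<^sup>2 \<le> w \<bullet> (snd (apply_bcontfun u p) *v w)" using u unfolding dominating_fields_def mat_le_tensor_iff x_def by blast
      show "y\<^sup>2 \<le> w \<bullet> (snd (apply_bcontfun v p) *v w)" using v unfolding dominating_fields_def mat_le_tensor_iff y_def by blast
    qed
    finally show "(w \<bullet> fst (apply_bcontfun (a *\<^sub>R u + b *\<^sub>R v) p))\<^sup>2 \<le> w \<bullet> (snd (apply_bcontfun (a *\<^sub>R u + b *\<^sub>R v) p) *v w)"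
      by (simp add: plus_bcontfun.rep_eq x_def y_def inner_add_right matrix_vector_mult_add_rdistrib scaleR_matrix_vector_assoc[symmetric])
  qed
qed

lemma homogeneous_fields_test:
  assumes "u \<in> homogeneous_fields T" "(E, B) \<in> test_fields T"
  shows "test_pairing T (\<lambda>p. fst (apply_bcontfun u p)) (\<lambda>p. snd (apply_bcontfun u p)) E B = 0"
  using assms by (auto simp: homogeneous_fields_def dest!: bspec[where x = "(E, B)"])

lemma subspace_homogeneous_fields: "subspace (homogeneous_fields T)"
proof -
  have "a *\<^sub>R u + b *\<^sub>R v \<in> homogeneous_fields T" if u: "u \<in> homogeneous_fields T" and v: "v \<in> homogeneous_fields T"
    for a b and u v :: "(real \<times> (real ^ 'n)) \<Rightarrow>\<^sub>C ((real ^ 'n) \<times> (real ^ 'n ^ 'n))"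
    unfolding homogeneous_fields_def mem_Collect_eq
  proof (intro conjI ballI)
    show "space_periodic T (apply_bcontfun (a *\<^sub>R u + b *\<^sub>R v))"
      using u v by (simp add: homogeneous_fields_def space_periodic_def periodic_def plus_bcontfun.rep_eq)
    show "symmetric (snd (apply_bcontfun (a *\<^sub>R u + b *\<^sub>R v) p))" if "p \<in> slab T" for p
      using u v that by (simp add: homogeneous_fields_def symmetric_def transpose_def vec_eq_iff plus_bcontfun.rep_eq)
    show "case EB of (E, B) \<Rightarrow> test_pairing T (\<lambda>p. fst (apply_bcontfun (a *\<^sub>R u + b *\<^sub>R v) p))
        (\<lambda>p. snd (apply_bcontfun (a *\<^sub>R u + b *\<^sub>R v) p)) E B = 0" if EB: "EB \<in> test_fields T" for EB
    proof (cases EB)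
      case (Pair E B)
      note c = test_fields_continuous[OF EB[unfolded Pair]]
      have "test_pairing T (\<lambda>p. a *\<^sub>R fst (apply_bcontfun u p) + b *\<^sub>R fst (apply_bcontfun v p))
          (\<lambda>p. a *\<^sub>R snd (apply_bcontfun u p) + b *\<^sub>R snd (apply_bcontfun v p)) E B =
          a * test_pairing T (\<lambda>p. fst (apply_bcontfun u p)) (\<lambda>p. snd (apply_bcontfun u p)) E B +
          b * test_pairing T (\<lambda>p. fst (apply_bcontfun v p)) (\<lambda>p. snd (apply_bcontfun v p)) E B"
        by (intro test_pairing_lincomb continuous_on_fst continuous_on_snd continuous_on_apply_bcontfun c)
      also have "\<dots> = 0" using homogeneous_fields_test[OF u EB[unfolded Pair]] homogeneous_fields_test[OF v EB[unfolded Pair]] by simp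
      finally show ?thesis using Pair by (simp add: plus_bcontfun.rep_eq)
    qed
  qed
  note lincomb = this
  have "0 \<in> homogeneous_fields T"
    by (simp add: homogeneous_fields_def space_periodic_def periodic_def symmetric_def transpose_def vec_eq_iff
        test_pairing_def set_lebesgue_integral_def case_prod_beta')
  thus ?thesis
    using lincomb[of _ _ 1 1] lincomb[of _ _ _ 0] by (auto simp: subspace_def)
qed

lemma clamped_homogeneous_fields:
  assumes T: "T \<ge> 0" and V: "cyl_field T V" and M: "cyl_field T M" and sym: "\<And>p. p \<in> slab T \<Longrightarrow> symmetric (M p)"
    and test: "\<And>E B. (E, B) \<in> test_fields T \<Longrightarrow> test_pairing T V M E B = 0"
  shows "clamped T (\<lambda>p. (V p, M p)) \<in> homogeneous_fields T"
proof -
  have eq: "apply_bcontfun (clamped T (\<lambda>p. (V p, M p))) p = (V p, M p)" if "p \<in> slab T" for p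
    using that by (simp add: apply_clamped[OF T cyl_field_Pair[OF V M]] clamp_time_id)
  have "space_periodic T (apply_bcontfun (clamped T (\<lambda>p. (V p, M p))))"
    using V M eq by (simp add: cyl_field_def space_periodic_def periodic_def slab_def)
  moreover have "test_pairing T (\<lambda>p. fst (apply_bcontfun (clamped T (\<lambda>p. (V p, M p))) p))
      (\<lambda>p. snd (apply_bcontfun (clamped T (\<lambda>p. (V p, M p))) p)) E B = test_pairing T V M E B" for E B
    by (rule test_pairing_cong) (use eq cylinder_subset(3) in fastforce)+
  ultimately show ?thesis using sym test eq by (auto simp: homogeneous_fields_def)
qed

text \<open>A linear functional bounded above on a ball about 0 is bounded, the ball being
  symmetric. This supplies the continuity that the algebraic duality theorem does not give.\<close>

lemma linear_bounded_of_dominated: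
  fixes f \<phi> :: "'a::real_normed_vector \<Rightarrow> real"
  assumes f: "linear f" and \<phi>: "\<And>u. \<bar>\<phi> u\<bar> \<le> C * norm u" and s: "s > 0"
    and A: "\<And>x. norm x \<le> 1 \<Longrightarrow> u0 + s *\<^sub>R x \<in> A" and le: "\<And>u. u \<in> A \<Longrightarrow> f (u - u0) \<le> \<phi> u - m"
  obtains K where "\<And>x. \<bar>f x\<bar> \<le> K * norm x"
proof -
  interpret f: linear f by fact
  define K where "K = (\<bar>C\<bar> * (norm u0 + s) + \<bar>m\<bar>) / s"
  have 1: "f x \<le> K" if x: "norm x \<le> 1" for x
  proof -
    have "s * f x = f (u0 + s *\<^sub>R x - u0)" by (simp add: f.scale)
    also have "\<dots> \<le> \<phi> (u0 + s *\<^sub>R x) - m" by (rule le[OF A[OF x]])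
    also have "\<phi> (u0 + s *\<^sub>R x) \<le> C * norm (u0 + s *\<^sub>R x)" using \<phi>[of "u0 + s *\<^sub>R x"] by simp
    also have "\<dots> \<le> \<bar>C\<bar> * (norm u0 + s)"
    proof (rule mult_mono)
      have "norm (s *\<^sub>R x) \<le> s * 1" using s x by simp
      thus "norm (u0 + s *\<^sub>R x) \<le> norm u0 + s" using norm_triangle_ineq[of u0 "s *\<^sub>R x"] by linarith
    qed auto
    finally show ?thesis using s by (simp add: K_def field_simps)
  qed
  have "\<bar>f x\<bar> \<le> K * norm x" for x
  proof (cases "x = 0")
    case False
    define y where "y = x /\<^sub>R norm x"
    have "norm y \<le> 1" "norm (- y) \<le> 1" using False by (simp_all add: y_def)
    hence "\<bar>f y\<bar> \<le> K" using 1[of y] 1[of "- y"] by (simp add: f.neg abs_le_iff)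
    moreover have "x = norm x *\<^sub>R y" using False by (simp add: y_def)
    hence "f x = norm x * f y" using f.scale[of "norm x" y] by simp
    ultimately show ?thesis using mult_left_mono[of "\<bar>f y\<bar>" K "norm x"] by (simp add: abs_mult mult.commute)
  qed simp
  thus ?thesis by (rule that)
qed

text \<open>Contraction with \<open>c I\<close> is \<open>c\<close> times the trace, so the multiple
  of the identity that creates the interior point drops out of the constraint.\<close>

lemma test_pairing_scalar_matrix:
  fixes E :: "real \<times> (real ^ 'n) \<Rightarrow> real ^ 'n"
  assumes T: "T > 0" and EB: "(E, B) \<in> test_fields T"
  shows "test_pairing T (\<lambda>p. 0) (\<lambda>p. mat c) E B = 0"
proof -
  have "(\<Sum>i\<in>UNIV. \<Sum>j\<in>UNIV. (mat c :: real ^ 'n ^ 'n) $ i $ j * B p $ i $ j) = c * (\<Sum>i\<in>UNIV. B p $ i $ i)" for p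
    by (simp add: mat_def if_distrib[of "\<lambda>a. a * _"] sum_distrib_left cong: if_cong)
  hence "test_pairing T (\<lambda>p. 0) (\<lambda>p. mat c) E B = (LINT p:(cylinder T :: (real \<times> (real ^ 'n)) set)|lborel. 0)"
    unfolding test_pairing_def
    by (intro set_lebesgue_integral_cong) (auto dest!: subsetD[OF cylinder_subset(3)] simp: test_field_trace_zero[OF T EB])
  thus ?thesis by (simp add: set_lebesgue_integral_def)
qed

lemma symmetric_mat: "symmetric (mat c)"
  by (simp add: symmetric_def)

text \<open>
  \<open>E\<close> enters \<open>K\<close> with the sign opposite to \<open>pairing\<close>; since \<open>M \<ge> Z \<otimes> Z\<close> is even in \<open>Z\<close>, this does
  not affect the supremum.
\<close>

lemma K_functional_ge:
  assumes mp: "(E, B) \<in> measure_pairs T" and ZM: "(Z, M) \<in> admissible_pairs T"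
  shows "ereal (- pairing T E B Z M - 1/2 * (LINT p:cylinder T|lborel. trace (M p))) \<le> K_functional T E B"
proof -
  have "(\<lambda>p. - Z p, M) \<in> admissible_pairs T"
    using ZM by (auto simp: admissible_pairs_def space_periodic_def periodic_def mat_le_tensor_iff intro!: continuous_intros)
  hence "ereal (1/2 *
     (2 * (\<Sum>i\<in>UNIV. cyl_integral T (\<lambda>A. E A $ i) (\<lambda>p. (- Z p) $ i))
      - (LINT p:cylinder T|lborel. trace (M p))
      - 2 * (\<Sum>i\<in>UNIV. \<Sum>j\<in>UNIV. cyl_integral T (\<lambda>A. B A $ i $ j) (\<lambda>p. M p $ i $ j)))) \<le> K_functional T E B"
    unfolding K_functional_def by (intro SUP_upper2[of "(\<lambda>p. - Z p, M)"]) auto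
  thus ?thesis by (simp add: signed_integral_minus sum_negf pairing_def algebra_simps)
qed

lemma K_functional_le:
  assumes "\<And>Z M. (Z, M) \<in> admissible_pairs T \<Longrightarrow> - pairing T E B Z M - 1/2 * (LINT p:cylinder T|lborel. trace (M p)) \<le> c"
  shows "K_functional T E B \<le> ereal c"
  unfolding K_functional_def
proof (rule SUP_least, clarify)
  fix Z :: "real \<times> (real ^ 'a) \<Rightarrow> real ^ 'a" and M :: "real \<times> (real ^ 'a) \<Rightarrow> real ^ 'a ^ 'a"
  assume "(Z, M) \<in> admissible_pairs T"
  hence "(\<lambda>p. - Z p, M) \<in> admissible_pairs T"
    by (auto simp: admissible_pairs_def space_periodic_def periodic_def mat_le_tensor_iff intro!: continuous_intros)
  from assms[OF this]
  show "ereal (1/2 * (2 * (\<Sum>i\<in>UNIV. cyl_integral T (\<lambda>A. E A $ i) (\<lambda>p. Z p $ i))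
      - (LINT p:cylinder T|lborel. trace (M p))
      - 2 * (\<Sum>i\<in>UNIV. \<Sum>j\<in>UNIV. cyl_integral T (\<lambda>A. B A $ i $ j) (\<lambda>p. M p $ i $ j)))) \<le> ereal c"
    by (simp add: signed_integral_minus sum_negf pairing_def algebra_simps)
qed

lemma pairing_zero_matrix: "pairing T E B V (\<lambda>p. 0) = (\<Sum>k\<in>UNIV. cyl_integral T (\<lambda>A. E A $ k) (\<lambda>p. V p $ k))"
  by (simp add: pairing_def signed_integral_def)

lemma dual_objective_eq:
  "dual_objective T P0 E B = - K_functional T E B - ereal (pairing T E B (\<lambda>p. P0 (snd p)) (\<lambda>p. 0))"
  by (simp add: dual_objective_def pairing_zero_matrix case_prod_beta')

lemma admissible_cyl_fields:
  assumes "(Z, M) \<in> admissible_pairs T"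
  shows "cyl_field T Z" "cyl_field T M" "\<And>p. p \<in> slab T \<Longrightarrow> symmetric (M p)"
  using assms by (auto simp: admissible_pairs_def cyl_field_def)

text \<open>The direction \<open>(Z - P0, M)\<close> satisfies the homogeneous constraint, so
  \<open>EB_orthogonal\<close> equates the pairings with \<open>(Z, M)\<close> and
  \<open>(P0, 0)\<close>. Inserting \<open>(- Z, M)\<close> into the supremum defining
  \<open>K\<close> then gives the inequality.\<close>

lemma weak_duality:
  assumes T: "T > 0" and P0: "cyl_field T (\<lambda>p. P0 (snd p))" and EB: "(E, B) \<in> EB_class T" and ZM: "(Z, M) \<in> subsolutions T P0"
  shows "dual_objective T P0 E B \<le> ereal (1/2 * (LINT p:cylinder T|lborel. trace (M p)))"
proof -
  have mp: "(E, B) \<in> measure_pairs T" using EB unfolding EB_class_def by blast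
  have adm: "(Z, M) \<in> admissible_pairs T"
    and test: "\<And>E B. (E, B) \<in> test_fields T \<Longrightarrow> test_pairing T (\<lambda>p. Z p - P0 (snd p)) M E B = 0"
    using ZM unfolding subsolutions_iff by auto
  note fields = admissible_cyl_fields[OF adm]
  have "pairing T E B (\<lambda>p. Z p - P0 (snd p)) (\<lambda>p. M p) = 0"
    by (rule EB_orthogonal[OF T EB cyl_field_diff[OF fields(1) P0] fields(2,3)]) (use test in \<open>auto simp: test_pairing_def\<close>)
  moreover have "pairing T E B (\<lambda>p. Z p - P0 (snd p)) (\<lambda>p. M p - 0) = pairing T E B Z M - pairing T E B (\<lambda>p. P0 (snd p)) (\<lambda>p. 0)"
    by (rule pairing_diff[OF mp fields(1) P0 fields(2) cyl_field_const])
  ultimately have eq: "pairing T E B Z M = pairing T E B (\<lambda>p. P0 (snd p)) (\<lambda>p. 0)" by simp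
  show ?thesis
    using K_functional_ge[OF mp adm] unfolding dual_objective_eq eq
    by (cases "K_functional T E B") auto
qed

text \<open>Here \<open>m\<close> is any real lower bound of the primal problem. Taking it to be the
  infimum gives a maximiser at once, without a limit along a maximising sequence.\<close>

lemma strong_duality:
  fixes P0 :: "real ^ 'n \<Rightarrow> real ^ 'n"
  assumes T: "T > 0" and P0: "cyl_field T (\<lambda>p. P0 (snd p))"
    and m: "\<And>Z M. (Z, M) \<in> subsolutions T P0 \<Longrightarrow> m \<le> 1/2 * (LINT p:cylinder T|lborel. trace (M p))"
  obtains E B where "(E, B) \<in> EB_class T" "ereal m \<le> dual_objective T P0 E B"
proof -
  have T0: "T \<ge> 0" using T by simp
  obtain C where C: "C \<ge> 0" "\<And>p. p \<in> slab T \<Longrightarrow> norm (P0 (snd p)) \<le> C"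
    using P0 cyl_fun_bounded[of T "\<lambda>p. P0 (snd p)"] unfolding cyl_field_def by metis
  \<comment> \<open>Together with \<open>s\<close> below, the constants of
    \<open>mat_le_tensor_perturb\<close>: the ball of radius \<open>s\<close> about
    \<open>u0\<close> consists of dominating fields.\<close>
  define c where "c = (C + 1)\<^sup>2 + 1"
  define u0 where "u0 = clamped T (\<lambda>p. (P0 (snd p), mat c :: real ^ 'n ^ 'n))"
  have u0_apply: "apply_bcontfun u0 p = (P0 (snd (clamp_time T p)), mat c)" for p
    by (simp add: u0_def apply_clamped[OF T0 cyl_field_Pair[OF P0 cyl_field_const]])
  define s where "s = 1 / (real CARD('n))\<^sup>2"
  have s: "s > 0" "s * (real CARD('n))\<^sup>2 \<le> 1" by (simp_all add: s_def)
  have near: "u0 + s *\<^sub>R x \<in> dominating_fields" if "norm x \<le> 1" for x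
    unfolding dominating_fields_def mem_Collect_eq
  proof
    fix p
    have x: "norm (fst (apply_bcontfun x p)) \<le> 1" "norm (snd (apply_bcontfun x p)) \<le> 1"
      using norm_fst_le[of "fst (apply_bcontfun x p)" "snd (apply_bcontfun x p)", unfolded prod.collapse]
        norm_snd_le[of "snd (apply_bcontfun x p)" "fst (apply_bcontfun x p)", unfolded prod.collapse]
        norm_bounded[of x p] that by linarith+
    show "mat_le (tensor (fst (apply_bcontfun (u0 + s *\<^sub>R x) p)) (fst (apply_bcontfun (u0 + s *\<^sub>R x) p)))
        (snd (apply_bcontfun (u0 + s *\<^sub>R x) p))"
      using mat_le_tensor_perturb[OF C(2)[OF clamp_time_slab[OF T0]] x less_imp_le[OF s(1)] s(2)]
      by (simp add: plus_bcontfun.rep_eq u0_apply c_def)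
  qed
  have A0: "u0 \<in> dominating_fields" using near[of 0] by simp
  have internal: "\<exists>r>0. u0 + r *\<^sub>R x \<in> dominating_fields" for x
  proof (intro exI conjI)
    have "norm ((1 / (norm x + 1)) *\<^sub>R x) \<le> 1" by (simp add: field_simps, simp add: divide_le_eq_1 add_pos_nonneg)
    from near[OF this] show "u0 + (s * (1 / (norm x + 1))) *\<^sub>R x \<in> dominating_fields" by simp
    show "s * (1 / (norm x + 1)) > 0" using s(1) norm_ge_zero[of x] by (intro mult_pos_pos divide_pos_pos) linarith+
  qed
  \<comment> \<open>Competitors of the abstract problem are sub-solutions: periodicity and symmetry
    come from the difference with \<open>u0\<close>, and \<open>c I\<close> does not change the test
    pairing.\<close>
  have minim: "m \<le> half_trace T u" if u: "u \<in> dominating_fields" "u - u0 \<in> homogeneous_fields T" for u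
  proof -
    define Z where "Z = (\<lambda>p. fst (apply_bcontfun u p))"
    define M where "M = (\<lambda>p. snd (apply_bcontfun u p))"
    have d: "apply_bcontfun (u - u0) p = (Z p - P0 (snd p), M p - mat c)" if "p \<in> slab T" for p
      using that by (simp add: minus_bcontfun.rep_eq u0_apply clamp_time_id Z_def M_def prod_eq_iff)
    have cont: "continuous_on (slab T) Z" "continuous_on (slab T) M" unfolding Z_def M_def
      by (intro continuous_on_fst continuous_on_snd continuous_on_apply_bcontfun)+
    have P0': "P0 (x + axis i 1) = P0 x" for x i
      using P0 T by (auto simp: cyl_field_def space_periodic_def periodic_def)
    have "space_periodic T (apply_bcontfun (u - u0))" using u(2) by (simp add: homogeneous_fields_def)
    hence per: "space_periodic T Z" "space_periodic T M"
      using d P0' by (auto simp: space_periodic_def periodic_def slab_def)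
    have sym: "symmetric (M p)" if "p \<in> slab T" for p
    proof -
      have "symmetric (snd (apply_bcontfun (u - u0) p))" using u(2) that unfolding homogeneous_fields_def by blast
      hence "symmetric (M p - mat c)" by (simp only: d[OF that] snd_conv)
      hence e: "\<forall>i j. M p $ j $ i - mat c $ j $ i = M p $ i $ j - mat c $ i $ j"
        by (simp add: symmetric_def transpose_def vec_eq_iff)
      have "M p $ j $ i = M p $ i $ j" for i j using e[rule_format, of i j] by (cases "i = j") (simp_all add: mat_def)
      thus ?thesis by (simp add: symmetric_def transpose_def vec_eq_iff)
    qed
    have "(Z, M) \<in> admissible_pairs T"
      using cont per sym u(1) by (auto simp: admissible_pairs_def dominating_fields_def Z_def M_def)
    moreover have "test_pairing T (\<lambda>p. Z p - P0 (snd p)) M E B = 0" if EB: "(E, B) \<in> test_fields T" for E B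
    proof -
      note cEB = test_fields_continuous[OF EB]
      have "test_pairing T (\<lambda>p. fst (apply_bcontfun (u - u0) p)) (\<lambda>p. snd (apply_bcontfun (u - u0) p)) E B = 0"
        by (rule homogeneous_fields_test[OF u(2) EB])
      moreover have "test_pairing T (\<lambda>p. fst (apply_bcontfun (u - u0) p)) (\<lambda>p. snd (apply_bcontfun (u - u0) p)) E B =
          test_pairing T (\<lambda>p. Z p - P0 (snd p)) (\<lambda>p. M p - mat c) E B"
        by (rule test_pairing_cong) (simp_all only: d[OF subsetD[OF cylinder_subset(3)]] fst_conv snd_conv)
      ultimately have 1: "test_pairing T (\<lambda>p. Z p - P0 (snd p)) (\<lambda>p. M p - mat c) E B = 0" by simp
      have "test_pairing T (\<lambda>p. 1 *\<^sub>R (Z p - P0 (snd p)) + 1 *\<^sub>R 0) (\<lambda>p. 1 *\<^sub>R (M p - mat c) + 1 *\<^sub>R mat c) E B =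
          1 * test_pairing T (\<lambda>p. Z p - P0 (snd p)) (\<lambda>p. M p - mat c) E B + 1 * test_pairing T (\<lambda>p. 0) (\<lambda>p. mat c) E B"
        using P0 by (intro test_pairing_lincomb cEB continuous_on_const continuous_on_diff cont) (auto simp: cyl_field_def)
      thus ?thesis using 1 test_pairing_scalar_matrix[OF T EB] by simp
    qed
    ultimately have "(Z, M) \<in> subsolutions T P0" by (auto simp: subsolutions_iff)
    from m[OF this] show ?thesis by (simp add: half_trace_def M_def)
  qed
  obtain f where f: "linear f" "\<And>l. l \<in> homogeneous_fields T \<Longrightarrow> f l = 0"
    "\<And>u. u \<in> dominating_fields \<Longrightarrow> f (u - u0) \<le> half_trace T u - m"
    using convex_duality[OF convex_half_trace subspace_homogeneous_fields A0 internal minim] by blast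
  interpret f: linear f by (rule f(1))
  obtain C' where C': "\<And>u :: (real \<times> (real ^ 'n)) \<Rightarrow>\<^sub>C ((real ^ 'n) \<times> (real ^ 'n ^ 'n)). \<bar>half_trace T u\<bar> \<le> C' * norm u"
    using half_trace_bounded by blast
  obtain K where K: "\<And>x. \<bar>f x\<bar> \<le> K * norm x"
    using linear_bounded_of_dominated[OF f(1) C' s(1) near f(3)] by blast
  \<comment> \<open>With the sign reversed, \<open>- pairing\<close> is \<open>f\<close>, and the
    domination of \<open>f\<close> becomes an upper bound for \<open>K\<close>.\<close>
  have "linear (\<lambda>u. - f u)" by (intro linear_compose_neg f(1))
  moreover have "\<bar>- f u\<bar> \<le> K * norm u" for u using K[of u] by simp
  ultimately obtain E B where mp: "(E, B) \<in> measure_pairs T" and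
    rep: "\<And>V M. cyl_field T V \<Longrightarrow> cyl_field T M \<Longrightarrow> (\<And>p. p \<in> slab T \<Longrightarrow> symmetric (M p)) \<Longrightarrow>
      pairing T E B V M = - f (clamped T (\<lambda>p. (V p, M p)))"
    using clamped_functional_representation[OF T, of "\<lambda>u. - f u" K] by blast
  show ?thesis
  proof
    have "(\<Sum>i\<in>UNIV. \<Sum>j\<in>UNIV. cyl_integral T (\<lambda>A. B A $ i $ j)
            (\<lambda>(t, x). vector_derivative \<zeta> (at t within {0..T}) * \<psi> x $ i $ j))
        - (\<Sum>k\<in>UNIV. cyl_integral T (\<lambda>A. E A $ k)
            (\<lambda>(t, x). \<zeta> t *
               ((\<Sum>j\<in>UNIV. pd j (\<lambda>y. \<psi> y $ k $ j) x)
                + pd k (inv_neg_laplacian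
                    (\<lambda>y. \<Sum>i\<in>UNIV. \<Sum>j\<in>UNIV. pd i (pd j (\<lambda>z. \<psi> z $ i $ j)) y)) x))) = 0"
      if h: "smooth_on {0..T} \<zeta>" "\<zeta> 0 = 0" "smooth_on UNIV \<psi>" "periodic \<psi>" "\<forall>x. symmetric (\<psi> x)"
      for \<zeta> :: "real \<Rightarrow> real" and \<psi> :: "real ^ 'n \<Rightarrow> real ^ 'n ^ 'n"
    proof -
      note h' = T h(1-4) h(5)[rule_format]
      note V = EB_test_velocity_field[OF h'] and M = EB_test_matrix_field[OF h']
      have sym: "symmetric (EB_test_matrix T \<zeta> \<psi> p)" for p
        using h(5) by (cases p) (simp add: EB_test_matrix_def symmetric_def transpose_def vec_eq_iff)
      have "clamped T (\<lambda>p. (EB_test_velocity \<zeta> \<psi> p, EB_test_matrix T \<zeta> \<psi> p)) \<in> homogeneous_fields T"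
        using EB_test_constraint[OF h'] by (intro clamped_homogeneous_fields T0 V M sym) (simp add: test_pairing_def)
      hence "pairing T E B (EB_test_velocity \<zeta> \<psi>) (EB_test_matrix T \<zeta> \<psi>) = 0" by (simp add: rep[OF V M sym] f(2))
      moreover have "(\<lambda>p. EB_test_velocity \<zeta> \<psi> p $ k) = (\<lambda>p. - (case p of (t, x) \<Rightarrow> \<zeta> t *
               ((\<Sum>j\<in>UNIV. pd j (\<lambda>y. \<psi> y $ k $ j) x)
                + pd k (inv_neg_laplacian
                    (\<lambda>y. \<Sum>i\<in>UNIV. \<Sum>j\<in>UNIV. pd i (pd j (\<lambda>z. \<psi> z $ i $ j)) y)) x)))" for k
        by (simp add: EB_test_velocity_def case_prod_beta')
      moreover have "(\<lambda>p. EB_test_matrix T \<zeta> \<psi> p $ i $ j) = (\<lambda>(t, x). vector_derivative \<zeta> (at t within {0..T}) * \<psi> x $ i $ j)" for i j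
        by (simp add: EB_test_matrix_def case_prod_beta')
      ultimately show ?thesis by (simp only: pairing_def signed_integral_minus sum_negf)
    qed
    thus "(E, B) \<in> EB_class T" unfolding EB_class_def using mp by blast
    define q where "q = pairing T E B (\<lambda>p. P0 (snd p)) (\<lambda>p. 0)"
    have "f u0 = - q"
    proof -
      have zero: "cyl_field T (\<lambda>p. 0 :: real ^ 'n ^ 'n)" "symmetric (0 :: real ^ 'n ^ 'n)"
        by (simp_all add: cyl_field_const symmetric_def transpose_def vec_eq_iff)
      have "clamped T (\<lambda>p. (0, mat c)) \<in> homogeneous_fields T"
        by (intro clamped_homogeneous_fields T0 cyl_field_const symmetric_mat test_pairing_scalar_matrix T)
      moreover have "u0 = clamped T (\<lambda>p. (P0 (snd p), 0)) + clamped T (\<lambda>p. (0, mat c))"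
        using clamped_add[OF T0 cyl_field_Pair[OF P0 zero(1)] cyl_field_Pair[OF cyl_field_const cyl_field_const], of 0 "mat c"]
        by (simp add: u0_def)
      ultimately show ?thesis using rep[OF P0 zero] f(2) by (simp add: f.add q_def)
    qed
    \<comment> \<open>Rearranged, \<open>f (u - u0) \<le> half_trace T u - m\<close> reads
      \<open>f u - half_trace T u \<le> f u0 - m\<close>, a bound on each competitor of
      \<open>K\<close>. With \<open>f u0 = - q\<close> the dual objective is at least
      \<open>m\<close>.\<close>
    moreover have "K_functional T E B \<le> ereal (f u0 - m)"
    proof (rule K_functional_le)
      fix Z :: "real \<times> (real ^ 'n) \<Rightarrow> real ^ 'n" and M :: "real \<times> (real ^ 'n) \<Rightarrow> real ^ 'n ^ 'n"
      assume ZM: "(Z, M) \<in> admissible_pairs T"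
      note fields = admissible_cyl_fields[OF ZM]
      define u where "u = clamped T (\<lambda>p. (Z p, M p))"
      have u: "apply_bcontfun u p = (Z (clamp_time T p), M (clamp_time T p))" for p
        by (simp add: u_def apply_clamped[OF T0 cyl_field_Pair[OF fields(1,2)]])
      have "u \<in> dominating_fields"
        using ZM clamp_time_slab[OF T0] by (auto simp: dominating_fields_def u admissible_pairs_def)
      from f(3)[OF this] have "f u \<le> half_trace T u - m + f u0" by (simp add: f.diff)
      moreover have "half_trace T u = 1/2 * (LINT p:cylinder T|lborel. trace (M p))"
        unfolding half_trace_def u
        by (intro arg_cong[where f = "(*) (1/2)"] set_lebesgue_integral_cong)
           (auto dest!: subsetD[OF cylinder_subset(3)] simp: clamp_time_id)
      moreover have "pairing T E B Z M = - f u" unfolding u_def by (rule rep[OF fields])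
      ultimately show "- pairing T E B Z M - 1/2 * (LINT p:cylinder T|lborel. trace (M p)) \<le> f u0 - m" by linarith
    qed
    ultimately show "ereal m \<le> dual_objective T P0 E B"
      unfolding dual_objective_eq q_def[symmetric] by (cases "K_functional T E B") auto
  qed
qed

text \<open>\<open>Z = P0\<close> cancels the velocity term, and a large multiple of the identity
  pairs to zero with test matrices because of their zero trace. The primal infimum is thus bounded
  above.\<close>

lemma constant_subsolution:
  fixes P0 :: "real ^ 'n \<Rightarrow> real ^ 'n"
  assumes T: "T > 0" and P0: "cyl_field T (\<lambda>p. P0 (snd p))"
  obtains c where "(\<lambda>p. P0 (snd p), \<lambda>p. mat c) \<in> subsolutions T P0"
proof -
  obtain C where C: "C \<ge> 0" "\<And>p. p \<in> slab T \<Longrightarrow> norm (P0 (snd p)) \<le> C"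
    using P0 cyl_fun_bounded[of T "\<lambda>p. P0 (snd p)"] unfolding cyl_field_def by metis
  have "mat_le (tensor (P0 (snd p)) (P0 (snd p))) (mat ((C + 1)\<^sup>2 + 1))" if "p \<in> slab T" for p
    using mat_le_tensor_perturb[OF C(2)[OF that], of 0 0 0] by simp
  hence "(\<lambda>p. P0 (snd p), \<lambda>p. mat ((C + 1)\<^sup>2 + 1)) \<in> subsolutions T P0"
    using P0 cyl_field_const[of T "mat ((C + 1)\<^sup>2 + 1) :: real ^ 'n ^ 'n"] test_pairing_scalar_matrix[OF T]
    by (auto simp: subsolutions_iff admissible_pairs_def cyl_field_def symmetric_mat)
  thus ?thesis by (rule that)
qed

theorem theorem4p3:
  fixes T :: real and P0 :: "real ^ 'n \<Rightarrow> real ^ 'n"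
  assumes "T > 0"
    and "continuous_on UNIV P0" and "periodic P0"
    and "weakly_div_free P0"
    and "(LINT x:cell|lborel. P0 x) = 0"
  shows "\<bar>primal_value T P0\<bar> \<noteq> \<infinity> \<and> primal_value T P0 = J_value T P0 \<and>
    (\<exists>(E, B)\<in>EB_class T. dual_objective T P0 E B = J_value T P0)"
proof -
  have P0: "cyl_field T (\<lambda>p. P0 (snd p))"
    using assms(3) by (auto simp: cyl_field_def space_periodic_def periodic_def
        intro!: continuous_on_compose2[OF assms(2)] continuous_intros)
  \<comment> \<open>\<open>M \<ge> Z \<otimes> Z\<close> forces a nonnegative trace.\<close>
  have lower: "0 \<le> primal_value T P0"
    unfolding primal_value_def
  proof (rule INF_greatest, clarify)
    fix Z :: "real \<times> (real ^ 'n) \<Rightarrow> real ^ 'n" and M :: "real \<times> (real ^ 'n) \<Rightarrow> real ^ 'n ^ 'n"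
    assume "(Z, M) \<in> subsolutions T P0"
    hence "trace (M p) \<ge> 0" if "p \<in> cylinder T" for p
      using that cylinder_subset(3) trace_nonneg_of_mat_le[of "Z p" "M p"] by (auto simp: subsolutions_iff admissible_pairs_def)
    hence "0 \<le> (LINT p:cylinder T|lborel. trace (M p))"
      unfolding set_lebesgue_integral_def by (intro Bochner_Integration.integral_nonneg) (simp add: indicator_def)
    thus "0 \<le> ereal (1/2 * (LINT p:cylinder T|lborel. trace (M p)))" by simp
  qed
  obtain c :: real where "(\<lambda>p. P0 (snd p), \<lambda>p. mat c) \<in> subsolutions T P0"
    using constant_subsolution[OF assms(1) P0] by blast
  hence "primal_value T P0 \<le> ereal (1/2 * (LINT p:(cylinder T :: (real \<times> (real ^ 'n)) set)|lborel. trace (mat c :: real ^ 'n ^ 'n)))"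
    unfolding primal_value_def by (rule INF_lower2) simp
  with lower obtain m where m: "primal_value T P0 = ereal m" by (cases "primal_value T P0") auto
  have "m \<le> 1/2 * (LINT p:cylinder T|lborel. trace (M p))" if "(Z, M) \<in> subsolutions T P0" for Z M
  proof -
    have "primal_value T P0 \<le> ereal (1/2 * (LINT p:cylinder T|lborel. trace (M p)))"
      unfolding primal_value_def using that by (rule INF_lower2) simp
    thus ?thesis by (simp add: m)
  qed
  then obtain E B where EB: "(E, B) \<in> EB_class T" "ereal m \<le> dual_objective T P0 E B"
    using strong_duality[OF assms(1) P0] by blast
  have weak: "dual_objective T P0 E B \<le> primal_value T P0" if "(E, B) \<in> EB_class T" for E B
    unfolding primal_value_def by (rule INF_greatest) (use weak_duality[OF assms(1) P0 that] in auto)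
  have "J_value T P0 \<le> primal_value T P0"
    unfolding J_value_def by (rule SUP_least) (use weak in auto)
  moreover have "dual_objective T P0 E B \<le> J_value T P0"
    unfolding J_value_def using EB(1) by (rule SUP_upper2) simp
  ultimately have "primal_value T P0 = J_value T P0" "dual_objective T P0 E B = J_value T P0"
    using EB(2) m by (metis order_trans antisym)+
  thus ?thesis using EB(1) m by auto
qed

end
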